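(* Let $\Lambda$ be a basic finite dimensional algebra over an algebraically closed field $K$ with radical square zero, let $Q$ be its quiver and $Q^{s}$ the separated quiver of $Q$. Let $X$ be a $\Lambda$-module and let $P_1^X\to P_0^X\to X\to 0$ be a minimal projective presentation of $X$. Then the following are equivalent: (1) $X$ is a $\tau$-rigid $\Lambda$-module. (2) $FX$ is a $\tau$-rigid $KQ^{s}$-module and $\mathrm{add}\,P_0^X\cap \mathrm{add}\,P_1^X=0$. Here $F$ is the functor $\mathrm{mod}\,\Lambda\to\mathrm{mod}\,\Delta$ described in the context, with $\Delta\cong KQ^{s}$.
   Context: Modules are finite dimensional right modules; $\tau$ denotes the Auslander–Reiten translation of the algebra in question. A module $X$ over an algebra $A$ is $\tau$-rigid if $\mathrm{Hom}_A(X,\tau X)=0$. $J$ denotes the Jacobson radical of $\Lambda$, and $J^2=0$. For a module $M$, $\mathrm{add}\,M$ is the class of direct summands of finite direct sums of copies of $M$; $\mathrm{add}\,P_0^X\cap \mathrm{add}\,P_1^X=0$ means that $P_0^X$ and $P_1^X$ have no common nonzero direct summand up to isomorphism. The separated quiver $Q^{s}$ of $Q=(Q_0,Q_1)$ has vertex set $\{i^{+}\mid i\in Q_0\}\sqcup\{i^{-}\mid i\in Q_0\}$ and one arrow $i^{+}\to j^{-}$ for each arrow $i\to j$ in $Q_1$. Let $\Delta=\begin{pmatrix}\Lambda/J & J\\ 0&\Lambda/J\end{pmatrix}$. It is a hereditary algebra isomorphic to the path algebra $KQ^{s}$. Each $\Delta$-module is given by a triplet $(X',X'';\varphi)$, where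 $X',X''$ are $(\Lambda/J)$-modules and $\varphi: X'\otimes_{\Lambda/J}J\to X''$ is a morphism of $(\Lambda/J)$-modules; a morphism $(X',X'';\varphi)\to(Y',Y'';\psi)$ is a pair $(f',f'')$ of $(\Lambda/J)$-module morphisms $f':X'\to Y'$, $f'':X''\to Y''$ with $\psi\circ(f'\otimes J)=f''\circ\varphi$. The functor $F:\mathrm{mod}\,\Lambda\to\mathrm{mod}\,\Delta$ is defined by $F(X)=(X/XJ,\,XJ;\,\varphi_X)$, where $\varphi_X: X/XJ\otimes_{\Lambda/J}J\to XJ$ is induced by the multiplication map $X\otimes_\Lambda J\to XJ$ (well defined as $J^2=0$), and for $g:X\to Y$, $F(g)=(g',g'')$ with $g':X/XJ\to Y/YJ$ induced by $g$ and $g'':XJ\to YJ$ the restriction of $g$. *)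

theory Defs
  imports
    "HOL-Algebra.Algebraic_Closure"
    "HOL-Algebra.Ideal_Product"
    "Jordan_Normal_Form.Missing_VectorSpace"
    "Graph_Theory.Arc_Walk"
begin

hide_const (open) Multiset.mult \<comment> \<open>shadows the record field \<^const>\<open>monoid.mult\<close>\<close>

section \<open>Finite dimensional algebras and modules\<close>

text \<open>An algebra \<open>A\<close> over a field \<open>K\<close> is a \<^typ>\<open>('k, 'a) module\<close> record: its scalar
  multiplication is the action of \<open>K\<close>, and its ring part need not be commutative.\<close>

locale fd_algebra = vectorspace K A + A: ring A
  for K :: "('k, 'r) ring_scheme" (structure) and A :: "('k, 'a) module" (structure) +
  assumes fin_dim: "vectorspace.fin_dim K A"
    and smult_mult_left:
      "\<lbrakk>c \<in> carrier K; a \<in> carrier A; b \<in> carrier A\<rbrakk>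
        \<Longrightarrow> (c \<odot>\<^bsub>A\<^esub> a) \<otimes>\<^bsub>A\<^esub> b = c \<odot>\<^bsub>A\<^esub> (a \<otimes>\<^bsub>A\<^esub> b)"
    and smult_mult_right:
      "\<lbrakk>c \<in> carrier K; a \<in> carrier A; b \<in> carrier A\<rbrakk>
        \<Longrightarrow> a \<otimes>\<^bsub>A\<^esub> (c \<odot>\<^bsub>A\<^esub> b) = c \<odot>\<^bsub>A\<^esub> (a \<otimes>\<^bsub>A\<^esub> b)"

text \<open>A right \<open>A\<close>-module is a \<open>K\<close>-vector space with a compatible right action of \<open>A\<close>. The fields
  \<^const>\<open>mult\<close> and \<^const>\<open>one\<close> inherited from \<^typ>\<open>('k, 'x) module\<close> are not used.\<close>

record ('k, 'a, 'x) rmodule = "('k, 'x) module" +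
  ract :: "'x \<Rightarrow> 'a \<Rightarrow> 'x" (infixl \<open>\<triangleleft>\<index>\<close> 70)

locale fd_rmodule = vectorspace K M + A: fd_algebra K A
  for K :: "('k, 'r) ring_scheme" (structure) and A :: "('k, 'a) module" (structure)
    and M :: "('k, 'a, 'x) rmodule" (structure) +
  assumes fin_dim: "vectorspace.fin_dim K M"
    and ract_closed: "\<lbrakk>x \<in> carrier M; a \<in> carrier A\<rbrakk> \<Longrightarrow> x \<triangleleft>\<^bsub>M\<^esub> a \<in> carrier M"
    and ract_add_left:
      "\<lbrakk>x \<in> carrier M; y \<in> carrier M; a \<in> carrier A\<rbrakk>
        \<Longrightarrow> (x \<oplus>\<^bsub>M\<^esub> y) \<triangleleft>\<^bsub>M\<^esub> a = x \<triangleleft>\<^bsub>M\<^esub> a \<oplus>\<^bsub>M\<^esub> y \<triangleleft>\<^bsub>M\<^esub> a"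
    and ract_add_right:
      "\<lbrakk>x \<in> carrier M; a \<in> carrier A; b \<in> carrier A\<rbrakk>
        \<Longrightarrow> x \<triangleleft>\<^bsub>M\<^esub> (a \<oplus>\<^bsub>A\<^esub> b) = x \<triangleleft>\<^bsub>M\<^esub> a \<oplus>\<^bsub>M\<^esub> x \<triangleleft>\<^bsub>M\<^esub> b"
    and ract_mult:
      "\<lbrakk>x \<in> carrier M; a \<in> carrier A; b \<in> carrier A\<rbrakk>
        \<Longrightarrow> x \<triangleleft>\<^bsub>M\<^esub> (a \<otimes>\<^bsub>A\<^esub> b) = (x \<triangleleft>\<^bsub>M\<^esub> a) \<triangleleft>\<^bsub>M\<^esub> b"
    and ract_one: "x \<in> carrier M \<Longrightarrow> x \<triangleleft>\<^bsub>M\<^esub> \<one>\<^bsub>A\<^esub> = x"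
    and smult_ract_left:
      "\<lbrakk>c \<in> carrier K; x \<in> carrier M; a \<in> carrier A\<rbrakk>
        \<Longrightarrow> (c \<odot>\<^bsub>M\<^esub> x) \<triangleleft>\<^bsub>M\<^esub> a = c \<odot>\<^bsub>M\<^esub> (x \<triangleleft>\<^bsub>M\<^esub> a)"
    and smult_ract_right:
      "\<lbrakk>c \<in> carrier K; x \<in> carrier M; a \<in> carrier A\<rbrakk>
        \<Longrightarrow> x \<triangleleft>\<^bsub>M\<^esub> (c \<odot>\<^bsub>A\<^esub> a) = c \<odot>\<^bsub>M\<^esub> (x \<triangleleft>\<^bsub>M\<^esub> a)"

definition rmod_hom ::
  "('k, 'a) module \<Rightarrow> ('k, 'a, 'x) rmodule \<Rightarrow> ('k, 'a, 'y) rmodule \<Rightarrow> ('x \<Rightarrow> 'y) set" where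
  "rmod_hom A M Y =
    {h \<in> carrier M \<rightarrow> carrier Y.
      (\<forall>x \<in> carrier M. \<forall>y \<in> carrier M. h (x \<oplus>\<^bsub>M\<^esub> y) = h x \<oplus>\<^bsub>Y\<^esub> h y) \<and>
      (\<forall>x \<in> carrier M. \<forall>a \<in> carrier A. h (x \<triangleleft>\<^bsub>M\<^esub> a) = h x \<triangleleft>\<^bsub>Y\<^esub> a)}"

definition rmod_isomorphic ::
  "('k, 'a) module \<Rightarrow> ('k, 'a, 'x) rmodule \<Rightarrow> ('k, 'a, 'y) rmodule \<Rightarrow> bool" where
  "rmod_isomorphic A M Y \<longleftrightarrow> (\<exists>h \<in> rmod_hom A M Y. bij_betw h (carrier M) (carrier Y))"

text \<open>Closure under negation and under \<open>K\<close>-scalars follows from closure under the action.\<close>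

definition rsubmodule :: "('k, 'a) module \<Rightarrow> ('k, 'a, 'x) rmodule \<Rightarrow> 'x set \<Rightarrow> bool" where
  "rsubmodule A M N \<longleftrightarrow>
    N \<subseteq> carrier M \<and> \<zero>\<^bsub>M\<^esub> \<in> N \<and>
    (\<forall>x \<in> N. \<forall>y \<in> N. x \<oplus>\<^bsub>M\<^esub> y \<in> N) \<and>
    (\<forall>x \<in> N. \<forall>a \<in> carrier A. x \<triangleleft>\<^bsub>M\<^esub> a \<in> N)"

definition quot_rmodule :: "('k, 'a, 'x) rmodule \<Rightarrow> 'x set \<Rightarrow> ('k, 'a, 'x set) rmodule" where
  "quot_rmodule M N =
    \<lparr>carrier = a_rcosets\<^bsub>M\<^esub> N, mult = undefined, one = undefined, zero = N, add = set_add M,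
     smult = (\<lambda>c C. \<Union>x\<in>C. N +>\<^bsub>M\<^esub> (c \<odot>\<^bsub>M\<^esub> x)),
     ract = (\<lambda>C a. \<Union>x\<in>C. N +>\<^bsub>M\<^esub> (x \<triangleleft>\<^bsub>M\<^esub> a))\<rparr>"

definition regular :: "('k, 'a) module \<Rightarrow> ('k, 'a, 'a) rmodule" where
  "regular A =
    \<lparr>carrier = carrier A, mult = undefined, one = undefined, zero = \<zero>\<^bsub>A\<^esub>, add = add A,
     smult = smult A, ract = mult A\<rparr>"

definition rmod_power :: "('k, 'a, 'x) rmodule \<Rightarrow> nat \<Rightarrow> ('k, 'a, nat \<Rightarrow> 'x) rmodule" where
  "rmod_power M n =
    \<lparr>carrier = {..<n} \<rightarrow>\<^sub>E carrier M, mult = undefined, one = undefined,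
     zero = (\<lambda>i\<in>{..<n}. \<zero>\<^bsub>M\<^esub>), add = (\<lambda>u v. \<lambda>i\<in>{..<n}. u i \<oplus>\<^bsub>M\<^esub> v i),
     smult = (\<lambda>c u. \<lambda>i\<in>{..<n}. c \<odot>\<^bsub>M\<^esub> u i), ract = (\<lambda>u a. \<lambda>i\<in>{..<n}. u i \<triangleleft>\<^bsub>M\<^esub> a)\<rparr>"

text \<open>\<open>N\<close> belongs to \<open>add M\<close>: it is, up to isomorphism, a direct summand of some \<open>M\<^sup>n\<close>.\<close>

definition in_add ::
  "('k, 'a) module \<Rightarrow> ('k, 'a, 'x) rmodule \<Rightarrow> ('k, 'a, 'y) rmodule \<Rightarrow> bool" where
  "in_add A M N \<longleftrightarrow>
    (\<exists>n. \<exists>s \<in> rmod_hom A N (rmod_power M n). \<exists>r \<in> rmod_hom A (rmod_power M n) N.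
      \<forall>x \<in> carrier N. r (s x) = x)"

text \<open>Every member of \<open>add M\<close> is isomorphic to a submodule of some \<^term>\<open>rmod_power M n\<close>, so it
  is no restriction that \<open>N\<close> ranges over modules with elements in \<^typ>\<open>nat \<Rightarrow> 'x\<close>.\<close>

definition add_inter_trivial ::
  "('k, 'r) ring_scheme \<Rightarrow> ('k, 'a) module \<Rightarrow> ('k, 'a, 'x) rmodule \<Rightarrow> ('k, 'a, 'y) rmodule \<Rightarrow> bool"
  where
  "add_inter_trivial K A M Y \<longleftrightarrow>
    (\<forall>N :: ('k, 'a, nat \<Rightarrow> 'x) rmodule.
      fd_rmodule K A N \<and> in_add A M N \<and> in_add A Y N \<longrightarrow> carrier N = {\<zero>\<^bsub>N\<^esub>})"

text \<open>Finitely generated projective modules are the direct summands of the free modules \<open>A\<^sup>n\<close>.\<close>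

definition projective :: "('k, 'a) module \<Rightarrow> ('k, 'a, 'x) rmodule \<Rightarrow> bool" where
  "projective A P \<longleftrightarrow> in_add A (regular A) P"

text \<open>The last conjunct says that the kernel of \<open>g\<close> is superfluous in \<open>P\<close>.\<close>

definition projective_cover ::
  "('k, 'r) ring_scheme \<Rightarrow> ('k, 'a) module \<Rightarrow>
    ('k, 'a, 'p) rmodule \<Rightarrow> ('p \<Rightarrow> 'x) \<Rightarrow> ('k, 'a, 'x) rmodule \<Rightarrow> bool" where
  "projective_cover K A P g M \<longleftrightarrow>
    fd_rmodule K A P \<and> projective A P \<and> g \<in> rmod_hom A P M \<and> g ` carrier P = carrier M \<and>
    (\<forall>N. rsubmodule A P N \<and> N <+>\<^bsub>P\<^esub> a_kernel P M g = carrier P \<longrightarrow> N = carrier P)"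

text \<open>\<open>P1 \<rightarrow>f P0 \<rightarrow>g M \<rightarrow> 0\<close> is a minimal projective presentation.\<close>

definition minimal_presentation ::
  "('k, 'r) ring_scheme \<Rightarrow> ('k, 'a) module \<Rightarrow> ('k, 'a, 'q) rmodule \<Rightarrow> ('q \<Rightarrow> 'p) \<Rightarrow>
    ('k, 'a, 'p) rmodule \<Rightarrow> ('p \<Rightarrow> 'x) \<Rightarrow> ('k, 'a, 'x) rmodule \<Rightarrow> bool" where
  "minimal_presentation K A P1 f P0 g M \<longleftrightarrow>
    projective_cover K A P0 g M \<and>
    projective_cover K A P1 f (P0\<lparr>carrier := a_kernel P0 M g\<rparr>)"

section \<open>The Auslander--Reiten translation\<close>

text \<open>Left \<open>A\<close>-modules are written as right modules over the opposite algebra: their \<^const>\<open>ract\<close>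
  takes \<open>m\<close> and \<open>a\<close> to \<open>a m\<close>.\<close>

text \<open>The left \<open>A\<close>-module \<open>Hom\<^sub>A(P, A)\<close>, with \<open>(a h)(p) = a \<cdot> h(p)\<close>. Maps are taken extensional, so
  that homomorphisms agreeing on \<^term>\<open>carrier P\<close> are equal.\<close>

definition hom_regular ::
  "('k, 'a) module \<Rightarrow> ('k, 'a, 'p) rmodule \<Rightarrow> ('k, 'a, 'p \<Rightarrow> 'a) rmodule" where
  "hom_regular A P =
    \<lparr>carrier = rmod_hom A P (regular A) \<inter> extensional (carrier P),
     mult = undefined, one = undefined,
     zero = (\<lambda>p\<in>carrier P. \<zero>\<^bsub>A\<^esub>), add = (\<lambda>h k. \<lambda>p\<in>carrier P. h p \<oplus>\<^bsub>A\<^esub> k p),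
     smult = (\<lambda>c h. \<lambda>p\<in>carrier P. c \<odot>\<^bsub>A\<^esub> h p), ract = (\<lambda>h a. \<lambda>p\<in>carrier P. a \<otimes>\<^bsub>A\<^esub> h p)\<rparr>"

text \<open>The transpose: the cokernel of \<open>Hom\<^sub>A(f, A) : Hom\<^sub>A(P0, A) \<rightarrow> Hom\<^sub>A(P1, A)\<close>, a left
  \<open>A\<close>-module.\<close>

definition transpose_module ::
  "('k, 'a) module \<Rightarrow> ('k, 'a, 'q) rmodule \<Rightarrow> ('q \<Rightarrow> 'p) \<Rightarrow> ('k, 'a, 'p) rmodule \<Rightarrow>
    ('k, 'a, ('q \<Rightarrow> 'a) set) rmodule" where
  "transpose_module A P1 f P0 =
    quot_rmodule (hom_regular A P1)
      ((\<lambda>h. \<lambda>p\<in>carrier P1. h (f p)) ` carrier (hom_regular A P0))"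

text \<open>The duality \<open>D = Hom\<^sub>K(-, K)\<close>, with \<open>(\<xi> a)(m) = \<xi>(a m)\<close>; it turns left \<open>A\<close>-modules
  into right \<open>A\<close>-modules.\<close>

definition dual ::
  "('k, 'r) ring_scheme \<Rightarrow> ('k, 'a, 'x) rmodule \<Rightarrow> ('k, 'a, 'x \<Rightarrow> 'k) rmodule" where
  "dual K M =
    \<lparr>carrier = {\<xi> \<in> carrier M \<rightarrow>\<^sub>E carrier K.
        (\<forall>x \<in> carrier M. \<forall>y \<in> carrier M. \<xi> (x \<oplus>\<^bsub>M\<^esub> y) = \<xi> x \<oplus>\<^bsub>K\<^esub> \<xi> y) \<and>
        (\<forall>c \<in> carrier K. \<forall>x \<in> carrier M. \<xi> (c \<odot>\<^bsub>M\<^esub> x) = c \<otimes>\<^bsub>K\<^esub> \<xi> x)},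
     mult = undefined, one = undefined,
     zero = (\<lambda>x\<in>carrier M. \<zero>\<^bsub>K\<^esub>), add = (\<lambda>\<xi> \<eta>. \<lambda>x\<in>carrier M. \<xi> x \<oplus>\<^bsub>K\<^esub> \<eta> x),
     smult = (\<lambda>c \<xi>. \<lambda>x\<in>carrier M. c \<otimes>\<^bsub>K\<^esub> \<xi> x), ract = (\<lambda>\<xi> a. \<lambda>x\<in>carrier M. \<xi> (x \<triangleleft>\<^bsub>M\<^esub> a))\<rparr>"

text \<open>\<open>\<tau> M = D Tr M\<close>, computed from a chosen minimal projective presentation. Every finitely
  generated projective module is isomorphic to a submodule of some \<^term>\<open>rmod_power (regular A) n\<close>, so
  a finite dimensional module has a minimal projective presentation with elements in
  \<^typ>\<open>nat \<Rightarrow> 'a\<close>; all of them yield isomorphic modules.\<close>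

definition tau ::
  "('k, 'r) ring_scheme \<Rightarrow> ('k, 'a) module \<Rightarrow> ('k, 'a, 'x) rmodule \<Rightarrow>
    ('k, 'a, ((nat \<Rightarrow> 'a) \<Rightarrow> 'a) set \<Rightarrow> 'k) rmodule" where
  "tau K A M =
    (let (P1, f, P0, g) =
        SOME (P1 :: ('k, 'a, nat \<Rightarrow> 'a) rmodule, f, P0 :: ('k, 'a, nat \<Rightarrow> 'a) rmodule, g).
          minimal_presentation K A P1 f P0 g M
     in dual K (transpose_module A P1 f P0))"

definition tau_rigid ::
  "('k, 'r) ring_scheme \<Rightarrow> ('k, 'a) module \<Rightarrow> ('k, 'a, 'x) rmodule \<Rightarrow> bool" where
  "tau_rigid K A M \<longleftrightarrow>
    (\<forall>h \<in> rmod_hom A M (tau K A M). \<forall>x \<in> carrier M. h x = \<zero>\<^bsub>tau K A M\<^esub>)"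

section \<open>Radical, basic algebras, quivers\<close>

definition maximal_rsubmodule :: "('k, 'a) module \<Rightarrow> ('k, 'a, 'x) rmodule \<Rightarrow> 'x set \<Rightarrow> bool" where
  "maximal_rsubmodule A M N \<longleftrightarrow>
    rsubmodule A M N \<and> N \<noteq> carrier M \<and>
    (\<forall>L. rsubmodule A M L \<and> N \<subseteq> L \<longrightarrow> L = N \<or> L = carrier M)"

definition jacobson_radical :: "('k, 'a) module \<Rightarrow> 'a set" where
  "jacobson_radical A = {a \<in> carrier A. \<forall>N. maximal_rsubmodule A (regular A) N \<longrightarrow> a \<in> N}"

definition radical_square_zero :: "('k, 'a) module \<Rightarrow> bool" where
  "radical_square_zero A \<longleftrightarrow>
    ideal_prod A (jacobson_radical A) (jacobson_radical A) = {\<zero>\<^bsub>A\<^esub>}"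

definition idempotent_in :: "('k, 'a) module \<Rightarrow> 'a \<Rightarrow> bool" where
  "idempotent_in A e \<longleftrightarrow> e \<in> carrier A \<and> e \<otimes>\<^bsub>A\<^esub> e = e"

definition orthogonal_in :: "('k, 'a) module \<Rightarrow> 'a \<Rightarrow> 'a \<Rightarrow> bool" where
  "orthogonal_in A e f \<longleftrightarrow> e \<otimes>\<^bsub>A\<^esub> f = \<zero>\<^bsub>A\<^esub> \<and> f \<otimes>\<^bsub>A\<^esub> e = \<zero>\<^bsub>A\<^esub>"

definition primitive_idempotent :: "('k, 'a) module \<Rightarrow> 'a \<Rightarrow> bool" where
  "primitive_idempotent A e \<longleftrightarrow>
    idempotent_in A e \<and> e \<noteq> \<zero>\<^bsub>A\<^esub> \<and>
    (\<forall>f g. idempotent_in A f \<and> idempotent_in A g \<and> orthogonal_in A f g \<and> e = f \<oplus>\<^bsub>A\<^esub> g \<longrightarrow>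
      f = \<zero>\<^bsub>A\<^esub> \<or> g = \<zero>\<^bsub>A\<^esub>)"

definition complete_primitive_idempotents :: "('k, 'a) module \<Rightarrow> 'a set \<Rightarrow> bool" where
  "complete_primitive_idempotents A E \<longleftrightarrow>
    finite E \<and> (\<forall>e \<in> E. primitive_idempotent A e) \<and>
    (\<forall>e \<in> E. \<forall>f \<in> E. e \<noteq> f \<longrightarrow> orthogonal_in A e f) \<and>
    finsum A (\<lambda>e. e) E = \<one>\<^bsub>A\<^esub>"

text \<open>The indecomposable summands \<open>eA\<close> of \<open>A\<^sub>A\<close> are pairwise non-isomorphic.\<close>

definition basic_algebra :: "('k, 'a) module \<Rightarrow> bool" where
  "basic_algebra A \<longleftrightarrow>
    (\<exists>E. complete_primitive_idempotents A E \<and>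
      (\<forall>e \<in> E. \<forall>f \<in> E. e \<noteq> f \<longrightarrow>
        \<not> rmod_isomorphic A
            ((regular A)\<lparr>carrier := (\<lambda>a. e \<otimes>\<^bsub>A\<^esub> a) ` carrier A\<rparr>)
            ((regular A)\<lparr>carrier := (\<lambda>a. f \<otimes>\<^bsub>A\<^esub> a) ` carrier A\<rparr>)))"

definition quot_algebra :: "('k, 'a) module \<Rightarrow> 'a set \<Rightarrow> ('k, 'a set) module" where
  "quot_algebra A I =
    \<lparr>carrier = carrier (A Quot I), mult = mult (A Quot I), one = one (A Quot I),
     zero = zero (A Quot I), add = add (A Quot I),
     smult = (\<lambda>c C. \<Union>x\<in>C. I +>\<^bsub>A\<^esub> (c \<odot>\<^bsub>A\<^esub> x))\<rparr>"

text \<open>A quiver is a finite directed multigraph. The vertices of the quiver of a basic algebra \<open>A\<close> are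
  indexed by a complete set of primitive orthogonal idempotents \<open>e\<^sub>i\<close>, and the arrows
  \<open>i \<rightarrow> j\<close> by a basis of \<open>e\<^sub>i (J/J\<^sup>2) e\<^sub>j\<close>; with right modules and paths composed from left to right,
  this makes \<open>A\<close> a quotient of the path algebra defined below.\<close>

definition is_quiver_of ::
  "('k, 'r) ring_scheme \<Rightarrow> ('k, 'a) module \<Rightarrow> ('v, 'e) pre_digraph \<Rightarrow> bool" where
  "is_quiver_of K A Q \<longleftrightarrow>
    fin_digraph Q \<and>
    (\<exists>\<epsilon>. inj_on \<epsilon> (verts Q) \<and> complete_primitive_idempotents A (\<epsilon> ` verts Q) \<and>
      (let J = jacobson_radical A; J2 = ideal_prod A J J in
        \<forall>i \<in> verts Q. \<forall>j \<in> verts Q.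
          card {\<alpha> \<in> arcs Q. tail Q \<alpha> = i \<and> head Q \<alpha> = j} =
          vectorspace.dim K ((quot_algebra A J2)
            \<lparr>carrier := (\<lambda>x. J2 +>\<^bsub>A\<^esub> (\<epsilon> i \<otimes>\<^bsub>A\<^esub> x \<otimes>\<^bsub>A\<^esub> \<epsilon> j)) ` J\<rparr>)))"

text \<open>\<open>Inl i\<close> is the vertex \<open>i\<^sup>+\<close> and \<open>Inr i\<close> the vertex \<open>i\<^sup>-\<close>.\<close>

definition separated_quiver :: "('v, 'e) pre_digraph \<Rightarrow> ('v + 'v, 'e) pre_digraph" where
  "separated_quiver Q =
    \<lparr>verts = verts Q <+> verts Q, arcs = arcs Q,
     tail = (\<lambda>\<alpha>. Inl (tail Q \<alpha>)), head = (\<lambda>\<alpha>. Inr (head Q \<alpha>))\<rparr>"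

text \<open>A path is a pair of its source and its list of arrows; the trivial paths have an empty list.\<close>

definition quiver_paths :: "('v, 'e) pre_digraph \<Rightarrow> ('v \<times> 'e list) set" where
  "quiver_paths Q = {(u, p). \<exists>v. pre_digraph.awalk Q u p v}"

text \<open>Elements are finitely supported functions on paths. The product of two paths is their
  concatenation, the left factor first, if it is a path, and zero otherwise; so the coefficient of a
  path in a product is a sum over its decompositions.\<close>

definition path_algebra ::
  "('k, 'r) ring_scheme \<Rightarrow> ('v, 'e) pre_digraph \<Rightarrow> ('k, 'v \<times> 'e list \<Rightarrow> 'k) module" where
  "path_algebra K Q =
    \<lparr>carrier = {x. (\<forall>w. x w \<in> carrier K) \<and> (\<forall>w. w \<notin> quiver_paths Q \<longrightarrow> x w = \<zero>\<^bsub>K\<^esub>) \<and>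
        finite {w. x w \<noteq> \<zero>\<^bsub>K\<^esub>}},
     mult = (\<lambda>x y (u, p).
        finsum K (\<lambda>i. x (u, take i p) \<otimes>\<^bsub>K\<^esub> y (pre_digraph.awlast Q u (take i p), drop i p))
          {..length p}),
     one = (\<lambda>(u, p). if u \<in> verts Q \<and> p = [] then \<one>\<^bsub>K\<^esub> else \<zero>\<^bsub>K\<^esub>),
     zero = (\<lambda>w. \<zero>\<^bsub>K\<^esub>), add = (\<lambda>x y w. x w \<oplus>\<^bsub>K\<^esub> y w),
     smult = (\<lambda>c x w. c \<otimes>\<^bsub>K\<^esub> x w)\<rparr>"

section \<open>The triangular algebra and the functor to its modules\<close>

text \<open>Below, \<^const>\<open>the_elem\<close> extracts the common value of an operation on
  all representatives of a coset. An \<open>A\<close>-module annihilated by an ideal \<open>I\<close> is a module over \<open>A/I\<close>:\<close>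

definition descend :: "('k, 'a, 'x) rmodule \<Rightarrow> ('k, 'a set, 'x) rmodule" where
  "descend M =
    \<lparr>carrier = carrier M, mult = undefined, one = undefined, zero = \<zero>\<^bsub>M\<^esub>, add = add M,
     smult = smult M, ract = (\<lambda>x R. the_elem ((\<lambda>a. x \<triangleleft>\<^bsub>M\<^esub> a) ` R))\<rparr>"

text \<open>The algebra of matrices with diagonal entries \<open>r\<close>, \<open>s\<close> in \<open>A/J\<close> and upper right entry \<open>j\<close> in
  \<open>J\<close>, written as triples \<open>(r, j, s)\<close>. As \<open>J\<^sup>2 = 0\<close>, the radical \<open>J\<close> is an \<open>A/J\<close>-bimodule.\<close>

definition triangular_algebra :: "('k, 'a) module \<Rightarrow> ('k, 'a set \<times> 'a \<times> 'a set) module" where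
  "triangular_algebra A =
    (let J = jacobson_radical A; B = quot_algebra A J in
    \<lparr>carrier = carrier B \<times> J \<times> carrier B,
     mult = (\<lambda>(r, j, s) (r', j', s').
       (r \<otimes>\<^bsub>B\<^esub> r',
        the_elem ((\<lambda>a. a \<otimes>\<^bsub>A\<^esub> j') ` r) \<oplus>\<^bsub>A\<^esub> the_elem ((\<lambda>a. j \<otimes>\<^bsub>A\<^esub> a) ` s'),
        s \<otimes>\<^bsub>B\<^esub> s')),
     one = (\<one>\<^bsub>B\<^esub>, \<zero>\<^bsub>A\<^esub>, \<one>\<^bsub>B\<^esub>), zero = (\<zero>\<^bsub>B\<^esub>, \<zero>\<^bsub>A\<^esub>, \<zero>\<^bsub>B\<^esub>),
     add = (\<lambda>(r, j, s) (r', j', s'). (r \<oplus>\<^bsub>B\<^esub> r', j \<oplus>\<^bsub>A\<^esub> j', s \<oplus>\<^bsub>B\<^esub> s')),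
     smult = (\<lambda>c (r, j, s). (c \<odot>\<^bsub>B\<^esub> r, c \<odot>\<^bsub>A\<^esub> j, c \<odot>\<^bsub>B\<^esub> s))\<rparr>)"

text \<open>The right module over \<^const>\<open>triangular_algebra\<close> given by a triplet \<open>(M', M''; \<phi>)\<close>: row vectors
  \<open>(x', x'')\<close> multiplied by matrices. The map \<open>\<phi> : M' \<otimes> J \<rightarrow> M''\<close> is represented by the balanced map
  \<open>(x', j) \<mapsto> \<phi>(x' \<otimes> j)\<close>, to which it corresponds by the universal property of the tensor product.\<close>

definition triplet_module ::
  "('k, 'b, 'x) rmodule \<Rightarrow> ('k, 'b, 'y) rmodule \<Rightarrow> ('x \<Rightarrow> 'a \<Rightarrow> 'y) \<Rightarrow>
    ('k, 'b \<times> 'a \<times> 'b, 'x \<times> 'y) rmodule" where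
  "triplet_module M' M'' \<phi> =
    \<lparr>carrier = carrier M' \<times> carrier M'', mult = undefined, one = undefined,
     zero = (\<zero>\<^bsub>M'\<^esub>, \<zero>\<^bsub>M''\<^esub>), add = (\<lambda>(x, y) (x', y'). (x \<oplus>\<^bsub>M'\<^esub> x', y \<oplus>\<^bsub>M''\<^esub> y')),
     smult = (\<lambda>c (x, y). (c \<odot>\<^bsub>M'\<^esub> x, c \<odot>\<^bsub>M''\<^esub> y)),
     ract = (\<lambda>(x, y) (r, j, s). (x \<triangleleft>\<^bsub>M'\<^esub> r, \<phi> x j \<oplus>\<^bsub>M''\<^esub> y \<triangleleft>\<^bsub>M''\<^esub> s))\<rparr>"

inductive_set ideal_action :: "('k, 'a, 'x) rmodule \<Rightarrow> 'a set \<Rightarrow> 'x set"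
  for M :: "('k, 'a, 'x) rmodule" and I :: "'a set" where
    prod: "\<lbrakk>x \<in> carrier M; a \<in> I\<rbrakk> \<Longrightarrow> x \<triangleleft>\<^bsub>M\<^esub> a \<in> ideal_action M I"
  | sum: "\<lbrakk>x \<in> ideal_action M I; y \<in> ideal_action M I\<rbrakk> \<Longrightarrow> x \<oplus>\<^bsub>M\<^esub> y \<in> ideal_action M I"

text \<open>\<open>F M = (M/MJ, MJ; \<phi>\<^sub>M)\<close> with \<open>\<phi>\<^sub>M\<close> induced by the multiplication \<open>M \<otimes> J \<rightarrow> MJ\<close>.\<close>

definition functor_F ::
  "('k, 'a) module \<Rightarrow> ('k, 'a, 'x) rmodule \<Rightarrow>
    ('k, 'a set \<times> 'a \<times> 'a set, 'x set \<times> 'x) rmodule" where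
  "functor_F A M =
    (let MJ = ideal_action M (jacobson_radical A) in
      triplet_module (descend (quot_rmodule M MJ)) (descend (M\<lparr>carrier := MJ\<rparr>))
        (\<lambda>C j. the_elem ((\<lambda>x. x \<triangleleft>\<^bsub>M\<^esub> j) ` C)))"

definition algebra_iso ::
  "('k, 'r) ring_scheme \<Rightarrow> ('k, 'a) module \<Rightarrow> ('k, 'b) module \<Rightarrow> ('a \<Rightarrow> 'b) set" where
  "algebra_iso K A B =
    {\<theta> \<in> ring_iso A B. \<forall>c \<in> carrier K. \<forall>a \<in> carrier A. \<theta> (c \<odot>\<^bsub>A\<^esub> a) = c \<odot>\<^bsub>B\<^esub> \<theta> a}"

definition restrict_scalars :: "('a \<Rightarrow> 'b) \<Rightarrow> ('k, 'b, 'x) rmodule \<Rightarrow> ('k, 'a, 'x) rmodule" where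
  "restrict_scalars \<theta> M =
    \<lparr>carrier = carrier M, mult = undefined, one = undefined, zero = \<zero>\<^bsub>M\<^esub>, add = add M,
     smult = smult M, ract = (\<lambda>x a. x \<triangleleft>\<^bsub>M\<^esub> \<theta> a)\<rparr>"

end

theory Submission
  imports Defs
begin

text \<open>By the duality \<open>Hom(M, \<tau> M) = D Coker Hom(f, M)\<close>, a module \<open>M\<close> with minimal presentation
  \<open>P1 \<rightarrow>f P0 \<rightarrow>g M\<close> is \<open>\<tau>\<close>-rigid iff every homomorphism \<open>P1 \<rightarrow> M\<close> factors through \<open>f\<close>. Let \<open>J\<^sup>2 = 0\<close> and
  let \<open>Z \<subseteq> P0 J\<close> be the kernel of \<open>g\<close>. A homomorphism \<open>P1 \<rightarrow> M\<close> with image outside \<open>M J\<close> never factors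
  through \<open>f\<close>, since \<open>f\<close> has image in \<open>P0 J\<close>; such homomorphisms exist iff \<open>P1\<close> and the projective cover
  \<open>P0\<close> of \<open>M\<close> have a common summand. One with image in \<open>M J\<close> kills \<open>P1 J\<close>, so it is a homomorphism
  \<open>Z \<rightarrow> M J\<close>, and it factors through \<open>f\<close> iff it extends to \<open>P0 \<rightarrow> M\<close>. Over the triangular algebra,
  \<open>(0, Z) \<rightarrow> F P0 \<rightarrow> F M\<close> is a minimal presentation of \<open>F M\<close>, and homomorphisms \<open>F P0 \<rightarrow> F M\<close> lift to
  \<open>P0 \<rightarrow> M\<close>, so the last condition is the \<open>\<tau>\<close>-rigidity of \<open>F M\<close>.

  Over an algebraically closed field, a basic algebra is split: modulo \<open>J\<close> it is spanned by the
  primitive idempotents. Hence the triangular algebra has a basis of two copies of the idempotents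
  and a basis of \<open>J\<close> adapted to \<open>J = \<Oplus> e\<^sub>i J e\<^sub>j\<close>, multiplied like the paths of the separated quiver.\<close>

section \<open>Modules over finite dimensional algebras\<close>

text \<open>The definition of \<open>tau\<close> chooses one among all minimal presentations with
  elements in a fixed type and then applies a transpose and a dual. None of this matches
  \<open>functor_F\<close> or a change of algebra on the nose. Rigidity is therefore traded at once
  for \<open>factors_through\<close>, a statement about homomorphisms between given modules that
  does not depend on the presentation; only in this form are the algebra, the triangular algebra and
  the path algebra compared.

  Projectivity is handled by dual bases: they describe the homomorphisms out of P, detect P J by
  coordinates in J, and are carried explicitly to F P, to (0, Z) and along algebra isomorphisms.

  A further obstacle lies in the basic algebra: the idempotents that witness basicness need not be
  those that index the vertices of the quiver. The bridge between the two sets is the commutativity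
  of A/J, which does not refer to idempotents.\<close>

lemma vectorspace_surj_image:
  assumes V: "vectorspace K V" and im: "\<pi> ` carrier V = carrier W"
    and add: "\<And>x y. \<lbrakk>x \<in> carrier V; y \<in> carrier V\<rbrakk> \<Longrightarrow> \<pi> (x \<oplus>\<^bsub>V\<^esub> y) = \<pi> x \<oplus>\<^bsub>W\<^esub> \<pi> y"
    and zero: "\<pi> \<zero>\<^bsub>V\<^esub> = \<zero>\<^bsub>W\<^esub>"
    and smult: "\<And>c x. \<lbrakk>c \<in> carrier K; x \<in> carrier V\<rbrakk> \<Longrightarrow> \<pi> (c \<odot>\<^bsub>V\<^esub> x) = c \<odot>\<^bsub>W\<^esub> \<pi> x"
  shows "vectorspace K W"
    and "vectorspace.fin_dim K V \<Longrightarrow> vectorspace.fin_dim K W"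
proof -
  interpret V: vectorspace K V by fact
  have rep: "\<exists>y\<in>carrier V. x = \<pi> y" if "x \<in> carrier W" for x
    using that im by auto
  have cl: "\<pi> y \<in> carrier W" if "y \<in> carrier V" for y
    using that im by auto
  show W: "vectorspace K W"
  proof (rule vs_criteria)
    show "field K" by (rule V.field_axioms)
    show "\<zero>\<^bsub>W\<^esub> \<in> carrier W"
      using cl[OF V.zero_closed] zero by simp
    show "\<forall>v w. v \<in> carrier W \<and> w \<in> carrier W \<longrightarrow> v \<oplus>\<^bsub>W\<^esub> w \<in> carrier W"
      using rep cl add by (metis V.add.m_closed)
    show "\<forall>v\<in>carrier W. \<exists>n\<in>carrier W. v \<oplus>\<^bsub>W\<^esub> n = \<zero>\<^bsub>W\<^esub>"
    proof
      fix v assume "v \<in> carrier W"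
      then obtain y where y: "y \<in> carrier V" "v = \<pi> y" using rep by blast
      have "v \<oplus>\<^bsub>W\<^esub> \<pi> (\<ominus>\<^bsub>V\<^esub> y) = \<zero>\<^bsub>W\<^esub>"
        using y add[of y "\<ominus>\<^bsub>V\<^esub> y"] zero by (simp add: V.M.r_neg)
      then show "\<exists>n\<in>carrier W. v \<oplus>\<^bsub>W\<^esub> n = \<zero>\<^bsub>W\<^esub>"
        using cl y by blast
    qed
    show "\<forall>c v. c \<in> carrier K \<and> v \<in> carrier W \<longrightarrow> c \<odot>\<^bsub>W\<^esub> v \<in> carrier W"
      using rep cl smult by (metis V.smult_closed)
    show "\<forall>v w. v \<in> carrier W \<and> w \<in> carrier W \<longrightarrow> v \<oplus>\<^bsub>W\<^esub> w = w \<oplus>\<^bsub>W\<^esub> v"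
      using rep add by (metis V.M.a_comm)
    show "\<forall>v w x. v \<in> carrier W \<and> w \<in> carrier W \<and> x \<in> carrier W \<longrightarrow>
        (v \<oplus>\<^bsub>W\<^esub> w) \<oplus>\<^bsub>W\<^esub> x = v \<oplus>\<^bsub>W\<^esub> (w \<oplus>\<^bsub>W\<^esub> x)"
    proof (intro allI impI, elim conjE)
      fix v w x assume "v \<in> carrier W" "w \<in> carrier W" "x \<in> carrier W"
      then obtain v' w' x' where [simp]: "v' \<in> carrier V" "w' \<in> carrier V" "x' \<in> carrier V"
        "v = \<pi> v'" "w = \<pi> w'" "x = \<pi> x'" using rep by meson
      show "(v \<oplus>\<^bsub>W\<^esub> w) \<oplus>\<^bsub>W\<^esub> x = v \<oplus>\<^bsub>W\<^esub> (w \<oplus>\<^bsub>W\<^esub> x)"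
        by (simp add: add[symmetric] V.M.a_assoc)
    qed
    show "\<forall>v\<in>carrier W. v \<oplus>\<^bsub>W\<^esub> \<zero>\<^bsub>W\<^esub> = v"
      using rep add zero by (metis V.M.r_zero V.zero_closed)
    show "\<forall>a b v. a \<in> carrier K \<and> b \<in> carrier K \<and> v \<in> carrier W \<longrightarrow>
        (a \<otimes>\<^bsub>K\<^esub> b) \<odot>\<^bsub>W\<^esub> v = a \<odot>\<^bsub>W\<^esub> (b \<odot>\<^bsub>W\<^esub> v)"
      using rep smult by (metis V.smult_assoc1 V.smult_closed V.R.m_closed)
    show "\<forall>v\<in>carrier W. \<one>\<^bsub>K\<^esub> \<odot>\<^bsub>W\<^esub> v = v"
      using rep smult by (metis V.smult_one V.R.one_closed)
    show "\<forall>a b v. a \<in> carrier K \<and> b \<in> carrier K \<and> v \<in> carrier W \<longrightarrow>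
        (a \<oplus>\<^bsub>K\<^esub> b) \<odot>\<^bsub>W\<^esub> v = (a \<odot>\<^bsub>W\<^esub> v) \<oplus>\<^bsub>W\<^esub> (b \<odot>\<^bsub>W\<^esub> v)"
      using rep smult add by (metis V.smult_l_distr V.smult_closed V.R.a_closed)
    show "\<forall>a v w. a \<in> carrier K \<and> v \<in> carrier W \<and> w \<in> carrier W \<longrightarrow>
        a \<odot>\<^bsub>W\<^esub> (v \<oplus>\<^bsub>W\<^esub> w) = (a \<odot>\<^bsub>W\<^esub> v) \<oplus>\<^bsub>W\<^esub> (a \<odot>\<^bsub>W\<^esub> w)"
    proof (intro allI impI, elim conjE)
      fix a v w assume a: "a \<in> carrier K" "v \<in> carrier W" "w \<in> carrier W"
      then obtain v' w' where [simp]: "v' \<in> carrier V" "w' \<in> carrier V"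
        "v = \<pi> v'" "w = \<pi> w'" using rep by meson
      show "a \<odot>\<^bsub>W\<^esub> (v \<oplus>\<^bsub>W\<^esub> w) = (a \<odot>\<^bsub>W\<^esub> v) \<oplus>\<^bsub>W\<^esub> (a \<odot>\<^bsub>W\<^esub> w)"
        using a by (simp add: add[symmetric] smult[symmetric] V.smult_r_distr)
    qed
  qed
  assume fd: "vectorspace.fin_dim K V"
  interpret W: vectorspace K W by fact
  interpret l: linear_map K V W \<pi>
    by unfold_locales (auto simp: module_hom_def add smult cl)
  show "vectorspace.fin_dim K W"
    using l.surj_fin_dim[OF fd im] .
qed

text \<open>A set that is independent in \<open>W\<close> is independent in \<open>V\<close>, so
  \<open>dim\<close> bounds its size. Hence there is a maximal independent subset of
  \<open>W\<close>, and it spans \<open>W\<close>.\<close>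

lemma (in vectorspace) subspace_fin_dim:
  assumes W: "subspace K W V" and fd: fin_dim
  shows "vectorspace.fin_dim K (V\<lparr>carrier := W\<rparr>)"
proof -
  interpret W: vectorspace K "V\<lparr>carrier := W\<rparr>" by (rule subspace_is_vs[OF W])
  have sm: "submodule K W V" using W by simp
  have WV: "W \<subseteq> carrier V" using sm submodule.subset by blast
  have li: "W.lin_indpt S \<longleftrightarrow> lin_indpt S" if "S \<subseteq> W" for S
    using span_li_not_depend(2)[OF that sm] by simp
  have "\<exists>S. finite S \<and> maximal S (\<lambda>S. S \<subseteq> carrier (V\<lparr>carrier := W\<rparr>) \<and> W.lin_indpt S)"
  proof (rule maximal_exists)
    fix S assume "S \<subseteq> carrier (V\<lparr>carrier := W\<rparr>) \<and> W.lin_indpt S"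
    then show "finite S \<and> card S \<le> dim"
      using li_le_dim[OF fd, of S] li WV by auto
  next
    show "{} \<subseteq> carrier (V\<lparr>carrier := W\<rparr>) \<and> W.lin_indpt {}"
      by (auto simp: W.lin_dep_def)
  qed
  then show ?thesis
    unfolding W.fin_dim_def using W.max_li_is_gen by (auto simp: maximal_def)
qed

text \<open>The target is a bare record: each axiom for \<open>B\<close> is pulled back to
  representatives in \<open>A\<close>. The same scheme for spaces and modules also serves with the
  identity map, to pass between records that share their operations.\<close>

lemma fd_algebra_surj_image:
  fixes B :: "('k, 'b) module"
  assumes A: "fd_algebra K A" and im: "\<theta> ` carrier A = carrier B"
    and add: "\<And>x y. \<lbrakk>x \<in> carrier A; y \<in> carrier A\<rbrakk> \<Longrightarrow> \<theta> (x \<oplus>\<^bsub>A\<^esub> y) = \<theta> x \<oplus>\<^bsub>B\<^esub> \<theta> y"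
    and mult: "\<And>x y. \<lbrakk>x \<in> carrier A; y \<in> carrier A\<rbrakk> \<Longrightarrow> \<theta> (x \<otimes>\<^bsub>A\<^esub> y) = \<theta> x \<otimes>\<^bsub>B\<^esub> \<theta> y"
    and zero: "\<theta> \<zero>\<^bsub>A\<^esub> = \<zero>\<^bsub>B\<^esub>" and one: "\<theta> \<one>\<^bsub>A\<^esub> = \<one>\<^bsub>B\<^esub>"
    and smult: "\<And>c x. \<lbrakk>c \<in> carrier K; x \<in> carrier A\<rbrakk> \<Longrightarrow> \<theta> (c \<odot>\<^bsub>A\<^esub> x) = c \<odot>\<^bsub>B\<^esub> \<theta> x"
  shows "fd_algebra K B"
proof -
  interpret A: fd_algebra K A by fact
  have B: "vectorspace K B"
    by (rule vectorspace_surj_image[OF A.vectorspace_axioms im add zero smult])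
  interpret B: vectorspace K B by fact
  have rep: "\<exists>y\<in>carrier A. x = \<theta> y" if "x \<in> carrier B" for x
    using that im by auto
  have cl: "\<theta> y \<in> carrier B" if "y \<in> carrier A" for y
    using that im by auto
  have "ring B"
  proof (rule ringI)
    show "abelian_group B" by (rule B.M.abelian_group_axioms)
    show "monoid B"
    proof (rule monoidI)
      show "\<one>\<^bsub>B\<^esub> \<in> carrier B" using cl[OF A.A.one_closed] one by simp
      show "x \<otimes>\<^bsub>B\<^esub> y \<in> carrier B" if "x \<in> carrier B" "y \<in> carrier B" for x y
        using that rep cl mult by (metis A.A.m_closed)
      show "\<one>\<^bsub>B\<^esub> \<otimes>\<^bsub>B\<^esub> x = x" "x \<otimes>\<^bsub>B\<^esub> \<one>\<^bsub>B\<^esub> = x" if "x \<in> carrier B" for x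
        using that rep mult one by (metis A.A.one_closed A.A.l_one A.A.r_one)+
      fix x y z assume "x \<in> carrier B" "y \<in> carrier B" "z \<in> carrier B"
      then obtain v' w' x' where [simp]: "v' \<in> carrier A" "w' \<in> carrier A" "x' \<in> carrier A"
        "x = \<theta> v'" "y = \<theta> w'" "z = \<theta> x'" using rep by meson
      show "x \<otimes>\<^bsub>B\<^esub> y \<otimes>\<^bsub>B\<^esub> z = x \<otimes>\<^bsub>B\<^esub> (y \<otimes>\<^bsub>B\<^esub> z)"
        by (simp add: mult[symmetric] A.A.m_assoc)
    qed
    fix x y z assume "x \<in> carrier B" "y \<in> carrier B" "z \<in> carrier B"
    then obtain v' w' x' where [simp]: "v' \<in> carrier A" "w' \<in> carrier A" "x' \<in> carrier A"
      "x = \<theta> v'" "y = \<theta> w'" "z = \<theta> x'" using rep by meson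
    show "(x \<oplus>\<^bsub>B\<^esub> y) \<otimes>\<^bsub>B\<^esub> z = x \<otimes>\<^bsub>B\<^esub> z \<oplus>\<^bsub>B\<^esub> y \<otimes>\<^bsub>B\<^esub> z"
      "z \<otimes>\<^bsub>B\<^esub> (x \<oplus>\<^bsub>B\<^esub> y) = z \<otimes>\<^bsub>B\<^esub> x \<oplus>\<^bsub>B\<^esub> z \<otimes>\<^bsub>B\<^esub> y"
      by (simp_all add: mult[symmetric] add[symmetric] A.A.l_distr A.A.r_distr)
  qed
  then interpret BR: ring B .
  show ?thesis
  proof
    show "vectorspace.fin_dim K B"
      by (rule vectorspace_surj_image(2)[OF A.vectorspace_axioms im add zero smult A.fin_dim])
    fix c x y assume c: "c \<in> carrier K" and "x \<in> carrier B" "y \<in> carrier B"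
    then obtain v' w' where [simp]: "v' \<in> carrier A" "w' \<in> carrier A"
      "x = \<theta> v'" "y = \<theta> w'" using rep by meson
    show "(c \<odot>\<^bsub>B\<^esub> x) \<otimes>\<^bsub>B\<^esub> y = c \<odot>\<^bsub>B\<^esub> (x \<otimes>\<^bsub>B\<^esub> y)" "x \<otimes>\<^bsub>B\<^esub> (c \<odot>\<^bsub>B\<^esub> y) = c \<odot>\<^bsub>B\<^esub> (x \<otimes>\<^bsub>B\<^esub> y)"
      using c by (simp_all add: mult[symmetric] smult[symmetric] A.smult_mult_left A.smult_mult_right)
  qed
qed

text \<open>The algebra may vary together with the module. An identity \<open>\<theta>\<close>
  covers quotients and images; an inverse algebra isomorphism \<open>\<theta>\<close> with identity
  \<open>\<pi>\<close> covers restriction of scalars.\<close>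

lemma fd_rmodule_surj_image:
  fixes N :: "('k, 'b, 'y) rmodule"
  assumes M: "fd_rmodule K A M" and B: "fd_algebra K B" and imA: "\<theta> ` carrier A = carrier B"
    and addA: "\<And>x y. \<lbrakk>x \<in> carrier A; y \<in> carrier A\<rbrakk> \<Longrightarrow> \<theta> (x \<oplus>\<^bsub>A\<^esub> y) = \<theta> x \<oplus>\<^bsub>B\<^esub> \<theta> y"
    and multA: "\<And>x y. \<lbrakk>x \<in> carrier A; y \<in> carrier A\<rbrakk> \<Longrightarrow> \<theta> (x \<otimes>\<^bsub>A\<^esub> y) = \<theta> x \<otimes>\<^bsub>B\<^esub> \<theta> y"
    and oneA: "\<theta> \<one>\<^bsub>A\<^esub> = \<one>\<^bsub>B\<^esub>"
    and smultA: "\<And>c x. \<lbrakk>c \<in> carrier K; x \<in> carrier A\<rbrakk> \<Longrightarrow> \<theta> (c \<odot>\<^bsub>A\<^esub> x) = c \<odot>\<^bsub>B\<^esub> \<theta> x"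
    and im: "\<pi> ` carrier M = carrier N"
    and add: "\<And>x y. \<lbrakk>x \<in> carrier M; y \<in> carrier M\<rbrakk> \<Longrightarrow> \<pi> (x \<oplus>\<^bsub>M\<^esub> y) = \<pi> x \<oplus>\<^bsub>N\<^esub> \<pi> y"
    and zero: "\<pi> \<zero>\<^bsub>M\<^esub> = \<zero>\<^bsub>N\<^esub>"
    and smult: "\<And>c x. \<lbrakk>c \<in> carrier K; x \<in> carrier M\<rbrakk> \<Longrightarrow> \<pi> (c \<odot>\<^bsub>M\<^esub> x) = c \<odot>\<^bsub>N\<^esub> \<pi> x"
    and ract: "\<And>x a. \<lbrakk>x \<in> carrier M; a \<in> carrier A\<rbrakk> \<Longrightarrow> \<pi> (x \<triangleleft>\<^bsub>M\<^esub> a) = \<pi> x \<triangleleft>\<^bsub>N\<^esub> \<theta> a"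
  shows "fd_rmodule K B N"
proof -
  interpret M: fd_rmodule K A M by fact
  interpret B: fd_algebra K B by fact
  interpret N: vectorspace K N
    by (rule vectorspace_surj_image[OF M.vectorspace_axioms im add zero smult])
  have rep: "\<exists>y\<in>carrier M. x = \<pi> y" if "x \<in> carrier N" for x
    using that im by auto
  have repA: "\<exists>y\<in>carrier A. x = \<theta> y" if "x \<in> carrier B" for x
    using that imA by auto
  have cl[simp]: "\<pi> y \<in> carrier N" if "y \<in> carrier M" for y
    using that im by auto
  show ?thesis
  proof
    show "vectorspace.fin_dim K N"
      by (rule vectorspace_surj_image(2)[OF M.vectorspace_axioms im add zero smult M.fin_dim])
    fix c x y a b
    assume "x \<in> carrier N" then obtain x' where [simp]: "x' \<in> carrier M" "x = \<pi> x'"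
      using rep by meson
    show "x \<triangleleft>\<^bsub>N\<^esub> \<one>\<^bsub>B\<^esub> = x"
      by (simp add: oneA[symmetric] ract[symmetric] M.ract_one)
    assume "a \<in> carrier B" then obtain a' where [simp]: "a' \<in> carrier A" "a = \<theta> a'"
      using repA by meson
    show "x \<triangleleft>\<^bsub>N\<^esub> a \<in> carrier N" by (simp add: ract[symmetric] M.ract_closed)
    { assume "y \<in> carrier N" then obtain y' where [simp]: "y' \<in> carrier M" "y = \<pi> y'"
        using rep by meson
      show "(x \<oplus>\<^bsub>N\<^esub> y) \<triangleleft>\<^bsub>N\<^esub> a = x \<triangleleft>\<^bsub>N\<^esub> a \<oplus>\<^bsub>N\<^esub> y \<triangleleft>\<^bsub>N\<^esub> a"
        by (simp add: ract[symmetric] add[symmetric] M.ract_add_left M.ract_closed) }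
    { assume "b \<in> carrier B" then obtain b' where [simp]: "b' \<in> carrier A" "b = \<theta> b'"
        using repA by meson
      show "x \<triangleleft>\<^bsub>N\<^esub> (a \<oplus>\<^bsub>B\<^esub> b) = x \<triangleleft>\<^bsub>N\<^esub> a \<oplus>\<^bsub>N\<^esub> x \<triangleleft>\<^bsub>N\<^esub> b"
        "x \<triangleleft>\<^bsub>N\<^esub> (a \<otimes>\<^bsub>B\<^esub> b) = (x \<triangleleft>\<^bsub>N\<^esub> a) \<triangleleft>\<^bsub>N\<^esub> b"
        by (simp_all add: ract[symmetric] add[symmetric] addA[symmetric] multA[symmetric]
            M.ract_add_right M.ract_mult M.ract_closed) }
    { assume c: "c \<in> carrier K"
      then show "(c \<odot>\<^bsub>N\<^esub> x) \<triangleleft>\<^bsub>N\<^esub> a = c \<odot>\<^bsub>N\<^esub> (x \<triangleleft>\<^bsub>N\<^esub> a)" "x \<triangleleft>\<^bsub>N\<^esub> (c \<odot>\<^bsub>B\<^esub> a) = c \<odot>\<^bsub>N\<^esub> (x \<triangleleft>\<^bsub>N\<^esub> a)"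
        by (simp_all add: ract[symmetric] smult[symmetric] smultA[symmetric]
            M.smult_ract_left M.smult_ract_right M.ract_closed) }
  qed
qed

lemma fd_rmodule_surj_image_same:
  assumes M: "fd_rmodule K A M"
    and im: "\<pi> ` carrier M = carrier N"
    and add: "\<And>x y. \<lbrakk>x \<in> carrier M; y \<in> carrier M\<rbrakk> \<Longrightarrow> \<pi> (x \<oplus>\<^bsub>M\<^esub> y) = \<pi> x \<oplus>\<^bsub>N\<^esub> \<pi> y"
    and zero: "\<pi> \<zero>\<^bsub>M\<^esub> = \<zero>\<^bsub>N\<^esub>"
    and smult: "\<And>c x. \<lbrakk>c \<in> carrier K; x \<in> carrier M\<rbrakk> \<Longrightarrow> \<pi> (c \<odot>\<^bsub>M\<^esub> x) = c \<odot>\<^bsub>N\<^esub> \<pi> x"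
    and ract: "\<And>x a. \<lbrakk>x \<in> carrier M; a \<in> carrier A\<rbrakk> \<Longrightarrow> \<pi> (x \<triangleleft>\<^bsub>M\<^esub> a) = \<pi> x \<triangleleft>\<^bsub>N\<^esub> a"
  shows "fd_rmodule K A N"
  by (rule fd_rmodule_surj_image[where \<theta> = "\<lambda>x. x" and \<pi> = \<pi>, OF M fd_rmodule.axioms(2)[OF M]])
    (auto simp: assms)

context fd_algebra
begin

lemma smult_one_mult: "\<lbrakk>c \<in> carrier K; a \<in> carrier A\<rbrakk> \<Longrightarrow> (c \<odot>\<^bsub>A\<^esub> \<one>\<^bsub>A\<^esub>) \<otimes>\<^bsub>A\<^esub> a = c \<odot>\<^bsub>A\<^esub> a"
  by (simp add: smult_mult_left)

lemma mult_smult_one: "\<lbrakk>c \<in> carrier K; a \<in> carrier A\<rbrakk> \<Longrightarrow> a \<otimes>\<^bsub>A\<^esub> (c \<odot>\<^bsub>A\<^esub> \<one>\<^bsub>A\<^esub>) = c \<odot>\<^bsub>A\<^esub> a"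
  by (simp add: smult_mult_right)

end

context fd_rmodule
begin

lemma fd_algebra: "fd_algebra K A"
  by (rule A.fd_algebra_axioms)

lemma ract_zero_left:
  assumes "a \<in> carrier A"
  shows "\<zero>\<^bsub>M\<^esub> \<triangleleft>\<^bsub>M\<^esub> a = \<zero>\<^bsub>M\<^esub>"
  using ract_add_left[OF M.zero_closed M.zero_closed assms] ract_closed[OF M.zero_closed assms]
  by simp

lemma ract_zero_right:
  assumes "x \<in> carrier M"
  shows "x \<triangleleft>\<^bsub>M\<^esub> \<zero>\<^bsub>A\<^esub> = \<zero>\<^bsub>M\<^esub>"
  using ract_add_right[OF assms A.M.zero_closed A.M.zero_closed] ract_closed[OF assms A.M.zero_closed]
  by simp

lemma ract_minus_left:
  assumes "x \<in> carrier M" "a \<in> carrier A"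
  shows "(\<ominus>\<^bsub>M\<^esub> x) \<triangleleft>\<^bsub>M\<^esub> a = \<ominus>\<^bsub>M\<^esub> (x \<triangleleft>\<^bsub>M\<^esub> a)"
proof -
  have "(\<ominus>\<^bsub>M\<^esub> x) \<triangleleft>\<^bsub>M\<^esub> a \<oplus>\<^bsub>M\<^esub> x \<triangleleft>\<^bsub>M\<^esub> a = \<zero>\<^bsub>M\<^esub>"
    using ract_add_left[of "\<ominus>\<^bsub>M\<^esub> x" x a] assms by (simp add: M.l_neg ract_zero_left)
  then show ?thesis
    using M.minus_equality[of "(\<ominus>\<^bsub>M\<^esub> x) \<triangleleft>\<^bsub>M\<^esub> a" "x \<triangleleft>\<^bsub>M\<^esub> a"] assms by (simp add: ract_closed)
qed

lemma ract_minus_right: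
  assumes "x \<in> carrier M" "a \<in> carrier A"
  shows "x \<triangleleft>\<^bsub>M\<^esub> (\<ominus>\<^bsub>A\<^esub> a) = \<ominus>\<^bsub>M\<^esub> (x \<triangleleft>\<^bsub>M\<^esub> a)"
proof -
  have "x \<triangleleft>\<^bsub>M\<^esub> (\<ominus>\<^bsub>A\<^esub> a) \<oplus>\<^bsub>M\<^esub> x \<triangleleft>\<^bsub>M\<^esub> a = \<zero>\<^bsub>M\<^esub>"
    using ract_add_right[of x "\<ominus>\<^bsub>A\<^esub> a" a] assms by (simp add: A.M.l_neg ract_zero_right)
  then show ?thesis
    using M.minus_equality[of "x \<triangleleft>\<^bsub>M\<^esub> (\<ominus>\<^bsub>A\<^esub> a)" "x \<triangleleft>\<^bsub>M\<^esub> a"] assms by (simp add: ract_closed)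
qed

text \<open>Scalars act through multiples of the unit, so additive maps and subgroups that are
  compatible with the action are automatically compatible with scalars.\<close>

lemma ract_smult_one: "\<lbrakk>c \<in> carrier K; x \<in> carrier M\<rbrakk> \<Longrightarrow> x \<triangleleft>\<^bsub>M\<^esub> (c \<odot>\<^bsub>A\<^esub> \<one>\<^bsub>A\<^esub>) = c \<odot>\<^bsub>M\<^esub> x"
  by (simp add: smult_ract_right ract_one)

lemma finsum_ract:
  assumes "finite I" "f \<in> I \<rightarrow> carrier M" "a \<in> carrier A"
  shows "finsum M f I \<triangleleft>\<^bsub>M\<^esub> a = finsum M (\<lambda>i. f i \<triangleleft>\<^bsub>M\<^esub> a) I"
  using assms
proof (induct I)
  case empty then show ?case by (simp add: ract_zero_left)
next
  case (insert i I)
  then have "f \<in> I \<rightarrow> carrier M" "f i \<in> carrier M" by auto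
  moreover have "(\<lambda>i. f i \<triangleleft>\<^bsub>M\<^esub> a) \<in> I \<rightarrow> carrier M" using insert by (auto intro: ract_closed)
  ultimately show ?case
    using insert by (simp add: M.finsum_insert ract_add_left ract_closed)
qed

lemma ract_finsum:
  assumes "finite I" "f \<in> I \<rightarrow> carrier A" "x \<in> carrier M"
  shows "x \<triangleleft>\<^bsub>M\<^esub> finsum A f I = finsum M (\<lambda>i. x \<triangleleft>\<^bsub>M\<^esub> f i) I"
  using assms
proof (induct I)
  case empty then show ?case by (simp add: ract_zero_right)
next
  case (insert i I)
  then have "f \<in> I \<rightarrow> carrier A" "f i \<in> carrier A" by auto
  moreover have "(\<lambda>i. x \<triangleleft>\<^bsub>M\<^esub> f i) \<in> I \<rightarrow> carrier M" using insert by (auto intro: ract_closed)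
  ultimately show ?case
    using insert by (simp add: M.finsum_insert A.M.finsum_insert ract_add_right ract_closed)
qed

end

lemma regular_simps [simp]:
  "carrier (regular A) = carrier A" "zero (regular A) = zero A" "add (regular A) = add A"
  "smult (regular A) = smult A" "ract (regular A) = mult A"
  by (simp_all add: regular_def)

lemma a_inv_regular [simp]: "a_inv (regular A) = a_inv A"
  by (simp add: fun_eq_iff a_inv_def m_inv_def)

lemma fd_rmodule_regular:
  assumes "fd_algebra K A"
  shows "fd_rmodule K A (regular A)"
proof -
  interpret A: fd_algebra K A by fact
  have V: "vectorspace K (regular A)"
    by (rule vectorspace_surj_image(1)[where \<pi> = "\<lambda>x. x", OF A.vectorspace_axioms]) simp_all
  have fd: "vectorspace.fin_dim K (regular A)"
    by (rule vectorspace_surj_image(2)[where \<pi> = "\<lambda>x. x", OF A.vectorspace_axioms _ _ _ _ A.fin_dim])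
      simp_all
  interpret V: vectorspace K "regular A" by (rule V)
  show ?thesis
    apply unfold_locales
            apply (rule fd)
           apply (simp_all only: regular_simps)
           apply (simp_all only: A.A.m_closed A.A.m_assoc A.A.l_distr A.A.r_distr A.A.r_one
        A.smult_mult_left A.smult_mult_right)
    done
qed

text \<open>\<open>finsum\<close> is built from carrier, addition and zero alone, so it can be
  compared across record types, for instance between an algebra and its regular module.\<close>

lemma finsum_cong_struct:
  assumes "carrier A = carrier B" "add A = add B" "zero A = zero B"
  shows "finsum A = finsum B"
proof (intro ext)
  fix f I
  show "finsum A f I = finsum B f I"
    using assms by (cases "finite I") (simp_all add: finsum_def finprod_def)
qed

lemma finsum_regular [simp]: "finsum (regular A) = finsum A"
  by (rule finsum_cong_struct) simp_all

subsection \<open>Homomorphisms and submodules\<close>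

lemma rmod_homI:
  assumes "\<And>x. x \<in> carrier M \<Longrightarrow> h x \<in> carrier Y"
    and "\<And>x y. \<lbrakk>x \<in> carrier M; y \<in> carrier M\<rbrakk> \<Longrightarrow> h (x \<oplus>\<^bsub>M\<^esub> y) = h x \<oplus>\<^bsub>Y\<^esub> h y"
    and "\<And>x a. \<lbrakk>x \<in> carrier M; a \<in> carrier A\<rbrakk> \<Longrightarrow> h (x \<triangleleft>\<^bsub>M\<^esub> a) = h x \<triangleleft>\<^bsub>Y\<^esub> a"
  shows "h \<in> rmod_hom A M Y"
  using assms by (auto simp: rmod_hom_def)

lemma rmod_hom_closed: "\<lbrakk>h \<in> rmod_hom A M Y; x \<in> carrier M\<rbrakk> \<Longrightarrow> h x \<in> carrier Y"
  and rmod_hom_add: "\<lbrakk>h \<in> rmod_hom A M Y; x \<in> carrier M; y \<in> carrier M\<rbrakk> \<Longrightarrow> h (x \<oplus>\<^bsub>M\<^esub> y) = h x \<oplus>\<^bsub>Y\<^esub> h y"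
  and rmod_hom_ract: "\<lbrakk>h \<in> rmod_hom A M Y; x \<in> carrier M; a \<in> carrier A\<rbrakk> \<Longrightarrow> h (x \<triangleleft>\<^bsub>M\<^esub> a) = h x \<triangleleft>\<^bsub>Y\<^esub> a"
  by (auto simp: rmod_hom_def)

lemma rmod_hom_compose:
  "\<lbrakk>h \<in> rmod_hom A M Y; k \<in> rmod_hom A Y Z\<rbrakk> \<Longrightarrow> (\<lambda>x. k (h x)) \<in> rmod_hom A M Z"
  by (auto simp: rmod_hom_def Pi_iff)

lemma rmod_hom_cong:
  assumes "h \<in> rmod_hom A M Y" "fd_rmodule K A M" "\<And>x. x \<in> carrier M \<Longrightarrow> h x = k x"
  shows "k \<in> rmod_hom A M Y"
proof -
  interpret M: fd_rmodule K A M by fact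
  show ?thesis
    by (rule rmod_homI)
      (use assms in \<open>auto simp: assms(3)[symmetric] M.ract_closed rmod_hom_closed rmod_hom_add rmod_hom_ract\<close>)
qed

locale rmod_hom_pair = M: fd_rmodule K A M + Y: fd_rmodule K A Y
  for K :: "('k, 'r) ring_scheme" and A :: "('k, 'a) module"
    and M :: "('k, 'a, 'x) rmodule" and Y :: "('k, 'a, 'y) rmodule" +
  fixes h
  assumes hom: "h \<in> rmod_hom A M Y"
begin

lemmas hom_closed [simp] = rmod_hom_closed[OF hom]
  and hom_add = rmod_hom_add[OF hom]
  and hom_ract = rmod_hom_ract[OF hom]

lemma hom_zero [simp]: "h \<zero>\<^bsub>M\<^esub> = \<zero>\<^bsub>Y\<^esub>"
  using hom_add[OF M.M.zero_closed M.M.zero_closed] hom_closed[OF M.M.zero_closed] by simp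

lemma hom_minus:
  assumes "x \<in> carrier M"
  shows "h (\<ominus>\<^bsub>M\<^esub> x) = \<ominus>\<^bsub>Y\<^esub> h x"
  using assms hom_add[of "\<ominus>\<^bsub>M\<^esub> x" x] Y.M.minus_equality[of "h (\<ominus>\<^bsub>M\<^esub> x)" "h x"]
  by (simp add: M.M.l_neg)

lemma hom_finsum:
  assumes "finite I" "f \<in> I \<rightarrow> carrier M"
  shows "h (finsum M f I) = finsum Y (\<lambda>i. h (f i)) I"
  using assms
proof (induct I)
  case empty then show ?case by simp
next
  case (insert i I)
  then have "f \<in> I \<rightarrow> carrier M" "f i \<in> carrier M" by auto
  moreover have "(\<lambda>i. h (f i)) \<in> I \<rightarrow> carrier Y" using insert(4) by (auto intro: hom_closed)
  ultimately show ?case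
    using insert by (simp add: M.M.finsum_insert Y.M.finsum_insert hom_add)
qed

end

lemma rmod_hom_pairI:
  "\<lbrakk>fd_rmodule K A M; fd_rmodule K A Y; h \<in> rmod_hom A M Y\<rbrakk> \<Longrightarrow> rmod_hom_pair K A M Y h"
  by (simp add: rmod_hom_pair_def rmod_hom_pair_axioms_def)

lemma rsubmoduleD:
  assumes "rsubmodule A M N"
  shows "N \<subseteq> carrier M" "\<zero>\<^bsub>M\<^esub> \<in> N" "\<lbrakk>x \<in> N; y \<in> N\<rbrakk> \<Longrightarrow> x \<oplus>\<^bsub>M\<^esub> y \<in> N"
    "\<lbrakk>x \<in> N; a \<in> carrier A\<rbrakk> \<Longrightarrow> x \<triangleleft>\<^bsub>M\<^esub> a \<in> N"
  using assms by (auto simp: rsubmodule_def)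

context fd_rmodule
begin

lemma rsubmodule_smult:
  assumes "rsubmodule A M N" "c \<in> carrier K" "x \<in> N"
  shows "c \<odot>\<^bsub>M\<^esub> x \<in> N"
proof -
  have "x \<triangleleft>\<^bsub>M\<^esub> (c \<odot>\<^bsub>A\<^esub> \<one>\<^bsub>A\<^esub>) \<in> N"
    using assms rsubmoduleD(4)[OF assms(1)] by simp
  then show ?thesis
    using assms rsubmoduleD(1)[OF assms(1)] by (simp add: ract_smult_one subset_iff)
qed

lemma rsubmodule_minus:
  assumes "rsubmodule A M N" "x \<in> N"
  shows "\<ominus>\<^bsub>M\<^esub> x \<in> N"
proof -
  have "x \<triangleleft>\<^bsub>M\<^esub> (\<ominus>\<^bsub>A\<^esub> \<one>\<^bsub>A\<^esub>) \<in> N"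
    using assms rsubmoduleD(4)[OF assms(1)] by simp
  then show ?thesis
    using assms rsubmoduleD(1)[OF assms(1)] by (simp add: ract_minus_right ract_one subset_iff)
qed

lemma rsubmodule_finsum:
  assumes "rsubmodule A M N" "finite I" "f \<in> I \<rightarrow> N"
  shows "finsum M f I \<in> N"
  using assms(2,3)
proof (induct I)
  case empty then show ?case using rsubmoduleD[OF assms(1)] by simp
next
  case (insert i I)
  then have "f \<in> I \<rightarrow> carrier M" "f i \<in> carrier M" using rsubmoduleD(1)[OF assms(1)] by auto
  then show ?case using insert rsubmoduleD[OF assms(1)] by (simp add: M.finsum_insert)
qed

lemma rsubmodule_subspace:
  assumes "rsubmodule A M N"
  shows "subspace K N M"
  using rsubmoduleD[OF assms] rsubmodule_smult[OF assms]
  by (auto simp: subspace_def submodule_def vectorspace_axioms module_axioms)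

lemma rsubmodule_additive_subgroup:
  assumes "rsubmodule A M N"
  shows "additive_subgroup N M"
  using rsubmoduleD[OF assms] rsubmodule_minus[OF assms]
  by (auto intro!: additive_subgroupI M.add.subgroupI simp flip: a_inv_def)

lemma fd_rmodule_submodule:
  assumes "rsubmodule A M N"
  shows "fd_rmodule K A (M\<lparr>carrier := N\<rparr>)"
proof -
  note s = rsubmoduleD[OF assms]
  interpret N: vectorspace K "M\<lparr>carrier := N\<rparr>"
    by (rule subspace_is_vs[OF rsubmodule_subspace[OF assms]])
  show ?thesis
    apply unfold_locales
    using subspace_fin_dim[OF rsubmodule_subspace[OF assms] fin_dim] s
    by (auto simp: ract_add_left ract_add_right ract_mult ract_one smult_ract_left smult_ract_right subset_iff)
qed

text \<open>\<open>finsum\<close> refers to the carrier, so the two sums are different terms; they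
  agree once all summands lie in the submodule.\<close>

lemma finsum_submodule:
  assumes "rsubmodule A M N" "finite I" "f \<in> I \<rightarrow> N"
  shows "finsum (M\<lparr>carrier := N\<rparr>) f I = finsum M f I"
  using assms(2,3)
proof (induct I)
  case empty
  interpret N: fd_rmodule K A "M\<lparr>carrier := N\<rparr>" by (rule fd_rmodule_submodule[OF assms(1)])
  show ?case using N.M.finsum_empty by simp
next
  interpret N: fd_rmodule K A "M\<lparr>carrier := N\<rparr>" by (rule fd_rmodule_submodule[OF assms(1)])
  case (insert i I)
  then have f: "f \<in> I \<rightarrow> carrier M" "f i \<in> carrier M" "f \<in> I \<rightarrow> N" "f i \<in> N"
    using rsubmoduleD(1)[OF assms(1)] by auto
  then have "finsum (M\<lparr>carrier := N\<rparr>) f (insert i I) = f i \<oplus>\<^bsub>M\<^esub> finsum (M\<lparr>carrier := N\<rparr>) f I"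
    using insert(1,2) N.M.finsum_insert[of I i f] by simp
  then show ?case using insert f by (simp add: M.finsum_insert)
qed

end

section \<open>Quotient modules\<close>

text \<open>Maps out of a quotient are encoded as the union, over all representatives, of the cosets
  of their images. For an additive map that carries \<open>N\<close> into \<open>N'\<close> all
  these cosets coincide, so the union is a single coset.\<close>

lemma coset_UN_hom_eq:
  fixes M (structure) and M' (structure)
  assumes "abelian_group M" "additive_subgroup N M" "abelian_group M'" "additive_subgroup N' M'"
    and \<phi>: "\<And>y. y \<in> carrier M \<Longrightarrow> \<phi> y \<in> carrier M'"
    and add: "\<And>y z. \<lbrakk>y \<in> carrier M; z \<in> carrier M\<rbrakk> \<Longrightarrow> \<phi> (y \<oplus>\<^bsub>M\<^esub> z) = \<phi> y \<oplus>\<^bsub>M'\<^esub> \<phi> z"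
    and sub: "\<And>y. y \<in> N \<Longrightarrow> \<phi> y \<in> N'"
    and x: "x \<in> carrier M"
  shows "(\<Union>y\<in>N +>\<^bsub>M\<^esub> x. N' +>\<^bsub>M'\<^esub> \<phi> y) = N' +>\<^bsub>M'\<^esub> \<phi> x"
proof -
  interpret M: abelian_group M by fact
  interpret N: additive_subgroup N M by fact
  interpret M': abelian_group M' by fact
  interpret N': additive_subgroup N' M' by fact
  have "N' +>\<^bsub>M'\<^esub> \<phi> y = N' +>\<^bsub>M'\<^esub> \<phi> x" if y: "y \<in> N +>\<^bsub>M\<^esub> x" for y
  proof -
    obtain n where n: "n \<in> N" "y = n \<oplus>\<^bsub>M\<^esub> x" using y by (auto simp: a_r_coset_def')
    have "n \<in> carrier M" using n N.a_subset by auto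
    then have "\<phi> y = \<phi> n \<oplus>\<^bsub>M'\<^esub> \<phi> x" using n add x by auto
    then have "\<phi> y \<in> N' +>\<^bsub>M'\<^esub> \<phi> x" using n sub by (auto simp: a_r_coset_def')
    then show ?thesis
      using M'.a_repr_independence[OF _ \<phi>[OF x] N'.a_subgroup] by metis
  qed
  moreover have "x \<in> N +>\<^bsub>M\<^esub> x"
    using x by (auto simp: a_r_coset_def' intro!: bexI[of _ "\<zero>\<^bsub>M\<^esub>"])
  ultimately show ?thesis by blast
qed

locale rmod_quotient = fd_rmodule K A M
  for K :: "('k, 'r) ring_scheme" and A :: "('k, 'a) module" and M :: "('k, 'a, 'x) rmodule" +
  fixes N
  assumes sub: "rsubmodule A M N"
begin

abbreviation "coset x \<equiv> N +>\<^bsub>M\<^esub> x"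

lemma additive: "additive_subgroup N M"
  by (rule rsubmodule_additive_subgroup[OF sub])

lemma carrier_quot: "carrier (quot_rmodule M N) = coset ` carrier M"
  by (auto simp: quot_rmodule_def A_RCOSETS_def')

lemma coset_closed: "x \<in> carrier M \<Longrightarrow> coset x \<in> carrier (quot_rmodule M N)"
  by (simp add: carrier_quot)

lemma coset_add:
  assumes "x \<in> carrier M" "y \<in> carrier M"
  shows "coset x \<oplus>\<^bsub>quot_rmodule M N\<^esub> coset y = coset (x \<oplus>\<^bsub>M\<^esub> y)"
  using abelian_subgroup.a_rcos_sum[OF abelian_subgroupI3[OF additive M.abelian_group_axioms] assms]
  by (simp add: quot_rmodule_def)

lemma coset_zero: "coset \<zero>\<^bsub>M\<^esub> = \<zero>\<^bsub>quot_rmodule M N\<^esub>"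
  using rsubmoduleD(1)[OF sub] by (simp add: quot_rmodule_def)

lemma coset_smult:
  assumes "c \<in> carrier K" "x \<in> carrier M"
  shows "c \<odot>\<^bsub>quot_rmodule M N\<^esub> coset x = coset (c \<odot>\<^bsub>M\<^esub> x)"
  using coset_UN_hom_eq[OF M.abelian_group_axioms additive M.abelian_group_axioms additive, of "\<lambda>x. c \<odot>\<^bsub>M\<^esub> x" x] assms
    rsubmodule_smult[OF sub]
  by (simp add: quot_rmodule_def smult_r_distr)

lemma coset_ract:
  assumes "x \<in> carrier M" "a \<in> carrier A"
  shows "coset x \<triangleleft>\<^bsub>quot_rmodule M N\<^esub> a = coset (x \<triangleleft>\<^bsub>M\<^esub> a)"
  using coset_UN_hom_eq[OF M.abelian_group_axioms additive M.abelian_group_axioms additive, of "\<lambda>x. x \<triangleleft>\<^bsub>M\<^esub> a" x] assms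
    rsubmoduleD(4)[OF sub]
  by (simp add: quot_rmodule_def ract_add_left ract_closed)

lemma coset_eq_iff:
  assumes "x \<in> carrier M" "y \<in> carrier M"
  shows "coset x = coset y \<longleftrightarrow> x \<ominus>\<^bsub>M\<^esub> y \<in> N"
proof -
  interpret N: abelian_subgroup N M
    by (rule abelian_subgroupI3[OF additive M.abelian_group_axioms])
  show ?thesis
    using N.a_rcos_module[OF assms(2,1)] N.a_repr_independence'[OF _ assms(2)]
      N.a_repr_independenceD[OF assms(1), of y]
    by (auto simp: M.minus_eq)
qed

lemma coset_eq_zero_iff:
  "x \<in> carrier M \<Longrightarrow> coset x = \<zero>\<^bsub>quot_rmodule M N\<^esub> \<longleftrightarrow> x \<in> N"
  using coset_eq_iff[of x "\<zero>\<^bsub>M\<^esub>"] coset_zero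
    M.minus_equality[of "\<zero>\<^bsub>M\<^esub>" "\<zero>\<^bsub>M\<^esub>"]
  by (simp add: M.minus_eq)

lemma fd_rmodule_quot: "fd_rmodule K A (quot_rmodule M N)"
  by (rule fd_rmodule_surj_image_same[OF fd_rmodule_axioms, of "coset"])
    (auto simp: carrier_quot coset_add coset_zero coset_smult coset_ract)

lemma coset_hom: "coset \<in> rmod_hom A M (quot_rmodule M N)"
  by (rule rmod_homI) (simp_all add: coset_closed coset_add coset_ract)

end

section \<open>Projective modules\<close>

text \<open>The dual basis theorem identifies the existence of such data with projectivity. The
  \<open>p i\<close> are generators, in general with relations, and the linear forms
  \<open>h i\<close> supply a preferred choice of coefficients.\<close>

definition dual_basis ::
  "('k, 'a) module \<Rightarrow> ('k, 'a, 'p) rmodule \<Rightarrow> nat \<Rightarrow> (nat \<Rightarrow> 'p) \<Rightarrow> (nat \<Rightarrow> 'p \<Rightarrow> 'a) \<Rightarrow> bool" where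
  "dual_basis A P n p h \<longleftrightarrow>
    (\<forall>i<n. p i \<in> carrier P \<and> h i \<in> rmod_hom A P (regular A)) \<and>
    (\<forall>x\<in>carrier P. finsum P (\<lambda>i. p i \<triangleleft>\<^bsub>P\<^esub> h i x) {..<n} = x)"

lemma dual_basisD:
  assumes "dual_basis A P n p h"
  shows "i < n \<Longrightarrow> p i \<in> carrier P" "i < n \<Longrightarrow> h i \<in> rmod_hom A P (regular A)"
    "\<lbrakk>i < n; x \<in> carrier P\<rbrakk> \<Longrightarrow> h i x \<in> carrier A"
    "x \<in> carrier P \<Longrightarrow> finsum P (\<lambda>i. p i \<triangleleft>\<^bsub>P\<^esub> h i x) {..<n} = x"
  using assms rmod_hom_closed by (fastforce simp: dual_basis_def)+

text \<open>The coordinates \<open>h i\<close> are linear, hence any choice of elements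
  \<open>m i\<close> defines a homomorphism. Unlike for a free basis, it need not send
  \<open>p i\<close> to \<open>m i\<close>.\<close>

lemma dual_basis_map_hom:
  assumes M: "fd_rmodule K A M" and db: "dual_basis A P n p h"
    and m: "\<And>i. i < n \<Longrightarrow> m i \<in> carrier M"
  shows "(\<lambda>x. finsum M (\<lambda>i. m i \<triangleleft>\<^bsub>M\<^esub> h i x) {..<n}) \<in> rmod_hom A P M"
proof -
  interpret M: fd_rmodule K A M by fact
  note d = dual_basisD[OF db]
  have cl: "(\<lambda>i. m i \<triangleleft>\<^bsub>M\<^esub> h i x) \<in> {..<n} \<rightarrow> carrier M" if "x \<in> carrier P" for x
    using that m d by (auto intro: M.ract_closed)
  show ?thesis
  proof (rule rmod_homI)
    show "finsum M (\<lambda>i. m i \<triangleleft>\<^bsub>M\<^esub> h i x) {..<n} \<in> carrier M" if "x \<in> carrier P" for x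
      by (rule M.M.finsum_closed[OF cl[OF that]])
    fix x assume x: "x \<in> carrier P"
    { fix y assume y: "y \<in> carrier P"
      have "finsum M (\<lambda>i. m i \<triangleleft>\<^bsub>M\<^esub> h i (x \<oplus>\<^bsub>P\<^esub> y)) {..<n}
        = finsum M (\<lambda>i. m i \<triangleleft>\<^bsub>M\<^esub> h i x \<oplus>\<^bsub>M\<^esub> m i \<triangleleft>\<^bsub>M\<^esub> h i y) {..<n}"
        using x y m d rmod_hom_add[OF d(2)]
        by (intro M.M.finsum_cong') (auto simp: M.ract_add_right intro!: M.ract_closed M.M.a_closed)
      also have "\<dots> = finsum M (\<lambda>i. m i \<triangleleft>\<^bsub>M\<^esub> h i x) {..<n} \<oplus>\<^bsub>M\<^esub> finsum M (\<lambda>i. m i \<triangleleft>\<^bsub>M\<^esub> h i y) {..<n}"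
        by (rule M.M.finsum_addf[OF cl[OF x] cl[OF y]])
      finally show "finsum M (\<lambda>i. m i \<triangleleft>\<^bsub>M\<^esub> h i (x \<oplus>\<^bsub>P\<^esub> y)) {..<n} = \<dots>" . }
    fix a assume a: "a \<in> carrier A"
    have "finsum M (\<lambda>i. m i \<triangleleft>\<^bsub>M\<^esub> h i (x \<triangleleft>\<^bsub>P\<^esub> a)) {..<n}
        = finsum M (\<lambda>i. (m i \<triangleleft>\<^bsub>M\<^esub> h i x) \<triangleleft>\<^bsub>M\<^esub> a) {..<n}"
      using x a m d rmod_hom_ract[OF d(2)]
      by (intro M.M.finsum_cong') (auto simp: M.ract_mult intro!: M.ract_closed)
    then show "finsum M (\<lambda>i. m i \<triangleleft>\<^bsub>M\<^esub> h i (x \<triangleleft>\<^bsub>P\<^esub> a)) {..<n} = finsum M (\<lambda>i. m i \<triangleleft>\<^bsub>M\<^esub> h i x) {..<n} \<triangleleft>\<^bsub>M\<^esub> a"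
      by (simp add: M.finsum_ract[OF _ cl[OF x] a])
  qed
qed

text \<open>\<open>v\<close> is applied to the dual basis expansion of \<open>x\<close>. Thus every
  homomorphism out of \<open>P\<close> is a finite sum of maps x -> m h(x); both directions of the
  rigidity criterion rest on this.\<close>

lemma dual_basis_hom_expand:
  assumes P: "fd_rmodule K A P" and M: "fd_rmodule K A M" and db: "dual_basis A P n p h"
    and v: "v \<in> rmod_hom A P M" and x: "x \<in> carrier P"
  shows "finsum M (\<lambda>i. v (p i) \<triangleleft>\<^bsub>M\<^esub> h i x) {..<n} = v x"
proof -
  interpret v: rmod_hom_pair K A P M v by (rule rmod_hom_pairI[OF P M v])
  note d = dual_basisD[OF db]
  have cl: "(\<lambda>i. p i \<triangleleft>\<^bsub>P\<^esub> h i x) \<in> {..<n} \<rightarrow> carrier P"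
    using x d by (auto intro: v.M.ract_closed)
  have "v x = v (finsum P (\<lambda>i. p i \<triangleleft>\<^bsub>P\<^esub> h i x) {..<n})" by (simp add: d(4) x)
  also have "\<dots> = finsum M (\<lambda>i. v (p i \<triangleleft>\<^bsub>P\<^esub> h i x)) {..<n}" by (rule v.hom_finsum[OF _ cl]) simp
  also have "\<dots> = finsum M (\<lambda>i. v (p i) \<triangleleft>\<^bsub>M\<^esub> h i x) {..<n}"
    using x d by (intro v.Y.M.finsum_cong') (auto simp: v.hom_ract intro!: v.Y.ract_closed)
  finally show ?thesis by simp
qed

lemma rmod_power_simps [simp]:
  "carrier (rmod_power M n) = {..<n} \<rightarrow>\<^sub>E carrier M"
  "zero (rmod_power M n) = (\<lambda>i\<in>{..<n}. \<zero>\<^bsub>M\<^esub>)"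
  "add (rmod_power M n) u v = (\<lambda>i\<in>{..<n}. u i \<oplus>\<^bsub>M\<^esub> v i)"
  "smult (rmod_power M n) c u = (\<lambda>i\<in>{..<n}. c \<odot>\<^bsub>M\<^esub> u i)"
  "ract (rmod_power M n) u a = (\<lambda>i\<in>{..<n}. u i \<triangleleft>\<^bsub>M\<^esub> a)"
  by (simp_all add: rmod_power_def)

text \<open>Additivity of \<open>r\<close>, applied to the decomposition of \<open>u\<close> into
  vectors supported in one coordinate. The prefixes \<open>U m\<close> build this decomposition one
  coordinate at a time.\<close>

lemma power_hom_sum:
  assumes P: "fd_rmodule K A P" and N: "fd_rmodule K A N"
    and r: "r \<in> rmod_hom A (rmod_power P n) N" and u: "u \<in> {..<n} \<rightarrow>\<^sub>E carrier P"
  shows "r u = finsum N (\<lambda>i. r (\<lambda>j\<in>{..<n}. if j = i then u i else \<zero>\<^bsub>P\<^esub>)) {..<n}"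
proof -
  interpret P: fd_rmodule K A P by fact
  interpret N: fd_rmodule K A N by fact
  define \<delta> where "\<delta> i = (\<lambda>j\<in>{..<n}. if j = i then u i else \<zero>\<^bsub>P\<^esub>)" for i
  define U where "U m = (\<lambda>j\<in>{..<n}. if j < m then u j else \<zero>\<^bsub>P\<^esub>)" for m
  have uc: "u i \<in> carrier P" if "i < n" for i using u that by auto
  have \<delta>c: "\<delta> i \<in> carrier (rmod_power P n)" if "i < n" for i using uc[OF that] by (auto simp: \<delta>_def)
  have Uc: "U m \<in> carrier (rmod_power P n)" for m using uc by (auto simp: U_def)
  have zero: "(\<lambda>j\<in>{..<n}. \<zero>\<^bsub>P\<^esub>) \<in> carrier (rmod_power P n)" by auto
  have r0: "r (\<lambda>j\<in>{..<n}. \<zero>\<^bsub>P\<^esub>) = \<zero>\<^bsub>N\<^esub>"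
  proof -
    have "(\<lambda>j\<in>{..<n}. \<zero>\<^bsub>P\<^esub>) \<oplus>\<^bsub>rmod_power P n\<^esub> (\<lambda>j\<in>{..<n}. \<zero>\<^bsub>P\<^esub>) = (\<lambda>j\<in>{..<n}. \<zero>\<^bsub>P\<^esub>)"
      by (auto simp: fun_eq_iff)
    then show ?thesis
      using rmod_hom_add[OF r zero zero] rmod_hom_closed[OF r zero] by simp
  qed
  have rU: "m \<le> n \<Longrightarrow> r (U m) = finsum N (\<lambda>i. r (\<delta> i)) {..<m}" for m
  proof (induct m)
    case 0
    have "U 0 = (\<lambda>j\<in>{..<n}. \<zero>\<^bsub>P\<^esub>)" by (auto simp: U_def fun_eq_iff)
    then have "r (U 0) = \<zero>\<^bsub>N\<^esub>" using r0 by metis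
    then show ?case by simp
  next
    case (Suc m)
    then have m: "m < n" by simp
    have "U (Suc m) = \<delta> m \<oplus>\<^bsub>rmod_power P n\<^esub> U m"
      using uc m by (auto simp: U_def \<delta>_def fun_eq_iff less_Suc_eq)
    then have "r (U (Suc m)) = r (\<delta> m) \<oplus>\<^bsub>N\<^esub> r (U m)"
      using rmod_hom_add[OF r \<delta>c[OF m] Uc] by simp
    also have "\<dots> = finsum N (\<lambda>i. r (\<delta> i)) {..<Suc m}"
      using Suc m rmod_hom_closed[OF r \<delta>c]
      by (simp add: lessThan_Suc N.M.finsum_insert Pi_iff)
    finally show ?case .
  qed
  have Un: "U n = u" using u by (auto simp: U_def fun_eq_iff PiE_def extensional_def)
  show ?thesis using rU[OF order.refl] unfolding \<delta>_def Un .
qed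

lemma power_hom_expand:
  assumes A: "fd_algebra K A" and P: "fd_rmodule K A P"
    and r: "r \<in> rmod_hom A (rmod_power (regular A) n) P" and u: "u \<in> {..<n} \<rightarrow>\<^sub>E carrier A"
  shows "r u = finsum P (\<lambda>i. r (\<lambda>j\<in>{..<n}. if j = i then \<one>\<^bsub>A\<^esub> else \<zero>\<^bsub>A\<^esub>) \<triangleleft>\<^bsub>P\<^esub> u i) {..<n}"
proof -
  interpret P: fd_rmodule K A P by fact
  define \<delta> where "\<delta> i = (\<lambda>j\<in>{..<n}. if j = i then \<one>\<^bsub>A\<^esub> else \<zero>\<^bsub>A\<^esub>)" for i
  have \<delta>c: "\<delta> i \<in> carrier (rmod_power (regular A) n)" for i by (auto simp: \<delta>_def)
  have uc: "u i \<in> carrier A" if "i < n" for i using u that by auto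
  have eq: "(\<lambda>j\<in>{..<n}. if j = i then u i else \<zero>\<^bsub>A\<^esub>) = \<delta> i \<triangleleft>\<^bsub>rmod_power (regular A) n\<^esub> u i" if "i < n" for i
    using uc[OF that] by (auto simp: \<delta>_def fun_eq_iff)
  have "r u = finsum P (\<lambda>i. r (\<lambda>j\<in>{..<n}. if j = i then u i else \<zero>\<^bsub>A\<^esub>)) {..<n}"
    by (rule power_hom_sum[OF fd_rmodule_regular[OF A] P r, unfolded regular_simps, OF u])
  also have "\<dots> = finsum P (\<lambda>i. r (\<delta> i) \<triangleleft>\<^bsub>P\<^esub> u i) {..<n}"
    using uc rmod_hom_closed[OF r \<delta>c]
    by (intro P.M.finsum_cong') (auto simp: eq rmod_hom_ract[OF r \<delta>c] P.ract_closed simp del: rmod_power_simps)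
  finally show ?thesis unfolding \<delta>_def .
qed

lemma power_inj_hom:
  assumes "fd_rmodule K A P" "i < n"
  shows "(\<lambda>x. \<lambda>j\<in>{..<n}. if j = i then x else \<zero>\<^bsub>P\<^esub>) \<in> rmod_hom A P (rmod_power P n)"
proof -
  interpret P: fd_rmodule K A P by fact
  show ?thesis by (rule rmod_homI) (auto simp: fun_eq_iff P.ract_zero_left)
qed

lemma power_proj_hom: "i < n \<Longrightarrow> (\<lambda>u. u i) \<in> rmod_hom A (rmod_power P n) P"
  by (rule rmod_homI) (auto simp: PiE_iff)

text \<open>The dual basis theorem. A retract of a free module has the components of
  \<open>s\<close> as linear forms and the images under \<open>r\<close> of the unit vectors as
  generators; conversely the linear forms embed \<open>P\<close> into a free module and the
  generators define the retraction.\<close>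

lemma projective_iff_dual_basis:
  assumes P: "fd_rmodule K A P"
  shows "projective A P \<longleftrightarrow> (\<exists>n p h. dual_basis A P n p h)"
proof
  interpret P: fd_rmodule K A P by fact
  assume "projective A P"
  then obtain n s r where s: "s \<in> rmod_hom A P (rmod_power (regular A) n)"
    and r: "r \<in> rmod_hom A (rmod_power (regular A) n) P" and rs: "\<And>x. x \<in> carrier P \<Longrightarrow> r (s x) = x"
    by (auto simp: projective_def in_add_def)
  let ?p = "\<lambda>i. r (\<lambda>j\<in>{..<n}. if j = i then \<one>\<^bsub>A\<^esub> else \<zero>\<^bsub>A\<^esub>)"
  have "dual_basis A P n ?p (\<lambda>i x. s x i)"
    unfolding dual_basis_def
  proof (intro conjI allI impI ballI)
    fix i assume i: "i < n"
    show "?p i \<in> carrier P" by (rule rmod_hom_closed[OF r]) auto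
    show "(\<lambda>x. s x i) \<in> rmod_hom A P (regular A)"
      using i rmod_hom_closed[OF s] by (intro rmod_homI) (auto simp: rmod_hom_add[OF s] rmod_hom_ract[OF s])
  next
    fix x assume x: "x \<in> carrier P"
    show "finsum P (\<lambda>i. ?p i \<triangleleft>\<^bsub>P\<^esub> s x i) {..<n} = x"
      using power_hom_expand[OF P.fd_algebra P r, of "s x"] rmod_hom_closed[OF s x] rs[OF x] by simp
  qed
  then show "\<exists>n p h. dual_basis A P n p h" by blast
next
  interpret P: fd_rmodule K A P by fact
  assume "\<exists>n p h. dual_basis A P n p h"
  then obtain n p h where db: "dual_basis A P n p h" by blast
  note d = dual_basisD[OF db]
  let ?R = "rmod_power (regular A) n"
  have s: "(\<lambda>x. \<lambda>i\<in>{..<n}. h i x) \<in> rmod_hom A P ?R"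
    using d(3) by (intro rmod_homI) (auto simp: fun_eq_iff rmod_hom_add[OF d(2)] rmod_hom_ract[OF d(2)])
  have cl: "(\<lambda>i. p i \<triangleleft>\<^bsub>P\<^esub> u i) \<in> {..<n} \<rightarrow> carrier P" if "u \<in> {..<n} \<rightarrow>\<^sub>E carrier A" for u
    using that d by (auto intro: P.ract_closed)
  have r: "(\<lambda>u. finsum P (\<lambda>i. p i \<triangleleft>\<^bsub>P\<^esub> u i) {..<n}) \<in> rmod_hom A ?R P"
  proof (rule rmod_homI)
    fix u assume "u \<in> carrier ?R" then have u: "u \<in> {..<n} \<rightarrow>\<^sub>E carrier A" by simp
    show "finsum P (\<lambda>i. p i \<triangleleft>\<^bsub>P\<^esub> u i) {..<n} \<in> carrier P" by (rule P.M.finsum_closed[OF cl[OF u]])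
    { fix v assume "v \<in> carrier ?R" then have v: "v \<in> {..<n} \<rightarrow>\<^sub>E carrier A" by simp
      have "finsum P (\<lambda>i. p i \<triangleleft>\<^bsub>P\<^esub> (u \<oplus>\<^bsub>?R\<^esub> v) i) {..<n}
        = finsum P (\<lambda>i. p i \<triangleleft>\<^bsub>P\<^esub> u i \<oplus>\<^bsub>P\<^esub> p i \<triangleleft>\<^bsub>P\<^esub> v i) {..<n}"
        using u v d(1) by (intro P.M.finsum_cong') (auto simp: P.ract_add_right PiE_iff intro!: P.ract_closed P.M.a_closed)
      also have "\<dots> = finsum P (\<lambda>i. p i \<triangleleft>\<^bsub>P\<^esub> u i) {..<n} \<oplus>\<^bsub>P\<^esub> finsum P (\<lambda>i. p i \<triangleleft>\<^bsub>P\<^esub> v i) {..<n}"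
        by (rule P.M.finsum_addf[OF cl[OF u] cl[OF v]])
      finally show "finsum P (\<lambda>i. p i \<triangleleft>\<^bsub>P\<^esub> (u \<oplus>\<^bsub>?R\<^esub> v) i) {..<n} = \<dots>" . }
    fix a assume a: "a \<in> carrier A"
    have "finsum P (\<lambda>i. p i \<triangleleft>\<^bsub>P\<^esub> (u \<triangleleft>\<^bsub>?R\<^esub> a) i) {..<n} = finsum P (\<lambda>i. (p i \<triangleleft>\<^bsub>P\<^esub> u i) \<triangleleft>\<^bsub>P\<^esub> a) {..<n}"
      using u a d(1) by (intro P.M.finsum_cong') (auto simp: P.ract_mult PiE_iff intro!: P.ract_closed)
    then show "finsum P (\<lambda>i. p i \<triangleleft>\<^bsub>P\<^esub> (u \<triangleleft>\<^bsub>?R\<^esub> a) i) {..<n} = finsum P (\<lambda>i. p i \<triangleleft>\<^bsub>P\<^esub> u i) {..<n} \<triangleleft>\<^bsub>P\<^esub> a"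
      by (simp add: P.finsum_ract[OF _ cl[OF u] a])
  qed
  have "finsum P (\<lambda>i. p i \<triangleleft>\<^bsub>P\<^esub> (\<lambda>i\<in>{..<n}. h i x) i) {..<n} = x" if x: "x \<in> carrier P" for x
  proof -
    have "finsum P (\<lambda>i. p i \<triangleleft>\<^bsub>P\<^esub> (\<lambda>i\<in>{..<n}. h i x) i) {..<n} = finsum P (\<lambda>i. p i \<triangleleft>\<^bsub>P\<^esub> h i x) {..<n}"
      using d x by (intro P.M.finsum_cong') (auto intro!: P.ract_closed)
    then show ?thesis using d(4)[OF x] by simp
  qed
  then show "projective A P"
    unfolding projective_def in_add_def
    by (intro exI[where x = n] bexI[where x = "\<lambda>x. \<lambda>i\<in>{..<n}. h i x"]
        bexI[where x = "\<lambda>u. finsum P (\<lambda>i. p i \<triangleleft>\<^bsub>P\<^esub> u i) {..<n}"] ballI s r)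
qed

text \<open>Preimages \<open>m i\<close> under \<open>g\<close> of the elements
  \<open>h (p i)\<close> are combined with the coordinates of \<open>P\<close>. After applying
  \<open>g\<close> the sum becomes the dual basis expansion of \<open>h\<close>.\<close>

lemma projective_lift:
  assumes P: "fd_rmodule K A P" "projective A P" and M: "fd_rmodule K A M" and N: "fd_rmodule K A N"
    and g: "g \<in> rmod_hom A M N" and h: "h \<in> rmod_hom A P N" and sub: "h ` carrier P \<subseteq> g ` carrier M"
  shows "\<exists>k\<in>rmod_hom A P M. \<forall>x\<in>carrier P. g (k x) = h x"
proof -
  obtain n p c where db: "dual_basis A P n p c" using P projective_iff_dual_basis by blast
  note d = dual_basisD[OF db]
  interpret g: rmod_hom_pair K A M N g by (rule rmod_hom_pairI[OF M N g])
  have "\<forall>i. \<exists>m. i < n \<longrightarrow> m \<in> carrier M \<and> g m = h (p i)"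
    using sub d(1) by (fastforce simp: image_subset_iff image_iff)
  then obtain m where m: "\<And>i. i < n \<Longrightarrow> m i \<in> carrier M" "\<And>i. i < n \<Longrightarrow> g (m i) = h (p i)" by metis
  let ?k = "\<lambda>x. finsum M (\<lambda>i. m i \<triangleleft>\<^bsub>M\<^esub> c i x) {..<n}"
  have "g (?k x) = h x" if x: "x \<in> carrier P" for x
  proof -
    have "g (?k x) = finsum N (\<lambda>i. g (m i \<triangleleft>\<^bsub>M\<^esub> c i x)) {..<n}"
      using m d x by (intro g.hom_finsum) (auto intro: g.M.ract_closed)
    also have "\<dots> = finsum N (\<lambda>i. h (p i) \<triangleleft>\<^bsub>N\<^esub> c i x) {..<n}"
      using m d x rmod_hom_closed[OF h]
      by (intro g.Y.M.finsum_cong') (auto simp: g.hom_ract intro!: g.Y.ract_closed)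
    also have "\<dots> = h x" by (rule dual_basis_hom_expand[OF P(1) N db h x])
    finally show ?thesis .
  qed
  then show ?thesis by (intro bexI[OF _ dual_basis_map_hom[OF M db m(1)]]) auto
qed

lemma mem_a_kernel: "x \<in> a_kernel P M g \<longleftrightarrow> x \<in> carrier P \<and> g x = \<zero>\<^bsub>M\<^esub>"
  by (simp add: a_kernel_def')

lemma (in rmod_hom_pair) kernel_rsubmodule: "rsubmodule A M (a_kernel M Y h)"
  by (auto simp: rsubmodule_def mem_a_kernel hom_add hom_ract M.ract_closed Y.ract_zero_left)

lemma (in rmod_hom_pair) image_rsubmodule: "rsubmodule A Y (h ` carrier M)"
  unfolding rsubmodule_def
proof (intro conjI ballI)
  show "h ` carrier M \<subseteq> carrier Y" by auto
  show "\<zero>\<^bsub>Y\<^esub> \<in> h ` carrier M" using hom_zero by (metis M.M.zero_closed image_eqI)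
  fix x assume "x \<in> h ` carrier M"
  then obtain x' where x: "x' \<in> carrier M" "x = h x'" by blast
  { fix y assume "y \<in> h ` carrier M"
    then obtain y' where y: "y' \<in> carrier M" "y = h y'" by blast
    show "x \<oplus>\<^bsub>Y\<^esub> y \<in> h ` carrier M" using x y hom_add[OF x(1) y(1)] M.M.a_closed by (metis image_eqI) }
  fix a assume "a \<in> carrier A"
  then show "x \<triangleleft>\<^bsub>Y\<^esub> a \<in> h ` carrier M" using x hom_ract[OF x(1)] M.ract_closed by (metis image_eqI)
qed

lemma mem_set_add: "x \<in> H <+>\<^bsub>G\<^esub> L \<longleftrightarrow> (\<exists>h\<in>H. \<exists>l\<in>L. x = h \<oplus>\<^bsub>G\<^esub> l)"
  by (auto simp: set_add_def')

lemma inv_rmod_hom: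
  assumes M: "fd_rmodule K A M" and h: "h \<in> rmod_hom A M Y" and b: "bij_betw h (carrier M) (carrier Y)"
  shows "inv_into (carrier M) h \<in> rmod_hom A Y M"
proof -
  interpret M: fd_rmodule K A M by fact
  let ?k = "inv_into (carrier M) h"
  have k: "?k (h x) = x" if "x \<in> carrier M" for x using b that by (simp add: bij_betw_inv_into_left)
  have rep: "\<exists>x\<in>carrier M. y = h x" if "y \<in> carrier Y" for y using that b by (auto simp: bij_betw_def)
  show ?thesis
  proof (rule rmod_homI)
    fix y assume "y \<in> carrier Y" then obtain x where [simp]: "x \<in> carrier M" "y = h x" using rep by blast
    show "?k y \<in> carrier M" by (simp add: k)
    { fix y' assume "y' \<in> carrier Y" then obtain x' where [simp]: "x' \<in> carrier M" "y' = h x'" using rep by blast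
      show "?k (y \<oplus>\<^bsub>Y\<^esub> y') = ?k y \<oplus>\<^bsub>M\<^esub> ?k y'" by (simp add: rmod_hom_add[OF h, symmetric] k) }
    fix a assume "a \<in> carrier A"
    then show "?k (y \<triangleleft>\<^bsub>Y\<^esub> a) = ?k y \<triangleleft>\<^bsub>M\<^esub> a" by (simp add: rmod_hom_ract[OF h, symmetric] k M.ract_closed)
  qed
qed

lemma in_add_self:
  assumes "fd_rmodule K A M"
  shows "in_add A M M"
proof -
  interpret M: fd_rmodule K A M by fact
  have s: "(\<lambda>x. \<lambda>i\<in>{..<1::nat}. x) \<in> rmod_hom A M (rmod_power M 1)"
    by (rule rmod_homI) (auto simp: fun_eq_iff)
  have r: "(\<lambda>u. u 0) \<in> rmod_hom A (rmod_power M 1) M"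
    by (rule rmod_homI) (auto simp: PiE_iff)
  show ?thesis unfolding in_add_def by (intro exI[of _ 1] bexI[OF _ s] bexI[OF _ r]) auto
qed

lemma in_add_trans_retract:
  assumes "in_add A M N" "s \<in> rmod_hom A N' N" "r \<in> rmod_hom A N N'" "\<And>x. x \<in> carrier N' \<Longrightarrow> r (s x) = x"
  shows "in_add A M N'"
proof -
  obtain n s' r' where *: "s' \<in> rmod_hom A N (rmod_power M n)" "r' \<in> rmod_hom A (rmod_power M n) N"
    "\<And>x. x \<in> carrier N \<Longrightarrow> r' (s' x) = x" using assms(1) by (auto simp: in_add_def)
  show ?thesis unfolding in_add_def
    by (intro exI[of _ n] bexI[OF _ rmod_hom_compose[OF assms(2) *(1)]]
        bexI[OF _ rmod_hom_compose[OF *(2) assms(3)]])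
      (simp add: * assms(4) rmod_hom_closed[OF assms(2)])
qed

lemma projective_iso:
  assumes P: "fd_rmodule K A P" "projective A P"
    and \<sigma>: "\<sigma> \<in> rmod_hom A P P'" "bij_betw \<sigma> (carrier P) (carrier P')"
  shows "projective A P'"
  using in_add_trans_retract[of A "regular A" P "inv_into (carrier P) \<sigma>" P' \<sigma>] P(2) \<sigma>
    inv_rmod_hom[OF P(1) \<sigma>]
  by (simp add: projective_def bij_betw_inv_into_right)

subsection \<open>Projective covers\<close>

lemma projective_coverD:
  assumes "projective_cover K A P g M"
  shows "fd_rmodule K A P" "projective A P" "g \<in> rmod_hom A P M" "g ` carrier P = carrier M"
    "\<lbrakk>rsubmodule A P N; N <+>\<^bsub>P\<^esub> a_kernel P M g = carrier P\<rbrakk> \<Longrightarrow> N = carrier P"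
  using assms by (auto simp: projective_cover_def)

text \<open>An element of \<open>P\<close> and an element of \<open>N\<close> with the same image
  differ by an element of the kernel, so \<open>N\<close> and the kernel together give all of
  \<open>P\<close>. This is the form in which superfluity of the kernel is applied.\<close>

lemma projective_cover_submodule:
  assumes c: "projective_cover K A P g M" and M: "fd_rmodule K A M"
    and N: "rsubmodule A P N" and im: "g ` N = carrier M"
  shows "N = carrier P"
proof (rule projective_coverD(5)[OF c N])
  interpret g: rmod_hom_pair K A P M g
    by (rule rmod_hom_pairI[OF projective_coverD(1)[OF c] M projective_coverD(3)[OF c]])
  note n = rsubmoduleD[OF N]
  show "N <+>\<^bsub>P\<^esub> a_kernel P M g = carrier P"
  proof (intro equalityI subsetI)
    fix x assume "x \<in> N <+>\<^bsub>P\<^esub> a_kernel P M g"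
    then show "x \<in> carrier P" using n(1) by (auto simp: mem_set_add mem_a_kernel)
  next
    fix x assume x: "x \<in> carrier P"
    then have "g x \<in> g ` N" by (simp add: im)
    then obtain y where y: "y \<in> N" "g x = g y" by auto
    have yc: "y \<in> carrier P" using y n(1) by auto
    have "y \<oplus>\<^bsub>P\<^esub> (x \<ominus>\<^bsub>P\<^esub> y) = x"
      using x yc by (metis g.M.M.a_comm g.M.M.a_inv_closed g.M.M.a_assoc g.M.M.minus_eq g.M.M.l_neg g.M.M.r_zero)
    moreover have "x \<ominus>\<^bsub>P\<^esub> y \<in> a_kernel P M g"
      using x y yc by (simp add: mem_a_kernel g.M.M.minus_eq g.hom_add g.hom_minus g.Y.M.r_neg)
    ultimately show "x \<in> N <+>\<^bsub>P\<^esub> a_kernel P M g" using y by (metis mem_set_add)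
  qed
qed

text \<open>The lift \<open>a\<close> exists by projectivity and is onto because its image still
  covers \<open>M\<close>. Projectivity of \<open>P'\<close> then splits \<open>a\<close>, and
  superfluity applied to the image of the splitting \<open>s\<close> shows that \<open>s\<close> is
  onto as well, which makes \<open>a\<close> injective.\<close>

lemma projective_cover_unique:
  assumes c: "projective_cover K A P g M" and c': "projective_cover K A P' g' M" and M: "fd_rmodule K A M"
  shows "\<exists>a\<in>rmod_hom A P P'. bij_betw a (carrier P) (carrier P') \<and> (\<forall>x\<in>carrier P. g' (a x) = g x)"
proof -
  note p = projective_coverD[OF c] and p' = projective_coverD[OF c']
  obtain a where a: "a \<in> rmod_hom A P P'" "\<And>x. x \<in> carrier P \<Longrightarrow> g' (a x) = g x"
    using projective_lift[OF p(1,2) p'(1) M p'(3) p(3)] p(4) p'(4) by auto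
  interpret a: rmod_hom_pair K A P P' a by (rule rmod_hom_pairI[OF p(1) p'(1) a(1)])
  have "g' ` (a ` carrier P) = carrier M" using a(2) p(4) by (auto simp: image_image)
  then have surj: "a ` carrier P = carrier P'"
    by (rule projective_cover_submodule[OF c' M a.image_rsubmodule])
  have id: "(\<lambda>x. x) \<in> rmod_hom A P' P'" by (rule rmod_homI) auto
  obtain s where s: "s \<in> rmod_hom A P' P" "\<And>x. x \<in> carrier P' \<Longrightarrow> a (s x) = x"
    using projective_lift[OF p'(1,2) p(1) p'(1) a(1) id] surj by auto
  interpret s: rmod_hom_pair K A P' P s by (rule rmod_hom_pairI[OF p'(1) p(1) s(1)])
  have "g (s x) = g' x" if "x \<in> carrier P'" for x using a(2)[of "s x"] s(2) that by simp
  then have "g ` (s ` carrier P') = carrier M" using p'(4) by (auto simp: image_image)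
  then have "s ` carrier P' = carrier P"
    by (rule projective_cover_submodule[OF c M s.image_rsubmodule])
  then have "inj_on a (carrier P)" using s(2) by (metis (no_types, lifting) imageE inj_onI)
  then show ?thesis using a surj by (auto simp: bij_betw_def)
qed

lemma projective_cover_cong_codomain:
  assumes c: "projective_cover K A P f Z" and Z: "fd_rmodule K A Z" and Z': "fd_rmodule K A Z'"
    and a: "a \<in> rmod_hom A Z Z'" "bij_betw a (carrier Z) (carrier Z')"
  shows "projective_cover K A P (\<lambda>x. a (f x)) Z'"
proof -
  note p = projective_coverD[OF c]
  interpret a: rmod_hom_pair K A Z Z' a by (rule rmod_hom_pairI[OF Z Z' a(1)])
  have f: "f x \<in> carrier Z" if "x \<in> carrier P" for x using rmod_hom_closed[OF p(3) that] .
  have "a z = \<zero>\<^bsub>Z'\<^esub> \<longleftrightarrow> z = \<zero>\<^bsub>Z\<^esub>" if "z \<in> carrier Z" for z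
    using a(2) that a.hom_zero a.M.M.zero_closed by (metis bij_betw_def inj_on_def)
  then have "a_kernel P Z' (\<lambda>x. a (f x)) = a_kernel P Z f"
    using f by (auto simp: mem_a_kernel)
  moreover have "(\<lambda>x. a (f x)) ` carrier P = carrier Z'"
    using p(4) a(2) by (auto simp: bij_betw_def simp flip: image_image)
  ultimately show ?thesis
    using p rmod_hom_compose[OF p(3) a(1)] by (simp add: projective_cover_def)
qed

text \<open>Superfluity is transported by moving a submodule \<open>N\<close> of \<open>P'\<close>
  back to \<open>P\<close>: if \<open>N\<close> and the new kernel generate \<open>P'\<close>, the
  image of \<open>N\<close> in \<open>P\<close> already maps onto \<open>Z\<close>.\<close>

lemma projective_cover_cong_domain:
  assumes c: "projective_cover K A P f Z" and Z: "fd_rmodule K A Z" and P': "fd_rmodule K A P'"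
    and \<sigma>: "\<sigma> \<in> rmod_hom A P P'" "bij_betw \<sigma> (carrier P) (carrier P')"
  shows "projective_cover K A P' (\<lambda>x. f (inv_into (carrier P) \<sigma> x)) Z"
proof -
  note p = projective_coverD[OF c]
  let ?k = "inv_into (carrier P) \<sigma>"
  have k: "?k \<in> rmod_hom A P' P" by (rule inv_rmod_hom[OF p(1) \<sigma>])
  have kb: "bij_betw ?k (carrier P') (carrier P)" by (rule bij_betw_inv_into[OF \<sigma>(2)])
  have fk: "(\<lambda>x. f (?k x)) \<in> rmod_hom A P' Z" by (rule rmod_hom_compose[OF k p(3)])
  have im: "(\<lambda>x. f (?k x)) ` carrier P' = carrier Z"
    using kb p(4) by (auto simp: bij_betw_def simp flip: image_image)
  interpret k: rmod_hom_pair K A P' P ?k by (rule rmod_hom_pairI[OF P' p(1) k])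
  interpret fk: rmod_hom_pair K A P' Z "\<lambda>x. f (?k x)" by (rule rmod_hom_pairI[OF P' Z fk])
  have "N = carrier P'" if N: "rsubmodule A P' N" "N <+>\<^bsub>P'\<^esub> a_kernel P' Z (\<lambda>x. f (?k x)) = carrier P'" for N
  proof -
    interpret N: fd_rmodule K A "P'\<lparr>carrier := N\<rparr>" by (rule k.M.fd_rmodule_submodule[OF N(1)])
    have kN: "?k \<in> rmod_hom A (P'\<lparr>carrier := N\<rparr>) P"
      using rsubmoduleD(1)[OF N(1)] by (intro rmod_homI) (auto simp: k.hom_add k.hom_ract subset_iff)
    interpret kN: rmod_hom_pair K A "P'\<lparr>carrier := N\<rparr>" P ?k
      by (rule rmod_hom_pairI[OF N.fd_rmodule_axioms p(1) kN])
    have sub: "rsubmodule A P (?k ` N)" using kN.image_rsubmodule by simp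
    have "f ` (?k ` N) = carrier Z"
    proof (intro equalityI subsetI)
      fix z assume "z \<in> f ` (?k ` N)"
      then show "z \<in> carrier Z" using rsubmoduleD(1)[OF N(1)] fk.hom_closed by auto
    next
      fix z assume "z \<in> carrier Z"
      then obtain y where y: "y \<in> carrier P'" "z = f (?k y)" using im by blast
      then have "y \<in> N <+>\<^bsub>P'\<^esub> a_kernel P' Z (\<lambda>x. f (?k x))" using N(2) by simp
      then obtain m l where *: "m \<in> N" "l \<in> carrier P'" "f (?k l) = \<zero>\<^bsub>Z\<^esub>" "y = m \<oplus>\<^bsub>P'\<^esub> l"
        by (auto simp: mem_set_add mem_a_kernel)
      have "m \<in> carrier P'" using *(1) rsubmoduleD(1)[OF N(1)] by auto
      then have "z = f (?k m)" using y * fk.hom_add fk.hom_closed by simp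
      then show "z \<in> f ` (?k ` N)" using *(1) by blast
    qed
    then have kN': "?k ` N = carrier P" by (rule projective_cover_submodule[OF c Z sub])
    show ?thesis
    proof (intro equalityI subsetI)
      fix x assume x: "x \<in> carrier P'"
      then have "?k x \<in> ?k ` N" using kN' by simp
      then obtain m where m: "m \<in> N" "?k x = ?k m" by auto
      have "m \<in> carrier P'" using m rsubmoduleD(1)[OF N(1)] by auto
      then have "x = m" using m x kb by (auto simp: bij_betw_def inj_on_def)
      then show "x \<in> N" using m by simp
    qed (use rsubmoduleD(1)[OF N(1)] in auto)
  qed
  then show ?thesis
    using P' projective_iso[OF p(1,2) \<sigma>] fk im by (simp add: projective_cover_def)
qed

section \<open>Rigidity as a factorization property\<close>

text \<open>In other words, Hom(f, M) is surjective. Equality is demanded only on the carrier of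
  \<open>P1\<close>, since homomorphisms are total functions with arbitrary values
  elsewhere.\<close>

definition factors_through ::
  "('k, 'a) module \<Rightarrow> ('k, 'a, 'q) rmodule \<Rightarrow> ('q \<Rightarrow> 'p) \<Rightarrow> ('k, 'a, 'p) rmodule \<Rightarrow> ('k, 'a, 'x) rmodule \<Rightarrow> bool"
  where
  "factors_through A P1 f P0 M \<longleftrightarrow>
    (\<forall>u\<in>rmod_hom A P1 M. \<exists>v\<in>rmod_hom A P0 M. \<forall>p\<in>carrier P1. u p = v (f p))"

text \<open>Zorn's lemma gives a subspace \<open>U\<close> that contains \<open>W\<close> and is
  maximal without \<open>u\<close>. The whole space is then \<open>U\<close> plus the line through
  \<open>u\<close>, and the functional reads off the coefficient of \<open>u\<close>. The spaces of
  homomorphisms to which this is applied come without a finite spanning set at hand.\<close>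

lemma (in vectorspace) separating_functional:
  assumes W: "subspace K W V" and u: "u \<in> carrier V" "u \<notin> W"
  shows "\<exists>\<psi>. \<psi> \<in> carrier V \<rightarrow> carrier K \<and>
    (\<forall>x\<in>carrier V. \<forall>y\<in>carrier V. \<psi> (x \<oplus>\<^bsub>V\<^esub> y) = \<psi> x \<oplus>\<^bsub>K\<^esub> \<psi> y) \<and>
    (\<forall>c\<in>carrier K. \<forall>x\<in>carrier V. \<psi> (c \<odot>\<^bsub>V\<^esub> x) = c \<otimes>\<^bsub>K\<^esub> \<psi> x) \<and>
    (\<forall>x\<in>W. \<psi> x = \<zero>\<^bsub>K\<^esub>) \<and> \<psi> u = \<one>\<^bsub>K\<^esub>"
proof -
  define S where "S = {U. submodule K U V \<and> W \<subseteq> U \<and> u \<notin> U}"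
  have WS: "W \<in> S" using W u by (auto simp: S_def)
  have chain: "\<Union>C \<in> S" if C: "C \<noteq> {}" "subset.chain S C" for C
  proof -
    have CS: "U \<in> S" if "U \<in> C" for U using that C by (auto simp: subset_chain_def)
    have "submodule K (\<Union>U\<in>C. U) V"
    proof (rule nested_union_vs[where I = C and N = "\<lambda>U. U"])
      show "submodule K U V" if "U \<in> C" for U using CS[OF that] by (simp add: S_def)
      show "\<exists>k. k \<in> C \<and> U \<subseteq> k \<and> Y \<subseteq> k" if "U \<in> C" "Y \<in> C" for U Y
        using that C(2) unfolding subset_chain_def by (metis order.refl)
    qed (use C in auto)
    then show ?thesis using CS C(1) by (auto simp: S_def)
  qed
  obtain U where U: "U \<in> S" and max: "\<And>Y. \<lbrakk>Y \<in> S; U \<subseteq> Y\<rbrakk> \<Longrightarrow> Y = U"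
    using subset_Zorn_nonempty[of S] WS chain by (metis empty_iff)
  have sm: "submodule K U V" and WX: "W \<subseteq> U" and uX: "u \<notin> U" using U by (auto simp: S_def)
  have Xc: "U \<subseteq> carrier V" and X0: "\<zero>\<^bsub>V\<^esub> \<in> U" using sm by (auto simp: submodule_def)
  have Xadd: "x \<oplus>\<^bsub>V\<^esub> y \<in> U" if "x \<in> U" "y \<in> U" for x y using sm that by (auto simp: submodule_def)
  have Xsm: "c \<odot>\<^bsub>V\<^esub> x \<in> U" if "x \<in> U" "c \<in> carrier K" for x c using sm that by (auto simp: submodule_def)
  \<comment> \<open>For x outside \<open>U\<close>, the space U + Kx is strictly larger and by
    maximality contains \<open>u\<close>. The coefficient of x in that expression is invertible, so
    it can be solved for x.\<close>
  have ex: "\<exists>c\<in>carrier K. \<exists>w\<in>U. x = w \<oplus>\<^bsub>V\<^esub> c \<odot>\<^bsub>V\<^esub> u" if x: "x \<in> carrier V" for x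
  proof (cases "x \<in> U")
    case True
    have "x = x \<oplus>\<^bsub>V\<^esub> \<zero>\<^bsub>K\<^esub> \<odot>\<^bsub>V\<^esub> u" using x u by simp
    then show ?thesis using True R.zero_closed by blast
  next
    case False
    define Y where "Y = {w \<oplus>\<^bsub>V\<^esub> c \<odot>\<^bsub>V\<^esub> x | w c. w \<in> U \<and> c \<in> carrier K}"
    have XY: "U \<subseteq> Y"
    proof
      fix w assume w: "w \<in> U"
      then have "w = w \<oplus>\<^bsub>V\<^esub> \<zero>\<^bsub>K\<^esub> \<odot>\<^bsub>V\<^esub> x" using x Xc by (simp add: subset_iff)
      then show "w \<in> Y" using w R.zero_closed unfolding Y_def by blast
    qed
    have xY: "x \<in> Y"
    proof -
      have "x = \<zero>\<^bsub>V\<^esub> \<oplus>\<^bsub>V\<^esub> \<one>\<^bsub>K\<^esub> \<odot>\<^bsub>V\<^esub> x" using x by simp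
      then show ?thesis unfolding Y_def using X0 R.one_closed by blast
    qed
    have "submodule K Y V"
      unfolding submodule_def
    proof (intro conjI allI impI)
      show "module K V" by (rule module_axioms)
      show "Y \<subseteq> carrier V" using x Xc by (auto simp: Y_def)
      show "\<zero>\<^bsub>V\<^esub> \<in> Y" using XY X0 by auto
      { fix v w assume "v \<in> Y" "w \<in> Y"
        then obtain v' c w' d where *: "v = v' \<oplus>\<^bsub>V\<^esub> c \<odot>\<^bsub>V\<^esub> x" "v' \<in> U" "c \<in> carrier K"
          "w = w' \<oplus>\<^bsub>V\<^esub> d \<odot>\<^bsub>V\<^esub> x" "w' \<in> U" "d \<in> carrier K" unfolding Y_def by blast
        then have "v' \<in> carrier V" "w' \<in> carrier V" using Xc by auto
        then have "v \<oplus>\<^bsub>V\<^esub> w = (v' \<oplus>\<^bsub>V\<^esub> w') \<oplus>\<^bsub>V\<^esub> (c \<oplus>\<^bsub>K\<^esub> d) \<odot>\<^bsub>V\<^esub> x"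
          using * x by (simp add: smult_l_distr M.a_ac)
        then show "v \<oplus>\<^bsub>V\<^esub> w \<in> Y" using * Xadd unfolding Y_def by blast }
      { fix e v assume e: "e \<in> carrier K" and "v \<in> Y"
        then obtain v' c where *: "v = v' \<oplus>\<^bsub>V\<^esub> c \<odot>\<^bsub>V\<^esub> x" "v' \<in> U" "c \<in> carrier K"
          unfolding Y_def by blast
        then have "v' \<in> carrier V" using Xc by auto
        then have "e \<odot>\<^bsub>V\<^esub> v = e \<odot>\<^bsub>V\<^esub> v' \<oplus>\<^bsub>V\<^esub> (e \<otimes>\<^bsub>K\<^esub> c) \<odot>\<^bsub>V\<^esub> x"
          using * x e by (simp add: smult_r_distr smult_assoc1)
        then show "e \<odot>\<^bsub>V\<^esub> v \<in> Y" using * e Xsm unfolding Y_def by blast }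
    qed
    then have "u \<in> Y" using max[of Y] XY WX xY False by (auto simp: S_def)
    then obtain w c where wc: "u = w \<oplus>\<^bsub>V\<^esub> c \<odot>\<^bsub>V\<^esub> x" "w \<in> U" "c \<in> carrier K" unfolding Y_def by blast
    have wV: "w \<in> carrier V" using wc Xc by auto
    have c0: "c \<noteq> \<zero>\<^bsub>K\<^esub>" using wc uX x wV by auto
    then have ci: "inv\<^bsub>K\<^esub> c \<in> carrier K" "inv\<^bsub>K\<^esub> c \<otimes>\<^bsub>K\<^esub> c = \<one>\<^bsub>K\<^esub>"
      using wc(3) field_Units R.Units_inv_closed R.Units_l_inv by auto
    have "x = (\<ominus>\<^bsub>K\<^esub> (inv\<^bsub>K\<^esub> c)) \<odot>\<^bsub>V\<^esub> w \<oplus>\<^bsub>V\<^esub> inv\<^bsub>K\<^esub> c \<odot>\<^bsub>V\<^esub> u"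
    proof -
      have "inv\<^bsub>K\<^esub> c \<odot>\<^bsub>V\<^esub> u = inv\<^bsub>K\<^esub> c \<odot>\<^bsub>V\<^esub> w \<oplus>\<^bsub>V\<^esub> x"
        using wc wV x ci by (simp add: smult_r_distr smult_assoc1[symmetric])
      moreover have "(\<ominus>\<^bsub>K\<^esub> (inv\<^bsub>K\<^esub> c)) \<odot>\<^bsub>V\<^esub> w = \<ominus>\<^bsub>V\<^esub> (inv\<^bsub>K\<^esub> c \<odot>\<^bsub>V\<^esub> w)"
        using ci wV by (simp add: smult_l_minus)
      ultimately show ?thesis using wV x ci by (simp add: M.a_assoc[symmetric] M.l_neg)
    qed
    then show ?thesis using Xsm[OF wc(2)] ci by blast
  qed
  define \<psi> where "\<psi> x = (SOME c. c \<in> carrier K \<and> (\<exists>w\<in>U. x = w \<oplus>\<^bsub>V\<^esub> c \<odot>\<^bsub>V\<^esub> u))" for x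
  have \<psi>: "\<psi> x \<in> carrier K" "\<exists>w\<in>U. x = w \<oplus>\<^bsub>V\<^esub> \<psi> x \<odot>\<^bsub>V\<^esub> u" if "x \<in> carrier V" for x
    using someI_ex[of "\<lambda>c. c \<in> carrier K \<and> (\<exists>w\<in>U. x = w \<oplus>\<^bsub>V\<^esub> c \<odot>\<^bsub>V\<^esub> u)"] ex[OF that]
    unfolding \<psi>_def by blast+
  \<comment> \<open>Uniqueness of the coefficient: two different ones would put a nonzero multiple
    of \<open>u\<close>, hence \<open>u\<close> itself, into \<open>U\<close>.\<close>
  have \<psi>_eq: "\<psi> (w \<oplus>\<^bsub>V\<^esub> c \<odot>\<^bsub>V\<^esub> u) = c" if w: "w \<in> U" and c: "c \<in> carrier K" for w c
  proof (rule ccontr)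
    define d where "d = \<psi> (w \<oplus>\<^bsub>V\<^esub> c \<odot>\<^bsub>V\<^esub> u)"
    assume "\<psi> (w \<oplus>\<^bsub>V\<^esub> c \<odot>\<^bsub>V\<^esub> u) \<noteq> c"
    then have dc: "d \<noteq> c" by (simp add: d_def)
    have wV: "w \<in> carrier V" using w Xc by auto
    then have xV: "w \<oplus>\<^bsub>V\<^esub> c \<odot>\<^bsub>V\<^esub> u \<in> carrier V" using c u by simp
    obtain w' where w': "w' \<in> U" "w \<oplus>\<^bsub>V\<^esub> c \<odot>\<^bsub>V\<^esub> u = w' \<oplus>\<^bsub>V\<^esub> d \<odot>\<^bsub>V\<^esub> u"
      using \<psi>(2)[OF xV] by (auto simp: d_def)
    have dK: "d \<in> carrier K" using \<psi>(1)[OF xV] by (simp add: d_def)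
    have w'V: "w' \<in> carrier V" using w' Xc by auto
    define e where "e = d \<ominus>\<^bsub>K\<^esub> c"
    have eK: "e \<in> carrier K" using dK c by (simp add: e_def)
    have e0: "e \<noteq> \<zero>\<^bsub>K\<^esub>" using dc dK c by (simp add: e_def)
    have "d = e \<oplus>\<^bsub>K\<^esub> c" using dK c by (simp add: e_def R.minus_eq R.a_assoc R.l_neg)
    then have "w \<oplus>\<^bsub>V\<^esub> c \<odot>\<^bsub>V\<^esub> u = (w' \<oplus>\<^bsub>V\<^esub> e \<odot>\<^bsub>V\<^esub> u) \<oplus>\<^bsub>V\<^esub> c \<odot>\<^bsub>V\<^esub> u"
      using w'(2) w'V eK c u by (simp add: smult_l_distr M.a_assoc)
    then have "w = w' \<oplus>\<^bsub>V\<^esub> e \<odot>\<^bsub>V\<^esub> u" using wV w'V eK c u by simp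
    then have "e \<odot>\<^bsub>V\<^esub> u = w \<oplus>\<^bsub>V\<^esub> (\<ominus>\<^bsub>K\<^esub> \<one>\<^bsub>K\<^esub>) \<odot>\<^bsub>V\<^esub> w'"
      using w'V eK u by (simp add: smult_l_minus M.a_ac M.r_neg1 M.r_neg2)
    then have eu: "e \<odot>\<^bsub>V\<^esub> u \<in> U" using w w' Xadd Xsm by simp
    have "inv\<^bsub>K\<^esub> e \<in> carrier K" "inv\<^bsub>K\<^esub> e \<otimes>\<^bsub>K\<^esub> e = \<one>\<^bsub>K\<^esub>"
      using eK e0 field_Units R.Units_inv_closed R.Units_l_inv by auto
    then have "u \<in> U" using Xsm[OF eu, of "inv\<^bsub>K\<^esub> e"] u eK by (simp add: smult_assoc1[symmetric])
    then show False using uX by simp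
  qed
  show ?thesis
  proof (intro exI[of _ \<psi>] conjI ballI)
    show "\<psi> \<in> carrier V \<rightarrow> carrier K" using \<psi>(1) by auto
    fix x assume x: "x \<in> carrier V"
    then obtain w where w: "w \<in> U" "x = w \<oplus>\<^bsub>V\<^esub> \<psi> x \<odot>\<^bsub>V\<^esub> u" using \<psi>(2) by blast
    have wV: "w \<in> carrier V" using w Xc by auto
    { fix y assume y: "y \<in> carrier V"
      then obtain w' where w': "w' \<in> U" "y = w' \<oplus>\<^bsub>V\<^esub> \<psi> y \<odot>\<^bsub>V\<^esub> u" using \<psi>(2) by blast
      have w'V: "w' \<in> carrier V" using w' Xc by auto
      have "(w \<oplus>\<^bsub>V\<^esub> \<psi> x \<odot>\<^bsub>V\<^esub> u) \<oplus>\<^bsub>V\<^esub> (w' \<oplus>\<^bsub>V\<^esub> \<psi> y \<odot>\<^bsub>V\<^esub> u) = (w \<oplus>\<^bsub>V\<^esub> w') \<oplus>\<^bsub>V\<^esub> (\<psi> x \<oplus>\<^bsub>K\<^esub> \<psi> y) \<odot>\<^bsub>V\<^esub> u"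
        using wV w'V \<psi>(1)[OF x] \<psi>(1)[OF y] u by (simp add: smult_l_distr M.a_ac)
      then show "\<psi> (x \<oplus>\<^bsub>V\<^esub> y) = \<psi> x \<oplus>\<^bsub>K\<^esub> \<psi> y"
        using \<psi>_eq[OF Xadd[OF w(1) w'(1)], of "\<psi> x \<oplus>\<^bsub>K\<^esub> \<psi> y"] w(2) w'(2) \<psi>(1)[OF x] \<psi>(1)[OF y] by simp }
    { fix c assume c: "c \<in> carrier K"
      have "c \<odot>\<^bsub>V\<^esub> (w \<oplus>\<^bsub>V\<^esub> \<psi> x \<odot>\<^bsub>V\<^esub> u) = c \<odot>\<^bsub>V\<^esub> w \<oplus>\<^bsub>V\<^esub> (c \<otimes>\<^bsub>K\<^esub> \<psi> x) \<odot>\<^bsub>V\<^esub> u"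
        using wV \<psi>(1)[OF x] u c by (simp add: smult_r_distr smult_assoc1)
      then show "\<psi> (c \<odot>\<^bsub>V\<^esub> x) = c \<otimes>\<^bsub>K\<^esub> \<psi> x"
        using \<psi>_eq[OF Xsm[OF w(1) c], of "c \<otimes>\<^bsub>K\<^esub> \<psi> x"] w(2) \<psi>(1)[OF x] c by simp }
  next
    fix x assume "x \<in> W"
    then show "\<psi> x = \<zero>\<^bsub>K\<^esub>" using \<psi>_eq[of x "\<zero>\<^bsub>K\<^esub>"] WX Xc u by (auto simp: subset_iff)
  next
    show "\<psi> u = \<one>\<^bsub>K\<^esub>" using \<psi>_eq[OF X0, of "\<one>\<^bsub>K\<^esub>"] u by simp
  qed
qed

text \<open>Only the vector space of homomorphisms is recorded. For M = A it underlies
  \<open>hom_regular\<close>, and the vector space axioms for the latter are obtained from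
  here.\<close>

definition hom_space ::
  "('k, 'a) module \<Rightarrow> ('k, 'a, 'p) rmodule \<Rightarrow> ('k, 'a, 'x) rmodule \<Rightarrow> ('k, 'p \<Rightarrow> 'x) module" where
  "hom_space A P M =
    \<lparr>carrier = rmod_hom A P M \<inter> extensional (carrier P), mult = undefined, one = undefined,
     zero = (\<lambda>p\<in>carrier P. \<zero>\<^bsub>M\<^esub>), add = (\<lambda>h k. \<lambda>p\<in>carrier P. h p \<oplus>\<^bsub>M\<^esub> k p),
     smult = (\<lambda>c h. \<lambda>p\<in>carrier P. c \<odot>\<^bsub>M\<^esub> h p)\<rparr>"

lemma hom_space_simps [simp]:
  "carrier (hom_space A P M) = rmod_hom A P M \<inter> extensional (carrier P)"
  "zero (hom_space A P M) = (\<lambda>p\<in>carrier P. \<zero>\<^bsub>M\<^esub>)"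
  "add (hom_space A P M) h k = (\<lambda>p\<in>carrier P. h p \<oplus>\<^bsub>M\<^esub> k p)"
  "smult (hom_space A P M) c h = (\<lambda>p\<in>carrier P. c \<odot>\<^bsub>M\<^esub> h p)"
  by (simp_all add: hom_space_def)

lemma vectorspace_hom_space:
  assumes P: "fd_rmodule K A P" and M: "fd_rmodule K A M"
  shows "vectorspace K (hom_space A P M)"
proof -
  interpret P: fd_rmodule K A P by fact
  interpret M: fd_rmodule K A M by fact
  let ?V = "hom_space A P M"
  have cl: "h p \<in> carrier M" if "h \<in> carrier ?V" "p \<in> carrier P" for h p
    using that rmod_hom_closed by auto
  have homI: "(\<lambda>p\<in>carrier P. F p) \<in> carrier ?V"
    if "\<And>p. p \<in> carrier P \<Longrightarrow> F p \<in> carrier M"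
      "\<And>p q. \<lbrakk>p \<in> carrier P; q \<in> carrier P\<rbrakk> \<Longrightarrow> F (p \<oplus>\<^bsub>P\<^esub> q) = F p \<oplus>\<^bsub>M\<^esub> F q"
      "\<And>p a. \<lbrakk>p \<in> carrier P; a \<in> carrier A\<rbrakk> \<Longrightarrow> F (p \<triangleleft>\<^bsub>P\<^esub> a) = F p \<triangleleft>\<^bsub>M\<^esub> a" for F
    using that by (auto intro!: rmod_homI simp: P.ract_closed)
  have ad: "h (p \<oplus>\<^bsub>P\<^esub> q) = h p \<oplus>\<^bsub>M\<^esub> h q" if "h \<in> carrier ?V" "p \<in> carrier P" "q \<in> carrier P" for h p q
    using that rmod_hom_add by auto
  have ra: "h (p \<triangleleft>\<^bsub>P\<^esub> a) = h p \<triangleleft>\<^bsub>M\<^esub> a" if "h \<in> carrier ?V" "p \<in> carrier P" "a \<in> carrier A" for h p a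
    using that rmod_hom_ract by auto
  have ext: "h = (\<lambda>p\<in>carrier P. F p)" if "h \<in> carrier ?V" "\<And>p. p \<in> carrier P \<Longrightarrow> h p = F p" for h F
    using that by (auto simp: fun_eq_iff extensional_def)
  show ?thesis
  proof (rule vs_criteria)
    show "field K" by (rule vectorspace.axioms(2)[OF M.vectorspace_axioms])
    show "\<zero>\<^bsub>?V\<^esub> \<in> carrier ?V"
      unfolding hom_space_simps(2) by (rule homI) (simp_all add: M.ract_zero_left)
    show "\<forall>v w. v \<in> carrier ?V \<and> w \<in> carrier ?V \<longrightarrow> v \<oplus>\<^bsub>?V\<^esub> w \<in> carrier ?V"
      unfolding hom_space_simps(3)
      by (intro allI impI homI; elim conjE)
        (simp_all add: cl ad ra M.M.a_ac M.ract_add_left del: hom_space_simps)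
    show "\<forall>v\<in>carrier ?V. \<exists>n\<in>carrier ?V. v \<oplus>\<^bsub>?V\<^esub> n = \<zero>\<^bsub>?V\<^esub>"
    proof
      fix v assume v: "v \<in> carrier ?V"
      have "(\<lambda>p\<in>carrier P. \<ominus>\<^bsub>M\<^esub> v p) \<in> carrier ?V"
        by (rule homI) (simp_all add: cl[OF v] ad[OF v] ra[OF v] M.M.minus_add M.ract_minus_left)
      moreover have "v \<oplus>\<^bsub>?V\<^esub> (\<lambda>p\<in>carrier P. \<ominus>\<^bsub>M\<^esub> v p) = \<zero>\<^bsub>?V\<^esub>"
        using cl[OF v] by (auto simp: fun_eq_iff M.M.r_neg)
      ultimately show "\<exists>n\<in>carrier ?V. v \<oplus>\<^bsub>?V\<^esub> n = \<zero>\<^bsub>?V\<^esub>" by blast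
    qed
    show "\<forall>c v. c \<in> carrier K \<and> v \<in> carrier ?V \<longrightarrow> c \<odot>\<^bsub>?V\<^esub> v \<in> carrier ?V"
      unfolding hom_space_simps(4)
      by (intro allI impI homI; elim conjE)
        (simp_all add: cl ad ra M.smult_r_distr M.smult_ract_left del: hom_space_simps)
    show "\<forall>v w. v \<in> carrier ?V \<and> w \<in> carrier ?V \<longrightarrow> v \<oplus>\<^bsub>?V\<^esub> w = w \<oplus>\<^bsub>?V\<^esub> v"
      using cl by (auto simp: fun_eq_iff M.M.a_comm)
    show "\<forall>v w x. v \<in> carrier ?V \<and> w \<in> carrier ?V \<and> x \<in> carrier ?V \<longrightarrow>
        (v \<oplus>\<^bsub>?V\<^esub> w) \<oplus>\<^bsub>?V\<^esub> x = v \<oplus>\<^bsub>?V\<^esub> (w \<oplus>\<^bsub>?V\<^esub> x)"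
      using cl by (auto simp: fun_eq_iff M.M.a_assoc)
    show "\<forall>v\<in>carrier ?V. v \<oplus>\<^bsub>?V\<^esub> \<zero>\<^bsub>?V\<^esub> = v"
      using cl by (auto simp: fun_eq_iff extensional_def)
    show "\<forall>a b v. a \<in> carrier K \<and> b \<in> carrier K \<and> v \<in> carrier ?V \<longrightarrow>
        (a \<otimes>\<^bsub>K\<^esub> b) \<odot>\<^bsub>?V\<^esub> v = a \<odot>\<^bsub>?V\<^esub> (b \<odot>\<^bsub>?V\<^esub> v)"
      using cl by (auto simp: fun_eq_iff M.smult_assoc1)
    show "\<forall>v\<in>carrier ?V. \<one>\<^bsub>K\<^esub> \<odot>\<^bsub>?V\<^esub> v = v"
      using cl by (auto simp: fun_eq_iff extensional_def)
    show "\<forall>a b v. a \<in> carrier K \<and> b \<in> carrier K \<and> v \<in> carrier ?V \<longrightarrow>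
        (a \<oplus>\<^bsub>K\<^esub> b) \<odot>\<^bsub>?V\<^esub> v = (a \<odot>\<^bsub>?V\<^esub> v) \<oplus>\<^bsub>?V\<^esub> (b \<odot>\<^bsub>?V\<^esub> v)"
      using cl by (auto simp: fun_eq_iff M.smult_l_distr)
    show "\<forall>a v w. a \<in> carrier K \<and> v \<in> carrier ?V \<and> w \<in> carrier ?V \<longrightarrow>
        a \<odot>\<^bsub>?V\<^esub> (v \<oplus>\<^bsub>?V\<^esub> w) = (a \<odot>\<^bsub>?V\<^esub> v) \<oplus>\<^bsub>?V\<^esub> (a \<odot>\<^bsub>?V\<^esub> w)"
      using cl by (auto simp: fun_eq_iff M.smult_r_distr)
  qed
qed

lemma hom_regular_simps [simp]:
  "carrier (hom_regular A P) = rmod_hom A P (regular A) \<inter> extensional (carrier P)"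
  "zero (hom_regular A P) = (\<lambda>p\<in>carrier P. \<zero>\<^bsub>A\<^esub>)"
  "add (hom_regular A P) h k = (\<lambda>p\<in>carrier P. h p \<oplus>\<^bsub>A\<^esub> k p)"
  "smult (hom_regular A P) c h = (\<lambda>p\<in>carrier P. c \<odot>\<^bsub>A\<^esub> h p)"
  "ract (hom_regular A P) h a = (\<lambda>p\<in>carrier P. a \<otimes>\<^bsub>A\<^esub> h p)"
  by (simp_all add: hom_regular_def)

lemma vectorspace_hom_regular:
  assumes "fd_rmodule K A P"
  shows "vectorspace K (hom_regular A P)"
proof -
  interpret P: fd_rmodule K A P by fact
  show ?thesis
    by (rule vectorspace_surj_image(1)[where \<pi> = "\<lambda>x. x",
          OF vectorspace_hom_space[OF assms fd_rmodule_regular[OF P.fd_algebra]]]) simp_all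
qed

section \<open>Duality between Hom(M, D Tr) and Coker Hom(f, M)\<close>

text \<open>\<open>M\<close> is not tied to \<open>f\<close> here: the criterion for vanishing of
  all homomorphisms from \<open>M\<close> to the dual of the transpose is proved for any map between
  projectives and any test module.\<close>

locale transpose =
  M: fd_rmodule K A M + P0: fd_rmodule K A P0 + P1: fd_rmodule K A P1
  for K :: "('k, 'r) ring_scheme" and A :: "('k, 'a) module"
    and M :: "('k, 'a, 'x) rmodule" and P0 :: "('k, 'a, 'p) rmodule" and P1 :: "('k, 'a, 'q) rmodule" +
  fixes f
  assumes f: "f \<in> rmod_hom A P1 P0" and proj: "projective A P0" "projective A P1"
begin

abbreviation "H \<equiv> hom_regular A P1"
abbreviation "I \<equiv> (\<lambda>h. \<lambda>p\<in>carrier P1. h (f p)) ` carrier (hom_regular A P0)"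
abbreviation "T \<equiv> transpose_module A P1 f P0"

sublocale H: vectorspace K H
  by (rule vectorspace_hom_regular[OF P1.fd_rmodule_axioms])

lemma H_mem: "h \<in> carrier H \<Longrightarrow> p \<in> carrier P1 \<Longrightarrow> h p \<in> carrier A"
  using rmod_hom_closed by fastforce

lemma H_homI:
  assumes "\<And>p. p \<in> carrier P1 \<Longrightarrow> F p \<in> carrier A"
    "\<And>p q. \<lbrakk>p \<in> carrier P1; q \<in> carrier P1\<rbrakk> \<Longrightarrow> F (p \<oplus>\<^bsub>P1\<^esub> q) = F p \<oplus>\<^bsub>A\<^esub> F q"
    "\<And>p a. \<lbrakk>p \<in> carrier P1; a \<in> carrier A\<rbrakk> \<Longrightarrow> F (p \<triangleleft>\<^bsub>P1\<^esub> a) = F p \<otimes>\<^bsub>A\<^esub> a"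
  shows "(\<lambda>p\<in>carrier P1. F p) \<in> carrier H"
  using assms by (auto intro!: rmod_homI simp: P1.ract_closed)

lemma H_ract_closed:
  assumes "h \<in> carrier H" "a \<in> carrier A"
  shows "(\<lambda>p\<in>carrier P1. a \<otimes>\<^bsub>A\<^esub> h p) \<in> carrier H"
  using assms rmod_hom_closed[of h A P1 "regular A"] rmod_hom_add[of h A P1 "regular A"]
    rmod_hom_ract[of h A P1 "regular A"]
  by (intro H_homI) (auto simp: M.A.A.r_distr M.A.A.m_assoc)

lemma I_mem: "k \<in> rmod_hom A P0 (regular A) \<Longrightarrow> (\<lambda>p\<in>carrier P1. k (f p)) \<in> I"
proof -
  assume k: "k \<in> rmod_hom A P0 (regular A)"
  have "restrict k (carrier P0) \<in> carrier (hom_regular A P0)"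
    using rmod_hom_cong[OF k P0.fd_rmodule_axioms, of "restrict k (carrier P0)"] by simp
  moreover have "(\<lambda>p\<in>carrier P1. k (f p)) = (\<lambda>p\<in>carrier P1. restrict k (carrier P0) (f p))"
    using rmod_hom_closed[OF f] by (auto simp: fun_eq_iff)
  ultimately show ?thesis by blast
qed

lemma I_cases:
  assumes "i \<in> I"
  obtains k where "k \<in> rmod_hom A P0 (regular A)" "i = (\<lambda>p\<in>carrier P1. k (f p))"
  using assms by auto

lemma I_subset: "I \<subseteq> carrier H"
proof
  fix i assume "i \<in> I"
  then obtain k where k: "k \<in> rmod_hom A P0 (regular A)" "i = (\<lambda>p\<in>carrier P1. k (f p))"
    by (rule I_cases)
  have "i \<in> rmod_hom A P1 (regular A)"
    by (rule rmod_hom_cong[OF rmod_hom_compose[OF f k(1)] P1.fd_rmodule_axioms]) (simp add: k(2))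
  then show "i \<in> carrier H" by (simp add: k(2))
qed

lemma I_ract: "i \<in> I \<Longrightarrow> a \<in> carrier A \<Longrightarrow> i \<triangleleft>\<^bsub>H\<^esub> a \<in> I"
proof -
  assume i: "i \<in> I" and a: "a \<in> carrier A"
  obtain k where k: "k \<in> rmod_hom A P0 (regular A)" "i = (\<lambda>p\<in>carrier P1. k (f p))"
    by (rule I_cases[OF i])
  have "(\<lambda>x. a \<otimes>\<^bsub>A\<^esub> k x) \<in> rmod_hom A P0 (regular A)"
    using a rmod_hom_closed[OF k(1)]
    by (intro rmod_homI) (auto simp: rmod_hom_add[OF k(1)] rmod_hom_ract[OF k(1)] M.A.A.r_distr M.A.A.m_assoc)
  from I_mem[OF this] show ?thesis by (simp add: k(2) cong: restrict_cong)
qed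

lemma I_subspace: "subspace K I H"
proof -
  have "\<zero>\<^bsub>H\<^esub> \<in> I"
    using I_mem[of "\<lambda>_. \<zero>\<^bsub>A\<^esub>"] by (simp add: rmod_hom_def)
  moreover have "i \<oplus>\<^bsub>H\<^esub> j \<in> I" if i: "i \<in> I" and j: "j \<in> I" for i j
  proof -
    obtain k where k: "k \<in> rmod_hom A P0 (regular A)" "i = (\<lambda>p\<in>carrier P1. k (f p))"
      by (rule I_cases[OF i])
    obtain l where l: "l \<in> rmod_hom A P0 (regular A)" "j = (\<lambda>p\<in>carrier P1. l (f p))"
      by (rule I_cases[OF j])
    have "(\<lambda>x. k x \<oplus>\<^bsub>A\<^esub> l x) \<in> rmod_hom A P0 (regular A)"
      using rmod_hom_closed[OF k(1)] rmod_hom_closed[OF l(1)]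
      by (intro rmod_homI)
        (auto simp: rmod_hom_add[OF k(1)] rmod_hom_ract[OF k(1)] rmod_hom_add[OF l(1)] rmod_hom_ract[OF l(1)]
          M.A.A.l_distr M.A.M.a_ac)
    from I_mem[OF this] show ?thesis by (simp add: k(2) l(2) cong: restrict_cong)
  qed
  moreover have "c \<odot>\<^bsub>H\<^esub> i \<in> I" if c: "c \<in> carrier K" and i: "i \<in> I" for c i
  proof -
    have "c \<odot>\<^bsub>H\<^esub> i = i \<triangleleft>\<^bsub>H\<^esub> (c \<odot>\<^bsub>A\<^esub> \<one>\<^bsub>A\<^esub>)"
      using c H_mem[of i] i I_subset by (auto simp: fun_eq_iff M.A.smult_one_mult)
    then show ?thesis using I_ract[OF i, of "c \<odot>\<^bsub>A\<^esub> \<one>\<^bsub>A\<^esub>"] c by simp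
  qed
  ultimately show ?thesis
    unfolding subspace_def submodule_def
    by (intro conjI allI impI H.vectorspace_axioms H.module_axioms I_subset) assumption+
qed

lemma I_additive: "additive_subgroup I H"
proof -
  interpret I: vectorspace K "H\<lparr>carrier := I\<rparr>" by (rule H.subspace_is_vs[OF I_subspace])
  have sm: "submodule K I H" using I_subspace by simp
  have "\<ominus>\<^bsub>H\<^esub> i \<in> I" if "i \<in> I" for i
  proof -
    have "(\<ominus>\<^bsub>K\<^esub> \<one>\<^bsub>K\<^esub>) \<odot>\<^bsub>H\<^esub> i \<in> I" using submodule.smult_closed[OF sm _ that] by simp
    moreover have "(\<ominus>\<^bsub>K\<^esub> \<one>\<^bsub>K\<^esub>) \<odot>\<^bsub>H\<^esub> i = \<ominus>\<^bsub>H\<^esub> i"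
      using that I_subset by (intro H.smult_minus_1) auto
    ultimately show ?thesis by simp
  qed
  then show ?thesis
    using I_subset submodule.m_closed[OF sm] submodule.zero_closed[OF sm]
    by (intro additive_subgroupI H.M.add.subgroupI) (auto simp flip: a_inv_def)
qed

text \<open>\<open>hom_regular\<close> is a left module, so its action satisfies the reversed
  associativity law and \<open>rmod_quotient\<close>, made for right modules over \<open>A\<close>,
  does not cover it. The coset calculus is repeated for its quotient by the image of Hom(f,
  A).\<close>

abbreviation "cs k \<equiv> I +>\<^bsub>H\<^esub> k"

lemma carrier_T: "carrier T = cs ` carrier H"
  by (auto simp: transpose_module_def quot_rmodule_def A_RCOSETS_def')

lemma cs_add: "\<lbrakk>k \<in> carrier H; l \<in> carrier H\<rbrakk> \<Longrightarrow> cs k \<oplus>\<^bsub>T\<^esub> cs l = cs (k \<oplus>\<^bsub>H\<^esub> l)"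
  using abelian_subgroup.a_rcos_sum[OF abelian_subgroupI3[OF I_additive H.M.abelian_group_axioms], of k l]
  by (simp add: transpose_module_def quot_rmodule_def)

lemma cs_smult: "\<lbrakk>c \<in> carrier K; k \<in> carrier H\<rbrakk> \<Longrightarrow> c \<odot>\<^bsub>T\<^esub> cs k = cs (c \<odot>\<^bsub>H\<^esub> k)"
  unfolding transpose_module_def quot_rmodule_def
  apply (simp only: module.simps rmodule.simps)
  by (rule coset_UN_hom_eq[OF H.M.abelian_group_axioms I_additive H.M.abelian_group_axioms I_additive])
    (use submodule.smult_closed[OF H.is_module[OF I_subspace]] in \<open>simp_all add: H.smult_r_distr del: hom_regular_simps\<close>)

lemma H_ract_closed': "\<lbrakk>k \<in> carrier H; a \<in> carrier A\<rbrakk> \<Longrightarrow> k \<triangleleft>\<^bsub>H\<^esub> a \<in> carrier H"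
  using H_ract_closed by simp

lemma cs_ract: "\<lbrakk>a \<in> carrier A; k \<in> carrier H\<rbrakk> \<Longrightarrow> cs k \<triangleleft>\<^bsub>T\<^esub> a = cs (k \<triangleleft>\<^bsub>H\<^esub> a)"
  unfolding transpose_module_def quot_rmodule_def
  apply (simp only: module.simps rmodule.simps)
  apply (rule coset_UN_hom_eq[OF H.M.abelian_group_axioms I_additive H.M.abelian_group_axioms I_additive])
     apply (rule H_ract_closed'; assumption)
    apply (use H_mem in \<open>auto simp: fun_eq_iff M.A.A.r_distr\<close>)[1]
   apply (rule I_ract; assumption)
  apply assumption
  done

lemma cs_zero: "i \<in> I \<Longrightarrow> cs i = cs \<zero>\<^bsub>H\<^esub>"
proof -
  interpret s: abelian_subgroup I H
    by (rule abelian_subgroupI3[OF I_additive H.M.abelian_group_axioms])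
  assume i: "i \<in> I"
  then have "cs i = I" using I_subset by (intro H.M.a_coset_join2 s.a_subgroup) auto
  moreover have "cs \<zero>\<^bsub>H\<^esub> = I" by (rule H.M.a_coset_add_zero[OF I_subset])
  ultimately show ?thesis by simp
qed

text \<open>A map \<open>u0\<close> that does not factor is separated by a functional from those
  that do. Pairing with the maps p -> x k(p) turns the functional into a homomorphism from
  \<open>M\<close> to the dual of \<open>T\<close>. It cannot vanish because, by the dual basis of
  \<open>P1\<close>, sums of such maps exhaust Hom(P1, M).\<close>

lemma rigid_imp_factors:
  assumes rigid: "\<And>h x. \<lbrakk>h \<in> rmod_hom A M (dual K T); x \<in> carrier M\<rbrakk> \<Longrightarrow> h x = \<zero>\<^bsub>dual K T\<^esub>"
  shows "factors_through A P1 f P0 M"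
proof (rule ccontr)
  assume "\<not> factors_through A P1 f P0 M"
  then obtain u0 where u0: "u0 \<in> rmod_hom A P1 M"
    and nf: "\<And>v. v \<in> rmod_hom A P0 M \<Longrightarrow> \<exists>p\<in>carrier P1. u0 p \<noteq> v (f p)"
    unfolding factors_through_def by blast
  define V where "V = hom_space A P1 M"
  interpret V: vectorspace K V
    unfolding V_def by (rule vectorspace_hom_space[OF P1.fd_rmodule_axioms M.fd_rmodule_axioms])
  have Vi: "restrict u (carrier P1) \<in> carrier V" if "u \<in> rmod_hom A P1 M" for u
    using rmod_hom_cong[OF that P1.fd_rmodule_axioms, of "restrict u (carrier P1)"] by (simp add: V_def)
  define W where "W = (\<lambda>v. \<lambda>p\<in>carrier P1. v (f p)) ` rmod_hom A P0 M"
  have Wi: "(\<lambda>p\<in>carrier P1. v (f p)) \<in> W" if "v \<in> rmod_hom A P0 M" for v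
    using that by (auto simp: W_def)
  have Wsub: "W \<subseteq> carrier V"
    using Vi[OF rmod_hom_compose[OF f]] by (auto simp: W_def)
  have "subspace K W V"
  proof -
    have "\<zero>\<^bsub>V\<^esub> \<in> W" using Wi[of "\<lambda>_. \<zero>\<^bsub>M\<^esub>"] by (simp add: V_def rmod_hom_def M.ract_zero_left)
    moreover have "i \<oplus>\<^bsub>V\<^esub> j \<in> W" if i: "i \<in> W" and j: "j \<in> W" for i j
    proof -
      obtain k where k: "k \<in> rmod_hom A P0 M" "i = (\<lambda>p\<in>carrier P1. k (f p))"
        using i by (auto simp: W_def)
      obtain l where l: "l \<in> rmod_hom A P0 M" "j = (\<lambda>p\<in>carrier P1. l (f p))"
        using j by (auto simp: W_def)
      have "(\<lambda>x. k x \<oplus>\<^bsub>M\<^esub> l x) \<in> rmod_hom A P0 M"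
        using rmod_hom_closed[OF k(1)] rmod_hom_closed[OF l(1)]
        by (intro rmod_homI)
          (auto simp: rmod_hom_add[OF k(1)] rmod_hom_ract[OF k(1)] rmod_hom_add[OF l(1)] rmod_hom_ract[OF l(1)]
            M.ract_add_left M.M.a_ac)
      from Wi[OF this] show ?thesis by (simp add: V_def k(2) l(2) cong: restrict_cong)
    qed
    moreover have "c \<odot>\<^bsub>V\<^esub> i \<in> W" if c: "c \<in> carrier K" and i: "i \<in> W" for c i
    proof -
      obtain k where k: "k \<in> rmod_hom A P0 M" "i = (\<lambda>p\<in>carrier P1. k (f p))"
        using i by (auto simp: W_def)
      have "(\<lambda>x. c \<odot>\<^bsub>M\<^esub> k x) \<in> rmod_hom A P0 M"
        using rmod_hom_closed[OF k(1)] c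
        by (intro rmod_homI)
          (auto simp: rmod_hom_add[OF k(1)] rmod_hom_ract[OF k(1)] M.smult_r_distr M.smult_ract_left)
      from Wi[OF this] show ?thesis by (simp add: V_def k(2) cong: restrict_cong)
    qed
    ultimately show ?thesis
      using Wsub by (auto simp only: subspace_def submodule_def V.vectorspace_axioms V.module_axioms)
  qed
  moreover have "restrict u0 (carrier P1) \<notin> W"
  proof
    assume "restrict u0 (carrier P1) \<in> W"
    then obtain v where v: "v \<in> rmod_hom A P0 M" "restrict u0 (carrier P1) = (\<lambda>p\<in>carrier P1. v (f p))"
      by (auto simp: W_def)
    then have "u0 p = v (f p)" if "p \<in> carrier P1" for p using that by (metis restrict_apply')
    then show False using nf[OF v(1)] by blast
  qed
  ultimately have "\<exists>\<psi>. \<psi> \<in> carrier V \<rightarrow> carrier K \<and>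
    (\<forall>x\<in>carrier V. \<forall>y\<in>carrier V. \<psi> (x \<oplus>\<^bsub>V\<^esub> y) = \<psi> x \<oplus>\<^bsub>K\<^esub> \<psi> y) \<and>
    (\<forall>c\<in>carrier K. \<forall>x\<in>carrier V. \<psi> (c \<odot>\<^bsub>V\<^esub> x) = c \<otimes>\<^bsub>K\<^esub> \<psi> x) \<and>
    (\<forall>x\<in>W. \<psi> x = \<zero>\<^bsub>K\<^esub>) \<and> \<psi> (restrict u0 (carrier P1)) = \<one>\<^bsub>K\<^esub>"
    by (rule V.separating_functional[OF _ Vi[OF u0]])
  then obtain \<psi> where \<psi>: "\<psi> \<in> carrier V \<rightarrow> carrier K"
    "\<And>x y. \<lbrakk>x \<in> carrier V; y \<in> carrier V\<rbrakk> \<Longrightarrow> \<psi> (x \<oplus>\<^bsub>V\<^esub> y) = \<psi> x \<oplus>\<^bsub>K\<^esub> \<psi> y"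
    "\<And>c x. \<lbrakk>c \<in> carrier K; x \<in> carrier V\<rbrakk> \<Longrightarrow> \<psi> (c \<odot>\<^bsub>V\<^esub> x) = c \<otimes>\<^bsub>K\<^esub> \<psi> x"
    "\<And>x. x \<in> W \<Longrightarrow> \<psi> x = \<zero>\<^bsub>K\<^esub>" "\<psi> (restrict u0 (carrier P1)) = \<one>\<^bsub>K\<^esub>"
    by (elim exE conjE) blast
  \<comment> \<open>The map p -> x k(p): the image of x tensor k under the isomorphism from the
    tensor product of M and Hom(P1, A) to Hom(P1, M).\<close>
  define xk where "xk x k = (\<lambda>p\<in>carrier P1. x \<triangleleft>\<^bsub>M\<^esub> k p)" for x k
  have xkV: "xk x k \<in> carrier V" if "x \<in> carrier M" "k \<in> rmod_hom A P1 (regular A)" for x k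
  proof -
    have "(\<lambda>p. x \<triangleleft>\<^bsub>M\<^esub> k p) \<in> rmod_hom A P1 M"
      using that rmod_hom_closed[OF that(2)]
      by (intro rmod_homI) (auto simp: rmod_hom_add[OF that(2)] rmod_hom_ract[OF that(2)] M.ract_add_right M.ract_mult M.ract_closed)
    from Vi[OF this] show ?thesis by (simp add: xk_def)
  qed
  have Hr: "k \<in> rmod_hom A P1 (regular A)" if "k \<in> carrier H" for k using that by simp
  \<comment> \<open>The value on a coset is independent of the representative: if k is of the form l
    o f, then \<open>xk x k\<close> factors through \<open>f\<close> and lies in \<open>W\<close>,
    where \<open>\<psi>\<close> vanishes.\<close>
  define h where "h x = (\<lambda>C\<in>carrier T. the_elem ((\<lambda>k. \<psi> (xk x k)) ` C))" for x
  have hcs: "h x (cs k) = \<psi> (xk x k)" if x: "x \<in> carrier M" and k: "k \<in> carrier H" for x k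
  proof -
    have "\<psi> (xk x k') = \<psi> (xk x k)" if k': "k' \<in> cs k" for k'
    proof -
      obtain i where i: "i \<in> I" "k' = i \<oplus>\<^bsub>H\<^esub> k" using k' unfolding a_r_coset_def' by blast
      obtain l where l: "l \<in> rmod_hom A P0 (regular A)" "i = (\<lambda>p\<in>carrier P1. l (f p))"
        by (rule I_cases[OF i(1)])
      have iH: "i \<in> carrier H" using i I_subset by blast
      have "(\<lambda>q. x \<triangleleft>\<^bsub>M\<^esub> l q) \<in> rmod_hom A P0 M"
        using x rmod_hom_closed[OF l(1)]
        by (intro rmod_homI) (auto simp: rmod_hom_add[OF l(1)] rmod_hom_ract[OF l(1)] M.ract_add_right M.ract_mult M.ract_closed)
      from Wi[OF this] have W0: "xk x i \<in> W" by (simp add: xk_def l(2) cong: restrict_cong)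
      have "xk x k' = xk x i \<oplus>\<^bsub>V\<^esub> xk x k"
        using x H_mem[OF iH] H_mem[OF k] by (auto simp: xk_def V_def i(2) fun_eq_iff M.ract_add_right)
      then show ?thesis
        using \<psi>(2)[OF xkV[OF x Hr[OF iH]] xkV[OF x Hr[OF k]]] \<psi>(4)[OF W0] funcset_mem[OF \<psi>(1) xkV[OF x Hr[OF k]]] by simp
    qed
    moreover have "k \<in> cs k"
      using abelian_subgroup.a_rcos_self[OF abelian_subgroupI3[OF I_additive H.M.abelian_group_axioms] k] .
    ultimately have "(\<lambda>k. \<psi> (xk x k)) ` cs k = {\<psi> (xk x k)}" by blast
    then show ?thesis using k by (simp add: h_def carrier_T del: hom_regular_simps)
  qed
  have csT: "cs k \<in> carrier T" if "k \<in> carrier H" for k using that by (simp add: carrier_T del: hom_regular_simps)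
  have Trep: "\<exists>k\<in>carrier H. C = cs k" if "C \<in> carrier T" for C
    using that by (auto simp: carrier_T simp del: hom_regular_simps)
  have hext: "h x \<in> extensional (carrier T)" for x by (simp add: h_def)
  have hd: "h x \<in> carrier (dual K T)" if x: "x \<in> carrier M" for x
  proof -
    have "h x C \<in> carrier K" if "C \<in> carrier T" for C
      using Trep[OF that] hcs[OF x] funcset_mem[OF \<psi>(1) xkV[OF x Hr]] by auto
    then have "h x \<in> carrier T \<rightarrow>\<^sub>E carrier K" using hext by (auto simp: PiE_def)
    moreover     have "h x (C \<oplus>\<^bsub>T\<^esub> D) = h x C \<oplus>\<^bsub>K\<^esub> h x D" if "C \<in> carrier T" "D \<in> carrier T" for C D
    proof -
      have "\<exists>k\<in>carrier H. C = cs k" "\<exists>k\<in>carrier H. D = cs k" by (rule Trep[OF that(1)], rule Trep[OF that(2)])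
      then obtain k l where kl: "k \<in> carrier H" "C = cs k" "l \<in> carrier H" "D = cs l" by (elim bexE)
      have "xk x (k \<oplus>\<^bsub>H\<^esub> l) = xk x k \<oplus>\<^bsub>V\<^esub> xk x l"
        using x H_mem[OF kl(1)] H_mem[OF kl(3)] by (auto simp: xk_def V_def fun_eq_iff M.ract_add_right)
      then show ?thesis
        using kl hcs[OF x] cs_add[OF kl(1,3)] H.M.a_closed[OF kl(1,3)] \<psi>(2)[OF xkV[OF x Hr[OF kl(1)]] xkV[OF x Hr[OF kl(3)]]]
        by (simp del: hom_regular_simps)
    qed
    moreover have "h x (c \<odot>\<^bsub>T\<^esub> C) = c \<otimes>\<^bsub>K\<^esub> h x C" if c: "c \<in> carrier K" and "C \<in> carrier T" for c C
    proof -
      have "\<exists>k\<in>carrier H. C = cs k" by (rule Trep[OF that(2)])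
      then obtain k where k: "k \<in> carrier H" "C = cs k" by (elim bexE)
      have "xk x (c \<odot>\<^bsub>H\<^esub> k) = c \<odot>\<^bsub>V\<^esub> xk x k"
        using x c H_mem[OF k(1)] by (auto simp: xk_def V_def fun_eq_iff M.smult_ract_right)
      then show ?thesis
        using k hcs[OF x] cs_smult[OF c k(1)] H.smult_closed[OF c k(1)] \<psi>(3)[OF c xkV[OF x Hr[OF k(1)]]]
        by (simp del: hom_regular_simps)
    qed
    ultimately show ?thesis by (simp add: dual_def)
  qed
  have "h \<in> rmod_hom A M (dual K T)"
  proof (rule rmod_homI)
    show "h x \<in> carrier (dual K T)" if "x \<in> carrier M" for x by (rule hd[OF that])
    fix x assume x: "x \<in> carrier M"
    { fix y assume y: "y \<in> carrier M"
      show "h (x \<oplus>\<^bsub>M\<^esub> y) = h x \<oplus>\<^bsub>dual K T\<^esub> h y"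
      proof (rule extensionalityI[where A = "carrier T"])
        fix C assume "C \<in> carrier T"
        then obtain k where k: "k \<in> carrier H" "C = cs k" using Trep by meson
        have "xk (x \<oplus>\<^bsub>M\<^esub> y) k = xk x k \<oplus>\<^bsub>V\<^esub> xk y k"
          using x y H_mem[OF k(1)] by (auto simp: xk_def V_def fun_eq_iff M.ract_add_left)
        then show "h (x \<oplus>\<^bsub>M\<^esub> y) C = (h x \<oplus>\<^bsub>dual K T\<^esub> h y) C"
          using x y k hcs csT[OF k(1)] \<psi>(2)[OF xkV[OF x Hr[OF k(1)]] xkV[OF y Hr[OF k(1)]]]
          by (simp add: dual_def del: hom_regular_simps)
      qed (simp_all add: hext dual_def) }
    fix a assume a: "a \<in> carrier A"
    show "h (x \<triangleleft>\<^bsub>M\<^esub> a) = h x \<triangleleft>\<^bsub>dual K T\<^esub> a"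
    proof (rule extensionalityI[where A = "carrier T"])
      fix C assume "C \<in> carrier T"
      then obtain k where k: "k \<in> carrier H" "C = cs k" using Trep by meson
      have "xk (x \<triangleleft>\<^bsub>M\<^esub> a) k = xk x (k \<triangleleft>\<^bsub>H\<^esub> a)"
        using x a H_mem[OF k(1)] by (auto simp: xk_def fun_eq_iff M.ract_mult)
      then show "h (x \<triangleleft>\<^bsub>M\<^esub> a) C = (h x \<triangleleft>\<^bsub>dual K T\<^esub> a) C"
        using x a k hcs csT[OF k(1)] cs_ract[OF a k(1)] H_ract_closed'[OF k(1) a] M.ract_closed
        by (simp add: dual_def del: hom_regular_simps)
    qed (simp_all add: hext dual_def)
  qed
  then have h0: "h x = \<zero>\<^bsub>dual K T\<^esub>" if "x \<in> carrier M" for x using rigid that by blast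
  have \<psi>0: "\<psi> (xk x k) = \<zero>\<^bsub>K\<^esub>" if "x \<in> carrier M" "k \<in> carrier H" for x k
    using hcs[OF that] h0[OF that(1)] csT[OF that(2)] by (simp add: dual_def)
  obtain n p c where db: "dual_basis A P1 n p c"
    using proj(2) projective_iff_dual_basis[OF P1.fd_rmodule_axioms] by blast
  note d = dual_basisD[OF db]
  \<comment> \<open>Partial sums of the dual basis expansion of \<open>u0\<close>. Each summand has
    the form \<open>xk (u0 (p m)) k\<close>, which \<open>\<psi>\<close> kills by rigidity.\<close>
  define U where "U m = (\<lambda>q\<in>carrier P1. finsum M (\<lambda>i. u0 (p i) \<triangleleft>\<^bsub>M\<^esub> c i q) {..<m})" for m
  have "m \<le> n \<Longrightarrow> U m \<in> carrier V \<and> \<psi> (U m) = \<zero>\<^bsub>K\<^esub>" for m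
  proof (induct m)
    case 0
    have "U 0 = \<zero>\<^bsub>V\<^esub>" by (simp add: U_def V_def)
    moreover have "\<psi> \<zero>\<^bsub>V\<^esub> = \<zero>\<^bsub>K\<^esub>"
      using \<psi>(3)[of "\<zero>\<^bsub>K\<^esub>" "\<zero>\<^bsub>V\<^esub>"] \<psi>(1) V.M.zero_closed by (simp add: Pi_iff)
    ultimately show ?case by simp
  next
    case (Suc m)
    then have m: "m < n" by simp
    define k where "k = restrict (c m) (carrier P1)"
    have kH: "k \<in> carrier H"
      using rmod_hom_cong[OF d(2)[OF m] P1.fd_rmodule_axioms, of k] by (simp add: k_def)
    have u0m: "u0 (p m) \<in> carrier M" using rmod_hom_closed[OF u0 d(1)[OF m]] .
    have cl: "(\<lambda>i. u0 (p i) \<triangleleft>\<^bsub>M\<^esub> c i q) \<in> {..<m} \<rightarrow> carrier M" if "q \<in> carrier P1" for q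
      using m d that rmod_hom_closed[OF u0] by (auto intro!: M.ract_closed)
    have "U (Suc m) = xk (u0 (p m)) k \<oplus>\<^bsub>V\<^esub> U m"
      using cl d(3)[OF m] u0m
      by (auto simp: fun_eq_iff U_def V_def xk_def k_def lessThan_Suc M.M.finsum_insert M.ract_closed)
    then show ?case
      using Suc m \<psi>(2)[OF xkV[OF u0m Hr[OF kH]], of "U m"] \<psi>0[OF u0m kH] xkV[OF u0m Hr[OF kH]] by simp
  qed
  from this[of n] have "\<psi> (U n) = \<zero>\<^bsub>K\<^esub>" by simp
  moreover have "U n = restrict u0 (carrier P1)"
    using dual_basis_hom_expand[OF P1.fd_rmodule_axioms M.fd_rmodule_axioms db u0] by (auto simp: U_def fun_eq_iff)
  ultimately show False using \<psi>(5) by simp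
qed

text \<open>A homomorphism \<open>h\<close> amounts to a balanced pairing \<open>\<beta>\<close>
  between \<open>M\<close> and Hom(P1, A), and this induces a functional \<open>\<Phi>\<close> on
  Hom(P1, M). The functional vanishes on all maps that factor through \<open>f\<close>, hence
  everywhere, and so does the pairing.\<close>

lemma factors_imp_rigid:
  assumes fac: "factors_through A P1 f P0 M"
    and h: "h \<in> rmod_hom A M (dual K T)" and x: "x \<in> carrier M"
  shows "h x = \<zero>\<^bsub>dual K T\<^esub>"
proof -
  have csT: "cs k \<in> carrier T" if "k \<in> carrier H" for k using that by (simp add: carrier_T del: hom_regular_simps)
  \<comment> \<open>The argument k is restricted first, so that \<open>\<beta>\<close> accepts
    arbitrary functions and depends only on their values on \<open>P1\<close>.\<close>
  define \<beta> where "\<beta> x k = h x (cs (restrict k (carrier P1)))" for x k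
  define R where "R = rmod_hom A P1 (regular A)"
  have rH: "restrict k (carrier P1) \<in> carrier H" if "k \<in> R" for k
    using rmod_hom_cong[of k A P1 "regular A" K "restrict k (carrier P1)"] that P1.fd_rmodule_axioms by (simp add: R_def)
  have hx: "h x \<in> carrier (dual K T)" if "x \<in> carrier M" for x using rmod_hom_closed[OF h that] .
  have \<beta>K: "\<beta> x k \<in> carrier K" if "x \<in> carrier M" "k \<in> R" for x k
    using hx[OF that(1)] csT[OF rH[OF that(2)]] by (auto simp: \<beta>_def dual_def PiE_iff)
  have \<beta>addl: "\<beta> (x \<oplus>\<^bsub>M\<^esub> y) k = \<beta> x k \<oplus>\<^bsub>K\<^esub> \<beta> y k" if "x \<in> carrier M" "y \<in> carrier M" "k \<in> R" for x y k
    using rmod_hom_add[OF h that(1,2)] csT[OF rH[OF that(3)]] by (simp add: \<beta>_def dual_def)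
  have \<beta>ract: "\<beta> (x \<triangleleft>\<^bsub>M\<^esub> a) k = \<beta> x (\<lambda>p. a \<otimes>\<^bsub>A\<^esub> k p)" if "x \<in> carrier M" "a \<in> carrier A" "k \<in> R" for x a k
  proof -
    have "restrict k (carrier P1) \<triangleleft>\<^bsub>H\<^esub> a = restrict (\<lambda>p. a \<otimes>\<^bsub>A\<^esub> k p) (carrier P1)" by (auto simp: fun_eq_iff)
    then show ?thesis
      using rmod_hom_ract[OF h that(1,2)] csT[OF rH[OF that(3)]] cs_ract[OF that(2) rH[OF that(3)]]
      by (simp add: \<beta>_def dual_def del: hom_regular_simps)
  qed
  have \<beta>addr: "\<beta> x (\<lambda>p. k p \<oplus>\<^bsub>A\<^esub> l p) = \<beta> x k \<oplus>\<^bsub>K\<^esub> \<beta> x l" if "x \<in> carrier M" "k \<in> R" "l \<in> R" for x k l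
  proof -
    have eq: "restrict k (carrier P1) \<oplus>\<^bsub>H\<^esub> restrict l (carrier P1) = restrict (\<lambda>p. k p \<oplus>\<^bsub>A\<^esub> l p) (carrier P1)"
      by (auto simp: fun_eq_iff)
    have "h x (C \<oplus>\<^bsub>T\<^esub> D) = h x C \<oplus>\<^bsub>K\<^esub> h x D" if "C \<in> carrier T" "D \<in> carrier T" for C D
      using hx[OF \<open>x \<in> carrier M\<close>] that by (simp add: dual_def)
    from this[OF csT[OF rH[OF that(2)]] csT[OF rH[OF that(3)]]]
    show ?thesis
      unfolding \<beta>_def cs_add[OF rH[OF that(2)] rH[OF that(3)]] eq .
  qed
  have h0: "h x (cs \<zero>\<^bsub>H\<^esub>) = \<zero>\<^bsub>K\<^esub>" if "x \<in> carrier M" for x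
  proof -
    have "\<zero>\<^bsub>K\<^esub> \<odot>\<^bsub>T\<^esub> cs \<zero>\<^bsub>H\<^esub> = cs \<zero>\<^bsub>H\<^esub>"
      using cs_smult[of "\<zero>\<^bsub>K\<^esub>" "\<zero>\<^bsub>H\<^esub>"] H.M.zero_closed H.smult_r_null by (simp del: hom_regular_simps)
    moreover have "h x (\<zero>\<^bsub>K\<^esub> \<odot>\<^bsub>T\<^esub> cs \<zero>\<^bsub>H\<^esub>) = \<zero>\<^bsub>K\<^esub> \<otimes>\<^bsub>K\<^esub> h x (cs \<zero>\<^bsub>H\<^esub>)"
      using hx[OF that] csT[OF H.M.zero_closed] by (auto simp: dual_def simp del: hom_regular_simps)
    moreover have "h x (cs \<zero>\<^bsub>H\<^esub>) \<in> carrier K"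
      using hx[OF that] csT[OF H.M.zero_closed] by (auto simp: dual_def PiE_iff simp del: hom_regular_simps)
    ultimately show ?thesis by simp
  qed
  have \<beta>I: "\<beta> x (\<lambda>p. k (f p)) = \<zero>\<^bsub>K\<^esub>" if "x \<in> carrier M" "k \<in> rmod_hom A P0 (regular A)" for x k
    using cs_zero[OF I_mem[OF that(2)]] h0[OF that(1)] by (simp add: \<beta>_def del: hom_regular_simps)
  have \<beta>cong: "\<beta> x k = \<beta> x l" if "\<And>p. p \<in> carrier P1 \<Longrightarrow> k p = l p" for x k l
    using that by (simp add: \<beta>_def cong: restrict_cong)
  obtain n p c where db: "dual_basis A P1 n p c"
    using proj(2) projective_iff_dual_basis[OF P1.fd_rmodule_axioms] by blast
  note d = dual_basisD[OF db]
  obtain n' q e where db': "dual_basis A P0 n' q e"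
    using proj(1) projective_iff_dual_basis[OF P0.fd_rmodule_axioms] by blast
  note d' = dual_basisD[OF db']
  have cR: "c i \<in> R" if "i < n" for i using d(2)[OF that] by (simp add: R_def)
  have acR: "(\<lambda>p. a \<otimes>\<^bsub>A\<^esub> k p) \<in> R" if "k \<in> R" "a \<in> carrier A" for a k
    using that rmod_hom_closed[of k A P1 "regular A"] rmod_hom_add[of k A P1 "regular A"]
      rmod_hom_ract[of k A P1 "regular A"] unfolding R_def
    by (intro rmod_homI) (auto simp: M.A.A.r_distr M.A.A.m_assoc)
  have \<beta>zero: "\<beta> x (\<lambda>_. \<zero>\<^bsub>A\<^esub>) = \<zero>\<^bsub>K\<^esub>" if "x \<in> carrier M" for x
    using h0[OF that] by (simp add: \<beta>_def)
  \<comment> \<open>The functional induced by \<open>\<beta>\<close>, read off from the dual basis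
    expansion of u into the maps y -> u(p_i) c_i(y).\<close>
  define \<Phi> where "\<Phi> u = finsum K (\<lambda>i. \<beta> (u (p i)) (c i)) {..<n}" for u
  have regA: "fd_rmodule K A (regular A)" by (rule fd_rmodule_regular[OF M.fd_algebra])
  \<comment> \<open>By k = sum of k(p_i) c_i and balancedness, \<open>\<beta> x k\<close> is the sum
    of the values of \<open>\<beta>\<close> at x k(p_i) and c_i.\<close>
  have \<beta>\<Phi>: "\<beta> x k = \<Phi> (\<lambda>p. x \<triangleleft>\<^bsub>M\<^esub> k p)" if x: "x \<in> carrier M" and k: "k \<in> R" for x k
  proof -
    have kp: "k (p i) \<in> carrier A" if "i < n" for i
      using rmod_hom_closed[OF k[unfolded R_def] d(1)[OF that]] by simp
    have "m \<le> n \<Longrightarrow> (\<lambda>y. finsum A (\<lambda>i. k (p i) \<otimes>\<^bsub>A\<^esub> c i y) {..<m}) \<in> R \<and>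
      \<beta> x (\<lambda>y. finsum A (\<lambda>i. k (p i) \<otimes>\<^bsub>A\<^esub> c i y) {..<m}) = finsum K (\<lambda>i. \<beta> (x \<triangleleft>\<^bsub>M\<^esub> k (p i)) (c i)) {..<m}" for m
    proof (induct m)
      case 0
      show ?case using \<beta>zero[OF x] by (simp add: R_def rmod_hom_def)
    next
      case (Suc m)
      then have m: "m < n" by simp
      define S where "S y = finsum A (\<lambda>i. k (p i) \<otimes>\<^bsub>A\<^esub> c i y) {..<m}" for y
      have SR: "S \<in> R" and \<beta>S: "\<beta> x S = finsum K (\<lambda>i. \<beta> (x \<triangleleft>\<^bsub>M\<^esub> k (p i)) (c i)) {..<m}"
        using Suc m unfolding S_def[abs_def] by auto
      have kc: "(\<lambda>y. k (p m) \<otimes>\<^bsub>A\<^esub> c m y) \<in> R" by (rule acR[OF cR[OF m] kp[OF m]])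
      have eq: "finsum A (\<lambda>i. k (p i) \<otimes>\<^bsub>A\<^esub> c i y) {..<Suc m} = k (p m) \<otimes>\<^bsub>A\<^esub> c m y \<oplus>\<^bsub>A\<^esub> S y"
        if "y \<in> carrier P1" for y
        using that d(3) kp m by (simp add: S_def lessThan_Suc M.A.M.finsum_insert Pi_iff)
      have sR: "(\<lambda>y. k (p m) \<otimes>\<^bsub>A\<^esub> c m y \<oplus>\<^bsub>A\<^esub> S y) \<in> R"
        using kc SR rmod_hom_closed[OF kc[unfolded R_def]] rmod_hom_closed[OF SR[unfolded R_def]]
          rmod_hom_add[OF kc[unfolded R_def]] rmod_hom_add[OF SR[unfolded R_def]]
          rmod_hom_ract[OF kc[unfolded R_def]] rmod_hom_ract[OF SR[unfolded R_def]]
        unfolding R_def by (intro rmod_homI) (simp_all add: M.A.A.l_distr M.A.M.a_ac)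
      have 1: "(\<lambda>y. finsum A (\<lambda>i. k (p i) \<otimes>\<^bsub>A\<^esub> c i y) {..<Suc m}) \<in> R"
        unfolding R_def by (rule rmod_hom_cong[OF sR[unfolded R_def] P1.fd_rmodule_axioms]) (simp add: eq)
      have "\<beta> x (\<lambda>y. finsum A (\<lambda>i. k (p i) \<otimes>\<^bsub>A\<^esub> c i y) {..<Suc m}) = \<beta> x (\<lambda>y. k (p m) \<otimes>\<^bsub>A\<^esub> c m y \<oplus>\<^bsub>A\<^esub> S y)"
        by (rule \<beta>cong) (rule eq)
      also have "\<dots> = \<beta> (x \<triangleleft>\<^bsub>M\<^esub> k (p m)) (c m) \<oplus>\<^bsub>K\<^esub> \<beta> x S"
        using \<beta>addr[OF x kc SR] \<beta>ract[OF x kp[OF m] cR[OF m]] by simp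
      also have "\<dots> = finsum K (\<lambda>i. \<beta> (x \<triangleleft>\<^bsub>M\<^esub> k (p i)) (c i)) {..<Suc m}"
        using m kp cR x by (simp add: \<beta>S lessThan_Suc Pi_iff \<beta>K M.ract_closed)
      finally show ?case using 1 by simp
    qed
    from this[of n] have "\<beta> x (\<lambda>y. finsum A (\<lambda>i. k (p i) \<otimes>\<^bsub>A\<^esub> c i y) {..<n}) = \<Phi> (\<lambda>p. x \<triangleleft>\<^bsub>M\<^esub> k p)"
      by (simp add: \<Phi>_def)
    moreover have "\<beta> x (\<lambda>y. finsum A (\<lambda>i. k (p i) \<otimes>\<^bsub>A\<^esub> c i y) {..<n}) = \<beta> x k"
    proof (rule \<beta>cong)
      show "finsum A (\<lambda>i. k (p i) \<otimes>\<^bsub>A\<^esub> c i y) {..<n} = k y" if "y \<in> carrier P1" for y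
      using dual_basis_hom_expand[OF P1.fd_rmodule_axioms regA db k[unfolded R_def] that] by simp
    qed
    ultimately show ?thesis by simp
  qed
  \<comment> \<open>A dual basis of \<open>P0\<close> writes v o f as the sum of the maps y ->
    v(q_j) e_j(f y). The pairing kills e_j o f, which lies in the image of Hom(f, A).\<close>
  have \<Phi>fac: "\<Phi> (\<lambda>y. v (f y)) = \<zero>\<^bsub>K\<^esub>" if v: "v \<in> rmod_hom A P0 M" for v
  proof -
    have fp: "f (p i) \<in> carrier P0" if "i < n" for i using rmod_hom_closed[OF f d(1)[OF that]] .
    have vq: "v (q j) \<in> carrier M" if "j < n'" for j using rmod_hom_closed[OF v d'(1)[OF that]] .
    have ef: "(\<lambda>y. e j (f y)) \<in> R" if "j < n'" for j
      unfolding R_def by (rule rmod_hom_compose[OF f d'(2)[OF that]])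
    have "m \<le> n' \<Longrightarrow> \<Phi> (\<lambda>y. finsum M (\<lambda>j. v (q j) \<triangleleft>\<^bsub>M\<^esub> e j (f y)) {..<m}) = \<zero>\<^bsub>K\<^esub>" for m
    proof (induct m)
      case 0
      have "\<beta> \<zero>\<^bsub>M\<^esub> (c i) = \<zero>\<^bsub>K\<^esub>" if "i < n" for i
        using \<beta>addl[OF M.M.zero_closed M.M.zero_closed cR[OF that]] \<beta>K[OF M.M.zero_closed cR[OF that]] by simp
      then have "finsum K (\<lambda>i. \<beta> \<zero>\<^bsub>M\<^esub> (c i)) {..<n} = finsum K (\<lambda>i. \<zero>\<^bsub>K\<^esub>) {..<n}"
        by (intro M.R.finsum_cong') auto
      then show ?case by (simp add: \<Phi>_def)
    next
      case (Suc m)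
      then have m: "m < n'" by simp
      have cl: "(\<lambda>j. v (q j) \<triangleleft>\<^bsub>M\<^esub> e j (f y)) \<in> {..<m} \<rightarrow> carrier M" if "f y \<in> carrier P0" for y
        using m vq d'(3)[OF _ that] by (auto intro!: M.ract_closed)
      have clm: "v (q m) \<triangleleft>\<^bsub>M\<^esub> e m (f y) \<in> carrier M" if "f y \<in> carrier P0" for y
        using m vq d'(3)[OF _ that] by (auto intro!: M.ract_closed)
      have "\<Phi> (\<lambda>y. finsum M (\<lambda>j. v (q j) \<triangleleft>\<^bsub>M\<^esub> e j (f y)) {..<Suc m}) =
        finsum K (\<lambda>i. \<beta> (v (q m) \<triangleleft>\<^bsub>M\<^esub> e m (f (p i))) (c i) \<oplus>\<^bsub>K\<^esub>
          \<beta> (finsum M (\<lambda>j. v (q j) \<triangleleft>\<^bsub>M\<^esub> e j (f (p i))) {..<m}) (c i)) {..<n}"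
        unfolding \<Phi>_def
        using fp cl clm cR
        by (intro M.R.finsum_cong') (auto simp: lessThan_Suc M.M.finsum_insert \<beta>addl \<beta>K)
      also have "\<dots> = \<Phi> (\<lambda>y. v (q m) \<triangleleft>\<^bsub>M\<^esub> e m (f y)) \<oplus>\<^bsub>K\<^esub> \<Phi> (\<lambda>y. finsum M (\<lambda>j. v (q j) \<triangleleft>\<^bsub>M\<^esub> e j (f y)) {..<m})"
        unfolding \<Phi>_def
        using fp cl clm cR
        by (intro M.R.finsum_addf) (auto intro!: \<beta>K)
      also have "\<dots> = \<zero>\<^bsub>K\<^esub>"
      proof -
        have "\<Phi> (\<lambda>y. v (q m) \<triangleleft>\<^bsub>M\<^esub> e m (f y)) = \<zero>\<^bsub>K\<^esub>"
          using \<beta>\<Phi>[OF vq[OF m] ef[OF m]] \<beta>I[OF vq[OF m] d'(2)[OF m]] by simp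
        moreover have "\<Phi> (\<lambda>y. finsum M (\<lambda>j. v (q j) \<triangleleft>\<^bsub>M\<^esub> e j (f y)) {..<m}) = \<zero>\<^bsub>K\<^esub>"
          using Suc m by simp
        ultimately show ?thesis by simp
      qed
      finally show ?case .
    qed
    from this[of n'] have "\<Phi> (\<lambda>y. finsum M (\<lambda>j. v (q j) \<triangleleft>\<^bsub>M\<^esub> e j (f y)) {..<n'}) = \<zero>\<^bsub>K\<^esub>" by simp
    moreover have "\<Phi> (\<lambda>y. v (f y)) = \<Phi> (\<lambda>y. finsum M (\<lambda>j. v (q j) \<triangleleft>\<^bsub>M\<^esub> e j (f y)) {..<n'})"
      unfolding \<Phi>_def
      using dual_basis_hom_expand[OF P0.fd_rmodule_axioms M.fd_rmodule_axioms db' v fp] rmod_hom_closed[OF v fp] cR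
      by (intro M.R.finsum_cong') (auto intro!: \<beta>K)
    ultimately show ?thesis by simp
  qed
  have "\<beta> x k = \<zero>\<^bsub>K\<^esub>" if k: "k \<in> R" for k
  proof -
    have "(\<lambda>p. x \<triangleleft>\<^bsub>M\<^esub> k p) \<in> rmod_hom A P1 M"
      using x rmod_hom_closed[OF k[unfolded R_def]] unfolding R_def
      by (intro rmod_homI) (auto simp: rmod_hom_add[OF k[unfolded R_def]] rmod_hom_ract[OF k[unfolded R_def]]
          M.ract_add_right M.ract_mult M.ract_closed)
    then obtain v where v: "v \<in> rmod_hom A P0 M" "\<And>y. y \<in> carrier P1 \<Longrightarrow> x \<triangleleft>\<^bsub>M\<^esub> k y = v (f y)"
      using bspec[OF fac[unfolded factors_through_def]] by blast
    have "\<Phi> (\<lambda>y. x \<triangleleft>\<^bsub>M\<^esub> k y) = \<Phi> (\<lambda>y. v (f y))"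
      unfolding \<Phi>_def using v d(1) rmod_hom_closed[OF v(1)] rmod_hom_closed[OF f] cR
      by (intro M.R.finsum_cong') (auto intro!: \<beta>K)
    then show ?thesis using \<beta>\<Phi>[OF x k] \<Phi>fac[OF v(1)] by simp
  qed
  then have hz: "h x (cs k) = \<zero>\<^bsub>K\<^esub>" if "k \<in> carrier H" for k
  proof -
    have "k \<in> R" "restrict k (carrier P1) = k" using that by (simp_all add: R_def extensional_restrict)
    then show ?thesis using \<open>\<And>k. k \<in> R \<Longrightarrow> \<beta> x k = \<zero>\<^bsub>K\<^esub>\<close>[of k] by (simp add: \<beta>_def)
  qed
  have "h x = (\<lambda>C\<in>carrier T. \<zero>\<^bsub>K\<^esub>)"
  proof (rule extensionalityI[where A = "carrier T"])
    show "h x \<in> extensional (carrier T)" using hx[OF x] by (auto simp: dual_def PiE_def)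
    fix C assume C: "C \<in> carrier T"
    then obtain k where "k \<in> carrier H" "C = cs k" by (auto simp: carrier_T simp del: hom_regular_simps)
    then show "h x C = (\<lambda>C\<in>carrier T. \<zero>\<^bsub>K\<^esub>) C" using hz C by simp
  qed simp
  then show ?thesis by (simp add: dual_def)
qed

end

section \<open>Independence of the chosen minimal presentation\<close>

lemma minimal_presentationD:
  assumes "minimal_presentation K A P1 f P0 g M"
  shows "projective_cover K A P0 g M"
    and "projective_cover K A P1 f (P0\<lparr>carrier := a_kernel P0 M g\<rparr>)"
    and "fd_rmodule K A P0" "fd_rmodule K A P1" "projective A P0" "projective A P1"
    and "g \<in> rmod_hom A P0 M" "g ` carrier P0 = carrier M"
    and "f \<in> rmod_hom A P1 P0" "f ` carrier P1 = a_kernel P0 M g"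
proof -
  show c: "projective_cover K A P0 g M" "projective_cover K A P1 f (P0\<lparr>carrier := a_kernel P0 M g\<rparr>)"
    using assms by (auto simp: minimal_presentation_def)
  note d0 = projective_coverD[OF c(1)] and d1 = projective_coverD[OF c(2)]
  show "fd_rmodule K A P0" "fd_rmodule K A P1" "projective A P0" "projective A P1"
    "g \<in> rmod_hom A P0 M" "g ` carrier P0 = carrier M" using d0 d1 by auto
  show "f ` carrier P1 = a_kernel P0 M g" using d1(4) by simp
  then show "f \<in> rmod_hom A P1 P0"
    using d1(3) by (auto simp: rmod_hom_def mem_a_kernel)
qed

lemma kernel_iso:
  assumes P: "fd_rmodule K A P" and P': "fd_rmodule K A P'" and M: "fd_rmodule K A M"
    and g: "g \<in> rmod_hom A P M" and g': "g' \<in> rmod_hom A P' M"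
    and a: "a \<in> rmod_hom A P P'" "bij_betw a (carrier P) (carrier P')"
    and ga: "\<And>x. x \<in> carrier P \<Longrightarrow> g' (a x) = g x"
  defines "Z \<equiv> P\<lparr>carrier := a_kernel P M g\<rparr>" and "Z' \<equiv> P'\<lparr>carrier := a_kernel P' M g'\<rparr>"
  shows "fd_rmodule K A Z" "fd_rmodule K A Z'" "a \<in> rmod_hom A Z Z'" "bij_betw a (carrier Z) (carrier Z')"
proof -
  interpret g: rmod_hom_pair K A P M g by (rule rmod_hom_pairI[OF P M g])
  interpret g': rmod_hom_pair K A P' M g' by (rule rmod_hom_pairI[OF P' M g'])
  show "fd_rmodule K A Z" "fd_rmodule K A Z'"
    unfolding Z_def Z'_def
    by (rule g.M.fd_rmodule_submodule[OF g.kernel_rsubmodule], rule g'.M.fd_rmodule_submodule[OF g'.kernel_rsubmodule])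
  show "a \<in> rmod_hom A Z Z'"
    using rmod_hom_closed[OF a(1)] rmod_hom_add[OF a(1)] rmod_hom_ract[OF a(1)] ga
    by (intro rmod_homI) (auto simp: Z_def Z'_def mem_a_kernel)
  have "a ` a_kernel P M g = a_kernel P' M g'"
  proof (intro equalityI subsetI)
    fix y assume "y \<in> a ` a_kernel P M g"
    then show "y \<in> a_kernel P' M g'" using rmod_hom_closed[OF a(1)] ga by (auto simp: mem_a_kernel)
  next
    fix y assume y: "y \<in> a_kernel P' M g'"
    then obtain x where "x \<in> carrier P" "y = a x" using a(2) by (auto simp: mem_a_kernel bij_betw_def)
    then show "y \<in> a ` a_kernel P M g" using y ga by (auto simp: mem_a_kernel)
  qed
  then show "bij_betw a (carrier Z) (carrier Z')"
    using a(2) by (auto simp: bij_betw_def Z_def Z'_def mem_a_kernel intro: inj_on_subset)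
qed

text \<open>Two minimal presentations are isomorphic: \<open>a\<close> compares the covers of
  \<open>M\<close> and restricts to an isomorphism of the kernels, and \<open>b\<close> compares the
  covers of these. Factorizations are conjugated by \<open>a\<close> and \<open>b\<close>.\<close>

lemma factors_through_presentation_indep:
  assumes M: "fd_rmodule K A M"
    and p: "minimal_presentation K A P1 f P0 g M" and p': "minimal_presentation K A P1' f' P0' g' M"
    and fac: "factors_through A P1 f P0 M"
  shows "factors_through A P1' f' P0' M"
proof -
  note d = minimal_presentationD[OF p] and d' = minimal_presentationD[OF p']
  obtain a where a: "a \<in> rmod_hom A P0 P0'" "bij_betw a (carrier P0) (carrier P0')"
    "\<And>x. x \<in> carrier P0 \<Longrightarrow> g' (a x) = g x"
    using projective_cover_unique[OF d(1) d'(1) M] by blast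
  note k = kernel_iso[OF d(3) d'(3) M d(7) d'(7) a]
  obtain b where b: "b \<in> rmod_hom A P1 P1'" "bij_betw b (carrier P1) (carrier P1')"
    "\<And>x. x \<in> carrier P1 \<Longrightarrow> f' (b x) = a (f x)"
    using projective_cover_unique[OF projective_cover_cong_codomain[OF d(2) k] d'(2) k(2)] by blast
  show ?thesis unfolding factors_through_def
  proof
    fix u assume u: "u \<in> rmod_hom A P1' M"
    obtain v where v: "v \<in> rmod_hom A P0 M" "\<And>p. p \<in> carrier P1 \<Longrightarrow> u (b p) = v (f p)"
      using bspec[OF fac[unfolded factors_through_def] rmod_hom_compose[OF b(1) u]] by auto
    have "u p = v (inv_into (carrier P0) a (f' p))" if p: "p \<in> carrier P1'" for p
    proof -
      obtain p0 where p0: "p0 \<in> carrier P1" "p = b p0" using b(2) p by (auto simp: bij_betw_def)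
      have "inv_into (carrier P0) a (a (f p0)) = f p0"
        by (rule bij_betw_inv_into_left[OF a(2) rmod_hom_closed[OF d(9) p0(1)]])
      then show ?thesis using v(2) p0 b(3) by simp
    qed
    then show "\<exists>v\<in>rmod_hom A P0' M. \<forall>p\<in>carrier P1'. u p = v (f' p)"
      by (intro bexI[OF _ rmod_hom_compose[OF inv_rmod_hom[OF d(3) a(1,2)] v(1)]]) auto
  qed
qed

text \<open>A member of add Y is isomorphic to its image in a power of \<open>Y\<close>, so it can
  be realized with elements in a type fixed in advance. This meets the type restrictions in
  \<open>tau\<close> and in \<open>add_inter_trivial\<close>.\<close>

lemma add_embeds_in_power:
  fixes Y :: "('k, 'a, 'y) rmodule"
  assumes P: "fd_rmodule K A P" "in_add A Y P"
  shows "\<exists>(P' :: ('k, 'a, nat \<Rightarrow> 'y) rmodule) \<sigma>. fd_rmodule K A P' \<and> \<sigma> \<in> rmod_hom A P P' \<and>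
    bij_betw \<sigma> (carrier P) (carrier P')"
proof -
  interpret P: fd_rmodule K A P by fact
  obtain n s r where s: "s \<in> rmod_hom A P (rmod_power Y n)"
    and r: "r \<in> rmod_hom A (rmod_power Y n) P" and rs: "\<And>x. x \<in> carrier P \<Longrightarrow> r (s x) = x"
    using P(2) by (auto simp: in_add_def)
  \<comment> \<open>Zero and scalar multiplication are carried over from \<open>P\<close>, so that
    all module axioms come from \<open>P\<close> along \<open>s\<close>; a homomorphism is by
    definition only compatible with addition and the action.\<close>
  define P' where "P' = (rmod_power Y n)\<lparr>carrier := s ` carrier P, zero := s \<zero>\<^bsub>P\<^esub>,
    smult := (\<lambda>c u. s (c \<odot>\<^bsub>P\<^esub> r u))\<rparr>"
  have "fd_rmodule K A P'"
    by (rule fd_rmodule_surj_image_same[OF P(1), where \<pi> = s])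
      (auto simp: P'_def rs rmod_hom_add[OF s] rmod_hom_ract[OF s] simp del: rmod_power_simps)
  moreover have "s \<in> rmod_hom A P P'"
    by (rule rmod_homI) (auto simp: P'_def rmod_hom_add[OF s] rmod_hom_ract[OF s] simp del: rmod_power_simps)
  moreover have "inj_on s (carrier P)" using rs by (metis inj_onI)
  ultimately show ?thesis
    by (intro exI[of _ P'] exI[of _ s]) (auto simp: bij_betw_def P'_def)
qed

text \<open>Guarantees that the choice in the definition of \<open>tau\<close> is made from a
  nonempty set.\<close>

lemma minimal_presentation_in_power:
  fixes A :: "('k, 'a) module"
  assumes M: "fd_rmodule K A M" and p: "minimal_presentation K A P1 f P0 g M"
  shows "\<exists>(P1' :: ('k, 'a, nat \<Rightarrow> 'a) rmodule) f' (P0' :: ('k, 'a, nat \<Rightarrow> 'a) rmodule) g'.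
    minimal_presentation K A P1' f' P0' g' M"
proof -
  note d = minimal_presentationD[OF p]
  obtain P0' :: "('k, 'a, nat \<Rightarrow> 'a) rmodule" and a where a: "fd_rmodule K A P0'"
    "a \<in> rmod_hom A P0 P0'" "bij_betw a (carrier P0) (carrier P0')"
    using add_embeds_in_power[OF d(3) d(5)[unfolded projective_def]] by blast
  obtain P1' :: "('k, 'a, nat \<Rightarrow> 'a) rmodule" and b where b: "fd_rmodule K A P1'"
    "b \<in> rmod_hom A P1 P1'" "bij_betw b (carrier P1) (carrier P1')"
    using add_embeds_in_power[OF d(4) d(6)[unfolded projective_def]] by blast
  define g' where "g' x = g (inv_into (carrier P0) a x)" for x
  have c0: "projective_cover K A P0' g' M"
    unfolding g'_def[abs_def] by (rule projective_cover_cong_domain[OF d(1) M a])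
  have ga: "g' (a x) = g x" if "x \<in> carrier P0" for x
    using bij_betw_inv_into_left[OF a(3) that] by (simp add: g'_def)
  note k = kernel_iso[where g = g and g' = g' and a = a, OF d(3) a(1) M d(7) projective_coverD(3)[OF c0] a(2,3) ga]
  have "projective_cover K A P1' (\<lambda>x. a (f (inv_into (carrier P1) b x))) (P0'\<lparr>carrier := a_kernel P0' M g'\<rparr>)"
    by (rule projective_cover_cong_domain[OF projective_cover_cong_codomain[OF d(2) k] k(2) b])
  then show ?thesis using c0 unfolding minimal_presentation_def by blast
qed

text \<open>The choice in \<open>tau\<close> is eliminated here: the duality is applied to the
  chosen presentation, and surjectivity of Hom(f, M) then passes to any other one.\<close>

theorem tau_rigid_iff_factors_through:
  fixes A :: "('k, 'a) module"
  assumes M: "fd_rmodule K A M" and p: "minimal_presentation K A P1 f P0 g M"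
  shows "tau_rigid K A M \<longleftrightarrow> factors_through A P1 f P0 M"
proof -
  define C where "C = (SOME (P1 :: ('k, 'a, nat \<Rightarrow> 'a) rmodule, f, P0 :: ('k, 'a, nat \<Rightarrow> 'a) rmodule, g).
    minimal_presentation K A P1 f P0 g M)"
  obtain Q1 f' Q0 g' where C: "C = (Q1, f', Q0, g')" by (metis prod.exhaust)
  have "case C of (P1, f, P0, g) \<Rightarrow> minimal_presentation K A P1 f P0 g M"
    unfolding C_def by (rule someI_ex) (use minimal_presentation_in_power[OF M p] in auto)
  then have q: "minimal_presentation K A Q1 f' Q0 g' M" by (simp add: C)
  have tau: "tau K A M = dual K (transpose_module A Q1 f' Q0)"
    unfolding tau_def C_def[symmetric] by (simp add: C)
  note d = minimal_presentationD[OF q]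
  interpret transpose K A M Q0 Q1 f'
    using M d by (simp add: transpose_def transpose_axioms_def)
  have "tau_rigid K A M \<longleftrightarrow> factors_through A Q1 f' Q0 M"
    unfolding tau_rigid_def tau using rigid_imp_factors factors_imp_rigid by blast
  also have "\<dots> \<longleftrightarrow> factors_through A P1 f P0 M"
    using factors_through_presentation_indep[OF M p q] factors_through_presentation_indep[OF M q p] by blast
  finally show ?thesis .
qed

section \<open>The radical\<close>

lemma (in fd_rmodule) cyclic_extension:
  assumes N: "rsubmodule A M N" and x: "x \<in> carrier M"
  defines "L \<equiv> {n \<oplus>\<^bsub>M\<^esub> x \<triangleleft>\<^bsub>M\<^esub> a | n a. n \<in> N \<and> a \<in> carrier A}"
  shows "rsubmodule A M L" "N \<subseteq> L" "x \<in> L"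
proof -
  note n = rsubmoduleD[OF N]
  have nc: "n \<in> carrier M" if "n \<in> N" for n using that n(1) by auto
  show NL: "N \<subseteq> L"
  proof
    fix n assume n': "n \<in> N"
    then have "n = n \<oplus>\<^bsub>M\<^esub> x \<triangleleft>\<^bsub>M\<^esub> \<zero>\<^bsub>A\<^esub>" using nc x by (simp add: ract_zero_right)
    then show "n \<in> L" using n' A.M.zero_closed unfolding L_def by blast
  qed
  have "x = \<zero>\<^bsub>M\<^esub> \<oplus>\<^bsub>M\<^esub> x \<triangleleft>\<^bsub>M\<^esub> \<one>\<^bsub>A\<^esub>" using x by (simp add: ract_one)
  then show "x \<in> L" using n(2) A.A.one_closed unfolding L_def by blast
  show "rsubmodule A M L"
    unfolding rsubmodule_def
  proof (intro conjI ballI)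
    show "L \<subseteq> carrier M" using nc x by (auto simp: L_def ract_closed)
    show "\<zero>\<^bsub>M\<^esub> \<in> L" using NL n(2) by auto
    fix u assume "u \<in> L"
    then obtain m a where u: "m \<in> N" "a \<in> carrier A" "u = m \<oplus>\<^bsub>M\<^esub> x \<triangleleft>\<^bsub>M\<^esub> a" unfolding L_def by blast
    { fix v assume "v \<in> L"
      then obtain k b where v: "k \<in> N" "b \<in> carrier A" "v = k \<oplus>\<^bsub>M\<^esub> x \<triangleleft>\<^bsub>M\<^esub> b" unfolding L_def by blast
      have "u \<oplus>\<^bsub>M\<^esub> v = (m \<oplus>\<^bsub>M\<^esub> k) \<oplus>\<^bsub>M\<^esub> x \<triangleleft>\<^bsub>M\<^esub> (a \<oplus>\<^bsub>A\<^esub> b)"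
        using u v nc x by (simp add: ract_add_right ract_closed M.a_ac)
      then show "u \<oplus>\<^bsub>M\<^esub> v \<in> L" using n(3)[OF u(1) v(1)] A.M.a_closed[OF u(2) v(2)] unfolding L_def by blast }
    fix b assume b: "b \<in> carrier A"
    have "u \<triangleleft>\<^bsub>M\<^esub> b = m \<triangleleft>\<^bsub>M\<^esub> b \<oplus>\<^bsub>M\<^esub> x \<triangleleft>\<^bsub>M\<^esub> (a \<otimes>\<^bsub>A\<^esub> b)"
      using u b nc x by (simp add: ract_add_left ract_closed ract_mult)
    then show "u \<triangleleft>\<^bsub>M\<^esub> b \<in> L" using n(4)[OF u(1) b] A.A.m_closed[OF u(2) b] unfolding L_def by blast
  qed
qed

text \<open>If \<open>L\<close> contains some x outside the preimage, maximality gives N + h(x)A =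
  Y. So every y in \<open>M\<close> differs from a multiple of x by an element of the preimage, and
  both lie in \<open>L\<close>.\<close>

lemma (in rmod_hom_pair) maximal_preimage:
  assumes N: "maximal_rsubmodule A Y N" and ne: "\<not> h ` carrier M \<subseteq> N"
  shows "maximal_rsubmodule A M {x \<in> carrier M. h x \<in> N}" (is "maximal_rsubmodule A M ?N'")
proof -
  have Ns: "rsubmodule A Y N" and Nmax: "\<And>L. \<lbrakk>rsubmodule A Y L; N \<subseteq> L\<rbrakk> \<Longrightarrow> L = N \<or> L = carrier Y"
    using N by (auto simp: maximal_rsubmodule_def)
  note n = rsubmoduleD[OF Ns]
  have sub: "rsubmodule A M ?N'"
    using n by (auto simp: rsubmodule_def hom_add hom_ract M.ract_closed)
  have "L = ?N' \<or> L = carrier M" if L: "rsubmodule A M L" "?N' \<subseteq> L" for L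
  proof (cases "L = ?N'")
    case False
    note l = rsubmoduleD[OF L(1)]
    obtain x where x: "x \<in> L" "x \<notin> ?N'" using False L(2) by blast
    then have xM: "x \<in> carrier M" and hx: "h x \<notin> N" using l(1) by auto
    note c = Y.cyclic_extension[OF Ns hom_closed[OF xM]]
    have all: "{n \<oplus>\<^bsub>Y\<^esub> h x \<triangleleft>\<^bsub>Y\<^esub> a | n a. n \<in> N \<and> a \<in> carrier A} = carrier Y"
      using Nmax[OF c(1,2)] c(3) hx by auto
    have "y \<in> L" if y: "y \<in> carrier M" for y
    proof -
      have "h y \<in> carrier Y" using y by simp
      then obtain k a where k: "k \<in> N" "a \<in> carrier A" "h y = k \<oplus>\<^bsub>Y\<^esub> h x \<triangleleft>\<^bsub>Y\<^esub> a"
        unfolding all[symmetric] by blast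
      have kY: "k \<in> carrier Y" using k n(1) by auto
      have xa: "x \<triangleleft>\<^bsub>M\<^esub> a \<in> carrier M" using xM k by (simp add: M.ract_closed)
      have "h (y \<ominus>\<^bsub>M\<^esub> x \<triangleleft>\<^bsub>M\<^esub> a) = k"
        using y xa k kY xM by (simp add: M.M.minus_eq hom_add hom_minus hom_ract Y.M.a_assoc Y.M.r_neg Y.ract_closed)
      then have "y \<ominus>\<^bsub>M\<^esub> x \<triangleleft>\<^bsub>M\<^esub> a \<in> L" using k(1) y xa L(2) by auto
      then have "(y \<ominus>\<^bsub>M\<^esub> x \<triangleleft>\<^bsub>M\<^esub> a) \<oplus>\<^bsub>M\<^esub> x \<triangleleft>\<^bsub>M\<^esub> a \<in> L" using l(3) l(4)[OF x(1) k(2)] by simp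
      then show ?thesis using y xa by (simp add: M.M.minus_eq M.M.a_assoc M.M.l_neg)
    qed
    then show ?thesis using l(1) by auto
  qed simp
  moreover have "?N' \<noteq> carrier M" using ne by auto
  ultimately show ?thesis using sub by (auto simp: maximal_rsubmodule_def)
qed

context fd_algebra
begin

abbreviation "J \<equiv> jacobson_radical A"

lemma regular_fd: "fd_rmodule K A (regular A)"
  by (rule fd_rmodule_regular[OF fd_algebra_axioms])

lemma J_closed: "x \<in> J \<Longrightarrow> x \<in> carrier A"
  by (simp add: jacobson_radical_def)

lemma J_rsubmodule: "rsubmodule A (regular A) J"
  unfolding rsubmodule_def
proof (intro conjI ballI)
  have s: "rsubmodule A (regular A) N" if "maximal_rsubmodule A (regular A) N" for N
    using that by (simp add: maximal_rsubmodule_def)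
  show "J \<subseteq> carrier (regular A)" by (auto simp: jacobson_radical_def)
  show "\<zero>\<^bsub>regular A\<^esub> \<in> J" using rsubmoduleD(2)[OF s] by (simp add: jacobson_radical_def)
  fix x assume x: "x \<in> J"
  show "x \<oplus>\<^bsub>regular A\<^esub> y \<in> J" if "y \<in> J" for y
    using x that rsubmoduleD(3)[OF s] by (simp add: jacobson_radical_def)
  show "x \<triangleleft>\<^bsub>regular A\<^esub> a \<in> J" if "a \<in> carrier A" for a
    using x that rsubmoduleD(4)[OF s] by (simp add: jacobson_radical_def)
qed

lemma zero_in_J: "\<zero>\<^bsub>A\<^esub> \<in> J" and J_add: "\<lbrakk>x \<in> J; y \<in> J\<rbrakk> \<Longrightarrow> x \<oplus>\<^bsub>A\<^esub> y \<in> J"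
  and J_mult_right: "\<lbrakk>x \<in> J; a \<in> carrier A\<rbrakk> \<Longrightarrow> x \<otimes>\<^bsub>A\<^esub> a \<in> J"
  using rsubmoduleD[OF J_rsubmodule] by auto

lemma J_smult: "\<lbrakk>c \<in> carrier K; x \<in> J\<rbrakk> \<Longrightarrow> c \<odot>\<^bsub>A\<^esub> x \<in> J"
  using fd_rmodule.rsubmodule_smult[OF regular_fd J_rsubmodule] by simp

lemma J_uminus: "x \<in> J \<Longrightarrow> \<ominus>\<^bsub>A\<^esub> x \<in> J"
  using J_smult[of "\<ominus>\<^bsub>K\<^esub> \<one>\<^bsub>K\<^esub>" x] J_closed[of x] by (simp add: smult_l_minus)

lemma J_minus: "\<lbrakk>x \<in> J; y \<in> J\<rbrakk> \<Longrightarrow> x \<ominus>\<^bsub>A\<^esub> y \<in> J"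
  by (simp add: M.minus_eq J_add J_uminus)

text \<open>The radical is defined by maximal right ideals, so it is a right ideal by construction.
  Preimages of maximal right ideals under an endomorphism are maximal or everything, so
  endomorphisms preserve it; left multiplications then make it a left ideal.\<close>

lemma hom_regular_J:
  assumes h: "h \<in> rmod_hom A (regular A) (regular A)" and x: "x \<in> J"
  shows "h x \<in> J"
proof -
  interpret h: rmod_hom_pair K A "regular A" "regular A" h
    by (rule rmod_hom_pairI[OF regular_fd regular_fd h])
  have "h x \<in> N" if N: "maximal_rsubmodule A (regular A) N" for N
  proof (cases "h ` carrier (regular A) \<subseteq> N")
    case True
    then show ?thesis using J_closed[OF x] by auto
  next
    case False
    from h.maximal_preimage[OF N this] show ?thesis using x by (auto simp: jacobson_radical_def)
  qed
  then show ?thesis using h.hom_closed[of x] J_closed[OF x] by (auto simp: jacobson_radical_def)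
qed

lemma J_mult_left: "\<lbrakk>a \<in> carrier A; x \<in> J\<rbrakk> \<Longrightarrow> a \<otimes>\<^bsub>A\<^esub> x \<in> J"
  by (rule hom_regular_J[of "\<lambda>x. a \<otimes>\<^bsub>A\<^esub> x"])
    (auto intro!: rmod_homI simp: A.r_distr A.m_assoc)

lemma J_finsum: "\<lbrakk>finite I; f \<in> I \<rightarrow> J\<rbrakk> \<Longrightarrow> finsum A f I \<in> J"
  using fd_rmodule.rsubmodule_finsum[OF regular_fd J_rsubmodule] by simp

text \<open>Otherwise \<open>h x\<close> avoids some maximal right ideal \<open>N\<close>. Its
  preimage \<open>N'\<close> in \<open>P\<close> is maximal, so N' + xA = P; as \<open>f x\<close>
  is zero, already \<open>N'\<close> maps onto \<open>Z\<close>, contradicting superfluity.\<close>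

lemma superfluous_kernel_J:
  assumes c: "projective_cover K A P f Z" and Z: "fd_rmodule K A Z"
    and x: "x \<in> a_kernel P Z f" and h: "h \<in> rmod_hom A P (regular A)"
  shows "h x \<in> J"
proof -
  note p = projective_coverD[OF c]
  interpret h: rmod_hom_pair K A P "regular A" h by (rule rmod_hom_pairI[OF p(1) regular_fd h])
  interpret f: rmod_hom_pair K A P Z f by (rule rmod_hom_pairI[OF p(1) Z p(3)])
  have xP: "x \<in> carrier P" and fx: "f x = \<zero>\<^bsub>Z\<^esub>" using x by (auto simp: mem_a_kernel)
  have "h x \<in> N" if N: "maximal_rsubmodule A (regular A) N" for N
  proof (rule ccontr)
    assume hx: "h x \<notin> N"
    define N' where "N' = {x \<in> carrier P. h x \<in> N}"
    have "maximal_rsubmodule A P N'"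
      unfolding N'_def by (rule h.maximal_preimage[OF N]) (use hx xP in auto)
    then have N's: "rsubmodule A P N'" and N'max: "\<And>L. \<lbrakk>rsubmodule A P L; N' \<subseteq> L\<rbrakk> \<Longrightarrow> L = N' \<or> L = carrier P"
      by (auto simp: maximal_rsubmodule_def)
    have xN': "x \<notin> N'" using hx by (simp add: N'_def)
    note e = h.M.cyclic_extension[OF N's xP]
    have all: "{n \<oplus>\<^bsub>P\<^esub> x \<triangleleft>\<^bsub>P\<^esub> a | n a. n \<in> N' \<and> a \<in> carrier A} = carrier P"
      using N'max[OF e(1,2)] e(3) xN' by auto
    have "f ` N' = carrier Z"
    proof (intro equalityI subsetI)
      fix z assume "z \<in> carrier Z"
      then obtain y where y: "y \<in> carrier P" "z = f y" using p(4) by auto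
      then obtain n a where n: "n \<in> N'" "a \<in> carrier A" "y = n \<oplus>\<^bsub>P\<^esub> x \<triangleleft>\<^bsub>P\<^esub> a" using all by blast
      have "n \<in> carrier P" using n by (simp add: N'_def)
      then have "z = f n" using y n xP fx by (simp add: f.hom_add f.hom_ract h.M.ract_closed f.Y.ract_zero_left)
      then show "z \<in> f ` N'" using n by blast
    qed (auto simp: N'_def)
    then have "N' = carrier P" by (rule projective_cover_submodule[OF c Z N's])
    then show False using xN' xP by simp
  qed
  then show ?thesis using h.hom_closed[OF xP] by (auto simp: jacobson_radical_def)
qed

end

section \<open>The submodule MJ\<close>

context fd_rmodule
begin

abbreviation "MJ \<equiv> ideal_action M (jacobson_radical A)"

lemma MJ_subset: "x \<in> MJ \<Longrightarrow> x \<in> carrier M"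
  by (induct x rule: ideal_action.induct) (auto simp: ract_closed A.J_closed)

lemma MJ_rsubmodule: "rsubmodule A M MJ"
  unfolding rsubmodule_def
proof (intro conjI ballI subsetI)
  show "\<zero>\<^bsub>M\<^esub> \<in> MJ"
  proof -
    have "\<zero>\<^bsub>M\<^esub> \<triangleleft>\<^bsub>M\<^esub> \<zero>\<^bsub>A\<^esub> \<in> MJ" by (rule ideal_action.prod) (simp_all add: A.zero_in_J)
    then show ?thesis by (simp add: ract_zero_right)
  qed
  fix x a assume "x \<in> MJ" and a: "a \<in> carrier A"
  then show "x \<triangleleft>\<^bsub>M\<^esub> a \<in> MJ"
  proof (induct x rule: ideal_action.induct)
    case (prod x j)
    then have "(x \<triangleleft>\<^bsub>M\<^esub> j) \<triangleleft>\<^bsub>M\<^esub> a = x \<triangleleft>\<^bsub>M\<^esub> (j \<otimes>\<^bsub>A\<^esub> a)" using a A.J_closed by (simp add: ract_mult)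
    then show ?case using prod a A.J_mult_right by (auto intro: ideal_action.prod)
  next
    case (sum x y)
    then show ?case using a MJ_subset by (auto simp: ract_add_left intro: ideal_action.sum)
  qed
qed (auto simp: MJ_subset intro: ideal_action.sum)

text \<open>Together with \<open>hom_to_regular_J\<close> this tests membership in P J on the
  coordinates of a projective module P.\<close>

lemma dual_basis_MJ:
  assumes db: "dual_basis A M n p h" and x: "x \<in> carrier M" and h: "\<And>i. i < n \<Longrightarrow> h i x \<in> A.J"
  shows "x \<in> MJ"
proof -
  note d = dual_basisD[OF db]
  have "finsum M (\<lambda>i. p i \<triangleleft>\<^bsub>M\<^esub> h i x) {..<n} \<in> MJ"
    by (rule rsubmodule_finsum[OF MJ_rsubmodule]) (use d h in \<open>auto intro: ideal_action.prod\<close>)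
  then show ?thesis using d(4)[OF x] by simp
qed

end

lemma (in rmod_hom_pair) hom_MJ: "x \<in> M.MJ \<Longrightarrow> h x \<in> Y.MJ"
proof (induct x rule: ideal_action.induct)
  case (prod x a)
  then show ?case using M.A.J_closed by (auto simp: hom_ract intro: ideal_action.prod)
next
  case (sum x y)
  then show ?case using M.MJ_subset by (auto simp: hom_add intro: ideal_action.sum)
qed

lemma (in rmod_hom_pair) surj_MJ:
  assumes surj: "h ` carrier M = carrier Y" and "y \<in> Y.MJ"
  shows "\<exists>x\<in>M.MJ. h x = y"
  using assms(2)
proof (induct y rule: ideal_action.induct)
  case (prod y a)
  then obtain x where x: "x \<in> carrier M" "y = h x" using surj by auto
  then show ?case
    using prod M.A.J_closed by (intro bexI[of _ "x \<triangleleft>\<^bsub>M\<^esub> a"]) (auto simp: hom_ract intro: ideal_action.prod)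
next
  case (sum y y')
  then obtain x x' where "x \<in> M.MJ" "x' \<in> M.MJ" "y = h x" "y' = h x'" by blast
  then show ?case
    using M.MJ_subset by (intro bexI[of _ "x \<oplus>\<^bsub>M\<^esub> x'"]) (auto simp: hom_add intro: ideal_action.sum)
qed

lemma hom_to_regular_J:
  assumes P: "fd_rmodule K A P" and h: "h \<in> rmod_hom A P (regular A)" and x: "x \<in> ideal_action P (jacobson_radical A)"
  shows "h x \<in> jacobson_radical A"
proof -
  interpret P: fd_rmodule K A P by fact
  show ?thesis using x
  proof (induct x rule: ideal_action.induct)
    case (prod x a)
    then show ?case
      using P.A.J_mult_left rmod_hom_closed[OF h] P.A.J_closed rmod_hom_ract[OF h] by fastforce
  next
    case (sum x y)
    then show ?case using rmod_hom_add[OF h] P.MJ_subset P.A.J_add by simp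
  qed
qed

text \<open>All linear forms send a kernel element into \<open>J\<close>, in particular those of a
  dual basis; its expansion then lies in P J.\<close>

lemma superfluous_kernel_PJ:
  assumes c: "projective_cover K A P f Z" and Z: "fd_rmodule K A Z" and x: "x \<in> a_kernel P Z f"
  shows "x \<in> ideal_action P (jacobson_radical A)"
proof -
  note p = projective_coverD[OF c]
  interpret P: fd_rmodule K A P by (rule p(1))
  obtain n q h where db: "dual_basis A P n q h" using p(1,2) projective_iff_dual_basis by blast
  show ?thesis
    by (rule P.dual_basis_MJ[OF db])
      (use x P.A.superfluous_kernel_J[OF c Z x] dual_basisD(2)[OF db] in \<open>auto simp: mem_a_kernel\<close>)
qed

text \<open>A radical square zero algebra whose semisimple quotient is a product of copies of \<open>K\<close>, with
  primitive idempotents \<open>e\<^sub>v\<close>.\<close>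

locale split_algebra = fd_algebra K A
  for K :: "('k, 'r) ring_scheme" and A :: "('k, 'a) module" +
  fixes e :: "'v \<Rightarrow> 'a" and V :: "'v set"
  assumes J_square: "\<lbrakk>x \<in> J; y \<in> J\<rbrakk> \<Longrightarrow> x \<otimes>\<^bsub>A\<^esub> y = \<zero>\<^bsub>A\<^esub>"
    and fin_V: "finite V"
    and e_closed: "v \<in> V \<Longrightarrow> e v \<in> carrier A"
    and e_idem: "v \<in> V \<Longrightarrow> e v \<otimes>\<^bsub>A\<^esub> e v = e v"
    and e_orth: "\<lbrakk>v \<in> V; w \<in> V; v \<noteq> w\<rbrakk> \<Longrightarrow> e v \<otimes>\<^bsub>A\<^esub> e w = \<zero>\<^bsub>A\<^esub>"
    and e_nonzero: "v \<in> V \<Longrightarrow> e v \<noteq> \<zero>\<^bsub>A\<^esub>"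
    and e_sum: "finsum A e V = \<one>\<^bsub>A\<^esub>"
    and off_diag: "\<lbrakk>v \<in> V; w \<in> V; v \<noteq> w; a \<in> carrier A\<rbrakk> \<Longrightarrow> e v \<otimes>\<^bsub>A\<^esub> a \<otimes>\<^bsub>A\<^esub> e w \<in> J"
    and diag: "\<lbrakk>v \<in> V; a \<in> carrier A\<rbrakk> \<Longrightarrow>
      \<exists>c\<in>carrier K. e v \<otimes>\<^bsub>A\<^esub> a \<otimes>\<^bsub>A\<^esub> e v \<ominus>\<^bsub>A\<^esub> c \<odot>\<^bsub>A\<^esub> e v \<in> J"
begin

text \<open>The components e_w a with w different from v lie in \<open>J\<close>, so e_v a does not,
  and it equals l e_v + j with l nonzero and j in \<open>J\<close>. Such an element is invertible in
  the corner of e_v.\<close>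

lemma left_inverse_mod_radical:
  assumes a: "a \<in> carrier A" and v: "v \<in> V" and ae: "a \<otimes>\<^bsub>A\<^esub> e v = a" and aJ: "a \<notin> J"
  shows "\<exists>c\<in>carrier A. c \<otimes>\<^bsub>A\<^esub> a = e v"
proof -
  note ev = e_closed[OF v]
  have "a = finsum A e V \<otimes>\<^bsub>A\<^esub> a" using a by (simp add: e_sum)
  also have "\<dots> = finsum A (\<lambda>w. e w \<otimes>\<^bsub>A\<^esub> a) V"
    using a e_closed by (intro A.finsum_ldistr fin_V) auto
  finally have a_sum: "finsum A (\<lambda>w. e w \<otimes>\<^bsub>A\<^esub> a) V = a" by simp
  define b where "b = e v \<otimes>\<^bsub>A\<^esub> a"
  have bc: "b \<in> carrier A" using a ev by (simp add: b_def)
  have bJ: "b \<notin> J"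
  proof
    assume "b \<in> J"
    have "e w \<otimes>\<^bsub>A\<^esub> a \<in> J" if w: "w \<in> V" for w
    proof (cases "w = v")
      case False
      have "e w \<otimes>\<^bsub>A\<^esub> a \<otimes>\<^bsub>A\<^esub> e v \<in> J" by (rule off_diag[OF w v False a])
      then show ?thesis using a ae e_closed[OF w] ev by (simp add: A.m_assoc)
    qed (use \<open>b \<in> J\<close> in \<open>simp add: b_def\<close>)
    then have "finsum A (\<lambda>w. e w \<otimes>\<^bsub>A\<^esub> a) V \<in> J" by (intro J_finsum fin_V) auto
    then show False using a_sum aJ by simp
  qed
  have eb: "e v \<otimes>\<^bsub>A\<^esub> b = b" using a ev e_idem[OF v] by (simp add: b_def A.m_assoc[symmetric])
  have be: "b \<otimes>\<^bsub>A\<^esub> e v = b" using a ev ae by (simp add: b_def A.m_assoc)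
  obtain l where l: "l \<in> carrier K" "e v \<otimes>\<^bsub>A\<^esub> a \<otimes>\<^bsub>A\<^esub> e v \<ominus>\<^bsub>A\<^esub> l \<odot>\<^bsub>A\<^esub> e v \<in> J"
    using diag[OF v a] by blast
  define j where "j = b \<ominus>\<^bsub>A\<^esub> l \<odot>\<^bsub>A\<^esub> e v"
  have jJ: "j \<in> J" using l be by (simp add: j_def b_def)
  have jc: "j \<in> carrier A" by (rule J_closed[OF jJ])
  have lev: "l \<odot>\<^bsub>A\<^esub> e v \<in> carrier A" using l ev by simp
  have bj: "b = j \<oplus>\<^bsub>A\<^esub> l \<odot>\<^bsub>A\<^esub> e v" using bc lev by (simp add: j_def M.minus_eq M.a_assoc M.l_neg)
  have l0: "l \<noteq> \<zero>\<^bsub>K\<^esub>" using bJ jJ bj jc ev by auto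
  define m where "m = inv\<^bsub>K\<^esub> l"
  have m: "m \<in> carrier K" "m \<otimes>\<^bsub>K\<^esub> l = \<one>\<^bsub>K\<^esub>"
    using l l0 field_Units R.Units_inv_closed R.Units_l_inv by (auto simp: m_def)
  have jb: "j \<otimes>\<^bsub>A\<^esub> b = l \<odot>\<^bsub>A\<^esub> j"
  proof -
    have "j \<otimes>\<^bsub>A\<^esub> e v = b \<otimes>\<^bsub>A\<^esub> e v \<ominus>\<^bsub>A\<^esub> (l \<odot>\<^bsub>A\<^esub> e v) \<otimes>\<^bsub>A\<^esub> e v"
      unfolding j_def M.minus_eq using bc lev ev by (simp add: A.l_distr A.l_minus)
    then have je: "j \<otimes>\<^bsub>A\<^esub> e v = j" using be ev l e_idem[OF v] by (simp add: smult_mult_left j_def)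
    have "j \<otimes>\<^bsub>A\<^esub> b = j \<otimes>\<^bsub>A\<^esub> j \<oplus>\<^bsub>A\<^esub> l \<odot>\<^bsub>A\<^esub> (j \<otimes>\<^bsub>A\<^esub> e v)"
      using jc lev ev l by (subst bj) (simp add: A.r_distr smult_mult_right)
    then show ?thesis using je J_square[OF jJ jJ] jc l by simp
  qed
  \<comment> \<open>The inverse of l e_v + j. The geometric series e_v/l - j/l^2 ends after its
    linear term because j^2 = 0; \<open>m\<close> is the inverse of \<open>l\<close>.\<close>
  define c where "c = m \<odot>\<^bsub>A\<^esub> e v \<ominus>\<^bsub>A\<^esub> (m \<otimes>\<^bsub>K\<^esub> m) \<odot>\<^bsub>A\<^esub> j"
  have cc: "c \<in> carrier A" using m ev jc by (simp add: c_def)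
  have "c \<otimes>\<^bsub>A\<^esub> b = m \<odot>\<^bsub>A\<^esub> (e v \<otimes>\<^bsub>A\<^esub> b) \<ominus>\<^bsub>A\<^esub> (m \<otimes>\<^bsub>K\<^esub> m) \<odot>\<^bsub>A\<^esub> (j \<otimes>\<^bsub>A\<^esub> b)"
    unfolding c_def M.minus_eq using m ev jc bc by (simp add: A.l_distr A.l_minus smult_mult_left)
  also have "\<dots> = m \<odot>\<^bsub>A\<^esub> b \<ominus>\<^bsub>A\<^esub> ((m \<otimes>\<^bsub>K\<^esub> m) \<otimes>\<^bsub>K\<^esub> l) \<odot>\<^bsub>A\<^esub> j"
    using m l jc by (simp add: eb jb smult_assoc1)
  also have "(m \<otimes>\<^bsub>K\<^esub> m) \<otimes>\<^bsub>K\<^esub> l = m" using m l by (simp add: R.m_assoc)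
  also have "m \<odot>\<^bsub>A\<^esub> b = m \<odot>\<^bsub>A\<^esub> j \<oplus>\<^bsub>A\<^esub> e v"
    using m l jc lev ev by (subst bj) (simp add: smult_r_distr smult_assoc1[symmetric])
  finally have "c \<otimes>\<^bsub>A\<^esub> b = e v" using m jc ev by (simp add: M.minus_eq M.a_ac M.r_neg M.r_neg2 M.r_neg1)
  then have "(c \<otimes>\<^bsub>A\<^esub> e v) \<otimes>\<^bsub>A\<^esub> a = e v" using cc ev a by (simp add: A.m_assoc b_def)
  then show ?thesis using cc ev by blast
qed

end

section \<open>Rigidity over split algebras with radical square zero\<close>

context split_algebra
begin

lemma MJ_J_zero:
  assumes M: "fd_rmodule K A M" and x: "x \<in> ideal_action M J" and a: "a \<in> J"
  shows "x \<triangleleft>\<^bsub>M\<^esub> a = \<zero>\<^bsub>M\<^esub>"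
proof -
  interpret M: fd_rmodule K A M by fact
  show ?thesis using x
  proof (induct x rule: ideal_action.induct)
    case (prod x j)
    then show ?case using a J_closed by (simp add: M.ract_mult[symmetric] J_square M.ract_zero_right)
  next
    case (sum x y)
    then show ?case using a J_closed M.MJ_subset by (simp add: M.ract_add_left)
  qed
qed

text \<open>The second condition is the \<open>\<tau>\<close>-rigidity of the triplet \<open>F M\<close>, expressed through homomorphisms
  of \<open>A\<close>-modules.\<close>

theorem factors_through_iff:
  fixes P0 :: "('k, 'a, 'p) rmodule" and P1 :: "('k, 'a, 'q) rmodule"
  assumes M: "fd_rmodule K A M" and p: "minimal_presentation K A P1 f P0 g M"
  defines "Z \<equiv> a_kernel P0 M g"
  shows "factors_through A P1 f P0 M \<longleftrightarrow>
    (\<forall>w\<in>rmod_hom A (P0\<lparr>carrier := Z\<rparr>) M. w ` Z \<subseteq> ideal_action M J \<longrightarrow>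
      (\<exists>v\<in>rmod_hom A P0 M. \<forall>z\<in>Z. w z = v z)) \<and>
    add_inter_trivial K A P0 P1" (is "?F \<longleftrightarrow> ?E \<and> ?T")
proof -
  note d = minimal_presentationD[OF p]
  interpret g: rmod_hom_pair K A P0 M g by (rule rmod_hom_pairI[OF d(3) M d(7)])
  interpret f: rmod_hom_pair K A P1 P0 f by (rule rmod_hom_pairI[OF d(4,3,9)])
  have Zs: "rsubmodule A P0 Z" unfolding Z_def by (rule g.kernel_rsubmodule)
  have Zf: "fd_rmodule K A (P0\<lparr>carrier := Z\<rparr>)" by (rule g.M.fd_rmodule_submodule[OF Zs])
  have fZ: "f ` carrier P1 = Z" using d(10) by (simp add: Z_def)
  have fZ': "f x \<in> Z" if "x \<in> carrier P1" for x using fZ that by blast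
  have ZJ: "z \<in> ideal_action P0 J" if "z \<in> Z" for z
    by (rule superfluous_kernel_PJ[OF d(1) M]) (use that in \<open>simp add: Z_def\<close>)
  have kerf: "x \<in> ideal_action P1 J" if "x \<in> carrier P1" "f x = \<zero>\<^bsub>P0\<^esub>" for x
    by (rule superfluous_kernel_PJ[OF d(2)[folded Z_def] Zf]) (use that in \<open>simp add: mem_a_kernel\<close>)
  have FE: ?E if F: ?F
  proof (intro ballI impI)
    fix w assume w: "w \<in> rmod_hom A (P0\<lparr>carrier := Z\<rparr>) M"
    have "(\<lambda>x. w (f x)) \<in> rmod_hom A P1 M"
      by (rule rmod_homI) (use rmod_hom_closed[OF w] rmod_hom_add[OF w] rmod_hom_ract[OF w] fZ'
          in \<open>auto simp: f.hom_add f.hom_ract\<close>)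
    then obtain v where v: "v \<in> rmod_hom A P0 M" "\<forall>x\<in>carrier P1. w (f x) = v (f x)"
      using bspec[OF F[unfolded factors_through_def]] by blast
    then show "\<exists>v\<in>rmod_hom A P0 M. \<forall>z\<in>Z. w z = v z" using fZ by blast
  qed
  have FT: ?T if F: ?F
    unfolding add_inter_trivial_def
  proof (intro allI impI, elim conjE)
    \<comment> \<open>Every map P1 -> P0 is radical: g o u = v o f takes values in M J, because
      \<open>f\<close> maps into \<open>Z\<close>, which lies in P0 J. Lifting back along
      \<open>g\<close> costs an element of \<open>Z\<close>, again in P0 J.\<close>
    have u_rad: "u x \<in> ideal_action P0 J" if u: "u \<in> rmod_hom A P1 P0" and x: "x \<in> carrier P1" for u x
    proof -
      obtain v where v: "v \<in> rmod_hom A P0 M" "\<forall>x\<in>carrier P1. g (u x) = v (f x)"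
        using bspec[OF F[unfolded factors_through_def] rmod_hom_compose[OF u d(7)]] by blast
      interpret v: rmod_hom_pair K A P0 M v by (rule rmod_hom_pairI[OF d(3) M v(1)])
      have "g (u x) \<in> ideal_action M J" using v(2) x v.hom_MJ[OF ZJ[OF fZ'[OF x]]] by simp
      then obtain y where y: "y \<in> ideal_action P0 J" "g y = g (u x)" using g.surj_MJ[OF d(8)] by blast
      have yc: "y \<in> carrier P0" and uc: "u x \<in> carrier P0"
        using g.M.MJ_subset[OF y(1)] rmod_hom_closed[OF u x] by auto
      have "u x \<ominus>\<^bsub>P0\<^esub> y \<in> Z"
        using y(2) yc uc by (simp add: Z_def mem_a_kernel g.M.M.minus_eq g.hom_add g.hom_minus g.Y.M.r_neg)
      then have "(u x \<ominus>\<^bsub>P0\<^esub> y) \<oplus>\<^bsub>P0\<^esub> y \<in> ideal_action P0 J" using ZJ y(1) by (blast intro: ideal_action.sum)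
      then show ?thesis using yc uc by (simp add: g.M.M.minus_eq g.M.M.a_assoc g.M.M.l_neg)
    qed
    fix N :: "('k, 'a, nat \<Rightarrow> 'p) rmodule"
    assume N: "fd_rmodule K A N" "in_add A P0 N" "in_add A P1 N"
    interpret N: fd_rmodule K A N by (rule N(1))
    obtain m s0 r0 where s0: "s0 \<in> rmod_hom A N (rmod_power P0 m)" and r0: "r0 \<in> rmod_hom A (rmod_power P0 m) N"
      and rs0: "\<And>x. x \<in> carrier N \<Longrightarrow> r0 (s0 x) = x" using N(2) by (auto simp: in_add_def)
    obtain n s1 r1 where s1: "s1 \<in> rmod_hom A N (rmod_power P1 n)" and r1: "r1 \<in> rmod_hom A (rmod_power P1 n) N"
      and rs1: "\<And>x. x \<in> carrier N \<Longrightarrow> r1 (s1 x) = x" using N(3) by (auto simp: in_add_def)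
    \<comment> \<open>The identity of \<open>N\<close> factors through a power of \<open>P1\<close>,
      and \<open>s0\<close> continues to a power of \<open>P0\<close>. The composite between the
      powers has components P1 -> P0, which are all radical.\<close>
    have comp: "s0 x j \<in> ideal_action P0 J" if x: "x \<in> carrier N" and j: "j < m" for x j
    proof -
      let ?u = "\<lambda>y. s0 (r1 y) j"
      have u: "?u \<in> rmod_hom A (rmod_power P1 n) P0"
        by (rule rmod_hom_compose[OF rmod_hom_compose[OF r1 s0] power_proj_hom[OF j]])
      have sx: "s1 x \<in> {..<n} \<rightarrow>\<^sub>E carrier P1" using rmod_hom_closed[OF s1 x] by simp
      have "?u (s1 x) = finsum P0 (\<lambda>i. ?u (\<lambda>j\<in>{..<n}. if j = i then s1 x i else \<zero>\<^bsub>P1\<^esub>)) {..<n}"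
        by (rule power_hom_sum[OF d(4,3) u sx])
      also have "\<dots> \<in> ideal_action P0 J"
      proof (rule g.M.rsubmodule_finsum[OF g.M.MJ_rsubmodule])
        show "(\<lambda>i. ?u (\<lambda>j\<in>{..<n}. if j = i then s1 x i else \<zero>\<^bsub>P1\<^esub>)) \<in> {..<n} \<rightarrow> ideal_action P0 J"
        proof
          fix i assume "i \<in> {..<n}"
          then have i: "i < n" by simp
          show "?u (\<lambda>j\<in>{..<n}. if j = i then s1 x i else \<zero>\<^bsub>P1\<^esub>) \<in> ideal_action P0 J"
            by (rule u_rad[OF rmod_hom_compose[OF power_inj_hom[OF d(4) i] u]]) (use sx i in auto)
        qed
      qed simp
      finally show ?thesis using rs1[OF x] by simp
    qed
    have rad: "x \<in> ideal_action N J" if x: "x \<in> carrier N" for x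
    proof -
      have sx: "s0 x \<in> {..<m} \<rightarrow>\<^sub>E carrier P0" using rmod_hom_closed[OF s0 x] by simp
      have "r0 (s0 x) = finsum N (\<lambda>i. r0 (\<lambda>j\<in>{..<m}. if j = i then s0 x i else \<zero>\<^bsub>P0\<^esub>)) {..<m}"
        by (rule power_hom_sum[OF d(3) N(1) r0 sx])
      also have "\<dots> \<in> ideal_action N J"
      proof (rule N.rsubmodule_finsum[OF N.MJ_rsubmodule])
        show "(\<lambda>i. r0 (\<lambda>j\<in>{..<m}. if j = i then s0 x i else \<zero>\<^bsub>P0\<^esub>)) \<in> {..<m} \<rightarrow> ideal_action N J"
        proof
          fix i assume "i \<in> {..<m}"
          then have i: "i < m" by simp
          interpret c: rmod_hom_pair K A P0 N "\<lambda>y. r0 (\<lambda>j\<in>{..<m}. if j = i then y else \<zero>\<^bsub>P0\<^esub>)"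
            by (rule rmod_hom_pairI[OF d(3) N(1) rmod_hom_compose[OF power_inj_hom[OF d(3) i] r0]])
          show "r0 (\<lambda>j\<in>{..<m}. if j = i then s0 x i else \<zero>\<^bsub>P0\<^esub>) \<in> ideal_action N J"
            by (rule c.hom_MJ[OF comp[OF x i]])
        qed
      qed simp
      finally show ?thesis using rs0[OF x] by simp
    qed
    \<comment> \<open>At this point N = N J, and N J = (N J) J = 0 because J^2 = 0.\<close>
    have "x = \<zero>\<^bsub>N\<^esub>" if "x \<in> carrier N" for x
      using rad[OF that]
    proof (induct x rule: ideal_action.induct)
      case (prod x a)
      then show ?case using MJ_J_zero[OF N(1) rad] by simp
    next
      case (sum x y)
      then show ?case using N.M.zero_closed by simp
    qed
    then show "carrier N = {\<zero>\<^bsub>N\<^esub>}" using N.M.zero_closed by blast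
  qed
  have ETF: ?F if E: ?E and T: ?T
    unfolding factors_through_def
  proof
    fix u assume u: "u \<in> rmod_hom A P1 M"
    interpret u: rmod_hom_pair K A P1 M u by (rule rmod_hom_pairI[OF d(4) M u])
    \<comment> \<open>A map \<open>u\<close> that leaves M J yields elements y of \<open>P1\<close>
      and q = u'(y) of \<open>P0\<close> such that qA is a copy of some e_v A and a summand of both
      modules. This contradicts the condition on add.\<close>
    have uJ: "u x \<in> ideal_action M J" if "x \<in> carrier P1" for x
    proof (rule ccontr)
      assume ux: "u x \<notin> ideal_action M J"
      obtain u' where u': "u' \<in> rmod_hom A P1 P0" "\<And>x. x \<in> carrier P1 \<Longrightarrow> g (u' x) = u x"
        using projective_lift[OF d(4,6,3) M d(7) u] d(8) u.hom_closed by blast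
      interpret u': rmod_hom_pair K A P1 P0 u' by (rule rmod_hom_pairI[OF d(4,3) u'(1)])
      \<comment> \<open>x is the sum of its multiples x e_v, so one of these still leaves M J and
        may replace x.\<close>
      have "\<exists>v\<in>V. u (x \<triangleleft>\<^bsub>P1\<^esub> e v) \<notin> ideal_action M J"
      proof (rule ccontr)
        assume "\<not> (\<exists>v\<in>V. u (x \<triangleleft>\<^bsub>P1\<^esub> e v) \<notin> ideal_action M J)"
        then have *: "(\<lambda>v. u (x \<triangleleft>\<^bsub>P1\<^esub> e v)) \<in> V \<rightarrow> ideal_action M J" by blast
        have ev: "e \<in> V \<rightarrow> carrier A" using e_closed by blast
        have "x = x \<triangleleft>\<^bsub>P1\<^esub> finsum A e V" using that by (simp add: e_sum f.M.ract_one)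
        also have "\<dots> = finsum P1 (\<lambda>v. x \<triangleleft>\<^bsub>P1\<^esub> e v) V" by (rule f.M.ract_finsum[OF fin_V ev that])
        finally have "u x = u (finsum P1 (\<lambda>v. x \<triangleleft>\<^bsub>P1\<^esub> e v) V)" by simp
        also have "\<dots> = finsum M (\<lambda>v. u (x \<triangleleft>\<^bsub>P1\<^esub> e v)) V"
          by (rule u.hom_finsum[OF fin_V]) (use that ev in \<open>auto intro: f.M.ract_closed\<close>)
        finally show False using ux g.Y.rsubmodule_finsum[OF g.Y.MJ_rsubmodule fin_V *] by simp
      qed
      then obtain v where v: "v \<in> V" and uv: "u (x \<triangleleft>\<^bsub>P1\<^esub> e v) \<notin> ideal_action M J" by blast
      note ev = e_closed[OF v]
      define y where "y = x \<triangleleft>\<^bsub>P1\<^esub> e v"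
      have y: "y \<in> carrier P1" using that ev by (simp add: y_def f.M.ract_closed)
      have ye: "y \<triangleleft>\<^bsub>P1\<^esub> e v = y" using that ev by (simp add: y_def f.M.ract_mult[symmetric] e_idem[OF v])
      define q where "q = u' y"
      have q: "q \<in> carrier P0" using y by (simp add: q_def)
      have qe: "q \<triangleleft>\<^bsub>P0\<^esub> e v = q" using u'.hom_ract[OF y ev] ye by (simp add: q_def)
      have qJ: "q \<notin> ideal_action P0 J" using g.hom_MJ[of q] u'(2)[OF y] uv by (auto simp: q_def y_def)
      obtain n b h where db: "dual_basis A P0 n b h" using d(3,5) projective_iff_dual_basis by blast
      obtain i where i: "i < n" and hq: "h i q \<notin> J" using g.M.dual_basis_MJ[OF db q] qJ by blast
      note hi = dual_basisD(2)[OF db i]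
      have hqc: "h i q \<in> carrier A" using rmod_hom_closed[OF hi q] by simp
      have "h i q \<otimes>\<^bsub>A\<^esub> e v = h i q" using rmod_hom_ract[OF hi q ev] qe by simp
      then obtain c where c: "c \<in> carrier A" "c \<otimes>\<^bsub>A\<^esub> h i q = e v"
        using left_inverse_mod_radical[OF hqc v _ hq] by blast
      \<comment> \<open>The linear form \<open>t\<close> sends q to e_v, so that x -> q t(x) is a
        retraction of \<open>P0\<close> onto qA.\<close>
      define t where "t x = e v \<otimes>\<^bsub>A\<^esub> (c \<otimes>\<^bsub>A\<^esub> h i x)" for x
      have t: "t \<in> rmod_hom A P0 (regular A)"
        using rmod_hom_closed[OF hi] c(1) ev
        by (intro rmod_homI) (auto simp: t_def rmod_hom_add[OF hi] rmod_hom_ract[OF hi] A.r_distr A.m_assoc)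
      have tc: "t x \<in> carrier A" if "x \<in> carrier P0" for x using rmod_hom_closed[OF t that] by simp
      have tq: "t q = e v" using c ev by (simp add: t_def e_idem[OF v])
      have et: "e v \<otimes>\<^bsub>A\<^esub> t x = t x" if "x \<in> carrier P0" for x
        using rmod_hom_closed[OF hi that] c(1) ev by (simp add: t_def A.m_assoc[symmetric] e_idem[OF v])
      define N where "N = (\<lambda>a. q \<triangleleft>\<^bsub>P0\<^esub> a) ` carrier A"
      have Ns: "rsubmodule A P0 N"
      proof -
        have l: "(\<lambda>a. q \<triangleleft>\<^bsub>P0\<^esub> a) \<in> rmod_hom A (regular A) P0"
          using q by (intro rmod_homI) (auto simp: g.M.ract_closed g.M.ract_add_right g.M.ract_mult)
        interpret l: rmod_hom_pair K A "regular A" P0 "\<lambda>a. q \<triangleleft>\<^bsub>P0\<^esub> a"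
          by (rule rmod_hom_pairI[OF regular_fd d(3) l])
        show ?thesis using l.image_rsubmodule by (simp add: N_def)
      qed
      let ?N = "P0\<lparr>carrier := N\<rparr>"
      have Nf: "fd_rmodule K A ?N" by (rule g.M.fd_rmodule_submodule[OF Ns])
      have NP: "x \<in> carrier P0" if "x \<in> N" for x using that rsubmoduleD(1)[OF Ns] by auto
      have inc: "(\<lambda>x. x) \<in> rmod_hom A ?N P0" by (rule rmod_homI) (auto simp: NP)
      have qt: "(\<lambda>x. q \<triangleleft>\<^bsub>P0\<^esub> t x) \<in> rmod_hom A P0 ?N"
        using q tc rmod_hom_add[OF t] rmod_hom_ract[OF t]
        by (intro rmod_homI) (auto simp: N_def g.M.ract_add_right g.M.ract_mult)
      have qtN: "q \<triangleleft>\<^bsub>P0\<^esub> t x = x" if x: "x \<in> N" for x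
      proof -
        obtain a where a: "a \<in> carrier A" "x = q \<triangleleft>\<^bsub>P0\<^esub> a" using x by (auto simp: N_def)
        then show ?thesis using rmod_hom_ract[OF t q a(1)] tq q ev by (simp add: g.M.ract_mult qe)
      qed
      have in0: "in_add A P0 ?N"
        by (rule in_add_trans_retract[OF in_add_self[OF d(3)] inc qt]) (simp add: qtN)
      \<comment> \<open>qA is also a summand of \<open>P1\<close>: the element qa goes to y t(qa),
        and the retraction is \<open>u'\<close> followed by x -> q t(x), because u'(y) = q.\<close>
      have yt: "(\<lambda>x. y \<triangleleft>\<^bsub>P1\<^esub> t x) \<in> rmod_hom A ?N P1"
        using y tc rmod_hom_add[OF t] rmod_hom_ract[OF t] NP
        by (intro rmod_homI) (auto simp: f.M.ract_add_right f.M.ract_mult f.M.ract_closed)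
      have in1: "in_add A P1 ?N"
      proof (rule in_add_trans_retract[OF in_add_self[OF d(4)] yt rmod_hom_compose[OF u'(1) qt]])
        fix x assume "x \<in> carrier ?N"
        then have x: "x \<in> N" by simp
        have "u' (y \<triangleleft>\<^bsub>P1\<^esub> t x) = q \<triangleleft>\<^bsub>P0\<^esub> t x" using y tc[OF NP[OF x]] by (simp add: u'.hom_ract q_def)
        then show "q \<triangleleft>\<^bsub>P0\<^esub> t (u' (y \<triangleleft>\<^bsub>P1\<^esub> t x)) = x" using qtN[OF x] by simp
      qed
      \<comment> \<open>\<open>add_inter_trivial\<close> ranges over modules with elements in one
        fixed type, so the common summand is moved there.\<close>
      obtain N' :: "('k, 'a, nat \<Rightarrow> 'p) rmodule" and \<sigma> where N': "fd_rmodule K A N'"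
        "\<sigma> \<in> rmod_hom A ?N N'" "bij_betw \<sigma> (carrier ?N) (carrier N')"
        using add_embeds_in_power[OF Nf in0] by blast
      have ret: "\<sigma> (inv_into (carrier ?N) \<sigma> x) = x" if "x \<in> carrier N'" for x
        by (rule bij_betw_inv_into_right[OF N'(3) that])
      note iv = inv_rmod_hom[OF Nf N'(2,3)]
      have "carrier N' = {\<zero>\<^bsub>N'\<^esub>}"
        using T N'(1) in_add_trans_retract[OF in0 iv N'(2) ret] in_add_trans_retract[OF in1 iv N'(2) ret]
        unfolding add_inter_trivial_def by blast
      then have "card (carrier ?N) = 1" using bij_betw_same_card[OF N'(3)] by simp
      moreover have "\<zero>\<^bsub>P0\<^esub> \<in> N" "q \<in> N"
        using rsubmoduleD(2)[OF Ns] qe ev by (auto simp: N_def image_iff intro!: bexI[of _ "e v"])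
      ultimately have "q = \<zero>\<^bsub>P0\<^esub>" by (auto simp: card_1_singleton_iff)
      then show False using qJ rsubmoduleD(2)[OF g.M.MJ_rsubmodule] by simp
    qed
    \<comment> \<open>u(P1 J) lies in (M J) J = 0. As the kernel of \<open>f\<close> is contained in
      P1 J, \<open>u\<close> descends along \<open>f\<close> to a map \<open>w\<close> on
      \<open>Z\<close>.\<close>
    have uker: "u x = \<zero>\<^bsub>M\<^esub>" if "x \<in> ideal_action P1 J" for x
      using that
    proof (induct x rule: ideal_action.induct)
      case (prod x a)
      then show ?case using J_closed MJ_J_zero[OF M uJ] by (simp add: u.hom_ract)
    next
      case (sum x y)
      then show ?case using f.M.MJ_subset by (simp add: u.hom_add)
    qed
    have ueq: "u x = u y" if x: "x \<in> carrier P1" and y: "y \<in> carrier P1" and xy: "f x = f y" for x y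
    proof -
      have "f (x \<ominus>\<^bsub>P1\<^esub> y) = \<zero>\<^bsub>P0\<^esub>"
        using x y xy by (simp add: f.M.M.minus_eq f.hom_add f.hom_minus g.M.M.r_neg)
      then have "u (x \<ominus>\<^bsub>P1\<^esub> y) = \<zero>\<^bsub>M\<^esub>" using uker kerf x y by simp
      moreover have "u x = u (x \<ominus>\<^bsub>P1\<^esub> y) \<oplus>\<^bsub>M\<^esub> u y"
        using x y by (simp add: f.M.M.minus_eq u.hom_add u.hom_minus g.Y.M.a_assoc g.Y.M.l_neg)
      ultimately show ?thesis using y by simp
    qed
    define w where "w z = u (inv_into (carrier P1) f z)" for z
    have wf: "w (f x) = u x" if "x \<in> carrier P1" for x
      unfolding w_def by (rule ueq) (use that in \<open>auto intro: inv_into_into f_inv_into_f\<close>)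
    have rep: "\<exists>x\<in>carrier P1. z = f x" if "z \<in> Z" for z using that fZ by blast
    have w: "w \<in> rmod_hom A (P0\<lparr>carrier := Z\<rparr>) M"
    proof (rule rmod_homI)
      fix z assume "z \<in> carrier (P0\<lparr>carrier := Z\<rparr>)"
      then obtain x where x: "x \<in> carrier P1" "z = f x" using rep by auto
      show "w z \<in> carrier M" using x by (simp add: wf)
      { fix z' assume "z' \<in> carrier (P0\<lparr>carrier := Z\<rparr>)"
        then obtain x' where x': "x' \<in> carrier P1" "z' = f x'" using rep by auto
        show "w (z \<oplus>\<^bsub>P0\<lparr>carrier := Z\<rparr>\<^esub> z') = w z \<oplus>\<^bsub>M\<^esub> w z'"
          using x x' wf[OF f.M.M.a_closed[OF x(1) x'(1)]] by (simp add: wf f.hom_add u.hom_add) }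
      fix a assume a: "a \<in> carrier A"
      show "w (z \<triangleleft>\<^bsub>P0\<lparr>carrier := Z\<rparr>\<^esub> a) = w z \<triangleleft>\<^bsub>M\<^esub> a"
        using x a wf[OF f.M.ract_closed[OF x(1) a]] by (simp add: wf f.hom_ract u.hom_ract)
    qed
    have "w ` Z \<subseteq> ideal_action M J" using rep uJ wf by fastforce
    then obtain v where v: "v \<in> rmod_hom A P0 M" "\<forall>z\<in>Z. w z = v z" using E w by blast
    then have "\<forall>x\<in>carrier P1. u x = v (f x)" using fZ' wf by metis
    then show "\<exists>v\<in>rmod_hom A P0 M. \<forall>x\<in>carrier P1. u x = v (f x)" using v(1) by blast
  qed
  show ?thesis using FE FT ETF by blast
qed

end

section \<open>Basic algebras over algebraically closed fields\<close>

context fd_algebra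
begin

text \<open>If \<open>x\<close> avoids a maximal right ideal \<open>N\<close>, then 1 = k + xa with
  k in \<open>N\<close>. But k = 1 - xa is right invertible, so \<open>N\<close> would contain
  1.\<close>

lemma mem_J_if_right_invertible:
  assumes x: "x \<in> carrier A"
    and inv: "\<And>y. y \<in> carrier A \<Longrightarrow> \<exists>z\<in>carrier A. (\<one>\<^bsub>A\<^esub> \<ominus>\<^bsub>A\<^esub> x \<otimes>\<^bsub>A\<^esub> y) \<otimes>\<^bsub>A\<^esub> z = \<one>\<^bsub>A\<^esub>"
  shows "x \<in> J"
proof -
  have "x \<in> N" if N: "maximal_rsubmodule A (regular A) N" for N
  proof (rule ccontr)
    assume xN: "x \<notin> N"
    have Ns: "rsubmodule A (regular A) N" and ne: "N \<noteq> carrier A"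
      and max: "\<And>L. \<lbrakk>rsubmodule A (regular A) L; N \<subseteq> L\<rbrakk> \<Longrightarrow> L = N \<or> L = carrier A"
      using N by (auto simp: maximal_rsubmodule_def)
    note n = rsubmoduleD[OF Ns, simplified]
    note c = fd_rmodule.cyclic_extension[OF regular_fd Ns, of x, simplified, OF x]
    have "{n \<oplus>\<^bsub>A\<^esub> x \<otimes>\<^bsub>A\<^esub> a | n a. n \<in> N \<and> a \<in> carrier A} = carrier A"
      using max[OF c(1,2)] c(3) xN by auto
    then obtain k a where k: "k \<in> N" "a \<in> carrier A" "\<one>\<^bsub>A\<^esub> = k \<oplus>\<^bsub>A\<^esub> x \<otimes>\<^bsub>A\<^esub> a"
      using A.one_closed by blast
    have kc: "k \<in> carrier A" using k n(1) by auto
    have "\<one>\<^bsub>A\<^esub> \<ominus>\<^bsub>A\<^esub> x \<otimes>\<^bsub>A\<^esub> a = k"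
      using k(2) kc x unfolding k(3) by (simp add: M.minus_eq M.a_assoc M.r_neg)
    then obtain z where "z \<in> carrier A" "k \<otimes>\<^bsub>A\<^esub> z = \<one>\<^bsub>A\<^esub>" using inv[OF k(2)] by auto
    then have 1: "\<one>\<^bsub>A\<^esub> \<in> N" using n(4)[OF k(1)] by metis
    have "a \<in> N" if "a \<in> carrier A" for a using n(4)[OF 1 that] that by simp
    then show False using ne n(1) by auto
  qed
  then show ?thesis using x by (auto simp: jacobson_radical_def)
qed

lemma pow_comm1: "x \<in> carrier A \<Longrightarrow> x [^]\<^bsub>A\<^esub> (k::nat) \<otimes>\<^bsub>A\<^esub> x = x \<otimes>\<^bsub>A\<^esub> x [^]\<^bsub>A\<^esub> k"
  using A.nat_pow_Suc2[of x k] by simp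

text \<open>Geometric series: by induction on k there is z with (1 - x) z = 1 - x^k.\<close>

lemma nilpotent_right_invertible:
  assumes x: "x \<in> carrier A" and k: "x [^]\<^bsub>A\<^esub> (k::nat) = \<zero>\<^bsub>A\<^esub>"
  shows "\<exists>z\<in>carrier A. (\<one>\<^bsub>A\<^esub> \<ominus>\<^bsub>A\<^esub> x) \<otimes>\<^bsub>A\<^esub> z = \<one>\<^bsub>A\<^esub>"
proof -
  have "\<exists>z\<in>carrier A. (\<one>\<^bsub>A\<^esub> \<ominus>\<^bsub>A\<^esub> x) \<otimes>\<^bsub>A\<^esub> z = \<one>\<^bsub>A\<^esub> \<ominus>\<^bsub>A\<^esub> x [^]\<^bsub>A\<^esub> k" for k :: nat
  proof (induct k)
    case 0
    then show ?case using x by (intro bexI[of _ "\<zero>\<^bsub>A\<^esub>"]) (simp_all add: M.minus_eq M.r_neg)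
  next
    case (Suc k)
    then obtain z where z: "z \<in> carrier A" "(\<one>\<^bsub>A\<^esub> \<ominus>\<^bsub>A\<^esub> x) \<otimes>\<^bsub>A\<^esub> z = \<one>\<^bsub>A\<^esub> \<ominus>\<^bsub>A\<^esub> x [^]\<^bsub>A\<^esub> k" by blast
    have p: "x [^]\<^bsub>A\<^esub> k \<in> carrier A" "x \<otimes>\<^bsub>A\<^esub> x [^]\<^bsub>A\<^esub> k \<in> carrier A" using x by simp_all
    have "(\<one>\<^bsub>A\<^esub> \<ominus>\<^bsub>A\<^esub> x) \<otimes>\<^bsub>A\<^esub> (z \<oplus>\<^bsub>A\<^esub> x [^]\<^bsub>A\<^esub> k) = (\<one>\<^bsub>A\<^esub> \<ominus>\<^bsub>A\<^esub> x [^]\<^bsub>A\<^esub> k) \<oplus>\<^bsub>A\<^esub> (x [^]\<^bsub>A\<^esub> k \<ominus>\<^bsub>A\<^esub> x \<otimes>\<^bsub>A\<^esub> x [^]\<^bsub>A\<^esub> k)"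
    proof -
      have "(\<one>\<^bsub>A\<^esub> \<ominus>\<^bsub>A\<^esub> x) \<otimes>\<^bsub>A\<^esub> x [^]\<^bsub>A\<^esub> k = x [^]\<^bsub>A\<^esub> k \<ominus>\<^bsub>A\<^esub> x \<otimes>\<^bsub>A\<^esub> x [^]\<^bsub>A\<^esub> k"
        using x p by (simp add: M.minus_eq A.l_distr A.l_minus)
      then show ?thesis using x z p by (simp add: A.r_distr)
    qed
    also have "\<dots> = \<one>\<^bsub>A\<^esub> \<ominus>\<^bsub>A\<^esub> x \<otimes>\<^bsub>A\<^esub> x [^]\<^bsub>A\<^esub> k"
      using p by (simp add: M.minus_eq M.a_assoc M.r_neg1 M.r_neg2)
    finally show ?case using z p x by (intro bexI[of _ "z \<oplus>\<^bsub>A\<^esub> x [^]\<^bsub>A\<^esub> k"]) (simp_all add: pow_comm1)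
  qed
  from this[of k] show ?thesis
    using k M.minus_equality[of "\<zero>\<^bsub>A\<^esub>" "\<zero>\<^bsub>A\<^esub>"] by (simp add: M.minus_eq)
qed

end

section \<open>Polynomials in one element of the algebra\<close>

text \<open>Polynomial evaluation at an algebra element by Horner's scheme, with ascending
  coefficients. The function \<open>ring.eval\<close> on the field takes the leading coefficient
  first, hence the \<open>rev\<close> in later statements.\<close>

fun pev :: "('k, 'a) module \<Rightarrow> 'a \<Rightarrow> 'k list \<Rightarrow> 'a" where
  "pev A b [] = \<zero>\<^bsub>A\<^esub>"
| "pev A b (c # cs) = c \<odot>\<^bsub>A\<^esub> \<one>\<^bsub>A\<^esub> \<oplus>\<^bsub>A\<^esub> b \<otimes>\<^bsub>A\<^esub> pev A b cs"

context fd_algebra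
begin

lemma pev_closed [simp]: "\<lbrakk>b \<in> carrier A; set cs \<subseteq> carrier K\<rbrakk> \<Longrightarrow> pev A b cs \<in> carrier A"
  by (induct cs) auto

lemma pev_commute: "\<lbrakk>b \<in> carrier A; set cs \<subseteq> carrier K\<rbrakk> \<Longrightarrow> b \<otimes>\<^bsub>A\<^esub> pev A b cs = pev A b cs \<otimes>\<^bsub>A\<^esub> b"
proof (induct cs)
  case (Cons c cs)
  then have "b \<otimes>\<^bsub>A\<^esub> pev A b cs = pev A b cs \<otimes>\<^bsub>A\<^esub> b" by simp
  then show ?case
    using Cons(2,3) by (simp add: A.r_distr A.l_distr smult_one_mult mult_smult_one A.m_assoc[symmetric])
qed simp

lemma pev_append1:
  assumes b: "b \<in> carrier A"
  shows "\<lbrakk>set cs \<subseteq> carrier K; c \<in> carrier K\<rbrakk> \<Longrightarrow> pev A b (cs @ [c]) = pev A b cs \<oplus>\<^bsub>A\<^esub> c \<odot>\<^bsub>A\<^esub> b [^]\<^bsub>A\<^esub> length cs"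
proof (induct cs)
  case (Cons d cs)
  then show ?case
    using b by (simp add: A.r_distr smult_mult_right M.a_assoc pow_comm1)
qed (use b in simp)

lemma pev_replicate:
  assumes b: "b \<in> carrier A" and cs: "set cs \<subseteq> carrier K"
  shows "pev A b (replicate m \<zero>\<^bsub>K\<^esub> @ cs) = b [^]\<^bsub>A\<^esub> m \<otimes>\<^bsub>A\<^esub> pev A b cs"
proof (induct m)
  case (Suc m)
  then show ?case using b cs by (simp add: A.m_assoc[symmetric] pow_comm1)
qed (use b cs in simp)

lemma pev_map:
  assumes b: "b \<in> carrier A" and c: "\<And>i. i < n \<Longrightarrow> c i \<in> carrier K"
  shows "pev A b (map c [0..<n]) = finsum A (\<lambda>i. c i \<odot>\<^bsub>A\<^esub> b [^]\<^bsub>A\<^esub> i) {..<n}"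
  using c
proof (induct n)
  case (Suc n)
  then have cn: "c n \<in> carrier K" "\<And>i. i < n \<Longrightarrow> c i \<in> carrier K" by auto
  have "pev A b (map c [0..<Suc n]) = pev A b (map c [0..<n]) \<oplus>\<^bsub>A\<^esub> c n \<odot>\<^bsub>A\<^esub> b [^]\<^bsub>A\<^esub> n"
    using pev_append1[OF b, of "map c [0..<n]" "c n"] cn by (auto simp: image_subset_iff)
  also have "\<dots> = finsum A (\<lambda>i. c i \<odot>\<^bsub>A\<^esub> b [^]\<^bsub>A\<^esub> i) {..<Suc n}"
    using Suc cn b by (simp add: lessThan_Suc M.finsum_insert Pi_iff M.a_comm)
  finally show ?case .
qed simp

text \<open>There are dim + 1 exponents from 0 to dim. If the corresponding powers of
  \<open>b\<close> are distinct, they are linearly dependent; if two of them coincide, their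
  difference is the required polynomial.\<close>

lemma annihilating_polynomial:
  assumes b: "b \<in> carrier A"
  shows "\<exists>cs. set cs \<subseteq> carrier K \<and> (\<exists>c\<in>set cs. c \<noteq> \<zero>\<^bsub>K\<^esub>) \<and> pev A b cs = \<zero>\<^bsub>A\<^esub>"
proof (cases "inj_on (\<lambda>i. b [^]\<^bsub>A\<^esub> i) {..<Suc dim}")
  case True
  define S where "S = (\<lambda>i. b [^]\<^bsub>A\<^esub> i) ` {..<Suc dim}"
  have S: "finite S" "S \<subseteq> carrier A" "card S = Suc dim"
    using b card_image[OF True] by (auto simp: S_def)
  have "lin_dep S" using li_le_dim(2)[OF fin_dim S(2)] S(3) by auto
  then obtain \<alpha> v where \<alpha>: "\<alpha> \<in> S \<rightarrow> carrier K" "lincomb \<alpha> S = \<zero>\<^bsub>A\<^esub>" "v \<in> S" "\<alpha> v \<noteq> \<zero>\<^bsub>K\<^esub>"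
    using finite_lin_dep[OF S(1) _ S(2)] by blast
  define c where "c i = \<alpha> (b [^]\<^bsub>A\<^esub> i)" for i :: nat
  have c: "c i \<in> carrier K" if "i < Suc dim" for i using \<alpha>(1) that by (auto simp: c_def S_def)
  have "lincomb \<alpha> S = finsum A (\<lambda>i. c i \<odot>\<^bsub>A\<^esub> b [^]\<^bsub>A\<^esub> i) {..<Suc dim}"
    unfolding lincomb_def S_def c_def
    by (rule M.finsum_reindex[OF _ True]) (use b c in \<open>auto simp: c_def\<close>)
  then have "pev A b (map c [0..<Suc dim]) = \<zero>\<^bsub>A\<^esub>"
    using pev_map[of b "Suc dim" c] b c \<alpha>(2) by (simp del: upt_Suc)
  moreover have "set (map c [0..<Suc dim]) \<subseteq> carrier K" using c by auto
  moreover have "\<exists>x\<in>set (map c [0..<Suc dim]). x \<noteq> \<zero>\<^bsub>K\<^esub>"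
  proof -
    obtain i where "i < Suc dim" "v = b [^]\<^bsub>A\<^esub> i" using \<alpha>(3) by (auto simp: S_def)
    then show ?thesis using \<alpha>(4) by (intro bexI[of _ "c i"]) (auto simp: c_def simp del: upt_Suc)
  qed
  ultimately show ?thesis by blast
next
  case False
  then obtain i j where ij: "i < j" "b [^]\<^bsub>A\<^esub> i = b [^]\<^bsub>A\<^esub> (j::nat)"
    unfolding inj_on_def by (metis linorder_neqE_nat)
  \<comment> \<open>The coefficients of X^i padded with zeros to length j, so that the appended
    coefficient -1 stands at X^j.\<close>
  define cs where "cs = (replicate i \<zero>\<^bsub>K\<^esub> @ [\<one>\<^bsub>K\<^esub>]) @ replicate (j - Suc i) \<zero>\<^bsub>K\<^esub>"
  have cs: "set cs \<subseteq> carrier K" "length cs = j" using ij by (auto simp: cs_def)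
  have z: "pev A b (replicate n \<zero>\<^bsub>K\<^esub>) = \<zero>\<^bsub>A\<^esub>" for n using pev_replicate[OF b, of "[]" n] b by simp
  have "pev A b cs = b [^]\<^bsub>A\<^esub> i \<otimes>\<^bsub>A\<^esub> pev A b (\<one>\<^bsub>K\<^esub> # replicate (j - Suc i) \<zero>\<^bsub>K\<^esub>)"
    unfolding cs_def append_assoc append_Cons append_Nil by (rule pev_replicate[OF b]) auto
  then have "pev A b cs = b [^]\<^bsub>A\<^esub> i" using b by (simp add: z)
  then have "pev A b (cs @ [\<ominus>\<^bsub>K\<^esub> \<one>\<^bsub>K\<^esub>]) = \<zero>\<^bsub>A\<^esub>"
    using pev_append1[OF b cs(1), of "\<ominus>\<^bsub>K\<^esub> \<one>\<^bsub>K\<^esub>"] b cs(2) ij(2) by (simp add: smult_l_minus M.r_neg)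
  then show ?thesis
    using cs(1) by (intro exI[of _ "cs @ [\<ominus>\<^bsub>K\<^esub> \<one>\<^bsub>K\<^esub>]"]) (auto simp: cs_def)
qed

text \<open>If c b^m is the lowest term of an annihilating polynomial, then c b^m = - b^(m+1) p with
  p a polynomial in \<open>b\<close>. Dividing by c gives \<open>w\<close>, again a polynomial in
  \<open>b\<close>, so it commutes with \<open>b\<close>.\<close>

lemma strongly_pi_regular:
  assumes b: "b \<in> carrier A"
  shows "\<exists>m w. w \<in> carrier A \<and> b \<otimes>\<^bsub>A\<^esub> w = w \<otimes>\<^bsub>A\<^esub> b \<and> b [^]\<^bsub>A\<^esub> m = b [^]\<^bsub>A\<^esub> Suc m \<otimes>\<^bsub>A\<^esub> w"
proof -
  obtain cs where cs: "set cs \<subseteq> carrier K" "\<exists>c\<in>set cs. c \<noteq> \<zero>\<^bsub>K\<^esub>" "pev A b cs = \<zero>\<^bsub>A\<^esub>"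
    using annihilating_polynomial[OF b] by blast
  obtain ys c r where s: "cs = ys @ c # r" "c \<noteq> \<zero>\<^bsub>K\<^esub>" "\<forall>y\<in>set ys. \<not> y \<noteq> \<zero>\<^bsub>K\<^esub>"
    using split_list_first_prop[OF cs(2)] by blast
  define m where "m = length ys"
  have ys: "ys = replicate m \<zero>\<^bsub>K\<^esub>" using s(3) by (simp add: m_def replicate_length_same)
  have c: "c \<in> carrier K" and r: "set r \<subseteq> carrier K" using cs(1) s(1) by auto
  define p where "p = pev A b r"
  have p: "p \<in> carrier A" "b \<otimes>\<^bsub>A\<^esub> p = p \<otimes>\<^bsub>A\<^esub> b" using b r by (simp_all add: p_def pev_commute)
  define d where "d = inv\<^bsub>K\<^esub> c"
  have d: "d \<in> carrier K" "d \<otimes>\<^bsub>K\<^esub> c = \<one>\<^bsub>K\<^esub>"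
    using c s(2) field_Units R.Units_inv_closed R.Units_l_inv by (auto simp: d_def)
  have bm: "b [^]\<^bsub>A\<^esub> m \<in> carrier A" using b by simp
  have "\<zero>\<^bsub>A\<^esub> = b [^]\<^bsub>A\<^esub> m \<otimes>\<^bsub>A\<^esub> (c \<odot>\<^bsub>A\<^esub> \<one>\<^bsub>A\<^esub> \<oplus>\<^bsub>A\<^esub> b \<otimes>\<^bsub>A\<^esub> p)"
    using cs(3) s(1) ys pev_replicate[OF b, of "c # r" m] c r by (simp add: p_def)
  also have "\<dots> = c \<odot>\<^bsub>A\<^esub> b [^]\<^bsub>A\<^esub> m \<oplus>\<^bsub>A\<^esub> b [^]\<^bsub>A\<^esub> Suc m \<otimes>\<^bsub>A\<^esub> p"
    using b p c bm by (simp add: A.r_distr mult_smult_one A.m_assoc)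
  finally have "c \<odot>\<^bsub>A\<^esub> b [^]\<^bsub>A\<^esub> m = \<ominus>\<^bsub>A\<^esub> (b [^]\<^bsub>A\<^esub> Suc m \<otimes>\<^bsub>A\<^esub> p)"
    using b p c bm by (metis A.m_closed A.nat_pow_closed M.minus_equality smult_closed)
  then have "d \<odot>\<^bsub>A\<^esub> (c \<odot>\<^bsub>A\<^esub> b [^]\<^bsub>A\<^esub> m) = d \<odot>\<^bsub>A\<^esub> (\<ominus>\<^bsub>A\<^esub> (b [^]\<^bsub>A\<^esub> Suc m \<otimes>\<^bsub>A\<^esub> p))" by simp
  then have "b [^]\<^bsub>A\<^esub> m = d \<odot>\<^bsub>A\<^esub> (\<ominus>\<^bsub>A\<^esub> (b [^]\<^bsub>A\<^esub> Suc m \<otimes>\<^bsub>A\<^esub> p))"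
    using d c bm by (simp add: smult_assoc1[symmetric])
  also have "\<dots> = b [^]\<^bsub>A\<^esub> Suc m \<otimes>\<^bsub>A\<^esub> (d \<odot>\<^bsub>A\<^esub> (\<ominus>\<^bsub>A\<^esub> p))"
    using b p d bm by (simp add: smult_mult_right A.r_minus)
  finally have "b [^]\<^bsub>A\<^esub> m = b [^]\<^bsub>A\<^esub> Suc m \<otimes>\<^bsub>A\<^esub> (d \<odot>\<^bsub>A\<^esub> (\<ominus>\<^bsub>A\<^esub> p))" .
  moreover have "b \<otimes>\<^bsub>A\<^esub> (d \<odot>\<^bsub>A\<^esub> (\<ominus>\<^bsub>A\<^esub> p)) = (d \<odot>\<^bsub>A\<^esub> (\<ominus>\<^bsub>A\<^esub> p)) \<otimes>\<^bsub>A\<^esub> b"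
    using b p d by (simp add: smult_mult_left smult_mult_right A.r_minus A.l_minus)
  moreover have "d \<odot>\<^bsub>A\<^esub> (\<ominus>\<^bsub>A\<^esub> p) \<in> carrier A" using p d by simp
  ultimately show ?thesis by blast
qed

text \<open>Fitting's dichotomy. Iterating b^m = b^(m+1) w gives b^m = b^(2m) w^m, so u = b^m w^m is
  idempotent with b^m u = b^m. If u = 0, then \<open>b\<close> is nilpotent; if u = 1, then
  \<open>b\<close> is invertible.\<close>

lemma nilpotent_or_invertible:
  assumes idem: "\<And>u. \<lbrakk>u \<in> carrier A; u \<otimes>\<^bsub>A\<^esub> u = u\<rbrakk> \<Longrightarrow> u = \<zero>\<^bsub>A\<^esub> \<or> u = \<one>\<^bsub>A\<^esub>" and b: "b \<in> carrier A"
  shows "(\<exists>k::nat. b [^]\<^bsub>A\<^esub> k = \<zero>\<^bsub>A\<^esub>) \<or> (\<exists>c\<in>carrier A. b \<otimes>\<^bsub>A\<^esub> c = \<one>\<^bsub>A\<^esub> \<and> c \<otimes>\<^bsub>A\<^esub> b = \<one>\<^bsub>A\<^esub>)"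
proof -
  obtain m w where w: "w \<in> carrier A" "b \<otimes>\<^bsub>A\<^esub> w = w \<otimes>\<^bsub>A\<^esub> b" "b [^]\<^bsub>A\<^esub> m = b [^]\<^bsub>A\<^esub> Suc m \<otimes>\<^bsub>A\<^esub> w"
    using strongly_pi_regular[OF b] by blast
  have comm: "b [^]\<^bsub>A\<^esub> i \<otimes>\<^bsub>A\<^esub> w [^]\<^bsub>A\<^esub> j = w [^]\<^bsub>A\<^esub> j \<otimes>\<^bsub>A\<^esub> b [^]\<^bsub>A\<^esub> i" for i j :: nat
  proof -
    have "w [^]\<^bsub>A\<^esub> j \<otimes>\<^bsub>A\<^esub> b = b \<otimes>\<^bsub>A\<^esub> w [^]\<^bsub>A\<^esub> j"
      using A.group_commutes_pow[OF w(2)[symmetric] w(1) b] .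
    then show ?thesis using A.group_commutes_pow[of b "w [^]\<^bsub>A\<^esub> j" i] b w(1) by simp
  qed
  have pw: "b [^]\<^bsub>A\<^esub> m = b [^]\<^bsub>A\<^esub> (m + k) \<otimes>\<^bsub>A\<^esub> w [^]\<^bsub>A\<^esub> k" for k :: nat
  proof (induct k)
    case (Suc k)
    have "b [^]\<^bsub>A\<^esub> (m + Suc k) \<otimes>\<^bsub>A\<^esub> w [^]\<^bsub>A\<^esub> Suc k = (b [^]\<^bsub>A\<^esub> k \<otimes>\<^bsub>A\<^esub> b [^]\<^bsub>A\<^esub> Suc m) \<otimes>\<^bsub>A\<^esub> (w \<otimes>\<^bsub>A\<^esub> w [^]\<^bsub>A\<^esub> k)"
    proof -
      have "b [^]\<^bsub>A\<^esub> (m + Suc k) = b [^]\<^bsub>A\<^esub> k \<otimes>\<^bsub>A\<^esub> b [^]\<^bsub>A\<^esub> Suc m"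
        by (metis A.nat_pow_mult add.commute add_Suc_right add_Suc_shift b)
      then show ?thesis using A.nat_pow_Suc2[OF w(1), of k] by metis
    qed
    also have "\<dots> = b [^]\<^bsub>A\<^esub> k \<otimes>\<^bsub>A\<^esub> (b [^]\<^bsub>A\<^esub> Suc m \<otimes>\<^bsub>A\<^esub> w) \<otimes>\<^bsub>A\<^esub> w [^]\<^bsub>A\<^esub> k"
      using b w(1) by (simp add: A.m_assoc del: A.nat_pow_Suc)
    also have "\<dots> = b [^]\<^bsub>A\<^esub> (m + k) \<otimes>\<^bsub>A\<^esub> w [^]\<^bsub>A\<^esub> k"
      using b by (simp only: w(3)[symmetric]) (simp add: A.nat_pow_mult add.commute)
    finally show ?case using Suc by simp
  qed (use b in simp)
  define u where "u = b [^]\<^bsub>A\<^esub> m \<otimes>\<^bsub>A\<^esub> w [^]\<^bsub>A\<^esub> m"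
  have u: "u \<in> carrier A" using b w(1) by (simp add: u_def)
  have bu: "b [^]\<^bsub>A\<^esub> m \<otimes>\<^bsub>A\<^esub> u = b [^]\<^bsub>A\<^esub> m"
    using pw[of m, symmetric] b w(1) by (simp add: u_def A.m_assoc[symmetric] A.nat_pow_mult)
  have "u \<otimes>\<^bsub>A\<^esub> u = w [^]\<^bsub>A\<^esub> m \<otimes>\<^bsub>A\<^esub> (b [^]\<^bsub>A\<^esub> m \<otimes>\<^bsub>A\<^esub> u)"
    using b w(1) u by (simp add: u_def comm A.m_assoc)
  also have "\<dots> = u" by (simp only: bu) (simp add: u_def comm)
  finally consider "u = \<zero>\<^bsub>A\<^esub>" | "u = \<one>\<^bsub>A\<^esub>" using idem[OF u] by blast
  then show ?thesis
  proof cases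
    case 1
    then have "b [^]\<^bsub>A\<^esub> m = \<zero>\<^bsub>A\<^esub>" using bu b by simp
    then show ?thesis by blast
  next
    case 2
    show ?thesis
    proof (cases m)
      \<comment> \<open>For m = 0 the relation itself reads 1 = b w.\<close>
      case 0
      then have "b \<otimes>\<^bsub>A\<^esub> w = \<one>\<^bsub>A\<^esub>" using w b by simp
      then show ?thesis using w by auto
    next
      case (Suc k)
      define c where "c = b [^]\<^bsub>A\<^esub> k \<otimes>\<^bsub>A\<^esub> w [^]\<^bsub>A\<^esub> m"
      have c: "c \<in> carrier A" using b w(1) by (simp add: c_def)
      have "b \<otimes>\<^bsub>A\<^esub> c = u"
        using b w(1) by (simp add: c_def u_def Suc A.m_assoc[symmetric] pow_comm1)
      moreover have "c \<otimes>\<^bsub>A\<^esub> b = u"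
        using b w(1) comm[of 1 m] comm[of m m]
        by (simp add: c_def u_def Suc A.m_assoc del: A.nat_pow_Suc)
      ultimately show ?thesis using c 2 by auto
    qed
  qed
qed

text \<open>Synthetic division by X - l along Horner's scheme: the remainder of the tail becomes the
  new lowest coefficient of the quotient. The leading coefficient, last in the list, is preserved;
  the descent to smaller degree in the search for an eigenvalue relies on this.\<close>

lemma polynomial_division_by_root:
  assumes l: "l \<in> carrier K" and cs: "set cs \<subseteq> carrier K" "cs \<noteq> []"
  shows "\<exists>q. set q \<subseteq> carrier K \<and> Suc (length q) = length cs \<and> (q \<noteq> [] \<longrightarrow> last q = last cs) \<and>
    (\<forall>b\<in>carrier A. pev A b cs = (b \<ominus>\<^bsub>A\<^esub> l \<odot>\<^bsub>A\<^esub> \<one>\<^bsub>A\<^esub>) \<otimes>\<^bsub>A\<^esub> pev A b q \<oplus>\<^bsub>A\<^esub> R.eval (rev cs) l \<odot>\<^bsub>A\<^esub> \<one>\<^bsub>A\<^esub>)"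
  using cs
proof (induct cs)
  case (Cons c cs)
  show ?case
  proof (cases "cs = []")
    case True
    then show ?thesis using Cons l by (intro exI[of _ "[]"]) (auto simp: M.minus_eq)
  next
    case False
    then obtain q where q: "set q \<subseteq> carrier K" "Suc (length q) = length cs" "q \<noteq> [] \<longrightarrow> last q = last cs"
      "\<And>b. b \<in> carrier A \<Longrightarrow> pev A b cs = (b \<ominus>\<^bsub>A\<^esub> l \<odot>\<^bsub>A\<^esub> \<one>\<^bsub>A\<^esub>) \<otimes>\<^bsub>A\<^esub> pev A b q \<oplus>\<^bsub>A\<^esub> R.eval (rev cs) l \<odot>\<^bsub>A\<^esub> \<one>\<^bsub>A\<^esub>"
      using Cons by auto
    define s where "s = R.eval (rev cs) l"
    have s: "s \<in> carrier K" using Cons(2) l by (simp add: s_def R.eval_in_carrier)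
    have c: "c \<in> carrier K" using Cons(2) by simp
    have ev: "R.eval (rev (c # cs)) l = s \<otimes>\<^bsub>K\<^esub> l \<oplus>\<^bsub>K\<^esub> c"
      using R.eval_append_aux[of "rev cs" c l] Cons(2) l by (simp add: s_def)
    have cs1: "last (s # q) = last (c # cs)"
    proof (cases "q = []")
      case True
      then obtain d where "cs = [d]" using q(2) by (cases cs) auto
      then show ?thesis using Cons(2) l by (simp add: True s_def)
    qed (use q(3) False in simp)
    have "pev A b (c # cs) = (b \<ominus>\<^bsub>A\<^esub> l \<odot>\<^bsub>A\<^esub> \<one>\<^bsub>A\<^esub>) \<otimes>\<^bsub>A\<^esub> pev A b (s # q) \<oplus>\<^bsub>A\<^esub> R.eval (rev (c # cs)) l \<odot>\<^bsub>A\<^esub> \<one>\<^bsub>A\<^esub>"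
      if b: "b \<in> carrier A" for b
    proof -
      define p where "p = pev A b q"
      define t where "t = b \<ominus>\<^bsub>A\<^esub> l \<odot>\<^bsub>A\<^esub> \<one>\<^bsub>A\<^esub>"
      have p: "p \<in> carrier A" using q(1) b by (simp add: p_def)
      have t: "t \<in> carrier A" using b l by (simp add: t_def)
      have bt: "b = t \<oplus>\<^bsub>A\<^esub> l \<odot>\<^bsub>A\<^esub> \<one>\<^bsub>A\<^esub>" using b l by (simp add: t_def M.minus_eq M.a_assoc M.l_neg)
      have btc: "b \<otimes>\<^bsub>A\<^esub> t = t \<otimes>\<^bsub>A\<^esub> b"
        using b l unfolding t_def M.minus_eq
        by (simp add: A.r_distr A.l_distr A.r_minus A.l_minus smult_one_mult mult_smult_one)
      have "pev A b (c # cs) = c \<odot>\<^bsub>A\<^esub> \<one>\<^bsub>A\<^esub> \<oplus>\<^bsub>A\<^esub> b \<otimes>\<^bsub>A\<^esub> (t \<otimes>\<^bsub>A\<^esub> p \<oplus>\<^bsub>A\<^esub> s \<odot>\<^bsub>A\<^esub> \<one>\<^bsub>A\<^esub>)"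
        using q(4)[OF b] by (simp add: p_def t_def s_def)
      also have "b \<otimes>\<^bsub>A\<^esub> (t \<otimes>\<^bsub>A\<^esub> p \<oplus>\<^bsub>A\<^esub> s \<odot>\<^bsub>A\<^esub> \<one>\<^bsub>A\<^esub>) = t \<otimes>\<^bsub>A\<^esub> (b \<otimes>\<^bsub>A\<^esub> p) \<oplus>\<^bsub>A\<^esub> s \<odot>\<^bsub>A\<^esub> b"
        using b t p s btc by (simp add: A.r_distr mult_smult_one A.m_assoc[symmetric])
      also have "s \<odot>\<^bsub>A\<^esub> b = t \<otimes>\<^bsub>A\<^esub> (s \<odot>\<^bsub>A\<^esub> \<one>\<^bsub>A\<^esub>) \<oplus>\<^bsub>A\<^esub> (s \<otimes>\<^bsub>K\<^esub> l) \<odot>\<^bsub>A\<^esub> \<one>\<^bsub>A\<^esub>"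
        using t s l by (subst bt) (simp add: smult_r_distr smult_assoc1 mult_smult_one)
      finally show ?thesis
        unfolding pev.simps ev t_def[symmetric] p_def[symmetric]
        using b t p s l c by (simp add: A.r_distr smult_l_distr M.a_ac)
    qed
    then show ?thesis
      using q s cs1 by (intro exI[of _ "s # q"]) auto
  qed
qed simp

end

lemma alg_closed_root:
  assumes "algebraically_closed K" and p: "set p \<subseteq> carrier K" "hd p \<noteq> \<zero>\<^bsub>K\<^esub>" "2 \<le> length p"
  shows "\<exists>l\<in>carrier K. ring.eval K p l = \<zero>\<^bsub>K\<^esub>"
proof -
  interpret algebraically_closed K by fact
  have "p \<in> carrier (poly_ring K)"
    using p by (auto simp: univ_poly_carrier[symmetric] polynomial_def)
  then have "size (roots p) = length p - 1"
    using roots_over_carrier by (simp add: splitted_def)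
  then have "roots p \<noteq> {#}" using p(3) by auto
  then obtain l where "l \<in># roots p" by blast
  then show ?thesis
    using roots_mem_iff_is_root[OF \<open>p \<in> carrier (poly_ring K)\<close>] by (auto simp: is_root_def)
qed

context fd_algebra
begin

text \<open>Descent on the degree of an annihilating polynomial: for a root l one has (b - l) q(b) =
  0, and either q(b) is the required nonzero \<open>y\<close> or q is an annihilating polynomial of
  smaller degree. A nonzero constant cannot annihilate, since 1 differs from 0.\<close>

lemma eigenvalue_exists:
  assumes K: "algebraically_closed K" and b: "b \<in> carrier A" and nz: "\<one>\<^bsub>A\<^esub> \<noteq> \<zero>\<^bsub>A\<^esub>"
  shows "\<exists>l\<in>carrier K. \<exists>y\<in>carrier A. y \<noteq> \<zero>\<^bsub>A\<^esub> \<and> (b \<ominus>\<^bsub>A\<^esub> l \<odot>\<^bsub>A\<^esub> \<one>\<^bsub>A\<^esub>) \<otimes>\<^bsub>A\<^esub> y = \<zero>\<^bsub>A\<^esub>"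
proof -
  have main: "\<lbrakk>length cs = Suc n; set cs \<subseteq> carrier K; last cs \<noteq> \<zero>\<^bsub>K\<^esub>; pev A b cs = \<zero>\<^bsub>A\<^esub>\<rbrakk> \<Longrightarrow> ?thesis" for cs n
  proof (induct n arbitrary: cs)
    case 0
    then obtain c where c: "cs = [c]" by (cases cs) auto
    then have c': "c \<in> carrier K" "c \<noteq> \<zero>\<^bsub>K\<^esub>" "c \<odot>\<^bsub>A\<^esub> \<one>\<^bsub>A\<^esub> = \<zero>\<^bsub>A\<^esub>" using 0 b by auto
    then have "\<one>\<^bsub>A\<^esub> = \<zero>\<^bsub>A\<^esub>"
      using mult_inverse[OF c'(1) A.one_closed c'(3,2)] field_Units R.Units_inv_closed by simp
    then show ?case using nz by simp
  next
    case (Suc n)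
    have "\<exists>l\<in>carrier K. ring.eval K (rev cs) l = \<zero>\<^bsub>K\<^esub>"
      by (rule alg_closed_root[OF K]) (use Suc in \<open>auto simp: hd_rev\<close>)
    then obtain l where l: "l \<in> carrier K" "R.eval (rev cs) l = \<zero>\<^bsub>K\<^esub>" by blast
    have "cs \<noteq> []" using Suc(2) by auto
    then obtain q where q: "set q \<subseteq> carrier K" "Suc (length q) = length cs" "q \<noteq> [] \<longrightarrow> last q = last cs"
      "pev A b cs = (b \<ominus>\<^bsub>A\<^esub> l \<odot>\<^bsub>A\<^esub> \<one>\<^bsub>A\<^esub>) \<otimes>\<^bsub>A\<^esub> pev A b q \<oplus>\<^bsub>A\<^esub> R.eval (rev cs) l \<odot>\<^bsub>A\<^esub> \<one>\<^bsub>A\<^esub>"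
      using polynomial_division_by_root[OF l(1) Suc(3)] b by blast
    have eq: "(b \<ominus>\<^bsub>A\<^esub> l \<odot>\<^bsub>A\<^esub> \<one>\<^bsub>A\<^esub>) \<otimes>\<^bsub>A\<^esub> pev A b q = \<zero>\<^bsub>A\<^esub>"
      using q(4) l b q(1) Suc(5) by simp
    show ?case
    proof (cases "pev A b q = \<zero>\<^bsub>A\<^esub>")
      case True
      have "q \<noteq> []" using q(2) Suc(2) by auto
      then show ?thesis using Suc(1)[of q] q Suc True by auto
    next
      case False
      then show ?thesis using eq l b q(1) by (intro bexI[of _ l] bexI[of _ "pev A b q"]) auto
    qed
  qed
  \<comment> \<open>Removes vanishing leading coefficients, which stand at the end of the list, so
    that \<open>main\<close> applies.\<close>
  have strip: "\<lbrakk>set cs \<subseteq> carrier K; \<exists>c\<in>set cs. c \<noteq> \<zero>\<^bsub>K\<^esub>; pev A b cs = \<zero>\<^bsub>A\<^esub>\<rbrakk> \<Longrightarrow> ?thesis" for cs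
  proof (induct cs rule: rev_induct)
    case (snoc c cs)
    show ?case
    proof (cases "c = \<zero>\<^bsub>K\<^esub>")
      case True
      then show ?thesis using snoc pev_append1[OF b, of cs c] b by auto
    next
      case False
      then show ?thesis using main[of "cs @ [c]" "length cs"] snoc by simp
    qed
  qed simp
  show ?thesis using annihilating_polynomial[OF b] strip by blast
qed

end

section \<open>Corner algebras of primitive idempotents\<close>

context fd_algebra
begin

definition "corner e = A\<lparr>carrier := (\<lambda>a. e \<otimes>\<^bsub>A\<^esub> a \<otimes>\<^bsub>A\<^esub> e) ` carrier A, one := e\<rparr>"

lemma corner_simps [simp]:
  "carrier (corner e) = (\<lambda>a. e \<otimes>\<^bsub>A\<^esub> a \<otimes>\<^bsub>A\<^esub> e) ` carrier A" "one (corner e) = e"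
  "mult (corner e) = mult A" "add (corner e) = add A" "zero (corner e) = zero A" "smult (corner e) = smult A"
  by (simp_all add: corner_def)

lemma corner_mem:
  assumes e: "e \<in> carrier A" "e \<otimes>\<^bsub>A\<^esub> e = e" and b: "b \<in> carrier (corner e)"
  shows "b \<in> carrier A" "e \<otimes>\<^bsub>A\<^esub> b = b" "b \<otimes>\<^bsub>A\<^esub> e = b"
proof -
  obtain a where a: "a \<in> carrier A" "b = e \<otimes>\<^bsub>A\<^esub> a \<otimes>\<^bsub>A\<^esub> e" using b by auto
  show "b \<in> carrier A" using a e by simp
  show "e \<otimes>\<^bsub>A\<^esub> b = b" using a e by (simp add: A.m_assoc[symmetric])
  show "b \<otimes>\<^bsub>A\<^esub> e = b" using a e by (simp add: A.m_assoc)
qed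

lemma corner_memI: "\<lbrakk>b \<in> carrier A; e \<otimes>\<^bsub>A\<^esub> b = b; b \<otimes>\<^bsub>A\<^esub> e = b\<rbrakk> \<Longrightarrow> b \<in> carrier (corner e)"
  by (auto intro!: image_eqI[of _ _ b])

lemma fd_algebra_corner:
  assumes e: "e \<in> carrier A" "e \<otimes>\<^bsub>A\<^esub> e = e"
  shows "fd_algebra K (corner e)"
proof -
  let ?\<pi> = "\<lambda>a. e \<otimes>\<^bsub>A\<^esub> a \<otimes>\<^bsub>A\<^esub> e"
  note m = corner_mem[OF e]
  have V: "vectorspace K (corner e)"
    by (rule vectorspace_surj_image(1)[where \<pi> = ?\<pi>, OF vectorspace_axioms])
      (use e in \<open>simp_all add: A.r_distr A.l_distr smult_mult_left smult_mult_right\<close>)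
  have fd: "vectorspace.fin_dim K (corner e)"
    by (rule vectorspace_surj_image(2)[where \<pi> = ?\<pi>, OF vectorspace_axioms _ _ _ _ fin_dim])
      (use e in \<open>simp_all add: A.r_distr A.l_distr smult_mult_left smult_mult_right\<close>)
  interpret V: vectorspace K "corner e" by (rule V)
  have "ring (corner e)"
  proof (rule ringI)
    show "abelian_group (corner e)" by (rule V.M.abelian_group_axioms)
    show "monoid (corner e)"
    proof (rule monoidI)
      show "x \<otimes>\<^bsub>corner e\<^esub> y \<in> carrier (corner e)" if "x \<in> carrier (corner e)" "y \<in> carrier (corner e)" for x y
        using m[OF that(1)] m[OF that(2)] e by (intro corner_memI) (simp_all add: A.m_assoc[symmetric], simp add: A.m_assoc)
      show "\<one>\<^bsub>corner e\<^esub> \<in> carrier (corner e)" using e by (intro corner_memI) simp_all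
      show "x \<otimes>\<^bsub>corner e\<^esub> y \<otimes>\<^bsub>corner e\<^esub> z = x \<otimes>\<^bsub>corner e\<^esub> (y \<otimes>\<^bsub>corner e\<^esub> z)"
        if "x \<in> carrier (corner e)" "y \<in> carrier (corner e)" "z \<in> carrier (corner e)" for x y z
        using m(1)[OF that(1)] m(1)[OF that(2)] m(1)[OF that(3)] by (simp add: A.m_assoc)
      show "\<one>\<^bsub>corner e\<^esub> \<otimes>\<^bsub>corner e\<^esub> x = x" "x \<otimes>\<^bsub>corner e\<^esub> \<one>\<^bsub>corner e\<^esub> = x" if "x \<in> carrier (corner e)" for x
        using m[OF that] by simp_all
    qed
    fix x y z assume "x \<in> carrier (corner e)" "y \<in> carrier (corner e)" "z \<in> carrier (corner e)"
    then have "x \<in> carrier A" "y \<in> carrier A" "z \<in> carrier A" using m(1) by blast+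
    then show "(x \<oplus>\<^bsub>corner e\<^esub> y) \<otimes>\<^bsub>corner e\<^esub> z = x \<otimes>\<^bsub>corner e\<^esub> z \<oplus>\<^bsub>corner e\<^esub> y \<otimes>\<^bsub>corner e\<^esub> z"
      "z \<otimes>\<^bsub>corner e\<^esub> (x \<oplus>\<^bsub>corner e\<^esub> y) = z \<otimes>\<^bsub>corner e\<^esub> x \<oplus>\<^bsub>corner e\<^esub> z \<otimes>\<^bsub>corner e\<^esub> y"
      by (simp_all add: A.l_distr A.r_distr)
  qed
  then interpret R: ring "corner e" .
  show ?thesis
  proof
    show "vectorspace.fin_dim K (corner e)" by (rule fd)
    fix c a b assume c: "c \<in> carrier K" "a \<in> carrier (corner e)" "b \<in> carrier (corner e)"
    then have "a \<in> carrier A" "b \<in> carrier A" using m(1) by blast+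
    then show "(c \<odot>\<^bsub>corner e\<^esub> a) \<otimes>\<^bsub>corner e\<^esub> b = c \<odot>\<^bsub>corner e\<^esub> (a \<otimes>\<^bsub>corner e\<^esub> b)"
      "a \<otimes>\<^bsub>corner e\<^esub> (c \<odot>\<^bsub>corner e\<^esub> b) = c \<odot>\<^bsub>corner e\<^esub> (a \<otimes>\<^bsub>corner e\<^esub> b)"
      using c by (simp_all add: smult_mult_left smult_mult_right)
  qed
qed

text \<open>The zeroth powers are the units of the two algebras and may differ, so the comparison
  starts at exponent one.\<close>

lemma corner_pow:
  assumes e: "e \<in> carrier A" "e \<otimes>\<^bsub>A\<^esub> e = e" and b: "b \<in> carrier (corner e)"
  shows "b [^]\<^bsub>A\<^esub> Suc k = b [^]\<^bsub>corner e\<^esub> Suc k"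
proof (induct k)
  case 0
  then show ?case using corner_mem[OF e b] by (simp add: nat_pow_def)
next
  case (Suc k)
  then show ?case by (simp add: nat_pow_def)
qed

text \<open>For the last claim, an idempotent \<open>u\<close> of the corner gives the orthogonal
  decomposition e = u + (e - u), and primitivity makes one of the parts zero.\<close>

lemma primitive_idempotentD:
  assumes "primitive_idempotent A e"
  shows "e \<in> carrier A" "e \<otimes>\<^bsub>A\<^esub> e = e" "e \<noteq> \<zero>\<^bsub>A\<^esub>"
    "\<lbrakk>u \<in> carrier (corner e); u \<otimes>\<^bsub>A\<^esub> u = u\<rbrakk> \<Longrightarrow> u = \<zero>\<^bsub>A\<^esub> \<or> u = e"
proof -
  show e: "e \<in> carrier A" "e \<otimes>\<^bsub>A\<^esub> e = e" "e \<noteq> \<zero>\<^bsub>A\<^esub>"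
    using assms by (auto simp: primitive_idempotent_def idempotent_in_def)
  assume u: "u \<in> carrier (corner e)" "u \<otimes>\<^bsub>A\<^esub> u = u"
  note m = corner_mem[OF e(1,2) u(1)]
  have eu: "(e \<ominus>\<^bsub>A\<^esub> u) \<otimes>\<^bsub>A\<^esub> u = \<zero>\<^bsub>A\<^esub>" "u \<otimes>\<^bsub>A\<^esub> (e \<ominus>\<^bsub>A\<^esub> u) = \<zero>\<^bsub>A\<^esub>"
    using m e u by (simp_all add: M.minus_eq A.l_distr A.r_distr A.l_minus A.r_minus M.r_neg)
  have ee: "(e \<ominus>\<^bsub>A\<^esub> u) \<otimes>\<^bsub>A\<^esub> (e \<ominus>\<^bsub>A\<^esub> u) = e \<ominus>\<^bsub>A\<^esub> u"
  proof -
    have "(e \<ominus>\<^bsub>A\<^esub> u) \<otimes>\<^bsub>A\<^esub> e = e \<ominus>\<^bsub>A\<^esub> u" using m e by (simp add: M.minus_eq A.l_distr A.l_minus)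
    moreover have "(e \<ominus>\<^bsub>A\<^esub> u) \<otimes>\<^bsub>A\<^esub> (e \<ominus>\<^bsub>A\<^esub> u) = (e \<ominus>\<^bsub>A\<^esub> u) \<otimes>\<^bsub>A\<^esub> e \<ominus>\<^bsub>A\<^esub> (e \<ominus>\<^bsub>A\<^esub> u) \<otimes>\<^bsub>A\<^esub> u"
      using m e by (simp add: M.minus_eq[of e] A.r_distr A.r_minus M.minus_eq[of "_ \<otimes>\<^bsub>A\<^esub> _"])
    ultimately show ?thesis
      using eu m e M.minus_equality[of "\<zero>\<^bsub>A\<^esub>" "\<zero>\<^bsub>A\<^esub>"] by (simp add: M.minus_eq)
  qed
  have eq: "e = u \<oplus>\<^bsub>A\<^esub> (e \<ominus>\<^bsub>A\<^esub> u)" using m e by (simp add: M.minus_eq M.a_ac M.r_neg M.r_neg1 M.r_neg2)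
  from this have "u = \<zero>\<^bsub>A\<^esub> \<or> e \<ominus>\<^bsub>A\<^esub> u = \<zero>\<^bsub>A\<^esub>"
    using assms u(2) m(1) e eu ee
    unfolding primitive_idempotent_def idempotent_in_def orthogonal_in_def by (metis M.minus_closed)
  then show "u = \<zero>\<^bsub>A\<^esub> \<or> u = e" using m(1) eq by force
qed

text \<open>Primitivity leaves only trivial idempotents in the corner, so Fitting's dichotomy holds
  in it. Nilpotency is stated with powers taken in \<open>A\<close>, which costs one extra
  factor.\<close>

lemma primitive_dichotomy:
  assumes e: "primitive_idempotent A e" and b: "b \<in> carrier (corner e)"
  shows "(\<exists>k::nat. b [^]\<^bsub>A\<^esub> k = \<zero>\<^bsub>A\<^esub>) \<or> (\<exists>c\<in>carrier (corner e). b \<otimes>\<^bsub>A\<^esub> c = e \<and> c \<otimes>\<^bsub>A\<^esub> b = e)"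
proof -
  note d = primitive_idempotentD[OF e]
  interpret C: fd_algebra K "corner e" by (rule fd_algebra_corner[OF d(1,2)])
  have "(\<exists>k::nat. b [^]\<^bsub>corner e\<^esub> k = \<zero>\<^bsub>corner e\<^esub>) \<or>
    (\<exists>c\<in>carrier (corner e). b \<otimes>\<^bsub>corner e\<^esub> c = \<one>\<^bsub>corner e\<^esub> \<and> c \<otimes>\<^bsub>corner e\<^esub> b = \<one>\<^bsub>corner e\<^esub>)"
    by (rule C.nilpotent_or_invertible[OF _ b]) (use d(4) in simp)
  then show ?thesis
  proof
    assume "\<exists>k::nat. b [^]\<^bsub>corner e\<^esub> k = \<zero>\<^bsub>corner e\<^esub>"
    then obtain k where k: "b [^]\<^bsub>corner e\<^esub> (k::nat) = \<zero>\<^bsub>A\<^esub>" by auto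
    have "b [^]\<^bsub>corner e\<^esub> Suc k = b [^]\<^bsub>corner e\<^esub> k \<otimes>\<^bsub>A\<^esub> b" by simp
    then have "b [^]\<^bsub>A\<^esub> Suc k = \<zero>\<^bsub>A\<^esub>"
      using k corner_mem(1)[OF d(1,2) b] corner_pow[OF d(1,2) b, of k] by simp
    then show ?thesis by blast
  qed simp
qed

text \<open>As d = ed, one has (dy)^(k+1) = (dye)^k dy. So dy is nilpotent for every y, and 1 - dy
  is right invertible.\<close>

lemma mem_J_if_corner_nilpotent:
  assumes d: "d \<in> carrier A" and e: "e \<in> carrier A" "e \<otimes>\<^bsub>A\<^esub> d = d"
    and nil: "\<And>y. y \<in> carrier A \<Longrightarrow> \<exists>k::nat. (d \<otimes>\<^bsub>A\<^esub> y \<otimes>\<^bsub>A\<^esub> e) [^]\<^bsub>A\<^esub> k = \<zero>\<^bsub>A\<^esub>"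
  shows "d \<in> J"
proof (rule mem_J_if_right_invertible[OF d])
  fix y assume y: "y \<in> carrier A"
  then obtain k :: nat where k: "(d \<otimes>\<^bsub>A\<^esub> y \<otimes>\<^bsub>A\<^esub> e) [^]\<^bsub>A\<^esub> k = \<zero>\<^bsub>A\<^esub>" using nil by blast
  have "(d \<otimes>\<^bsub>A\<^esub> y) [^]\<^bsub>A\<^esub> Suc k = (d \<otimes>\<^bsub>A\<^esub> y \<otimes>\<^bsub>A\<^esub> e) [^]\<^bsub>A\<^esub> k \<otimes>\<^bsub>A\<^esub> (d \<otimes>\<^bsub>A\<^esub> y)" for k :: nat
  proof (induct k)
    case (Suc k)
    have "(d \<otimes>\<^bsub>A\<^esub> y) [^]\<^bsub>A\<^esub> Suc (Suc k) = (d \<otimes>\<^bsub>A\<^esub> y \<otimes>\<^bsub>A\<^esub> e) [^]\<^bsub>A\<^esub> k \<otimes>\<^bsub>A\<^esub> (d \<otimes>\<^bsub>A\<^esub> y) \<otimes>\<^bsub>A\<^esub> (d \<otimes>\<^bsub>A\<^esub> y)"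
      by (simp only: A.nat_pow_Suc Suc[symmetric])
    also have "\<dots> = (d \<otimes>\<^bsub>A\<^esub> y \<otimes>\<^bsub>A\<^esub> e) [^]\<^bsub>A\<^esub> k \<otimes>\<^bsub>A\<^esub> ((d \<otimes>\<^bsub>A\<^esub> y) \<otimes>\<^bsub>A\<^esub> ((e \<otimes>\<^bsub>A\<^esub> d) \<otimes>\<^bsub>A\<^esub> y))"
      using d y e by (simp add: A.m_assoc)
    also have "\<dots> = (d \<otimes>\<^bsub>A\<^esub> y \<otimes>\<^bsub>A\<^esub> e) [^]\<^bsub>A\<^esub> Suc k \<otimes>\<^bsub>A\<^esub> (d \<otimes>\<^bsub>A\<^esub> y)"
      using d y e(1) by (simp add: A.m_assoc)
    finally show ?case .
  qed (use d y in simp)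
  then have "(d \<otimes>\<^bsub>A\<^esub> y) [^]\<^bsub>A\<^esub> Suc k = \<zero>\<^bsub>A\<^esub>" using k d y by simp
  from nilpotent_right_invertible[OF _ this]
  show "\<exists>z\<in>carrier A. (\<one>\<^bsub>A\<^esub> \<ominus>\<^bsub>A\<^esub> d \<otimes>\<^bsub>A\<^esub> y) \<otimes>\<^bsub>A\<^esub> z = \<one>\<^bsub>A\<^esub>" using d y by simp
qed

text \<open>An element b of eAe has an eigenvalue l by algebraic closedness, and d = b - le
  annihilates a nonzero \<open>y\<close>. Hence neither d nor any dze is invertible in eAe; by the
  dichotomy all dze are nilpotent, which puts d into \<open>J\<close>.\<close>

lemma primitive_corner_scalar:
  assumes K: "algebraically_closed K" and e: "primitive_idempotent A e" and a: "a \<in> carrier A"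
  shows "\<exists>c\<in>carrier K. e \<otimes>\<^bsub>A\<^esub> a \<otimes>\<^bsub>A\<^esub> e \<ominus>\<^bsub>A\<^esub> c \<odot>\<^bsub>A\<^esub> e \<in> J"
proof -
  note p = primitive_idempotentD[OF e]
  note m = corner_mem[OF p(1,2)]
  interpret C: fd_algebra K "corner e" by (rule fd_algebra_corner[OF p(1,2)])
  define b where "b = e \<otimes>\<^bsub>A\<^esub> a \<otimes>\<^bsub>A\<^esub> e"
  have b: "b \<in> carrier (corner e)" using a by (simp add: b_def)
  obtain l y where l: "l \<in> carrier K" and y: "y \<in> carrier (corner e)" "y \<noteq> \<zero>\<^bsub>A\<^esub>"
    and ly: "(b \<ominus>\<^bsub>corner e\<^esub> l \<odot>\<^bsub>A\<^esub> e) \<otimes>\<^bsub>A\<^esub> y = \<zero>\<^bsub>A\<^esub>"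
    using C.eigenvalue_exists[OF K b] p(3) by auto
  define d where "d = b \<ominus>\<^bsub>corner e\<^esub> l \<odot>\<^bsub>A\<^esub> e"
  have le: "l \<odot>\<^bsub>A\<^esub> e \<in> carrier (corner e)" using C.smult_closed[OF l C.A.one_closed] by simp
  have d: "d \<in> carrier (corner e)" using b le C.M.minus_closed[of b "l \<odot>\<^bsub>A\<^esub> e"] by (simp add: d_def del: corner_simps(1))
  \<comment> \<open>Negation in the corner is formed with respect to a smaller carrier and has to be
    identified with negation in \<open>A\<close>.\<close>
  have neg: "\<ominus>\<^bsub>corner e\<^esub> x = \<ominus>\<^bsub>A\<^esub> x" if x: "x \<in> carrier (corner e)" for x
  proof -
    have "\<ominus>\<^bsub>corner e\<^esub> x \<oplus>\<^bsub>A\<^esub> x = \<zero>\<^bsub>A\<^esub>" using C.M.l_neg[OF x] by simp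
    then show ?thesis using M.minus_equality[of "\<ominus>\<^bsub>corner e\<^esub> x" x] m(1)[OF x] m(1)[OF C.M.a_inv_closed[OF x]] by simp
  qed
  have dA: "d = b \<ominus>\<^bsub>A\<^esub> l \<odot>\<^bsub>A\<^esub> e" unfolding d_def a_minus_def neg[OF le] by simp
  \<comment> \<open>Even a right inverse of \<open>d\<close> is impossible: either \<open>d\<close>
    is invertible, contrary to dy = 0, or it is nilpotent, and then d^k c^k e = e for all k forces e
    = 0.\<close>
  have no_inv: False if c: "c \<in> carrier (corner e)" "d \<otimes>\<^bsub>A\<^esub> c = e" for c
  proof -
    note dm = m[OF d] and cm = m[OF c(1)] and ym = m[OF y(1)]
    from primitive_dichotomy[OF e d] show False
    proof
      assume "\<exists>c\<in>carrier (corner e). d \<otimes>\<^bsub>A\<^esub> c = e \<and> c \<otimes>\<^bsub>A\<^esub> d = e"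
      then obtain c' where c': "c' \<in> carrier (corner e)" "c' \<otimes>\<^bsub>A\<^esub> d = e" by blast
      have "y = (c' \<otimes>\<^bsub>A\<^esub> d) \<otimes>\<^bsub>A\<^esub> y" using ym c' by simp
      also have "\<dots> = c' \<otimes>\<^bsub>A\<^esub> (d \<otimes>\<^bsub>A\<^esub> y)" using m(1)[OF c'(1)] dm ym by (simp only: A.m_assoc)
      also have "\<dots> = \<zero>\<^bsub>A\<^esub>" using ly m(1)[OF c'(1)] by (simp add: d_def)
      finally show False using y(2) by simp
    next
      assume "\<exists>k::nat. d [^]\<^bsub>A\<^esub> k = \<zero>\<^bsub>A\<^esub>"
      then obtain k :: nat where k: "d [^]\<^bsub>A\<^esub> k = \<zero>\<^bsub>A\<^esub>" by blast
      have "d [^]\<^bsub>A\<^esub> k \<otimes>\<^bsub>A\<^esub> c [^]\<^bsub>A\<^esub> k \<otimes>\<^bsub>A\<^esub> e = e" for k :: nat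
      proof (induct k)
        case (Suc k)
        have "d [^]\<^bsub>A\<^esub> Suc k \<otimes>\<^bsub>A\<^esub> c [^]\<^bsub>A\<^esub> Suc k \<otimes>\<^bsub>A\<^esub> e = d [^]\<^bsub>A\<^esub> k \<otimes>\<^bsub>A\<^esub> (d \<otimes>\<^bsub>A\<^esub> c) \<otimes>\<^bsub>A\<^esub> (c [^]\<^bsub>A\<^esub> k \<otimes>\<^bsub>A\<^esub> e)"
          using dm(1) cm(1) p(1) by (simp add: pow_comm1[symmetric] A.nat_pow_Suc2 A.m_assoc)
            (simp add: A.m_assoc[symmetric] pow_comm1)
        also have "\<dots> = d [^]\<^bsub>A\<^esub> k \<otimes>\<^bsub>A\<^esub> (e \<otimes>\<^bsub>A\<^esub> (c [^]\<^bsub>A\<^esub> k \<otimes>\<^bsub>A\<^esub> e))"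
          using dm(1) cm(1) p(1) c(2) by (simp add: A.m_assoc)
        also have "e \<otimes>\<^bsub>A\<^esub> (c [^]\<^bsub>A\<^esub> k \<otimes>\<^bsub>A\<^esub> e) = c [^]\<^bsub>A\<^esub> k \<otimes>\<^bsub>A\<^esub> e"
        proof (cases k)
          case (Suc j)
          have "e \<otimes>\<^bsub>A\<^esub> c [^]\<^bsub>A\<^esub> k = c [^]\<^bsub>A\<^esub> k"
            using cm p(1) unfolding Suc by (simp add: pow_comm1 A.m_assoc[symmetric])
          then show ?thesis using cm(1) p(1) by (simp add: A.m_assoc[symmetric])
        qed (use p in simp)
        finally show ?case using Suc dm(1) cm(1) p(1) by (simp add: A.m_assoc)
      qed (use p in simp)
      from this[of k] have "e = \<zero>\<^bsub>A\<^esub>" using k cm(1) p(1) by simp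
      then show False using p(3) by simp
    qed
  qed
  have "d \<in> J"
  proof (rule mem_J_if_corner_nilpotent[OF m(1)[OF d] p(1) m(2)[OF d]])
    fix z assume z: "z \<in> carrier A"
    have dz: "d \<otimes>\<^bsub>A\<^esub> z \<otimes>\<^bsub>A\<^esub> e \<in> carrier (corner e)"
      using z m[OF d] p by (intro corner_memI) (simp_all add: A.m_assoc[symmetric], simp add: A.m_assoc)
    have False if c: "c \<in> carrier (corner e)" "(d \<otimes>\<^bsub>A\<^esub> z \<otimes>\<^bsub>A\<^esub> e) \<otimes>\<^bsub>A\<^esub> c = e" for c
    proof (rule no_inv)
      note cm = m[OF c(1)]
      show "e \<otimes>\<^bsub>A\<^esub> (z \<otimes>\<^bsub>A\<^esub> c) \<otimes>\<^bsub>A\<^esub> e \<in> carrier (corner e)" using z cm by simp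
      show "d \<otimes>\<^bsub>A\<^esub> (e \<otimes>\<^bsub>A\<^esub> (z \<otimes>\<^bsub>A\<^esub> c) \<otimes>\<^bsub>A\<^esub> e) = e"
      proof -
        have "d \<otimes>\<^bsub>A\<^esub> (e \<otimes>\<^bsub>A\<^esub> (z \<otimes>\<^bsub>A\<^esub> c) \<otimes>\<^bsub>A\<^esub> e) = (d \<otimes>\<^bsub>A\<^esub> e) \<otimes>\<^bsub>A\<^esub> z \<otimes>\<^bsub>A\<^esub> (c \<otimes>\<^bsub>A\<^esub> e)"
          using z cm(1) m(1)[OF d] p(1) by (simp add: A.m_assoc)
        also have "\<dots> = d \<otimes>\<^bsub>A\<^esub> z \<otimes>\<^bsub>A\<^esub> (e \<otimes>\<^bsub>A\<^esub> c)" using cm m[OF d] by simp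
        finally show ?thesis using c(2) z cm(1) m(1)[OF d] p(1) by (simp add: A.m_assoc)
      qed
    qed
    then show "\<exists>k::nat. (d \<otimes>\<^bsub>A\<^esub> z \<otimes>\<^bsub>A\<^esub> e) [^]\<^bsub>A\<^esub> k = \<zero>\<^bsub>A\<^esub>"
      using primitive_dichotomy[OF e dz] by blast
  qed
  then show ?thesis using l dA by (auto simp: b_def)
qed

text \<open>If d = eaf is not in \<open>J\<close>, then some dye is invertible in eAe, with inverse
  c. The element d' = fyc satisfies dd' = e, so d'd is a nonzero idempotent of fAf, hence equal to
  f. Left multiplication by d' is then an isomorphism from eA to fA.\<close>

lemma nonisomorphic_off_diagonal:
  assumes e: "primitive_idempotent A e" and f: "primitive_idempotent A f"
    and noniso: "\<not> rmod_isomorphic A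
      ((regular A)\<lparr>carrier := (\<lambda>a. e \<otimes>\<^bsub>A\<^esub> a) ` carrier A\<rparr>) ((regular A)\<lparr>carrier := (\<lambda>a. f \<otimes>\<^bsub>A\<^esub> a) ` carrier A\<rparr>)"
    and a: "a \<in> carrier A"
  shows "e \<otimes>\<^bsub>A\<^esub> a \<otimes>\<^bsub>A\<^esub> f \<in> J"
proof -
  note p = primitive_idempotentD[OF e] and q = primitive_idempotentD[OF f]
  define d where "d = e \<otimes>\<^bsub>A\<^esub> a \<otimes>\<^bsub>A\<^esub> f"
  have d: "d \<in> carrier A" using a p q by (simp add: d_def)
  have ed: "e \<otimes>\<^bsub>A\<^esub> d = d" using a p q by (simp add: d_def A.m_assoc[symmetric])
  have df: "d \<otimes>\<^bsub>A\<^esub> f = d" using a p q by (simp add: d_def A.m_assoc)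
  have "d \<in> J"
  proof (rule mem_J_if_corner_nilpotent[OF d p(1) ed])
    fix y assume y: "y \<in> carrier A"
    have b: "d \<otimes>\<^bsub>A\<^esub> y \<otimes>\<^bsub>A\<^esub> e \<in> carrier (corner e)"
      using y d p ed by (intro corner_memI) (simp_all add: A.m_assoc[symmetric], simp add: A.m_assoc)
    have False if c: "c \<in> carrier (corner e)" "(d \<otimes>\<^bsub>A\<^esub> y \<otimes>\<^bsub>A\<^esub> e) \<otimes>\<^bsub>A\<^esub> c = e" for c
    proof -
      note cm = corner_mem[OF p(1,2) c(1)]
      define d' where "d' = f \<otimes>\<^bsub>A\<^esub> (y \<otimes>\<^bsub>A\<^esub> c)"
      have d': "d' \<in> carrier A" using y cm q by (simp add: d'_def)
      have fd': "f \<otimes>\<^bsub>A\<^esub> d' = d'" using y cm q by (simp add: d'_def A.m_assoc[symmetric])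
      have d'e: "d' \<otimes>\<^bsub>A\<^esub> e = d'" using y cm q p by (simp add: d'_def A.m_assoc)
      have dd': "d \<otimes>\<^bsub>A\<^esub> d' = e"
      proof -
        have "d \<otimes>\<^bsub>A\<^esub> d' = (d \<otimes>\<^bsub>A\<^esub> f) \<otimes>\<^bsub>A\<^esub> (y \<otimes>\<^bsub>A\<^esub> (e \<otimes>\<^bsub>A\<^esub> c))" using y d q cm p by (simp add: d'_def A.m_assoc[symmetric])
        also have "\<dots> = (d \<otimes>\<^bsub>A\<^esub> y \<otimes>\<^bsub>A\<^esub> e) \<otimes>\<^bsub>A\<^esub> c" unfolding df using y d cm(1) p(1) by (simp only: A.m_assoc A.m_closed)
        finally show ?thesis using c by simp
      qed
      have u: "d' \<otimes>\<^bsub>A\<^esub> d \<in> carrier (corner f)"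
        using d d' fd' df q(1) by (intro corner_memI) (simp_all add: A.m_assoc[symmetric], simp add: A.m_assoc)
      have "(d' \<otimes>\<^bsub>A\<^esub> d) \<otimes>\<^bsub>A\<^esub> (d' \<otimes>\<^bsub>A\<^esub> d) = d' \<otimes>\<^bsub>A\<^esub> ((d \<otimes>\<^bsub>A\<^esub> d') \<otimes>\<^bsub>A\<^esub> d)" using d d' by (simp add: A.m_assoc)
      also have "\<dots> = d' \<otimes>\<^bsub>A\<^esub> d" by (simp add: dd' ed)
      finally have "d' \<otimes>\<^bsub>A\<^esub> d = \<zero>\<^bsub>A\<^esub> \<or> d' \<otimes>\<^bsub>A\<^esub> d = f" by (rule q(4)[OF u])
      moreover have "d' \<otimes>\<^bsub>A\<^esub> d \<noteq> \<zero>\<^bsub>A\<^esub>"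
      proof
        assume 0: "d' \<otimes>\<^bsub>A\<^esub> d = \<zero>\<^bsub>A\<^esub>"
        have "e = (d \<otimes>\<^bsub>A\<^esub> d') \<otimes>\<^bsub>A\<^esub> (d \<otimes>\<^bsub>A\<^esub> d')" by (simp add: dd' p)
        also have "\<dots> = d \<otimes>\<^bsub>A\<^esub> (d' \<otimes>\<^bsub>A\<^esub> d) \<otimes>\<^bsub>A\<^esub> d'" using d d' by (simp add: A.m_assoc)
        finally show False using p(3) d d' by (simp add: 0)
      qed
      ultimately have d'd: "d' \<otimes>\<^bsub>A\<^esub> d = f" by blast
      let ?eA = "(regular A)\<lparr>carrier := (\<lambda>a. e \<otimes>\<^bsub>A\<^esub> a) ` carrier A\<rparr>"
      let ?fA = "(regular A)\<lparr>carrier := (\<lambda>a. f \<otimes>\<^bsub>A\<^esub> a) ` carrier A\<rparr>"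
      have hom: "(\<lambda>x. d' \<otimes>\<^bsub>A\<^esub> x) \<in> rmod_hom A ?eA ?fA"
      proof (rule rmod_homI)
        fix x assume "x \<in> carrier ?eA"
        then obtain t where t: "t \<in> carrier A" "x = e \<otimes>\<^bsub>A\<^esub> t" by auto
        have "d' \<otimes>\<^bsub>A\<^esub> x = f \<otimes>\<^bsub>A\<^esub> (d' \<otimes>\<^bsub>A\<^esub> t)" using t d' p q fd' d'e by (simp add: A.m_assoc[symmetric])
        then show "d' \<otimes>\<^bsub>A\<^esub> x \<in> carrier ?fA" using t d' by simp
      qed (use d' p in \<open>auto simp: A.r_distr A.m_assoc\<close>)
      have "bij_betw (\<lambda>x. d' \<otimes>\<^bsub>A\<^esub> x) (carrier ?eA) (carrier ?fA)"
      proof (rule bij_betw_byWitness[where f' = "\<lambda>x. d \<otimes>\<^bsub>A\<^esub> x"])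
        show "\<forall>x\<in>carrier ?eA. d \<otimes>\<^bsub>A\<^esub> (d' \<otimes>\<^bsub>A\<^esub> x) = x"
          using d d' p by (auto simp: A.m_assoc[symmetric] dd')
        show "\<forall>x\<in>carrier ?fA. d' \<otimes>\<^bsub>A\<^esub> (d \<otimes>\<^bsub>A\<^esub> x) = x"
          using d d' q by (auto simp: A.m_assoc[symmetric] d'd)
        show "(\<lambda>x. d' \<otimes>\<^bsub>A\<^esub> x) ` carrier ?eA \<subseteq> carrier ?fA" using rmod_hom_closed[OF hom] by blast
        show "(\<lambda>x. d \<otimes>\<^bsub>A\<^esub> x) ` carrier ?fA \<subseteq> carrier ?eA"
        proof
          fix z assume "z \<in> (\<lambda>x. d \<otimes>\<^bsub>A\<^esub> x) ` carrier ?fA"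
          then obtain t where t: "t \<in> carrier A" "z = d \<otimes>\<^bsub>A\<^esub> (f \<otimes>\<^bsub>A\<^esub> t)" by auto
          then have "z = e \<otimes>\<^bsub>A\<^esub> (d \<otimes>\<^bsub>A\<^esub> t)" using d p q ed df by (simp add: A.m_assoc[symmetric])
          then show "z \<in> carrier ?eA" using t d by simp
        qed
      qed
      then show False using noniso hom by (auto simp: rmod_isomorphic_def)
    qed
    then show "\<exists>k::nat. (d \<otimes>\<^bsub>A\<^esub> y \<otimes>\<^bsub>A\<^esub> e) [^]\<^bsub>A\<^esub> k = \<zero>\<^bsub>A\<^esub>"
      using primitive_dichotomy[OF e b] by blast
  qed
  then show ?thesis by (simp add: d_def)
qed

end

lemma (in fd_algebra) finsum_mult_right:
  assumes "finite E" "f \<in> E \<rightarrow> carrier A" "a \<in> carrier A"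
  shows "a \<otimes>\<^bsub>A\<^esub> finsum A f E = finsum A (\<lambda>x. a \<otimes>\<^bsub>A\<^esub> f x) E"
    "finsum A f E \<otimes>\<^bsub>A\<^esub> a = finsum A (\<lambda>x. f x \<otimes>\<^bsub>A\<^esub> a) E"
  using assms by (simp_all add: A.finsum_rdistr A.finsum_ldistr)

text \<open>Basicness comes with a complete set \<open>E\<close> of idempotents that need not be the
  one indexing the vertices of the quiver. Commutativity of A/J does not mention idempotents, so it
  carries the information from \<open>E\<close> to any other complete set.\<close>

lemma (in fd_algebra) basic_commutative_mod_J:
  assumes K: "algebraically_closed K" and basic: "basic_algebra A" and a: "a \<in> carrier A" and b: "b \<in> carrier A"
  shows "a \<otimes>\<^bsub>A\<^esub> b \<ominus>\<^bsub>A\<^esub> b \<otimes>\<^bsub>A\<^esub> a \<in> J"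
proof -
  obtain E where E: "complete_primitive_idempotents A E"
    and noniso: "\<And>e f. \<lbrakk>e \<in> E; f \<in> E; e \<noteq> f\<rbrakk> \<Longrightarrow> \<not> rmod_isomorphic A
      ((regular A)\<lparr>carrier := (\<lambda>a. e \<otimes>\<^bsub>A\<^esub> a) ` carrier A\<rparr>) ((regular A)\<lparr>carrier := (\<lambda>a. f \<otimes>\<^bsub>A\<^esub> a) ` carrier A\<rparr>)"
    using basic by (auto simp: basic_algebra_def)
  have fE: "finite E" and prim: "\<And>e. e \<in> E \<Longrightarrow> primitive_idempotent A e"
    and sum1: "finsum A (\<lambda>e. e) E = \<one>\<^bsub>A\<^esub>"
    using E by (auto simp: complete_primitive_idempotents_def)
  note p = primitive_idempotentD[OF prim]
  have Ec: "(\<lambda>e. e) \<in> E \<rightarrow> carrier A" using p(1) by auto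
  have off: "e \<otimes>\<^bsub>A\<^esub> a \<otimes>\<^bsub>A\<^esub> f \<in> J" if "e \<in> E" "f \<in> E" "e \<noteq> f" "a \<in> carrier A" for e f a
    by (rule nonisomorphic_off_diagonal[OF prim[OF that(1)] prim[OF that(2)] noniso[OF that(1-3)] that(4)])
  \<comment> \<open>The elements that are central modulo \<open>J\<close>. They include
    \<open>J\<close> and \<open>E\<close> and are closed under linear combinations. So
    \<open>C\<close> contains every eaf, which is a multiple of e modulo \<open>J\<close> if e = f
    and lies in \<open>J\<close> otherwise.\<close>
  define C where "C = {a \<in> carrier A. \<forall>b\<in>carrier A. a \<otimes>\<^bsub>A\<^esub> b \<ominus>\<^bsub>A\<^esub> b \<otimes>\<^bsub>A\<^esub> a \<in> J}"
  have C_add: "x \<oplus>\<^bsub>A\<^esub> y \<in> C" if "x \<in> C" "y \<in> C" for x y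
  proof -
    have xy: "x \<in> carrier A" "y \<in> carrier A" using that by (auto simp: C_def)
    have "(x \<oplus>\<^bsub>A\<^esub> y) \<otimes>\<^bsub>A\<^esub> b \<ominus>\<^bsub>A\<^esub> b \<otimes>\<^bsub>A\<^esub> (x \<oplus>\<^bsub>A\<^esub> y) = (x \<otimes>\<^bsub>A\<^esub> b \<ominus>\<^bsub>A\<^esub> b \<otimes>\<^bsub>A\<^esub> x) \<oplus>\<^bsub>A\<^esub> (y \<otimes>\<^bsub>A\<^esub> b \<ominus>\<^bsub>A\<^esub> b \<otimes>\<^bsub>A\<^esub> y)"
      if "b \<in> carrier A" for b
      using xy that by (simp add: M.minus_eq A.l_distr A.r_distr M.minus_add M.a_ac)
    then show ?thesis using that xy by (auto simp: C_def intro: J_add)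
  qed
  have C_J: "x \<in> C" if "x \<in> J" for x
    using J_closed[OF that] J_minus[OF J_mult_right[OF that] J_mult_left[OF _ that]] by (simp add: C_def)
  have C_smult: "c \<odot>\<^bsub>A\<^esub> x \<in> C" if "x \<in> C" "c \<in> carrier K" for x c
  proof -
    have x: "x \<in> carrier A" using that by (auto simp: C_def)
    have "(c \<odot>\<^bsub>A\<^esub> x) \<otimes>\<^bsub>A\<^esub> b \<ominus>\<^bsub>A\<^esub> b \<otimes>\<^bsub>A\<^esub> (c \<odot>\<^bsub>A\<^esub> x) = c \<odot>\<^bsub>A\<^esub> (x \<otimes>\<^bsub>A\<^esub> b \<ominus>\<^bsub>A\<^esub> b \<otimes>\<^bsub>A\<^esub> x)"
      if b: "b \<in> carrier A" for b
    proof -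
      have "c \<odot>\<^bsub>A\<^esub> (\<ominus>\<^bsub>A\<^esub> (b \<otimes>\<^bsub>A\<^esub> x)) = \<ominus>\<^bsub>A\<^esub> (c \<odot>\<^bsub>A\<^esub> (b \<otimes>\<^bsub>A\<^esub> x))"
        using x b \<open>c \<in> carrier K\<close> by (simp add: smult_r_minus)
      then show ?thesis
        using x b \<open>c \<in> carrier K\<close> by (simp add: M.minus_eq smult_mult_left smult_mult_right smult_r_distr)
    qed
    then show ?thesis using that x by (auto simp: C_def intro: J_smult)
  qed
  have C_finsum: "finsum A f F \<in> C" if "finite F" "f \<in> F \<rightarrow> C" for f F
    using that
  proof (induct F)
    case empty
    then show ?case using C_J[OF zero_in_J] by simp
  next
    case (insert x F)
    then have "f \<in> F \<rightarrow> carrier A" "f x \<in> carrier A" by (auto simp: C_def)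
    then show ?case using insert C_add by (simp add: M.finsum_insert)
  qed
  \<comment> \<open>With s = 1 - e one has eb - be = ebs - sbe, and both terms are sums of
    off-diagonal pieces, which lie in \<open>J\<close>.\<close>
  have C_E: "e \<in> C" if e: "e \<in> E" for e
  proof -
    have "e \<otimes>\<^bsub>A\<^esub> b \<ominus>\<^bsub>A\<^esub> b \<otimes>\<^bsub>A\<^esub> e \<in> J" if b: "b \<in> carrier A" for b
    proof -
      note ec = p(1)[OF e]
      have rest: "(\<lambda>f. f) \<in> (E - {e}) \<rightarrow> carrier A" using Ec by auto
      have one: "\<one>\<^bsub>A\<^esub> = e \<oplus>\<^bsub>A\<^esub> finsum A (\<lambda>f. f) (E - {e})"
        using sum1 M.finsum_insert[of "E - {e}" e "\<lambda>f. f"] fE ec rest e by (simp add: insert_absorb)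
      define s where "s = finsum A (\<lambda>f. f) (E - {e})"
      have s: "s \<in> carrier A" unfolding s_def by (rule M.finsum_closed[OF rest])
      have eb: "e \<otimes>\<^bsub>A\<^esub> b = e \<otimes>\<^bsub>A\<^esub> b \<otimes>\<^bsub>A\<^esub> e \<oplus>\<^bsub>A\<^esub> e \<otimes>\<^bsub>A\<^esub> b \<otimes>\<^bsub>A\<^esub> s"
      proof -
        have "e \<otimes>\<^bsub>A\<^esub> b = e \<otimes>\<^bsub>A\<^esub> b \<otimes>\<^bsub>A\<^esub> (e \<oplus>\<^bsub>A\<^esub> s)" using one[folded s_def, symmetric] ec b by simp
        then show ?thesis using ec b s by (simp add: A.r_distr)
      qed
      have be: "b \<otimes>\<^bsub>A\<^esub> e = e \<otimes>\<^bsub>A\<^esub> b \<otimes>\<^bsub>A\<^esub> e \<oplus>\<^bsub>A\<^esub> s \<otimes>\<^bsub>A\<^esub> b \<otimes>\<^bsub>A\<^esub> e"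
      proof -
        have "b \<otimes>\<^bsub>A\<^esub> e = (e \<oplus>\<^bsub>A\<^esub> s) \<otimes>\<^bsub>A\<^esub> (b \<otimes>\<^bsub>A\<^esub> e)" using one[folded s_def, symmetric] ec b by simp
        then show ?thesis using ec b s by (simp add: A.l_distr A.m_assoc)
      qed
      have "e \<otimes>\<^bsub>A\<^esub> b \<otimes>\<^bsub>A\<^esub> s \<in> J"
      proof -
        have "e \<otimes>\<^bsub>A\<^esub> b \<otimes>\<^bsub>A\<^esub> s = finsum A (\<lambda>f. e \<otimes>\<^bsub>A\<^esub> b \<otimes>\<^bsub>A\<^esub> f) (E - {e})"
          unfolding s_def using finsum_mult_right(1)[OF _ rest] fE ec b by simp
        also have "\<dots> \<in> J" by (rule J_finsum) (use fE off[OF e _ _ b] in auto)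
        finally show ?thesis .
      qed
      moreover have "s \<otimes>\<^bsub>A\<^esub> b \<otimes>\<^bsub>A\<^esub> e \<in> J"
      proof -
        have "s \<otimes>\<^bsub>A\<^esub> b \<otimes>\<^bsub>A\<^esub> e = finsum A (\<lambda>f. f \<otimes>\<^bsub>A\<^esub> (b \<otimes>\<^bsub>A\<^esub> e)) (E - {e})"
          unfolding s_def using finsum_mult_right(2)[OF _ rest, of "b \<otimes>\<^bsub>A\<^esub> e"] fE ec b s by (simp add: s_def A.m_assoc)
        also have "\<dots> \<in> J"
          by (rule J_finsum) (use fE off[OF _ e _ b] p(1) ec b in \<open>auto simp: A.m_assoc\<close>)
        finally show ?thesis .
      qed
      moreover have "e \<otimes>\<^bsub>A\<^esub> b \<ominus>\<^bsub>A\<^esub> b \<otimes>\<^bsub>A\<^esub> e = e \<otimes>\<^bsub>A\<^esub> b \<otimes>\<^bsub>A\<^esub> s \<ominus>\<^bsub>A\<^esub> s \<otimes>\<^bsub>A\<^esub> b \<otimes>\<^bsub>A\<^esub> e"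
      proof -
        define x where "x = e \<otimes>\<^bsub>A\<^esub> b \<otimes>\<^bsub>A\<^esub> e"
        define y where "y = e \<otimes>\<^bsub>A\<^esub> b \<otimes>\<^bsub>A\<^esub> s"
        define z where "z = s \<otimes>\<^bsub>A\<^esub> b \<otimes>\<^bsub>A\<^esub> e"
        have "x \<in> carrier A" "y \<in> carrier A" "z \<in> carrier A" using ec b s by (simp_all add: x_def y_def z_def)
        then have "(x \<oplus>\<^bsub>A\<^esub> y) \<ominus>\<^bsub>A\<^esub> (x \<oplus>\<^bsub>A\<^esub> z) = y \<ominus>\<^bsub>A\<^esub> z"
          by (simp add: M.minus_eq M.minus_add M.a_assoc M.a_lcomm[of x y] M.r_neg1 M.r_neg2)
        then show ?thesis unfolding x_def y_def z_def eb[symmetric] be[symmetric] .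
      qed
      ultimately show ?thesis by (simp add: J_minus)
    qed
    then show ?thesis using p(1)[OF e] by (simp add: C_def)
  qed
  have C_eaf: "e \<otimes>\<^bsub>A\<^esub> a \<otimes>\<^bsub>A\<^esub> f \<in> C" if e: "e \<in> E" and f: "f \<in> E" for e f
  proof (cases "e = f")
    case True
    obtain c where c: "c \<in> carrier K" "e \<otimes>\<^bsub>A\<^esub> a \<otimes>\<^bsub>A\<^esub> e \<ominus>\<^bsub>A\<^esub> c \<odot>\<^bsub>A\<^esub> e \<in> J"
      using primitive_corner_scalar[OF K prim[OF e] a] by blast
    have "(e \<otimes>\<^bsub>A\<^esub> a \<otimes>\<^bsub>A\<^esub> e \<ominus>\<^bsub>A\<^esub> c \<odot>\<^bsub>A\<^esub> e) \<oplus>\<^bsub>A\<^esub> c \<odot>\<^bsub>A\<^esub> e \<in> C"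
      by (rule C_add[OF C_J[OF c(2)] C_smult[OF C_E[OF e] c(1)]])
    then show ?thesis using True a p(1)[OF e] c(1) by (simp add: M.minus_eq M.a_assoc M.l_neg)
  next
    case False
    then show ?thesis using C_J[OF off[OF e f _ a]] by simp
  qed
  have "a = finsum A (\<lambda>e. e) E \<otimes>\<^bsub>A\<^esub> a" using a sum1 by simp
  also have "\<dots> = finsum A (\<lambda>e. e \<otimes>\<^bsub>A\<^esub> a) E" by (rule finsum_mult_right(2)[OF fE Ec a])
  also have "\<dots> \<in> C"
  proof (rule C_finsum[OF fE], rule Pi_I)
    fix e assume e: "e \<in> E"
    have ea: "e \<otimes>\<^bsub>A\<^esub> a \<in> carrier A" using p(1)[OF e] a by simp
    have "e \<otimes>\<^bsub>A\<^esub> a = (e \<otimes>\<^bsub>A\<^esub> a) \<otimes>\<^bsub>A\<^esub> finsum A (\<lambda>e. e) E" using ea sum1 by simp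
    also have "\<dots> = finsum A (\<lambda>f. e \<otimes>\<^bsub>A\<^esub> a \<otimes>\<^bsub>A\<^esub> f) E" by (rule finsum_mult_right(1)[OF fE Ec ea])
    also have "\<dots> \<in> C" by (rule C_finsum[OF fE]) (use C_eaf[OF e] in auto)
    finally show "e \<otimes>\<^bsub>A\<^esub> a \<in> C" .
  qed
  finally show ?thesis using b by (simp add: C_def)
qed

lemma basic_split_algebra:
  assumes K: "algebraically_closed K" and A: "fd_algebra K A" and basic: "basic_algebra A"
    and sq: "radical_square_zero A" and inj: "inj_on \<epsilon> V"
    and E: "complete_primitive_idempotents A (\<epsilon> ` V)"
  shows "split_algebra K A \<epsilon> V"
proof -
  interpret A: fd_algebra K A by fact
  have prim: "primitive_idempotent A (\<epsilon> v)" if "v \<in> V" for v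
    using E that by (auto simp: complete_primitive_idempotents_def)
  note p = A.primitive_idempotentD[OF prim]
  show ?thesis
  proof (intro split_algebra.intro[OF A] split_algebra_axioms.intro)
    fix x y assume "x \<in> A.J" "y \<in> A.J"
    then have "x \<otimes>\<^bsub>A\<^esub> y \<in> ideal_prod A A.J A.J" by (rule ideal_prod.prod)
    then show "x \<otimes>\<^bsub>A\<^esub> y = \<zero>\<^bsub>A\<^esub>" using sq by (simp add: radical_square_zero_def)
  next
    show "finite V" using E inj by (auto simp: complete_primitive_idempotents_def dest: finite_imageD)
    have "finsum A (\<lambda>e. e) (\<epsilon> ` V) = finsum A \<epsilon> V"
      using A.M.finsum_reindex[of "\<lambda>e. e" \<epsilon> V] inj p(1) by (auto simp: image_subset_iff Pi_iff)
    then show "finsum A \<epsilon> V = \<one>\<^bsub>A\<^esub>" using E by (simp add: complete_primitive_idempotents_def)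
  next
    fix v assume v: "v \<in> V"
    show "\<epsilon> v \<in> carrier A" "\<epsilon> v \<otimes>\<^bsub>A\<^esub> \<epsilon> v = \<epsilon> v" "\<epsilon> v \<noteq> \<zero>\<^bsub>A\<^esub>" using p[OF v] by auto
    { fix a assume a: "a \<in> carrier A"
      show "\<exists>c\<in>carrier K. \<epsilon> v \<otimes>\<^bsub>A\<^esub> a \<otimes>\<^bsub>A\<^esub> \<epsilon> v \<ominus>\<^bsub>A\<^esub> c \<odot>\<^bsub>A\<^esub> \<epsilon> v \<in> A.J"
        by (rule A.primitive_corner_scalar[OF K prim[OF v] a]) }
    fix w assume w: "w \<in> V" "v \<noteq> w"
    then have "\<epsilon> v \<noteq> \<epsilon> w" using inj v by (auto simp: inj_on_def)
    then have o: "\<epsilon> v \<otimes>\<^bsub>A\<^esub> \<epsilon> w = \<zero>\<^bsub>A\<^esub>" "\<epsilon> w \<otimes>\<^bsub>A\<^esub> \<epsilon> v = \<zero>\<^bsub>A\<^esub>"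
      using E v w(1) by (auto simp: complete_primitive_idempotents_def orthogonal_in_def)
    then show "\<epsilon> v \<otimes>\<^bsub>A\<^esub> \<epsilon> w = \<zero>\<^bsub>A\<^esub>" by simp
    fix a assume a: "a \<in> carrier A"
    \<comment> \<open>The commutator with \<open>\<epsilon> w\<close> lies in \<open>J\<close>, and
      its second term vanishes by orthogonality. What remains is the off-diagonal piece.\<close>
    have "(\<epsilon> v \<otimes>\<^bsub>A\<^esub> a) \<otimes>\<^bsub>A\<^esub> \<epsilon> w \<ominus>\<^bsub>A\<^esub> \<epsilon> w \<otimes>\<^bsub>A\<^esub> (\<epsilon> v \<otimes>\<^bsub>A\<^esub> a) \<in> A.J"
      using A.basic_commutative_mod_J[OF K basic] a p(1)[OF v] p(1)[OF w(1)] by simp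
    moreover have "\<epsilon> w \<otimes>\<^bsub>A\<^esub> (\<epsilon> v \<otimes>\<^bsub>A\<^esub> a) = \<zero>\<^bsub>A\<^esub>"
      using a p(1)[OF v] p(1)[OF w(1)] o by (simp add: A.A.m_assoc[symmetric])
    ultimately show "\<epsilon> v \<otimes>\<^bsub>A\<^esub> a \<otimes>\<^bsub>A\<^esub> \<epsilon> w \<in> A.J"
      using a p(1)[OF v] p(1)[OF w(1)] A.M.minus_equality[of "\<zero>\<^bsub>A\<^esub>" "\<zero>\<^bsub>A\<^esub>"] by (simp add: A.M.minus_eq)
  qed
qed

section \<open>The triangular algebra\<close>

lemma direct_sum_simps [simp]:
  "carrier (direct_sum V W) = carrier V \<times> carrier W"
  "zero (direct_sum V W) = (\<zero>\<^bsub>V\<^esub>, \<zero>\<^bsub>W\<^esub>)"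
  "add (direct_sum V W) x y = (fst x \<oplus>\<^bsub>V\<^esub> fst y, snd x \<oplus>\<^bsub>W\<^esub> snd y)"
  "smult (direct_sum V W) c x = (c \<odot>\<^bsub>V\<^esub> fst x, c \<odot>\<^bsub>W\<^esub> snd x)"
  by (simp_all add: direct_sum_def)

text \<open>The span of the two embedded spanning sets contains V x 0 and 0 x W: the elements of
  \<open>V\<close> that embed into it form a subspace containing \<open>S\<close>, and likewise for
  \<open>W\<close> and \<open>T\<close>.\<close>

lemma direct_sum_fin_dim:
  assumes V: "vectorspace K V" and W: "vectorspace K W"
    and fd: "vectorspace.fin_dim K V" "vectorspace.fin_dim K W"
  shows "vectorspace.fin_dim K (direct_sum V W)"
proof -
  interpret V: vectorspace K V by fact
  interpret W: vectorspace K W by fact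
  interpret D: vectorspace K "direct_sum V W" by (rule direct_sum_is_vs[OF V W])
  obtain S where S: "finite S" "S \<subseteq> carrier V" "V.span S = carrier V" using fd(1) by (auto simp: V.fin_dim_def)
  obtain T where T: "finite T" "T \<subseteq> carrier W" "W.span T = carrier W" using fd(2) by (auto simp: W.fin_dim_def)
  define U where "U = (\<lambda>x. (x, \<zero>\<^bsub>W\<^esub>)) ` S \<union> (\<lambda>y. (\<zero>\<^bsub>V\<^esub>, y)) ` T"
  have U: "finite U" "U \<subseteq> carrier (direct_sum V W)" using S T by (auto simp: U_def)
  have sp: "submodule K (D.span U) (direct_sum V W)" by (rule D.span_is_submodule[OF U(2)])
  have US: "U \<subseteq> D.span U" by (rule D.in_own_span[OF U(2)])
  have z: "(\<zero>\<^bsub>V\<^esub>, \<zero>\<^bsub>W\<^esub>) \<in> D.span U" using submodule.zero_closed[OF sp] by simp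
  have ad: "(fst x \<oplus>\<^bsub>V\<^esub> fst y, snd x \<oplus>\<^bsub>W\<^esub> snd y) \<in> D.span U" if "x \<in> D.span U" "y \<in> D.span U" for x y
    using submodule.m_closed[OF sp that] by simp
  have sm: "(c \<odot>\<^bsub>V\<^esub> fst x, c \<odot>\<^bsub>W\<^esub> snd x) \<in> D.span U" if "c \<in> carrier K" "x \<in> D.span U" for c x
    using submodule.smult_closed[OF sp that] by simp
  have "V.span S \<subseteq> {x \<in> carrier V. (x, \<zero>\<^bsub>W\<^esub>) \<in> D.span U}"
  proof (rule V.span_is_subset)
    show "S \<subseteq> {x \<in> carrier V. (x, \<zero>\<^bsub>W\<^esub>) \<in> D.span U}" using S US by (auto simp: U_def)
    show "submodule K {x \<in> carrier V. (x, \<zero>\<^bsub>W\<^esub>) \<in> D.span U} V"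
      unfolding submodule_def using z ad sm by (fastforce simp: V.module_axioms)
  qed
  moreover have "W.span T \<subseteq> {y \<in> carrier W. (\<zero>\<^bsub>V\<^esub>, y) \<in> D.span U}"
  proof (rule W.span_is_subset)
    show "T \<subseteq> {y \<in> carrier W. (\<zero>\<^bsub>V\<^esub>, y) \<in> D.span U}" using T US by (auto simp: U_def)
    show "submodule K {y \<in> carrier W. (\<zero>\<^bsub>V\<^esub>, y) \<in> D.span U} W"
      unfolding submodule_def using z ad sm by (fastforce simp: W.module_axioms)
  qed
  ultimately have "x \<in> D.span U" if "x \<in> carrier (direct_sum V W)" for x
    using ad[of "(fst x, \<zero>\<^bsub>W\<^esub>)" "(\<zero>\<^bsub>V\<^esub>, snd x)"] that S(3) T(3) by (auto simp: subset_iff)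
  then have "D.span U = carrier (direct_sum V W)"
    using D.span_is_subset2[OF U(2)] by blast
  then show ?thesis unfolding D.fin_dim_def using U by blast
qed

text \<open>Actions of and on cosets are defined by \<open>the_elem\<close> of the set of all
  values. This evaluates them once the value is known to be independent of the
  representative.\<close>

lemma the_elem_image_const:
  assumes "x \<in> S" "\<And>y. y \<in> S \<Longrightarrow> f y = f x"
  shows "the_elem (f ` S) = f x"
proof -
  have "f ` S = {f x}" using assms by blast
  then show ?thesis by simp
qed

section \<open>The quotient by the radical\<close>

context fd_algebra
begin

interpretation Q: rmod_quotient K A "regular A" J
  by (rule rmod_quotient.intro[OF regular_fd]) (simp add: rmod_quotient_axioms_def J_rsubmodule)

abbreviation "qc a \<equiv> J +>\<^bsub>A\<^esub> a"
abbreviation "B \<equiv> quot_algebra A J"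

lemma coset_regular [simp]: "I +>\<^bsub>regular A\<^esub> a = I +>\<^bsub>A\<^esub> a"
  by (simp add: a_r_coset_def')

lemma set_add_regular [simp]: "set_add (regular A) = set_add A"
  by (simp add: fun_eq_iff set_add_def')

lemma J_ideal: "ideal J A"
proof (rule idealI)
  show "ring A" by (rule A.ring_axioms)
  show "subgroup J (add_monoid A)"
    by (rule M.add.subgroupI) (auto simp: J_closed J_add J_uminus zero_in_J simp flip: a_inv_def intro: zero_in_J)
qed (simp_all add: J_mult_left J_mult_right)

lemma carrier_B: "carrier B = qc ` carrier A"
  by (auto simp: quot_algebra_def FactRing_def A_RCOSETS_def')

lemma qc_closed [simp]: "a \<in> carrier A \<Longrightarrow> qc a \<in> carrier B"
  by (simp add: carrier_B)

lemma qc_ops: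
  "\<lbrakk>a \<in> carrier A; b \<in> carrier A\<rbrakk> \<Longrightarrow> qc a \<oplus>\<^bsub>B\<^esub> qc b = qc (a \<oplus>\<^bsub>A\<^esub> b)"
  "\<lbrakk>a \<in> carrier A; b \<in> carrier A\<rbrakk> \<Longrightarrow> qc a \<otimes>\<^bsub>B\<^esub> qc b = qc (a \<otimes>\<^bsub>A\<^esub> b)"
  "\<lbrakk>c \<in> carrier K; a \<in> carrier A\<rbrakk> \<Longrightarrow> c \<odot>\<^bsub>B\<^esub> qc a = qc (c \<odot>\<^bsub>A\<^esub> a)"
  "\<zero>\<^bsub>B\<^esub> = qc \<zero>\<^bsub>A\<^esub>" "\<one>\<^bsub>B\<^esub> = qc \<one>\<^bsub>A\<^esub>"
  using Q.coset_add[of a b] Q.coset_smult[of c a] Q.coset_zero ideal.rcoset_mult_add[OF J_ideal, of a b]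
  by (simp_all add: quot_algebra_def FactRing_def quot_rmodule_def)

lemma qc_eq_iff: "\<lbrakk>a \<in> carrier A; b \<in> carrier A\<rbrakk> \<Longrightarrow> qc a = qc b \<longleftrightarrow> a \<ominus>\<^bsub>A\<^esub> b \<in> J"
  using Q.coset_eq_iff[of a b] by (simp add: a_minus_def a_inv_def m_inv_def)

lemma qc_rep: "b \<in> carrier B \<Longrightarrow> \<exists>a\<in>carrier A. b = qc a"
  by (auto simp: carrier_B)

lemma qc_mem: "x \<in> qc a \<longleftrightarrow> (\<exists>i\<in>J. x = i \<oplus>\<^bsub>A\<^esub> a)"
  by (auto simp: a_r_coset_def')

lemma fd_algebra_B: "fd_algebra K B"
  by (rule fd_algebra_surj_image[OF fd_algebra_axioms, of qc]) (simp_all add: carrier_B qc_ops)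

end

section \<open>Triangular matrices over A/J and J\<close>

context split_algebra
begin

abbreviation "\<Delta> \<equiv> triangular_algebra A"

text \<open>Representatives differ by elements of \<open>J\<close>, which annihilate
  \<open>j\<close> because J^2 = 0.\<close>

lemma left_action_coset:
  assumes "a \<in> carrier A" "j \<in> J"
  shows "the_elem ((\<lambda>x. x \<otimes>\<^bsub>A\<^esub> j) ` qc a) = a \<otimes>\<^bsub>A\<^esub> j"
  by (rule the_elem_image_const)
    (use assms J_closed zero_in_J in \<open>auto simp: qc_mem A.l_distr J_square\<close>)

text \<open>Intended for elements of \<open>J\<close> itself, of M/MJ and of MJ, all of which are
  annihilated by \<open>J\<close> on the right.\<close>

lemma right_action_coset:
  assumes M: "fd_rmodule K A M" and x: "x \<in> carrier M" and xJ: "\<And>i. i \<in> J \<Longrightarrow> x \<triangleleft>\<^bsub>M\<^esub> i = \<zero>\<^bsub>M\<^esub>"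
    and a: "a \<in> carrier A"
  shows "the_elem ((\<lambda>b. x \<triangleleft>\<^bsub>M\<^esub> b) ` qc a) = x \<triangleleft>\<^bsub>M\<^esub> a"
proof -
  interpret M: fd_rmodule K A M by fact
  show ?thesis
    by (rule the_elem_image_const)
      (use assms J_closed zero_in_J in \<open>auto simp: qc_mem M.ract_add_right M.ract_closed\<close>)
qed

lemma triangular_simps:
  "carrier \<Delta> = carrier B \<times> J \<times> carrier B"
  "\<one>\<^bsub>\<Delta>\<^esub> = (qc \<one>\<^bsub>A\<^esub>, \<zero>\<^bsub>A\<^esub>, qc \<one>\<^bsub>A\<^esub>)" "\<zero>\<^bsub>\<Delta>\<^esub> = (qc \<zero>\<^bsub>A\<^esub>, \<zero>\<^bsub>A\<^esub>, qc \<zero>\<^bsub>A\<^esub>)"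
  "(r, j, s) \<oplus>\<^bsub>\<Delta>\<^esub> (r', j', s') = (r \<oplus>\<^bsub>B\<^esub> r', j \<oplus>\<^bsub>A\<^esub> j', s \<oplus>\<^bsub>B\<^esub> s')"
  "c \<odot>\<^bsub>\<Delta>\<^esub> (r, j, s) = (c \<odot>\<^bsub>B\<^esub> r, c \<odot>\<^bsub>A\<^esub> j, c \<odot>\<^bsub>B\<^esub> s)"
  by (simp_all add: triangular_algebra_def Let_def qc_ops)

lemma triangular_mult:
  assumes "a \<in> carrier A" "j \<in> J" "b \<in> carrier A" "a' \<in> carrier A" "j' \<in> J" "b' \<in> carrier A"
  shows "(qc a, j, qc b) \<otimes>\<^bsub>\<Delta>\<^esub> (qc a', j', qc b') = (qc (a \<otimes>\<^bsub>A\<^esub> a'), a \<otimes>\<^bsub>A\<^esub> j' \<oplus>\<^bsub>A\<^esub> j \<otimes>\<^bsub>A\<^esub> b', qc (b \<otimes>\<^bsub>A\<^esub> b'))"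
  using left_action_coset[OF assms(1,5)] right_action_coset[OF regular_fd, of j b'] assms J_closed J_square
  by (simp add: triangular_algebra_def Let_def qc_ops)

lemma triangular_rep:
  assumes "d \<in> carrier \<Delta>"
  shows "\<exists>a j b. a \<in> carrier A \<and> j \<in> J \<and> b \<in> carrier A \<and> d = (qc a, j, qc b)"
  using assms by (auto simp: triangular_simps dest!: qc_rep)

lemma triangular_memI [simp]: "\<lbrakk>a \<in> carrier A; j \<in> J; b \<in> carrier A\<rbrakk> \<Longrightarrow> (qc a, j, qc b) \<in> carrier \<Delta>"
  by (simp add: triangular_simps)

lemma fd_algebra_triangular: "fd_algebra K \<Delta>"
proof -
  interpret B: fd_algebra K B by (rule fd_algebra_B)
  have Jsub: "subspace K J A" using fd_rmodule.rsubmodule_subspace[OF regular_fd J_rsubmodule]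
    by (auto simp: subspace_def submodule_def vectorspace_axioms module_axioms)
  have JV: "vectorspace K (A\<lparr>carrier := J\<rparr>)" by (rule subspace_is_vs[OF Jsub])
  have Jfd: "vectorspace.fin_dim K (A\<lparr>carrier := J\<rparr>)" by (rule subspace_fin_dim[OF Jsub fin_dim])
  \<comment> \<open>The underlying space is the direct sum of B, J and B, which supplies the vector
    space axioms and finite dimension.\<close>
  let ?D1 = "direct_sum (A\<lparr>carrier := J\<rparr>) B" and ?D = "direct_sum B (direct_sum (A\<lparr>carrier := J\<rparr>) B)"
  have D1: "vectorspace K ?D1" by (rule direct_sum_is_vs[OF JV B.vectorspace_axioms])
  have D: "vectorspace K ?D" by (rule direct_sum_is_vs[OF B.vectorspace_axioms D1])
  have Dfd: "vectorspace.fin_dim K ?D"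
    by (rule direct_sum_fin_dim[OF B.vectorspace_axioms D1 B.fin_dim direct_sum_fin_dim[OF JV B.vectorspace_axioms Jfd B.fin_dim]])
  have V: "vectorspace K \<Delta>"
    by (rule vectorspace_surj_image(1)[where \<pi> = "\<lambda>x. x", OF D]) (auto simp: triangular_simps qc_ops)
  have fd: "vectorspace.fin_dim K \<Delta>"
    by (rule vectorspace_surj_image(2)[where \<pi> = "\<lambda>x. x", OF D _ _ _ _ Dfd]) (auto simp: triangular_simps qc_ops)
  interpret V: vectorspace K \<Delta> by (rule V)
  note ops = triangular_mult J_mult_left J_mult_right J_add J_smult J_closed
  have "ring \<Delta>"
  proof (rule ringI)
    show "abelian_group \<Delta>" by (rule V.M.abelian_group_axioms)
    show "monoid \<Delta>"
    proof (rule monoidI)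
      show "\<one>\<^bsub>\<Delta>\<^esub> \<in> carrier \<Delta>" by (simp add: triangular_simps zero_in_J)
      fix x assume "x \<in> carrier \<Delta>"
      then obtain a j b where x: "a \<in> carrier A" "j \<in> J" "b \<in> carrier A" "x = (qc a, j, qc b)"
        using triangular_rep by blast
      show "\<one>\<^bsub>\<Delta>\<^esub> \<otimes>\<^bsub>\<Delta>\<^esub> x = x" "x \<otimes>\<^bsub>\<Delta>\<^esub> \<one>\<^bsub>\<Delta>\<^esub> = x"
        using x by (simp_all add: triangular_simps(2) ops zero_in_J)
      fix y assume "y \<in> carrier \<Delta>"
      then obtain a' j' b' where y: "a' \<in> carrier A" "j' \<in> J" "b' \<in> carrier A" "y = (qc a', j', qc b')"
        using triangular_rep by blast
      show "x \<otimes>\<^bsub>\<Delta>\<^esub> y \<in> carrier \<Delta>" using x y by (simp add: ops)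
      fix z assume "z \<in> carrier \<Delta>"
      then obtain a'' j'' b'' where z: "a'' \<in> carrier A" "j'' \<in> J" "b'' \<in> carrier A" "z = (qc a'', j'', qc b'')"
        using triangular_rep by blast
      show "x \<otimes>\<^bsub>\<Delta>\<^esub> y \<otimes>\<^bsub>\<Delta>\<^esub> z = x \<otimes>\<^bsub>\<Delta>\<^esub> (y \<otimes>\<^bsub>\<Delta>\<^esub> z)"
        using x y z by (simp add: ops A.m_assoc A.r_distr A.l_distr M.a_assoc)
    qed
    fix x y z assume "x \<in> carrier \<Delta>" "y \<in> carrier \<Delta>" "z \<in> carrier \<Delta>"
    then obtain a j b a' j' b' a'' j'' b'' where x: "a \<in> carrier A" "j \<in> J" "b \<in> carrier A" "x = (qc a, j, qc b)"
      and y: "a' \<in> carrier A" "j' \<in> J" "b' \<in> carrier A" "y = (qc a', j', qc b')"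
      and z: "a'' \<in> carrier A" "j'' \<in> J" "b'' \<in> carrier A" "z = (qc a'', j'', qc b'')"
      using triangular_rep by meson
    show "(x \<oplus>\<^bsub>\<Delta>\<^esub> y) \<otimes>\<^bsub>\<Delta>\<^esub> z = x \<otimes>\<^bsub>\<Delta>\<^esub> z \<oplus>\<^bsub>\<Delta>\<^esub> y \<otimes>\<^bsub>\<Delta>\<^esub> z"
      "z \<otimes>\<^bsub>\<Delta>\<^esub> (x \<oplus>\<^bsub>\<Delta>\<^esub> y) = z \<otimes>\<^bsub>\<Delta>\<^esub> x \<oplus>\<^bsub>\<Delta>\<^esub> z \<otimes>\<^bsub>\<Delta>\<^esub> y"
      using x y z by (simp_all add: triangular_simps(4) qc_ops ops A.r_distr A.l_distr M.a_ac)
  qed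
  then interpret R: ring \<Delta> .
  show ?thesis
  proof
    show "vectorspace.fin_dim K \<Delta>" by (rule fd)
    fix c x y assume c: "c \<in> carrier K" and "x \<in> carrier \<Delta>" "y \<in> carrier \<Delta>"
    then obtain a j b a' j' b' where x: "a \<in> carrier A" "j \<in> J" "b \<in> carrier A" "x = (qc a, j, qc b)"
      and y: "a' \<in> carrier A" "j' \<in> J" "b' \<in> carrier A" "y = (qc a', j', qc b')"
      using triangular_rep by meson
    show "(c \<odot>\<^bsub>\<Delta>\<^esub> x) \<otimes>\<^bsub>\<Delta>\<^esub> y = c \<odot>\<^bsub>\<Delta>\<^esub> (x \<otimes>\<^bsub>\<Delta>\<^esub> y)" "x \<otimes>\<^bsub>\<Delta>\<^esub> (c \<odot>\<^bsub>\<Delta>\<^esub> y) = c \<odot>\<^bsub>\<Delta>\<^esub> (x \<otimes>\<^bsub>\<Delta>\<^esub> y)"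
      using c x y by (simp_all add: triangular_simps(5) qc_ops ops smult_mult_left smult_mult_right smult_r_distr)
  qed
qed

end

section \<open>The functor to modules over the triangular algebra\<close>

context split_algebra
begin

abbreviation "FF M \<equiv> functor_F A M"
abbreviation "\<kappa> M x \<equiv> ideal_action M J +>\<^bsub>M\<^esub> x"

lemma MJ_quotient:
  assumes "fd_rmodule K A M"
  shows "rmod_quotient K A M (ideal_action M J)"
proof -
  interpret M: fd_rmodule K A M by fact
  show ?thesis by (simp add: rmod_quotient_def rmod_quotient_axioms_def assms M.MJ_rsubmodule)
qed

text \<open>Representatives differ by elements of MJ, and (MJ)J = 0.\<close>

lemma phi_coset:
  assumes M: "fd_rmodule K A M" and x: "x \<in> carrier M" and j: "j \<in> J"
  shows "the_elem ((\<lambda>x. x \<triangleleft>\<^bsub>M\<^esub> j) ` \<kappa> M x) = x \<triangleleft>\<^bsub>M\<^esub> j"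
proof -
  interpret M: fd_rmodule K A M by fact
  show ?thesis
  proof (rule the_elem_image_const)
    have "x = \<zero>\<^bsub>M\<^esub> \<oplus>\<^bsub>M\<^esub> x" using x by simp
    then show "x \<in> \<kappa> M x" using rsubmoduleD(2)[OF M.MJ_rsubmodule] by (auto simp: a_r_coset_def')
    fix y assume "y \<in> \<kappa> M x"
    then obtain m where m: "m \<in> M.MJ" "y = m \<oplus>\<^bsub>M\<^esub> x" by (auto simp: a_r_coset_def')
    then show "y \<triangleleft>\<^bsub>M\<^esub> j = x \<triangleleft>\<^bsub>M\<^esub> j"
      using x j J_closed M.MJ_subset[OF m(1)] MJ_J_zero[OF M m(1) j] by (simp add: M.ract_add_left M.ract_closed)
  qed
qed

lemma quot_act_coset:
  assumes M: "fd_rmodule K A M" and x: "x \<in> carrier M" and a: "a \<in> carrier A"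
  shows "the_elem ((\<lambda>a. \<kappa> M x \<triangleleft>\<^bsub>quot_rmodule M (ideal_action M J)\<^esub> a) ` qc a) = \<kappa> M (x \<triangleleft>\<^bsub>M\<^esub> a)"
proof -
  interpret Q: rmod_quotient K A M "ideal_action M J" by (rule MJ_quotient[OF M])
  have fq: "fd_rmodule K A (quot_rmodule M (ideal_action M J))" by (rule Q.fd_rmodule_quot)
  have z: "Q.coset x \<triangleleft>\<^bsub>quot_rmodule M (ideal_action M J)\<^esub> i = \<zero>\<^bsub>quot_rmodule M (ideal_action M J)\<^esub>" if "i \<in> J" for i
    using x that J_closed[OF that] Q.coset_eq_zero_iff[of "x \<triangleleft>\<^bsub>M\<^esub> i"]
    by (simp add: Q.coset_ract Q.ract_closed ideal_action.prod)
  show ?thesis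
    using right_action_coset[OF fq Q.coset_closed[OF x] z a] x a by (simp add: Q.coset_ract)
qed

lemma FF_simps:
  assumes M: "fd_rmodule K A M"
  shows "carrier (FF M) = \<kappa> M ` carrier M \<times> ideal_action M J"
    "\<zero>\<^bsub>FF M\<^esub> = (\<kappa> M \<zero>\<^bsub>M\<^esub>, \<zero>\<^bsub>M\<^esub>)"
    "\<lbrakk>x \<in> carrier M; x' \<in> carrier M\<rbrakk> \<Longrightarrow> (\<kappa> M x, y) \<oplus>\<^bsub>FF M\<^esub> (\<kappa> M x', y') = (\<kappa> M (x \<oplus>\<^bsub>M\<^esub> x'), y \<oplus>\<^bsub>M\<^esub> y')"
    "\<lbrakk>c \<in> carrier K; x \<in> carrier M\<rbrakk> \<Longrightarrow> c \<odot>\<^bsub>FF M\<^esub> (\<kappa> M x, y) = (\<kappa> M (c \<odot>\<^bsub>M\<^esub> x), c \<odot>\<^bsub>M\<^esub> y)"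
    "\<lbrakk>x \<in> carrier M; y \<in> ideal_action M J; a \<in> carrier A; j \<in> J; b \<in> carrier A\<rbrakk> \<Longrightarrow>
      (\<kappa> M x, y) \<triangleleft>\<^bsub>FF M\<^esub> (qc a, j, qc b) = (\<kappa> M (x \<triangleleft>\<^bsub>M\<^esub> a), x \<triangleleft>\<^bsub>M\<^esub> j \<oplus>\<^bsub>M\<^esub> y \<triangleleft>\<^bsub>M\<^esub> b)"
proof -
  interpret Q: rmod_quotient K A M "ideal_action M J" by (rule MJ_quotient[OF M])
  note defs = functor_F_def Let_def triplet_module_def descend_def
  show "carrier (FF M) = \<kappa> M ` carrier M \<times> ideal_action M J"
    by (simp add: defs Q.carrier_quot)
  show "\<zero>\<^bsub>FF M\<^esub> = (\<kappa> M \<zero>\<^bsub>M\<^esub>, \<zero>\<^bsub>M\<^esub>)" by (simp add: defs Q.coset_zero)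
  show "\<lbrakk>x \<in> carrier M; x' \<in> carrier M\<rbrakk> \<Longrightarrow> (\<kappa> M x, y) \<oplus>\<^bsub>FF M\<^esub> (\<kappa> M x', y') = (\<kappa> M (x \<oplus>\<^bsub>M\<^esub> x'), y \<oplus>\<^bsub>M\<^esub> y')"
    by (simp add: defs Q.coset_add)
  show "\<lbrakk>c \<in> carrier K; x \<in> carrier M\<rbrakk> \<Longrightarrow> c \<odot>\<^bsub>FF M\<^esub> (\<kappa> M x, y) = (\<kappa> M (c \<odot>\<^bsub>M\<^esub> x), c \<odot>\<^bsub>M\<^esub> y)"
    by (simp add: defs Q.coset_smult)
  assume a: "x \<in> carrier M" "y \<in> ideal_action M J" "a \<in> carrier A" "j \<in> J" "b \<in> carrier A"
  show "(\<kappa> M x, y) \<triangleleft>\<^bsub>FF M\<^esub> (qc a, j, qc b) = (\<kappa> M (x \<triangleleft>\<^bsub>M\<^esub> a), x \<triangleleft>\<^bsub>M\<^esub> j \<oplus>\<^bsub>M\<^esub> y \<triangleleft>\<^bsub>M\<^esub> b)"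
    using quot_act_coset[OF M a(1,3)] phi_coset[OF M a(1,4)]
      right_action_coset[OF M Q.MJ_subset[OF a(2)] MJ_J_zero[OF M a(2)] a(5)]
    by (simp add: defs)
qed

lemma FF_rep:
  assumes "fd_rmodule K A M" "p \<in> carrier (FF M)"
  shows "\<exists>x y. x \<in> carrier M \<and> y \<in> ideal_action M J \<and> p = (\<kappa> M x, y)"
  using assms by (auto simp: FF_simps)

lemma FF_memI: "\<lbrakk>fd_rmodule K A M; x \<in> carrier M; y \<in> ideal_action M J\<rbrakk> \<Longrightarrow> (\<kappa> M x, y) \<in> carrier (FF M)"
  by (simp add: FF_simps)

lemma fd_rmodule_FF:
  assumes M: "fd_rmodule K A M"
  shows "fd_rmodule K \<Delta> (FF M)"
proof -
  interpret Q: rmod_quotient K A M "ideal_action M J" by (rule MJ_quotient[OF M])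
  interpret q: fd_rmodule K A "quot_rmodule M (ideal_action M J)" by (rule Q.fd_rmodule_quot)
  interpret m: fd_rmodule K A "M\<lparr>carrier := ideal_action M J\<rparr>" by (rule Q.fd_rmodule_submodule[OF Q.MJ_rsubmodule])
  interpret D: fd_algebra K \<Delta> by (rule fd_algebra_triangular)
  let ?D = "direct_sum (quot_rmodule M (ideal_action M J)) (M\<lparr>carrier := ideal_action M J\<rparr>)"
  have D: "vectorspace K ?D" by (rule direct_sum_is_vs[OF q.vectorspace_axioms m.vectorspace_axioms])
  have Dfd: "vectorspace.fin_dim K ?D"
    by (rule direct_sum_fin_dim[OF q.vectorspace_axioms m.vectorspace_axioms q.fin_dim m.fin_dim])
  note defs = functor_F_def Let_def triplet_module_def descend_def
  have V: "vectorspace K (FF M)"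
    by (rule vectorspace_surj_image(1)[where \<pi> = "\<lambda>x. x", OF D]) (auto simp: defs)
  have fd: "vectorspace.fin_dim K (FF M)"
    by (rule vectorspace_surj_image(2)[where \<pi> = "\<lambda>x. x", OF D _ _ _ _ Dfd]) (auto simp: defs)
  interpret V: vectorspace K "FF M" by (rule V)
  note s = FF_simps[OF M] and MJ = rsubmoduleD[OF Q.MJ_rsubmodule]
  have pr: "x \<triangleleft>\<^bsub>M\<^esub> j \<in> ideal_action M J" if "x \<in> carrier M" "j \<in> J" for x j
    using that by (rule ideal_action.prod)
  have act: "x \<triangleleft>\<^bsub>M\<^esub> j \<oplus>\<^bsub>M\<^esub> y \<triangleleft>\<^bsub>M\<^esub> b \<in> ideal_action M J"
    if "x \<in> carrier M" "j \<in> J" "y \<in> ideal_action M J" "b \<in> carrier A" for x j y b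
    using MJ(3)[OF pr[OF that(1,2)] MJ(4)[OF that(3,4)]] .
  note mem = Q.MJ_subset J_closed Q.ract_closed act MJ(3) MJ(4) pr
  show ?thesis
  proof
    show "vectorspace.fin_dim K (FF M)" by (rule fd)
    fix p assume "p \<in> carrier (FF M)"
    then obtain x y where p: "x \<in> carrier M" "y \<in> ideal_action M J" "p = (\<kappa> M x, y)" using FF_rep[OF M] by blast
    show "p \<triangleleft>\<^bsub>FF M\<^esub> \<one>\<^bsub>\<Delta>\<^esub> = p"
      using p by (simp add: triangular_simps(2) s(5) zero_in_J Q.ract_zero_right Q.ract_one mem)
    fix d assume "d \<in> carrier \<Delta>"
    then obtain a j b where d: "a \<in> carrier A" "j \<in> J" "b \<in> carrier A" "d = (qc a, j, qc b)"
      using triangular_rep by blast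
    show "p \<triangleleft>\<^bsub>FF M\<^esub> d \<in> carrier (FF M)" using p d by (simp add: s(5) FF_memI[OF M] mem)
    { fix p' assume "p' \<in> carrier (FF M)"
      then obtain x' y' where p': "x' \<in> carrier M" "y' \<in> ideal_action M J" "p' = (\<kappa> M x', y')" using FF_rep[OF M] by blast
      show "(p \<oplus>\<^bsub>FF M\<^esub> p') \<triangleleft>\<^bsub>FF M\<^esub> d = p \<triangleleft>\<^bsub>FF M\<^esub> d \<oplus>\<^bsub>FF M\<^esub> p' \<triangleleft>\<^bsub>FF M\<^esub> d"
        using p p' d by (simp add: s(3,5) mem Q.ract_add_left Q.M.a_ac) }
    { fix d' assume "d' \<in> carrier \<Delta>"
      then obtain a' j' b' where d': "a' \<in> carrier A" "j' \<in> J" "b' \<in> carrier A" "d' = (qc a', j', qc b')"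
        using triangular_rep by blast
      show "p \<triangleleft>\<^bsub>FF M\<^esub> (d \<oplus>\<^bsub>\<Delta>\<^esub> d') = p \<triangleleft>\<^bsub>FF M\<^esub> d \<oplus>\<^bsub>FF M\<^esub> p \<triangleleft>\<^bsub>FF M\<^esub> d'"
        using p d d' by (simp add: triangular_simps(4) qc_ops s(3,5) mem J_add Q.ract_add_right Q.M.a_ac)
      show "p \<triangleleft>\<^bsub>FF M\<^esub> (d \<otimes>\<^bsub>\<Delta>\<^esub> d') = (p \<triangleleft>\<^bsub>FF M\<^esub> d) \<triangleleft>\<^bsub>FF M\<^esub> d'"
        using p d d'
        by (simp add: triangular_mult s(5) mem J_add J_mult_left J_mult_right Q.ract_add_right Q.ract_add_left
            Q.ract_mult[symmetric] Q.M.a_assoc) }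
    { fix c assume c: "c \<in> carrier K"
      show "(c \<odot>\<^bsub>FF M\<^esub> p) \<triangleleft>\<^bsub>FF M\<^esub> d = c \<odot>\<^bsub>FF M\<^esub> (p \<triangleleft>\<^bsub>FF M\<^esub> d)"
        using p d c Q.rsubmodule_smult[OF Q.MJ_rsubmodule c p(2)]
        by (simp add: s(4,5) mem Q.smult_ract_left Q.smult_r_distr)
      show "p \<triangleleft>\<^bsub>FF M\<^esub> (c \<odot>\<^bsub>\<Delta>\<^esub> d) = c \<odot>\<^bsub>FF M\<^esub> (p \<triangleleft>\<^bsub>FF M\<^esub> d)"
        using p d c
        by (simp add: triangular_simps(5) qc_ops s(4,5) mem J_smult Q.smult_ract_right Q.smult_r_distr) }
  qed
qed

text \<open>The functor on morphisms. The union over representatives encodes the induced map from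
  M/MJ to N/NJ, as for the operations of quotient modules.\<close>

definition "Fmap M N g = (\<lambda>(C, y). (\<Union>x\<in>C. \<kappa> N (g x), g y))"

lemma Fmap_coset:
  assumes M: "fd_rmodule K A M" and N: "fd_rmodule K A N" and g: "g \<in> rmod_hom A M N" and x: "x \<in> carrier M"
  shows "Fmap M N g (\<kappa> M x, y) = (\<kappa> N (g x), g y)"
proof -
  interpret g: rmod_hom_pair K A M N g by (rule rmod_hom_pairI[OF M N g])
  have "(\<Union>x\<in>\<kappa> M x. \<kappa> N (g x)) = \<kappa> N (g x)"
    by (rule coset_UN_hom_eq[OF g.M.M.abelian_group_axioms g.M.rsubmodule_additive_subgroup[OF g.M.MJ_rsubmodule]
          g.Y.M.abelian_group_axioms g.Y.rsubmodule_additive_subgroup[OF g.Y.MJ_rsubmodule]])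
      (simp_all add: g.hom_add g.hom_MJ x)
  then show ?thesis by (simp add: Fmap_def)
qed

lemma Fmap_hom:
  assumes M: "fd_rmodule K A M" and N: "fd_rmodule K A N" and g: "g \<in> rmod_hom A M N"
  shows "Fmap M N g \<in> rmod_hom \<Delta> (FF M) (FF N)"
proof -
  interpret g: rmod_hom_pair K A M N g by (rule rmod_hom_pairI[OF M N g])
  note c = Fmap_coset[OF M N g] and s = FF_simps[OF M] and s' = FF_simps[OF N]
  show ?thesis
  proof (rule rmod_homI)
    fix p assume "p \<in> carrier (FF M)"
    then obtain x y where p: "x \<in> carrier M" "y \<in> ideal_action M J" "p = (\<kappa> M x, y)" using FF_rep[OF M] by blast
    then have y: "y \<in> carrier M" using g.M.MJ_subset by blast
    show "Fmap M N g p \<in> carrier (FF N)" using p by (simp add: c FF_memI[OF N] g.hom_MJ)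
    { fix p' assume "p' \<in> carrier (FF M)"
      then obtain x' y' where p': "x' \<in> carrier M" "y' \<in> ideal_action M J" "p' = (\<kappa> M x', y')" using FF_rep[OF M] by blast
      then have "y' \<in> carrier M" using g.M.MJ_subset by blast
      then show "Fmap M N g (p \<oplus>\<^bsub>FF M\<^esub> p') = Fmap M N g p \<oplus>\<^bsub>FF N\<^esub> Fmap M N g p'"
        using p p' y by (simp add: c s(3) s'(3) g.hom_add) }
    fix d assume "d \<in> carrier \<Delta>"
    then obtain a j b where d: "a \<in> carrier A" "j \<in> J" "b \<in> carrier A" "d = (qc a, j, qc b)"
      using triangular_rep by blast
    show "Fmap M N g (p \<triangleleft>\<^bsub>FF M\<^esub> d) = Fmap M N g p \<triangleleft>\<^bsub>FF N\<^esub> d"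
      using p d y J_closed[OF d(2)]
      by (simp add: c s(5) s'(5) g.hom_MJ g.hom_add g.hom_ract g.M.ract_closed)
  qed
qed

lemma quot_coset_eq:
  assumes "fd_rmodule K A M" "x \<in> carrier M"
  shows "\<kappa> M x = \<kappa> M \<zero>\<^bsub>M\<^esub> \<longleftrightarrow> x \<in> ideal_action M J"
proof -
  interpret Q: rmod_quotient K A M "ideal_action M J" by (rule MJ_quotient[OF assms(1)])
  show ?thesis using Q.coset_eq_zero_iff[OF assms(2)] Q.coset_zero by simp
qed

lemma FF_finsum:
  assumes M: "fd_rmodule K A M" and "finite I" "u \<in> I \<rightarrow> carrier M" "v \<in> I \<rightarrow> ideal_action M J"
  shows "finsum (FF M) (\<lambda>i. (\<kappa> M (u i), v i)) I = (\<kappa> M (finsum M u I), finsum M v I)"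
proof -
  interpret M: fd_rmodule K A M by fact
  interpret F: fd_rmodule K \<Delta> "FF M" by (rule fd_rmodule_FF[OF M])
  show ?thesis using assms(2-4)
  proof (induct I)
    case empty
    then show ?case by (simp add: FF_simps(2)[OF M])
  next
    case (insert i I)
    then have *: "u \<in> I \<rightarrow> carrier M" "u i \<in> carrier M" "v \<in> I \<rightarrow> ideal_action M J" "v i \<in> ideal_action M J" by auto
    then have vc: "v \<in> I \<rightarrow> carrier M" "v i \<in> carrier M" using M.MJ_subset by auto
    have mem: "(\<lambda>i. (\<kappa> M (u i), v i)) \<in> I \<rightarrow> carrier (FF M)" "(\<kappa> M (u i), v i) \<in> carrier (FF M)"
      using * FF_memI[OF M] by auto
    show ?case
      using insert * vc mem M.M.finsum_closed[OF *(1)]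
      by (simp add: F.M.finsum_insert M.M.finsum_insert FF_simps(3)[OF M])
  qed
qed

text \<open>A homomorphism out of \<open>F P\<close> with \<open>P\<close> projective is determined by its first component, which
  lifts along \<open>M \<rightarrow> M/MJ\<close>; so the functor is full on such pairs.\<close>

lemma FF_full_projective:
  assumes P: "fd_rmodule K A P" "projective A P" and M: "fd_rmodule K A M"
    and W: "W \<in> rmod_hom \<Delta> (FF P) (FF M)"
  shows "\<exists>v\<in>rmod_hom A P M. \<forall>x\<in>carrier P. \<forall>y\<in>ideal_action P J. W (\<kappa> P x, y) = (\<kappa> M (v x), v y)"
proof -
  interpret P: fd_rmodule K A P by (rule P(1))
  interpret Q: rmod_quotient K A M "ideal_action M J" by (rule MJ_quotient[OF M])
  let ?Q = "quot_rmodule M (ideal_action M J)"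
  note sP = FF_simps[OF P(1)] and sM = FF_simps[OF M]
  have P0: "\<zero>\<^bsub>P\<^esub> \<in> ideal_action P J" using rsubmoduleD(2)[OF P.MJ_rsubmodule] .
  have M0: "\<zero>\<^bsub>M\<^esub> \<in> ideal_action M J" using rsubmoduleD(2)[OF Q.MJ_rsubmodule] .
  define W1 where "W1 x = fst (W (\<kappa> P x, \<zero>\<^bsub>P\<^esub>))" for x
  have Wrep: "\<exists>m\<in>carrier M. \<exists>n\<in>ideal_action M J. W (\<kappa> P x, y) = (\<kappa> M m, n)"
    if "x \<in> carrier P" "y \<in> ideal_action P J" for x y
    using FF_rep[OF M rmod_hom_closed[OF W FF_memI[OF P(1) that]]] by blast
  \<comment> \<open>The matrix whose only entry is 1 in the upper left corner projects both modules
    to their first components. It fixes (x, 0), so the image under \<open>W\<close> has second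
    component 0.\<close>
  have W1: "W (\<kappa> P x, \<zero>\<^bsub>P\<^esub>) = (W1 x, \<zero>\<^bsub>M\<^esub>)" if x: "x \<in> carrier P" for x
  proof -
    obtain m n where mn: "m \<in> carrier M" "n \<in> ideal_action M J" "W (\<kappa> P x, \<zero>\<^bsub>P\<^esub>) = (\<kappa> M m, n)"
      using Wrep[OF x P0] by blast
    have d: "(qc \<one>\<^bsub>A\<^esub>, \<zero>\<^bsub>A\<^esub>, qc \<zero>\<^bsub>A\<^esub>) \<in> carrier \<Delta>" by (simp add: zero_in_J)
    have "(\<kappa> P x, \<zero>\<^bsub>P\<^esub>) \<triangleleft>\<^bsub>FF P\<^esub> (qc \<one>\<^bsub>A\<^esub>, \<zero>\<^bsub>A\<^esub>, qc \<zero>\<^bsub>A\<^esub>) = (\<kappa> P x, \<zero>\<^bsub>P\<^esub>)"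
      using x P0 by (simp add: sP(5) zero_in_J P.ract_one P.ract_zero_right)
    moreover have "(\<kappa> M m, n) \<triangleleft>\<^bsub>FF M\<^esub> (qc \<one>\<^bsub>A\<^esub>, \<zero>\<^bsub>A\<^esub>, qc \<zero>\<^bsub>A\<^esub>) = (\<kappa> M m, \<zero>\<^bsub>M\<^esub>)"
      using mn Q.MJ_subset[OF mn(2)] by (simp add: sM(5) zero_in_J Q.ract_one Q.ract_zero_right)
    ultimately have "W (\<kappa> P x, \<zero>\<^bsub>P\<^esub>) = (\<kappa> M m, \<zero>\<^bsub>M\<^esub>)"
      using rmod_hom_ract[OF W FF_memI[OF P(1) x P0] d] mn(3) by simp
    then show ?thesis by (simp add: W1_def)
  qed
  have W1rep: "\<exists>m\<in>carrier M. W1 x = \<kappa> M m" if "x \<in> carrier P" for x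
    using Wrep[OF that P0] W1[OF that] by force
  have W1hom: "W1 \<in> rmod_hom A P ?Q"
  proof (rule rmod_homI)
    fix x assume x: "x \<in> carrier P"
    obtain m where m: "m \<in> carrier M" "W1 x = \<kappa> M m" using W1rep[OF x] by blast
    show "W1 x \<in> carrier ?Q" using m by (simp add: Q.carrier_quot)
    { fix y assume y: "y \<in> carrier P"
      obtain n where n: "n \<in> carrier M" "W1 y = \<kappa> M n" using W1rep[OF y] by blast
      have "W ((\<kappa> P x, \<zero>\<^bsub>P\<^esub>) \<oplus>\<^bsub>FF P\<^esub> (\<kappa> P y, \<zero>\<^bsub>P\<^esub>)) = (\<kappa> M (m \<oplus>\<^bsub>M\<^esub> n), \<zero>\<^bsub>M\<^esub>)"
        using rmod_hom_add[OF W FF_memI[OF P(1) x P0] FF_memI[OF P(1) y P0]] W1[OF x] W1[OF y] m n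
        by (simp add: sM(3))
      then show "W1 (x \<oplus>\<^bsub>P\<^esub> y) = W1 x \<oplus>\<^bsub>?Q\<^esub> W1 y"
        using W1[of "x \<oplus>\<^bsub>P\<^esub> y"] x y m n by (simp add: sP(3) Q.coset_add) }
    fix a assume a: "a \<in> carrier A"
    have d: "(qc a, \<zero>\<^bsub>A\<^esub>, qc \<zero>\<^bsub>A\<^esub>) \<in> carrier \<Delta>" using a by (simp add: zero_in_J)
    have "W ((\<kappa> P x, \<zero>\<^bsub>P\<^esub>) \<triangleleft>\<^bsub>FF P\<^esub> (qc a, \<zero>\<^bsub>A\<^esub>, qc \<zero>\<^bsub>A\<^esub>)) = (\<kappa> M (m \<triangleleft>\<^bsub>M\<^esub> a), \<zero>\<^bsub>M\<^esub>)"
      using rmod_hom_ract[OF W FF_memI[OF P(1) x P0] d] W1[OF x] m a M0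
      by (simp add: sM(5) zero_in_J Q.ract_zero_right)
    then show "W1 (x \<triangleleft>\<^bsub>P\<^esub> a) = W1 x \<triangleleft>\<^bsub>?Q\<^esub> a"
      using W1[of "x \<triangleleft>\<^bsub>P\<^esub> a"] x a m P0
      by (simp add: sP(5) zero_in_J P.ract_zero_right P.ract_closed Q.coset_ract)
  qed
  have "W1 ` carrier P \<subseteq> Q.coset ` carrier M" using W1rep by blast
  then obtain v where v: "v \<in> rmod_hom A P M" "\<And>x. x \<in> carrier P \<Longrightarrow> \<kappa> M (v x) = W1 x"
    using projective_lift[OF P M Q.fd_rmodule_quot Q.coset_hom W1hom] by blast
  interpret v: rmod_hom_pair K A P M v by (rule rmod_hom_pairI[OF P(1) M v(1)])
  \<comment> \<open>Second components are generated from first ones: (x, 0) times the matrix with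
    upper right entry j is (0, xj). So \<open>W\<close> on P J is forced by \<open>W1\<close> and
    agrees with the restriction of \<open>v\<close>.\<close>
  have W2: "W (\<kappa> P \<zero>\<^bsub>P\<^esub>, y) = (\<kappa> M \<zero>\<^bsub>M\<^esub>, v y)" if "y \<in> ideal_action P J" for y
    using that
  proof (induct y rule: ideal_action.induct)
    case (prod x j)
    have d: "(qc \<zero>\<^bsub>A\<^esub>, j, qc \<zero>\<^bsub>A\<^esub>) \<in> carrier \<Delta>" using prod by simp
    have "(\<kappa> P x, \<zero>\<^bsub>P\<^esub>) \<triangleleft>\<^bsub>FF P\<^esub> (qc \<zero>\<^bsub>A\<^esub>, j, qc \<zero>\<^bsub>A\<^esub>) = (\<kappa> P \<zero>\<^bsub>P\<^esub>, x \<triangleleft>\<^bsub>P\<^esub> j)"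
      using prod P0 J_closed by (simp add: sP(5) P.ract_zero_right P.ract_zero_left P.ract_closed)
    moreover have "(\<kappa> M (v x), \<zero>\<^bsub>M\<^esub>) \<triangleleft>\<^bsub>FF M\<^esub> (qc \<zero>\<^bsub>A\<^esub>, j, qc \<zero>\<^bsub>A\<^esub>) = (\<kappa> M \<zero>\<^bsub>M\<^esub>, v (x \<triangleleft>\<^bsub>P\<^esub> j))"
      using prod M0 J_closed by (simp add: sM(5) Q.ract_zero_right Q.ract_zero_left Q.ract_closed v.hom_ract)
    ultimately show ?case
      using rmod_hom_ract[OF W FF_memI[OF P(1) prod(1) P0] d] W1[OF prod(1)] v(2)[OF prod(1)] by simp
  next
    case (sum x y)
    then have xy: "x \<in> carrier P" "y \<in> carrier P" using P.MJ_subset by auto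
    have "W ((\<kappa> P \<zero>\<^bsub>P\<^esub>, x) \<oplus>\<^bsub>FF P\<^esub> (\<kappa> P \<zero>\<^bsub>P\<^esub>, y)) = (\<kappa> M \<zero>\<^bsub>M\<^esub>, v x) \<oplus>\<^bsub>FF M\<^esub> (\<kappa> M \<zero>\<^bsub>M\<^esub>, v y)"
      using rmod_hom_add[OF W FF_memI[OF P(1) _ sum(1)] FF_memI[OF P(1) _ sum(3)], of "\<zero>\<^bsub>P\<^esub>" "\<zero>\<^bsub>P\<^esub>"] sum by simp
    then show ?case using xy by (simp add: sP(3) sM(3) v.hom_add)
  qed
  have "W (\<kappa> P x, y) = (\<kappa> M (v x), v y)" if x: "x \<in> carrier P" and y: "y \<in> ideal_action P J" for x y
  proof -
    have yc: "y \<in> carrier P" using P.MJ_subset[OF y] .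
    have "W ((\<kappa> P x, \<zero>\<^bsub>P\<^esub>) \<oplus>\<^bsub>FF P\<^esub> (\<kappa> P \<zero>\<^bsub>P\<^esub>, y)) = (\<kappa> M (v x), \<zero>\<^bsub>M\<^esub>) \<oplus>\<^bsub>FF M\<^esub> (\<kappa> M \<zero>\<^bsub>M\<^esub>, v y)"
      using rmod_hom_add[OF W FF_memI[OF P(1) x P0] FF_memI[OF P(1) P.M.zero_closed y]] W1[OF x] W2[OF y] v(2)[OF x] by simp
    then show ?thesis using x yc by (simp add: sP(3) sM(3))
  qed
  then show ?thesis using v(1) by blast
qed

end

section \<open>A minimal projective presentation of F M\<close>

context split_algebra
begin

text \<open>A dual basis of \<open>P\<close> induces one of F P, with generators (p_i, 0). As F A
  consists of the first rows of triangular matrices, the linear forms take values in matrices with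
  vanishing lower right entry.\<close>

lemma projective_FF:
  fixes P :: "('k, 'a, 'd) rmodule"
  assumes P: "fd_rmodule K A P" "projective A P"
  shows "projective \<Delta> (FF P)"
proof -
  interpret P: fd_rmodule K A P by (rule P(1))
  have F: "fd_rmodule K \<Delta> (FF P)" by (rule fd_rmodule_FF[OF P(1)])
  interpret F: fd_rmodule K \<Delta> "FF P" by (rule F)
  note s = FF_simps[OF P(1)]
  obtain n p h where db: "dual_basis A P n p h" using P projective_iff_dual_basis by blast
  note d = dual_basisD[OF db]
  have P0: "\<zero>\<^bsub>P\<^esub> \<in> ideal_action P J" using rsubmoduleD(2)[OF P.MJ_rsubmodule] .
  define H :: "nat \<Rightarrow> 'd set \<times> 'd \<Rightarrow> 'a set \<times> 'a \<times> 'a set"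
    where "H i = (\<lambda>(C, y). (\<Union>x\<in>C. qc (h i x), h i y, qc \<zero>\<^bsub>A\<^esub>))" for i
  have hJ: "h i y \<in> J" if "i < n" "y \<in> ideal_action P J" for i y
    by (rule hom_to_regular_J[OF P(1) d(2)[OF that(1)] that(2)])
  have H: "H i (\<kappa> P x, y) = (qc (h i x), h i y, qc \<zero>\<^bsub>A\<^esub>)" if i: "i < n" and x: "x \<in> carrier P" for i x y
  proof -
    have "(\<Union>x\<in>\<kappa> P x. qc (h i x)) = qc (h i x)"
      by (rule coset_UN_hom_eq[OF P.M.abelian_group_axioms P.rsubmodule_additive_subgroup[OF P.MJ_rsubmodule]
            M.abelian_group_axioms ideal.axioms(1)[OF J_ideal]])
        (use rmod_hom_add[OF d(2)[OF i]] d(3)[OF i] hJ[OF i] x in simp_all)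
    then show ?thesis by (simp add: H_def)
  qed
  have "dual_basis \<Delta> (FF P) n (\<lambda>i. (\<kappa> P (p i), \<zero>\<^bsub>P\<^esub>)) H"
    unfolding dual_basis_def
  proof (intro conjI allI impI ballI)
    fix i assume i: "i < n"
    show "(\<kappa> P (p i), \<zero>\<^bsub>P\<^esub>) \<in> carrier (FF P)" by (rule FF_memI[OF P(1) d(1)[OF i] P0])
    show "H i \<in> rmod_hom \<Delta> (FF P) (regular \<Delta>)"
    proof (rule rmod_homI)
      fix q assume "q \<in> carrier (FF P)"
      then obtain x y where q: "x \<in> carrier P" "y \<in> ideal_action P J" "q = (\<kappa> P x, y)" using FF_rep[OF P(1)] by blast
      have y: "y \<in> carrier P" using P.MJ_subset[OF q(2)] .
      show "H i q \<in> carrier (regular \<Delta>)" using q by (simp add: H[OF i] d(3)[OF i] hJ[OF i])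
      { fix q' assume "q' \<in> carrier (FF P)"
        then obtain x' y' where q': "x' \<in> carrier P" "y' \<in> ideal_action P J" "q' = (\<kappa> P x', y')" using FF_rep[OF P(1)] by blast
        have y': "y' \<in> carrier P" using P.MJ_subset[OF q'(2)] .
        show "H i (q \<oplus>\<^bsub>FF P\<^esub> q') = H i q \<oplus>\<^bsub>regular \<Delta>\<^esub> H i q'"
          using q q' y y' rmod_hom_add[OF d(2)[OF i]]
          by (simp add: H[OF i] s(3) triangular_simps(4) qc_ops d(3)[OF i]) }
      fix c assume "c \<in> carrier \<Delta>"
      then obtain a j b where c: "a \<in> carrier A" "j \<in> J" "b \<in> carrier A" "c = (qc a, j, qc b)"
        using triangular_rep by blast
      show "H i (q \<triangleleft>\<^bsub>FF P\<^esub> c) = H i q \<triangleleft>\<^bsub>regular \<Delta>\<^esub> c"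
        using q y c J_closed[OF c(2)] rmod_hom_add[OF d(2)[OF i]] rmod_hom_ract[OF d(2)[OF i]]
        by (simp add: H[OF i] s(5) triangular_mult d(3)[OF i] hJ[OF i] P.ract_closed)
    qed
  next
    fix q assume "q \<in> carrier (FF P)"
    then obtain x y where q: "x \<in> carrier P" "y \<in> ideal_action P J" "q = (\<kappa> P x, y)" using FF_rep[OF P(1)] by blast
    have y: "y \<in> carrier P" using P.MJ_subset[OF q(2)] .
    have pJ: "p i \<triangleleft>\<^bsub>P\<^esub> h i y \<in> ideal_action P J" if "i < n" for i
      using d(1)[OF that] hJ[OF that q(2)] by (rule ideal_action.prod)
    have eq: "(\<kappa> P (p i), \<zero>\<^bsub>P\<^esub>) \<triangleleft>\<^bsub>FF P\<^esub> H i q = (\<kappa> P (p i \<triangleleft>\<^bsub>P\<^esub> h i x), p i \<triangleleft>\<^bsub>P\<^esub> h i y)" if i: "i < n" for i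
      using q y P0 d(1,3)[OF i] hJ[OF i q(2)] pJ[OF i] P.MJ_subset
      by (simp add: H[OF i] s(5) P.ract_zero_left)
    have "finsum (FF P) (\<lambda>i. (\<kappa> P (p i), \<zero>\<^bsub>P\<^esub>) \<triangleleft>\<^bsub>FF P\<^esub> H i q) {..<n}
      = finsum (FF P) (\<lambda>i. (\<kappa> P (p i \<triangleleft>\<^bsub>P\<^esub> h i x), p i \<triangleleft>\<^bsub>P\<^esub> h i y)) {..<n}"
      using eq d q pJ by (intro F.M.finsum_cong') (auto intro!: FF_memI[OF P(1)] P.ract_closed)
    also have "\<dots> = (\<kappa> P (finsum P (\<lambda>i. p i \<triangleleft>\<^bsub>P\<^esub> h i x) {..<n}), finsum P (\<lambda>i. p i \<triangleleft>\<^bsub>P\<^esub> h i y) {..<n})"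
      using d q pJ by (intro FF_finsum[OF P(1)]) (auto intro!: P.ract_closed)
    also have "\<dots> = q" using d(4) q y by simp
    finally show "finsum (FF P) (\<lambda>i. (\<kappa> P (p i), \<zero>\<^bsub>P\<^esub>) \<triangleleft>\<^bsub>FF P\<^esub> H i q) {..<n} = q" .
  qed
  then show ?thesis using projective_iff_dual_basis[OF F] by blast
qed

context
  fixes M :: "('k, 'a, 'x) rmodule" and P0 :: "('k, 'a, 'p) rmodule" and P1 :: "('k, 'a, 'q) rmodule"
    and f :: "'q \<Rightarrow> 'p" and g :: "'p \<Rightarrow> 'x"
  assumes M: "fd_rmodule K A M" and pres: "minimal_presentation K A P1 f P0 g M"
begin

abbreviation "Z \<equiv> a_kernel P0 M g"
text \<open>The triplet (0, Z), realized inside F P0 with the zero coset as its only first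
  component. In this form it can be literally the kernel required by
  \<open>minimal_presentation\<close>.\<close>

abbreviation "FZ \<equiv> (FF P0)\<lparr>carrier := {\<kappa> P0 \<zero>\<^bsub>P0\<^esub>} \<times> Z\<rparr>"

lemma
  shows P0_fd: "fd_rmodule K A P0" and P0_proj: "projective A P0" and g_hom: "g \<in> rmod_hom A P0 M"
    and g_surj: "g ` carrier P0 = carrier M"
  using minimal_presentationD[OF pres] by auto

lemma Z_rsubmodule: "rsubmodule A P0 Z"
  by (rule rmod_hom_pair.kernel_rsubmodule[OF rmod_hom_pairI[OF P0_fd M g_hom]])

lemma Z_rad: "z \<in> Z \<Longrightarrow> z \<in> ideal_action P0 J"
  by (rule superfluous_kernel_PJ[OF minimal_presentationD(1)[OF pres] M])

text \<open>Minimality enters through Z being contained in P0 J. It follows that g x in MJ forces x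
  in P0 J, so the map on first components is injective, and that the kernel on the second component
  P0 J is all of Z.\<close>

lemma kernel_Fmap: "a_kernel (FF P0) (FF M) (Fmap P0 M g) = {\<kappa> P0 \<zero>\<^bsub>P0\<^esub>} \<times> Z"
proof -
  interpret g: rmod_hom_pair K A P0 M g by (rule rmod_hom_pairI[OF P0_fd M g_hom])
  have "x \<in> ideal_action P0 J" if x: "x \<in> carrier P0" and gx: "g x \<in> ideal_action M J" for x
  proof -
    obtain y where y: "y \<in> ideal_action P0 J" "g y = g x" using g.surj_MJ[OF g_surj gx] by blast
    have yc: "y \<in> carrier P0" using g.M.MJ_subset[OF y(1)] .
    have "x \<ominus>\<^bsub>P0\<^esub> y \<in> Z"
      using y(2) yc x by (simp add: mem_a_kernel g.M.M.minus_eq g.hom_add g.hom_minus g.Y.M.r_neg)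
    then have "(x \<ominus>\<^bsub>P0\<^esub> y) \<oplus>\<^bsub>P0\<^esub> y \<in> ideal_action P0 J" using Z_rad y(1) by (blast intro: ideal_action.sum)
    then show ?thesis using yc x by (simp add: g.M.M.minus_eq g.M.M.a_assoc g.M.M.l_neg)
  qed
  then have rad: "x \<in> ideal_action P0 J \<longleftrightarrow> g x \<in> ideal_action M J" if "x \<in> carrier P0" for x
    using that g.hom_MJ by blast
  show ?thesis
  proof (intro equalityI subsetI)
    fix q assume "q \<in> a_kernel (FF P0) (FF M) (Fmap P0 M g)"
    then have q: "q \<in> carrier (FF P0)" "Fmap P0 M g q = \<zero>\<^bsub>FF M\<^esub>" by (auto simp: mem_a_kernel)
    obtain x y where xy: "x \<in> carrier P0" "y \<in> ideal_action P0 J" "q = (\<kappa> P0 x, y)" using FF_rep[OF P0_fd q(1)] by blast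
    then show "q \<in> {\<kappa> P0 \<zero>\<^bsub>P0\<^esub>} \<times> Z"
      using q(2) quot_coset_eq[OF M, of "g x"] quot_coset_eq[OF P0_fd xy(1)] rad[OF xy(1)] g.M.MJ_subset[OF xy(2)]
      by (simp add: Fmap_coset[OF P0_fd M g_hom] FF_simps(2)[OF M] mem_a_kernel)
  next
    fix q assume "q \<in> {\<kappa> P0 \<zero>\<^bsub>P0\<^esub>} \<times> Z"
    then obtain z where z: "z \<in> Z" "q = (\<kappa> P0 \<zero>\<^bsub>P0\<^esub>, z)" by blast
    then show "q \<in> a_kernel (FF P0) (FF M) (Fmap P0 M g)"
      using Z_rad[OF z(1)]
      by (simp add: mem_a_kernel FF_memI[OF P0_fd] Fmap_coset[OF P0_fd M g_hom] FF_simps(2)[OF M])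
  qed
qed

lemma FZ_rsubmodule: "rsubmodule \<Delta> (FF P0) ({\<kappa> P0 \<zero>\<^bsub>P0\<^esub>} \<times> Z)"
  using rmod_hom_pair.kernel_rsubmodule[OF rmod_hom_pairI[OF fd_rmodule_FF[OF P0_fd] fd_rmodule_FF[OF M] Fmap_hom[OF P0_fd M g_hom]]]
  by (simp add: kernel_Fmap)

lemma FZ_fd: "fd_rmodule K \<Delta> FZ"
  by (rule fd_rmodule.fd_rmodule_submodule[OF fd_rmodule_FF[OF P0_fd] FZ_rsubmodule])

text \<open>As the first component is zero, only the lower right entry contributes; (0, Z) is in
  effect a module over A/J.\<close>

lemma FZ_act:
  assumes "z \<in> Z" "a \<in> carrier A" "j \<in> J" "b \<in> carrier A"
  shows "(\<kappa> P0 \<zero>\<^bsub>P0\<^esub>, z) \<triangleleft>\<^bsub>FF P0\<^esub> (qc a, j, qc b) = (\<kappa> P0 \<zero>\<^bsub>P0\<^esub>, z \<triangleleft>\<^bsub>P0\<^esub> b)"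
proof -
  interpret P0: fd_rmodule K A P0 by (rule P0_fd)
  have "z \<in> carrier P0" using assms(1) by (simp add: mem_a_kernel)
  then show ?thesis
    using assms Z_rad[OF assms(1)] J_closed[OF assms(3)]
    by (simp add: FF_simps(5)[OF P0_fd] P0.ract_zero_left P0.ract_closed)
qed

lemma projective_FZ: "projective \<Delta> FZ"
proof -
  note d = minimal_presentationD[OF pres]
  interpret P0: fd_rmodule K A P0 by (rule P0_fd)
  interpret f: rmod_hom_pair K A P1 P0 f by (rule rmod_hom_pairI[OF d(4,3,9)])
  have Zf: "fd_rmodule K A (P0\<lparr>carrier := Z\<rparr>)" by (rule P0.fd_rmodule_submodule[OF Z_rsubmodule])
  obtain n p h where db: "dual_basis A P1 n p h" using d(4,6) projective_iff_dual_basis by blast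
  note b = dual_basisD[OF db]
  interpret FZ: fd_rmodule K \<Delta> FZ by (rule FZ_fd)
  have fZ: "f ` carrier P1 = Z" by (rule d(10))
  have kerf: "h i x \<in> J" if "i < n" "x \<in> carrier P1" "f x = \<zero>\<^bsub>P0\<^esub>" for i x
    by (rule superfluous_kernel_J[OF d(2) Zf _ b(2)[OF that(1)]]) (use that in \<open>simp add: mem_a_kernel\<close>)
  \<comment> \<open>A preimage of z under \<open>f\<close> is chosen; another choice changes the
    coordinate by an element of \<open>J\<close>.\<close>
  define H :: "nat \<Rightarrow> 'p set \<times> 'p \<Rightarrow> 'a set \<times> 'a \<times> 'a set"
    where "H i = (\<lambda>(C, z). (qc \<zero>\<^bsub>A\<^esub>, \<zero>\<^bsub>A\<^esub>, qc (h i (inv_into (carrier P1) f z))))" for i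
  have H: "H i (C, f x) = (qc \<zero>\<^bsub>A\<^esub>, \<zero>\<^bsub>A\<^esub>, qc (h i x))" if i: "i < n" and x: "x \<in> carrier P1" for i C x
  proof -
    interpret hi: rmod_hom_pair K A P1 "regular A" "h i" by (rule rmod_hom_pairI[OF d(4) regular_fd b(2)[OF i]])
    define x' where "x' = inv_into (carrier P1) f (f x)"
    have x': "x' \<in> carrier P1" "f x' = f x"
      using x by (auto simp: x'_def intro: inv_into_into f_inv_into_f)
    have "f (x' \<ominus>\<^bsub>P1\<^esub> x) = \<zero>\<^bsub>P0\<^esub>"
      using x x' by (simp add: f.M.M.minus_eq f.hom_add f.hom_minus P0.M.r_neg)
    then have "h i (x' \<ominus>\<^bsub>P1\<^esub> x) \<in> J" using kerf[OF i] x x' by simp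
    moreover have "h i (x' \<ominus>\<^bsub>P1\<^esub> x) = h i x' \<ominus>\<^bsub>A\<^esub> h i x"
      using x x' by (simp add: f.M.M.minus_eq M.minus_eq hi.hom_add hi.hom_minus)
    ultimately show ?thesis
      using x x' b(3)[OF i] by (simp add: H_def x'_def[symmetric] qc_eq_iff)
  qed
  have rep: "\<exists>x\<in>carrier P1. q = (\<kappa> P0 \<zero>\<^bsub>P0\<^esub>, f x)" if "q \<in> carrier FZ" for q
    using that fZ by auto
  have Zm: "f x \<in> Z" if "x \<in> carrier P1" for x using fZ that by blast
  have "dual_basis \<Delta> FZ n (\<lambda>i. (\<kappa> P0 \<zero>\<^bsub>P0\<^esub>, f (p i))) H"
    unfolding dual_basis_def
  proof (intro conjI allI impI ballI)
    fix i assume i: "i < n"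
    show "(\<kappa> P0 \<zero>\<^bsub>P0\<^esub>, f (p i)) \<in> carrier FZ" using Zm b(1)[OF i] by simp
    show "H i \<in> rmod_hom \<Delta> FZ (regular \<Delta>)"
    proof (rule rmod_homI)
      fix q assume "q \<in> carrier FZ"
      then obtain x where x: "x \<in> carrier P1" "q = (\<kappa> P0 \<zero>\<^bsub>P0\<^esub>, f x)" using rep by blast
      show "H i q \<in> carrier (regular \<Delta>)" using x by (simp add: H[OF i] b(3)[OF i] zero_in_J)
      { fix q' assume "q' \<in> carrier FZ"
        then obtain x' where x': "x' \<in> carrier P1" "q' = (\<kappa> P0 \<zero>\<^bsub>P0\<^esub>, f x')" using rep by blast
        have "q \<oplus>\<^bsub>FZ\<^esub> q' = (\<kappa> P0 \<zero>\<^bsub>P0\<^esub>, f (x \<oplus>\<^bsub>P1\<^esub> x'))"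
          using x x' by (simp add: FF_simps(3)[OF P0_fd] f.hom_add)
        then show "H i (q \<oplus>\<^bsub>FZ\<^esub> q') = H i q \<oplus>\<^bsub>regular \<Delta>\<^esub> H i q'"
          using x x' rmod_hom_add[OF b(2)[OF i] x(1) x'(1)]
          by (simp add: H[OF i] triangular_simps(4) qc_ops b(3)[OF i]) }
      fix c assume "c \<in> carrier \<Delta>"
      then obtain a j e where c: "a \<in> carrier A" "j \<in> J" "e \<in> carrier A" "c = (qc a, j, qc e)"
        using triangular_rep by blast
      have "q \<triangleleft>\<^bsub>FZ\<^esub> c = (\<kappa> P0 \<zero>\<^bsub>P0\<^esub>, f (x \<triangleleft>\<^bsub>P1\<^esub> e))"
        using x c FZ_act[OF Zm[OF x(1)] c(1-3)] by (simp add: f.hom_ract)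
      then show "H i (q \<triangleleft>\<^bsub>FZ\<^esub> c) = H i q \<triangleleft>\<^bsub>regular \<Delta>\<^esub> c"
        using x c rmod_hom_ract[OF b(2)[OF i] x(1) c(3)] J_closed[OF c(2)]
        by (simp add: H[OF i] triangular_mult b(3)[OF i] zero_in_J f.M.ract_closed)
    qed
  next
    fix q assume "q \<in> carrier FZ"
    then obtain x where x: "x \<in> carrier P1" "q = (\<kappa> P0 \<zero>\<^bsub>P0\<^esub>, f x)" using rep by blast
    have eq: "(\<kappa> P0 \<zero>\<^bsub>P0\<^esub>, f (p i)) \<triangleleft>\<^bsub>FZ\<^esub> H i q = (\<kappa> P0 \<zero>\<^bsub>P0\<^esub>, f (p i \<triangleleft>\<^bsub>P1\<^esub> h i x))" if i: "i < n" for i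
      using x b(1,3)[OF i] FZ_act[OF Zm[OF b(1)[OF i]] M.zero_closed zero_in_J b(3)[OF i x(1)]]
      by (simp add: H[OF i] f.hom_ract)
    have mem: "p i \<triangleleft>\<^bsub>P1\<^esub> h i x \<in> carrier P1" if "i < n" for i using b that x by (simp add: f.M.ract_closed)
    have memZ: "f (p i \<triangleleft>\<^bsub>P1\<^esub> h i x) \<in> Z" if "i < n" for i using Zm[OF mem[OF that]] .
    have "finsum FZ (\<lambda>i. (\<kappa> P0 \<zero>\<^bsub>P0\<^esub>, f (p i)) \<triangleleft>\<^bsub>FZ\<^esub> H i q) {..<n}
      = finsum FZ (\<lambda>i. (\<kappa> P0 \<zero>\<^bsub>P0\<^esub>, f (p i \<triangleleft>\<^bsub>P1\<^esub> h i x))) {..<n}"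
      using eq memZ by (intro FZ.M.finsum_cong') auto
    also have "\<dots> = finsum (FF P0) (\<lambda>i. (\<kappa> P0 \<zero>\<^bsub>P0\<^esub>, f (p i \<triangleleft>\<^bsub>P1\<^esub> h i x))) {..<n}"
      by (rule fd_rmodule.finsum_submodule[OF fd_rmodule_FF[OF P0_fd] FZ_rsubmodule]) (use memZ in auto)
    also have "\<dots> = (\<kappa> P0 (finsum P0 (\<lambda>i. \<zero>\<^bsub>P0\<^esub>) {..<n}), finsum P0 (\<lambda>i. f (p i \<triangleleft>\<^bsub>P1\<^esub> h i x)) {..<n})"
      by (rule FF_finsum[OF P0_fd]) (use Z_rad[OF memZ] in auto)
    also have "finsum P0 (\<lambda>i. f (p i \<triangleleft>\<^bsub>P1\<^esub> h i x)) {..<n} = f (finsum P1 (\<lambda>i. p i \<triangleleft>\<^bsub>P1\<^esub> h i x) {..<n})"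
      by (rule f.hom_finsum[symmetric]) (use mem in auto)
    also have "finsum P1 (\<lambda>i. p i \<triangleleft>\<^bsub>P1\<^esub> h i x) {..<n} = x" by (rule b(4)[OF x(1)])
    finally show "finsum FZ (\<lambda>i. (\<kappa> P0 \<zero>\<^bsub>P0\<^esub>, f (p i)) \<triangleleft>\<^bsub>FZ\<^esub> H i q) {..<n} = q" using x by simp
  qed
  then show ?thesis using projective_iff_dual_basis[OF FZ_fd] by blast
qed

lemma minimal_presentation_FF:
  "minimal_presentation K \<Delta> FZ (\<lambda>q. q) (FF P0) (Fmap P0 M g) (FF M)"
proof -
  interpret g: rmod_hom_pair K A P0 M g by (rule rmod_hom_pairI[OF P0_fd M g_hom])
  have F0: "fd_rmodule K \<Delta> (FF P0)" by (rule fd_rmodule_FF[OF P0_fd])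
  have FM: "fd_rmodule K \<Delta> (FF M)" by (rule fd_rmodule_FF[OF M])
  interpret F0: fd_rmodule K \<Delta> "FF P0" by (rule F0)
  interpret FZ: fd_rmodule K \<Delta> FZ by (rule FZ_fd)
  note G = Fmap_hom[OF P0_fd M g_hom] and c = Fmap_coset[OF P0_fd M g_hom]
  have surj: "Fmap P0 M g ` carrier (FF P0) = carrier (FF M)"
  proof (intro equalityI subsetI)
    fix q assume "q \<in> carrier (FF M)"
    then obtain x y where q: "x \<in> carrier M" "y \<in> ideal_action M J" "q = (\<kappa> M x, y)" using FF_rep[OF M] by blast
    obtain x' where x': "x' \<in> carrier P0" "x = g x'" using g_surj q(1) by blast
    obtain y' where y': "y' \<in> ideal_action P0 J" "g y' = y" using g.surj_MJ[OF g_surj q(2)] by blast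
    have "q = Fmap P0 M g (\<kappa> P0 x', y')" using q x' y' by (simp add: c)
    then show "q \<in> Fmap P0 M g ` carrier (FF P0)" using FF_memI[OF P0_fd x'(1) y'(1)] by blast
  qed (use rmod_hom_closed[OF G] in auto)
  have "N = carrier (FF P0)"
    if N: "rsubmodule \<Delta> (FF P0) N" "N <+>\<^bsub>FF P0\<^esub> a_kernel (FF P0) (FF M) (Fmap P0 M g) = carrier (FF P0)" for N
  proof -
    note n = rsubmoduleD[OF N(1)]
    have z: "\<zero>\<^bsub>P0\<^esub> \<in> ideal_action P0 J" using rsubmoduleD(2)[OF g.M.MJ_rsubmodule] .
    \<comment> \<open>Adding kernel elements leaves first components unchanged, so \<open>N\<close>
      already realizes every first component.\<close>
    have first: "\<exists>y\<in>ideal_action P0 J. (\<kappa> P0 x, y) \<in> N" if x: "x \<in> carrier P0" for x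
    proof -
      have "(\<kappa> P0 x, \<zero>\<^bsub>P0\<^esub>) \<in> N <+>\<^bsub>FF P0\<^esub> a_kernel (FF P0) (FF M) (Fmap P0 M g)"
        unfolding N(2) by (rule FF_memI[OF P0_fd x z])
      then obtain m w where mw: "m \<in> N" "w \<in> Z" "(\<kappa> P0 x, \<zero>\<^bsub>P0\<^esub>) = m \<oplus>\<^bsub>FF P0\<^esub> (\<kappa> P0 \<zero>\<^bsub>P0\<^esub>, w)"
        unfolding kernel_Fmap mem_set_add by blast
      obtain x' y' where m: "x' \<in> carrier P0" "y' \<in> ideal_action P0 J" "m = (\<kappa> P0 x', y')"
        using FF_rep[OF P0_fd subsetD[OF n(1) mw(1)]] by blast
      have "\<kappa> P0 x = \<kappa> P0 x'" using mw(3) m by (simp add: FF_simps(3)[OF P0_fd])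
      then show ?thesis using m mw(1) by auto
    qed
    \<comment> \<open>The matrix with upper right entry j as its only entry takes (x, y) to (0, xj),
      whatever y is.\<close>
    have second: "(\<kappa> P0 \<zero>\<^bsub>P0\<^esub>, y) \<in> N" if "y \<in> ideal_action P0 J" for y
      using that
    proof (induct y rule: ideal_action.induct)
      case (prod x j)
      obtain y where y: "y \<in> ideal_action P0 J" "(\<kappa> P0 x, y) \<in> N" using first[OF prod(1)] by blast
      have "(\<kappa> P0 x, y) \<triangleleft>\<^bsub>FF P0\<^esub> (qc \<zero>\<^bsub>A\<^esub>, j, qc \<zero>\<^bsub>A\<^esub>) \<in> N" by (rule n(4)[OF y(2)]) (simp add: prod)
      then show ?case
        using prod y g.M.MJ_subset[OF y(1)] J_closed[OF prod(2)]
        by (simp add: FF_simps(5)[OF P0_fd] g.M.ract_zero_right g.M.ract_closed)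
    next
      case (sum x y)
      then have "(\<kappa> P0 \<zero>\<^bsub>P0\<^esub>, x) \<oplus>\<^bsub>FF P0\<^esub> (\<kappa> P0 \<zero>\<^bsub>P0\<^esub>, y) \<in> N" using n(3) by blast
      then show ?case by (simp add: FF_simps(3)[OF P0_fd])
    qed
    show ?thesis
    proof (intro equalityI subsetI)
      fix q assume "q \<in> carrier (FF P0)"
      then obtain x y where q: "x \<in> carrier P0" "y \<in> ideal_action P0 J" "q = (\<kappa> P0 x, y)" using FF_rep[OF P0_fd] by blast
      obtain y' where y': "y' \<in> ideal_action P0 J" "(\<kappa> P0 x, y') \<in> N" using first[OF q(1)] by blast
      have yc: "y \<in> carrier P0" "y' \<in> carrier P0" using g.M.MJ_subset q(2) y'(1) by blast+
      have "y \<ominus>\<^bsub>P0\<^esub> y' \<in> ideal_action P0 J"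
        unfolding a_minus_def
        by (rule rsubmoduleD(3)[OF g.M.MJ_rsubmodule q(2) g.M.rsubmodule_minus[OF g.M.MJ_rsubmodule y'(1)]])
      then have "(\<kappa> P0 x, y') \<oplus>\<^bsub>FF P0\<^esub> (\<kappa> P0 \<zero>\<^bsub>P0\<^esub>, y \<ominus>\<^bsub>P0\<^esub> y') \<in> N" using n(3)[OF y'(2) second] by blast
      moreover have "(y \<ominus>\<^bsub>P0\<^esub> y') \<oplus>\<^bsub>P0\<^esub> y' = y"
        using yc by (simp add: g.M.M.minus_eq g.M.M.a_assoc g.M.M.l_neg)
      then have "y' \<oplus>\<^bsub>P0\<^esub> (y \<ominus>\<^bsub>P0\<^esub> y') = y"
        using yc by (simp add: g.M.M.a_comm[of y'])
      ultimately show "q \<in> N" using q yc by (simp add: FF_simps(3)[OF P0_fd])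
    qed (use n(1) in auto)
  qed
  then have "projective_cover K \<Delta> (FF P0) (Fmap P0 M g) (FF M)"
    using F0 projective_FF[OF P0_fd P0_proj] G surj by (simp add: projective_cover_def)
  moreover have "projective_cover K \<Delta> FZ (\<lambda>q. q) FZ"
  proof -
    have "N = carrier FZ" if N: "rsubmodule \<Delta> FZ N" "N <+>\<^bsub>FZ\<^esub> a_kernel FZ FZ (\<lambda>q. q) = carrier FZ" for N
    proof -
      have k: "a_kernel FZ FZ (\<lambda>q. q) = {\<zero>\<^bsub>FZ\<^esub>}" using FZ.M.zero_closed by (auto simp: mem_a_kernel)
      have "x \<oplus>\<^bsub>FZ\<^esub> \<zero>\<^bsub>FZ\<^esub> = x" if "x \<in> N" for x
        by (rule FZ.M.r_zero[OF subsetD[OF rsubmoduleD(1)[OF N(1)] that]])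
      then have "N <+>\<^bsub>FZ\<^esub> {\<zero>\<^bsub>FZ\<^esub>} = N" unfolding set_add_def' by force
      then show ?thesis using N(2) k by simp
    qed
    moreover have "(\<lambda>q. q) \<in> rmod_hom \<Delta> FZ FZ" by (rule rmod_homI) auto
    ultimately show ?thesis using FZ_fd projective_FZ by (simp add: projective_cover_def)
  qed
  ultimately show ?thesis unfolding minimal_presentation_def kernel_Fmap by simp
qed

text \<open>A homomorphism from (0, Z) to F M has image in (0, MJ) and amounts to a homomorphism of
  A-modules from Z to MJ. Its extensions to F P0 correspond to extensions to \<open>P0\<close>,
  because \<open>F\<close> is full on homomorphisms out of a projective.\<close>

lemma factors_through_FF_iff:
  "factors_through \<Delta> FZ (\<lambda>q. q) (FF P0) (FF M) \<longleftrightarrow>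
    (\<forall>w\<in>rmod_hom A (P0\<lparr>carrier := Z\<rparr>) M. w ` Z \<subseteq> ideal_action M J \<longrightarrow>
      (\<exists>v\<in>rmod_hom A P0 M. \<forall>z\<in>Z. w z = v z))"
proof -
  interpret P0: fd_rmodule K A P0 by (rule P0_fd)
  interpret Mm: fd_rmodule K A M by (rule M)
  note sP = FF_simps[OF P0_fd] and sM = FF_simps[OF M]
  have Zc: "z \<in> carrier P0" if "z \<in> Z" for z using that by (simp add: mem_a_kernel)
  note Zs = rsubmoduleD[OF Z_rsubmodule]
  show ?thesis
  proof
    assume F: "factors_through \<Delta> FZ (\<lambda>q. q) (FF P0) (FF M)"
    show "\<forall>w\<in>rmod_hom A (P0\<lparr>carrier := Z\<rparr>) M. w ` Z \<subseteq> ideal_action M J \<longrightarrow>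
      (\<exists>v\<in>rmod_hom A P0 M. \<forall>z\<in>Z. w z = v z)"
    proof (intro ballI impI)
      fix w assume w: "w \<in> rmod_hom A (P0\<lparr>carrier := Z\<rparr>) M" and wJ: "w ` Z \<subseteq> ideal_action M J"
      have wc: "w z \<in> carrier M" "w z \<in> ideal_action M J" if "z \<in> Z" for z
        using rmod_hom_closed[OF w] wJ that by auto
      have wa: "w (z \<oplus>\<^bsub>P0\<^esub> z') = w z \<oplus>\<^bsub>M\<^esub> w z'" if "z \<in> Z" "z' \<in> Z" for z z'
        using rmod_hom_add[OF w] that by simp
      have wr: "w (z \<triangleleft>\<^bsub>P0\<^esub> a) = w z \<triangleleft>\<^bsub>M\<^esub> a" if "z \<in> Z" "a \<in> carrier A" for z a
        using rmod_hom_ract[OF w] that by simp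
      have "(\<lambda>(C, z). (\<kappa> M \<zero>\<^bsub>M\<^esub>, w z)) \<in> rmod_hom \<Delta> FZ (FF M)"
      proof (rule rmod_homI)
        fix q assume "q \<in> carrier FZ"
        then obtain z where z: "z \<in> Z" "q = (\<kappa> P0 \<zero>\<^bsub>P0\<^esub>, z)" by auto
        show "(case q of (C, z) \<Rightarrow> (\<kappa> M \<zero>\<^bsub>M\<^esub>, w z)) \<in> carrier (FF M)" using z wc(2) by (simp add: FF_memI[OF M])
        { fix q' assume "q' \<in> carrier FZ"
          then obtain z' where z': "z' \<in> Z" "q' = (\<kappa> P0 \<zero>\<^bsub>P0\<^esub>, z')" by auto
          show "(case q \<oplus>\<^bsub>FZ\<^esub> q' of (C, z) \<Rightarrow> (\<kappa> M \<zero>\<^bsub>M\<^esub>, w z)) =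
            (case q of (C, z) \<Rightarrow> (\<kappa> M \<zero>\<^bsub>M\<^esub>, w z)) \<oplus>\<^bsub>FF M\<^esub> (case q' of (C, z) \<Rightarrow> (\<kappa> M \<zero>\<^bsub>M\<^esub>, w z))"
            using z z' by (simp add: sP(3) sM(3) wa) }
        fix c assume "c \<in> carrier \<Delta>"
        then obtain a j b where c: "a \<in> carrier A" "j \<in> J" "b \<in> carrier A" "c = (qc a, j, qc b)"
          using triangular_rep by blast
        show "(case q \<triangleleft>\<^bsub>FZ\<^esub> c of (C, z) \<Rightarrow> (\<kappa> M \<zero>\<^bsub>M\<^esub>, w z)) = (case q of (C, z) \<Rightarrow> (\<kappa> M \<zero>\<^bsub>M\<^esub>, w z)) \<triangleleft>\<^bsub>FF M\<^esub> c"
          using z c wc[OF z(1)] J_closed[OF c(2)] FZ_act[OF z(1) c(1-3)]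
          by (simp add: sM(5) wr Mm.ract_zero_left Mm.ract_closed)
      qed
      then obtain W where W: "W \<in> rmod_hom \<Delta> (FF P0) (FF M)"
        "\<And>z. z \<in> Z \<Longrightarrow> W (\<kappa> P0 \<zero>\<^bsub>P0\<^esub>, z) = (\<kappa> M \<zero>\<^bsub>M\<^esub>, w z)"
        using bspec[OF F[unfolded factors_through_def]] by fastforce
      obtain v where v: "v \<in> rmod_hom A P0 M"
        "\<And>x y. \<lbrakk>x \<in> carrier P0; y \<in> ideal_action P0 J\<rbrakk> \<Longrightarrow> W (\<kappa> P0 x, y) = (\<kappa> M (v x), v y)"
        using FF_full_projective[OF P0_fd P0_proj M W(1)] by blast
      have "w z = v z" if "z \<in> Z" for z using W(2)[OF that] v(2)[OF P0.M.zero_closed Z_rad[OF that]] by simp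
      then show "\<exists>v\<in>rmod_hom A P0 M. \<forall>z\<in>Z. w z = v z" using v(1) by blast
    qed
  next
    assume E: "\<forall>w\<in>rmod_hom A (P0\<lparr>carrier := Z\<rparr>) M. w ` Z \<subseteq> ideal_action M J \<longrightarrow>
      (\<exists>v\<in>rmod_hom A P0 M. \<forall>z\<in>Z. w z = v z)"
    show "factors_through \<Delta> FZ (\<lambda>q. q) (FF P0) (FF M)"
      unfolding factors_through_def
    proof
      fix u assume u: "u \<in> rmod_hom \<Delta> FZ (FF M)"
      define w where "w z = snd (u (\<kappa> P0 \<zero>\<^bsub>P0\<^esub>, z))" for z
      have uw: "w z \<in> ideal_action M J \<and> u (\<kappa> P0 \<zero>\<^bsub>P0\<^esub>, z) = (\<kappa> M \<zero>\<^bsub>M\<^esub>, w z)" if z: "z \<in> Z" for z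
      proof -
        have q: "(\<kappa> P0 \<zero>\<^bsub>P0\<^esub>, z) \<in> carrier FZ" using z by simp
        obtain m n where mn: "m \<in> carrier M" "n \<in> ideal_action M J" "u (\<kappa> P0 \<zero>\<^bsub>P0\<^esub>, z) = (\<kappa> M m, n)"
          using FF_rep[OF M rmod_hom_closed[OF u q]] by blast
        \<comment> \<open>The lower right idempotent fixes (0, Z), so the image under
          \<open>u\<close> has first component zero.\<close>
        have c: "(qc \<zero>\<^bsub>A\<^esub>, \<zero>\<^bsub>A\<^esub>, qc \<one>\<^bsub>A\<^esub>) \<in> carrier \<Delta>" by (simp add: zero_in_J)
        have "(\<kappa> P0 \<zero>\<^bsub>P0\<^esub>, z) \<triangleleft>\<^bsub>FZ\<^esub> (qc \<zero>\<^bsub>A\<^esub>, \<zero>\<^bsub>A\<^esub>, qc \<one>\<^bsub>A\<^esub>) = (\<kappa> P0 \<zero>\<^bsub>P0\<^esub>, z)"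
          using FZ_act[OF z _ zero_in_J, of "\<zero>\<^bsub>A\<^esub>" "\<one>\<^bsub>A\<^esub>"] Zc[OF z] by (simp add: P0.ract_one)
        then have "u (\<kappa> P0 \<zero>\<^bsub>P0\<^esub>, z) = (\<kappa> M m, n) \<triangleleft>\<^bsub>FF M\<^esub> (qc \<zero>\<^bsub>A\<^esub>, \<zero>\<^bsub>A\<^esub>, qc \<one>\<^bsub>A\<^esub>)"
          using rmod_hom_ract[OF u q c] mn(3) by simp
        also have "\<dots> = (\<kappa> M \<zero>\<^bsub>M\<^esub>, n)"
          using mn Mm.MJ_subset[OF mn(2)] by (simp add: sM(5) zero_in_J Mm.ract_zero_right Mm.ract_one)
        finally show ?thesis using mn(2) by (simp add: w_def)
      qed
      have w: "w \<in> rmod_hom A (P0\<lparr>carrier := Z\<rparr>) M"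
      proof (rule rmod_homI)
        fix z assume "z \<in> carrier (P0\<lparr>carrier := Z\<rparr>)"
        then have z: "z \<in> Z" by simp
        have q: "(\<kappa> P0 \<zero>\<^bsub>P0\<^esub>, z) \<in> carrier FZ" using z by simp
        show "w z \<in> carrier M" using uw[OF z] Mm.MJ_subset by blast
        { fix z' assume "z' \<in> carrier (P0\<lparr>carrier := Z\<rparr>)"
          then have z': "z' \<in> Z" by simp
          have q': "(\<kappa> P0 \<zero>\<^bsub>P0\<^esub>, z') \<in> carrier FZ" using z' by simp
          have "u ((\<kappa> P0 \<zero>\<^bsub>P0\<^esub>, z) \<oplus>\<^bsub>FZ\<^esub> (\<kappa> P0 \<zero>\<^bsub>P0\<^esub>, z')) = (\<kappa> M \<zero>\<^bsub>M\<^esub>, w z \<oplus>\<^bsub>M\<^esub> w z')"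
            using rmod_hom_add[OF u q q'] uw[OF z] uw[OF z'] by (simp add: sM(3))
          then show "w (z \<oplus>\<^bsub>P0\<lparr>carrier := Z\<rparr>\<^esub> z') = w z \<oplus>\<^bsub>M\<^esub> w z'"
            using uw[OF Zs(3)[OF z z']] by (simp add: sP(3)) }
        fix a assume a: "a \<in> carrier A"
        have c: "(qc \<zero>\<^bsub>A\<^esub>, \<zero>\<^bsub>A\<^esub>, qc a) \<in> carrier \<Delta>" using a by (simp add: zero_in_J)
        have "u ((\<kappa> P0 \<zero>\<^bsub>P0\<^esub>, z) \<triangleleft>\<^bsub>FZ\<^esub> (qc \<zero>\<^bsub>A\<^esub>, \<zero>\<^bsub>A\<^esub>, qc a)) = (\<kappa> M \<zero>\<^bsub>M\<^esub>, w z \<triangleleft>\<^bsub>M\<^esub> a)"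
          using rmod_hom_ract[OF u q c] uw[OF z] a Mm.MJ_subset
          by (simp add: sM(5) zero_in_J Mm.ract_zero_right Mm.ract_closed)
        then show "w (z \<triangleleft>\<^bsub>P0\<lparr>carrier := Z\<rparr>\<^esub> a) = w z \<triangleleft>\<^bsub>M\<^esub> a"
          using uw[OF Zs(4)[OF z a]] FZ_act[OF z _ zero_in_J a, of "\<zero>\<^bsub>A\<^esub>"] by simp
      qed
      have wJ: "w ` Z \<subseteq> ideal_action M J" using uw by auto
      obtain v where v: "v \<in> rmod_hom A P0 M" "\<And>z. z \<in> Z \<Longrightarrow> w z = v z"
        using bspec[OF E w] wJ by auto
      interpret v: rmod_hom_pair K A P0 M v by (rule rmod_hom_pairI[OF P0_fd M v(1)])
      have "\<forall>q\<in>carrier FZ. u q = Fmap P0 M v q"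
      proof
        fix q assume "q \<in> carrier FZ"
        then obtain z where z: "z \<in> Z" "q = (\<kappa> P0 \<zero>\<^bsub>P0\<^esub>, z)" by auto
        then show "u q = Fmap P0 M v q" using uw[OF z(1)] v(2)[OF z(1)] by (simp add: Fmap_coset[OF P0_fd M v(1)])
      qed
      then show "\<exists>v\<in>rmod_hom \<Delta> (FF P0) (FF M). \<forall>q\<in>carrier FZ. u q = v q"
        using Fmap_hom[OF P0_fd M v(1)] by blast
    qed
  qed
qed

end

end

section \<open>Restriction along an isomorphism\<close>

lemma restrict_simps [simp]:
  "carrier (restrict_scalars \<theta> M) = carrier M" "zero (restrict_scalars \<theta> M) = zero M"
  "add (restrict_scalars \<theta> M) = add M" "smult (restrict_scalars \<theta> M) = smult M"
  "ract (restrict_scalars \<theta> M) = (\<lambda>x a. x \<triangleleft>\<^bsub>M\<^esub> \<theta> a)"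
  by (simp_all add: restrict_scalars_def)

lemma restrict_carrier_update:
  "(restrict_scalars \<theta> M)\<lparr>carrier := N\<rparr> = restrict_scalars \<theta> (M\<lparr>carrier := N\<rparr>)"
  by (simp add: restrict_scalars_def)

context
  fixes K :: "('k, 'r) ring_scheme" and A :: "('k, 'a) module" and B :: "('k, 'b) module" and \<theta>
  assumes A: "fd_algebra K A" and iso: "\<theta> \<in> algebra_iso K A B"
begin

lemma iso_image: "\<theta> ` carrier A = carrier B"
  using iso by (auto simp: algebra_iso_def ring_iso_def bij_betw_def)

lemma iso_closed: "a \<in> carrier A \<Longrightarrow> \<theta> a \<in> carrier B"
  using iso_image by blast

lemma iso_inj: "inj_on \<theta> (carrier A)"
  using iso by (auto simp: algebra_iso_def ring_iso_def bij_betw_def)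

lemma iso_ops:
  "\<lbrakk>a \<in> carrier A; b \<in> carrier A\<rbrakk> \<Longrightarrow> \<theta> (a \<oplus>\<^bsub>A\<^esub> b) = \<theta> a \<oplus>\<^bsub>B\<^esub> \<theta> b"
  "\<lbrakk>a \<in> carrier A; b \<in> carrier A\<rbrakk> \<Longrightarrow> \<theta> (a \<otimes>\<^bsub>A\<^esub> b) = \<theta> a \<otimes>\<^bsub>B\<^esub> \<theta> b"
  "\<theta> \<one>\<^bsub>A\<^esub> = \<one>\<^bsub>B\<^esub>"
  "\<lbrakk>c \<in> carrier K; a \<in> carrier A\<rbrakk> \<Longrightarrow> \<theta> (c \<odot>\<^bsub>A\<^esub> a) = c \<odot>\<^bsub>B\<^esub> \<theta> a"
  using iso by (auto simp: algebra_iso_def ring_iso_def ring_hom_def)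

text \<open>\<open>\<theta>\<close> maps onto \<open>B\<close>, so both sides test compatibility
  with the same set of operators.\<close>

lemma rmod_hom_restrict:
  "rmod_hom A (restrict_scalars \<theta> M) (restrict_scalars \<theta> N) = rmod_hom B M N"
  unfolding rmod_hom_def iso_image[symmetric] by simp

lemma rsubmodule_restrict: "rsubmodule A (restrict_scalars \<theta> M) N \<longleftrightarrow> rsubmodule B M N"
  unfolding rsubmodule_def iso_image[symmetric] by simp

lemma fd_rmodule_restrict:
  assumes M: "fd_rmodule K B M"
  shows "fd_rmodule K A (restrict_scalars \<theta> M)"
proof -
  interpret A: fd_algebra K A by (rule A)
  interpret M: fd_rmodule K B M by (rule M)
  let ?i = "inv_into (carrier A) \<theta>"
  have i: "?i b \<in> carrier A" "\<theta> (?i b) = b" if "b \<in> carrier B" for b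
    using that iso_image by (auto intro: inv_into_into f_inv_into_f)
  have eq: "?i b = a" if "a \<in> carrier A" "\<theta> a = b" for a b
    using that inv_into_f_f[OF iso_inj] by blast
  show ?thesis
    by (rule fd_rmodule_surj_image[where \<theta> = ?i and \<pi> = "\<lambda>x. x", OF M A])
      (auto simp: i iso_ops intro!: eq, metis eq i(1) iso_closed image_eqI)
qed

text \<open>The linear forms of a dual basis are composed with the inverse of
  \<open>\<theta>\<close>; the generators stay the same.\<close>

lemma projective_restrict:
  assumes M: "fd_rmodule K B M" and p: "projective B M"
  shows "projective A (restrict_scalars \<theta> M)"
proof -
  interpret A: fd_algebra K A by (rule A)
  let ?i = "inv_into (carrier A) \<theta>"
  have i: "?i b \<in> carrier A" "\<theta> (?i b) = b" if "b \<in> carrier B" for b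
    using that iso_image by (auto intro: inv_into_into f_inv_into_f)
  have eq: "?i b = a" if "a \<in> carrier A" "\<theta> a = b" for a b
    using that inv_into_f_f[OF iso_inj] by blast
  obtain n p h where db: "dual_basis B M n p h" using projective_iff_dual_basis[OF M] p by blast
  note d = dual_basisD[OF db]
  have "dual_basis A (restrict_scalars \<theta> M) n p (\<lambda>k x. ?i (h k x))"
    unfolding dual_basis_def
  proof (intro conjI allI impI ballI)
    fix k assume k: "k < n"
    show "p k \<in> carrier (restrict_scalars \<theta> M)" using d(1)[OF k] by simp
    show "(\<lambda>x. ?i (h k x)) \<in> rmod_hom A (restrict_scalars \<theta> M) (regular A)"
      using d(3)[OF k] rmod_hom_add[OF d(2)[OF k]] rmod_hom_ract[OF d(2)[OF k]]
      by (intro rmod_homI) (auto simp: i iso_ops iso_closed intro!: eq)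
  next
    fix x assume x: "x \<in> carrier (restrict_scalars \<theta> M)"
    interpret M: fd_rmodule K B M by (rule M)
    have "finsum (restrict_scalars \<theta> M) F I = finsum M F I" for F and I :: "nat set"
      by (rule fun_cong[OF fun_cong[OF finsum_cong_struct]]) simp_all
    moreover have "finsum M (\<lambda>k. p k \<triangleleft>\<^bsub>M\<^esub> \<theta> (?i (h k x))) {..<n} = finsum M (\<lambda>k. p k \<triangleleft>\<^bsub>M\<^esub> h k x) {..<n}"
      using x d(1,3) i(2) by (intro M.M.finsum_cong') (auto intro!: M.ract_closed)
    ultimately show "finsum (restrict_scalars \<theta> M) (\<lambda>k. p k \<triangleleft>\<^bsub>restrict_scalars \<theta> M\<^esub> ?i (h k x)) {..<n} = x"
      using d(4) x by simp
  qed
  then show ?thesis using projective_iff_dual_basis[OF fd_rmodule_restrict[OF M]] by blast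
qed

lemma projective_cover_restrict:
  assumes "projective_cover K B P g M"
  shows "projective_cover K A (restrict_scalars \<theta> P) g (restrict_scalars \<theta> M)"
proof -
  have "set_add (restrict_scalars \<theta> P) = set_add P" by (simp add: set_add_def' fun_eq_iff)
  moreover have "a_kernel (restrict_scalars \<theta> P) (restrict_scalars \<theta> M) g = a_kernel P M g"
    by (simp add: a_kernel_def')
  ultimately show ?thesis
    using assms fd_rmodule_restrict[of P] projective_restrict[of P]
    by (simp add: projective_cover_def rmod_hom_restrict rsubmodule_restrict)
qed

lemma minimal_presentation_restrict:
  assumes "minimal_presentation K B P1 f P0 g M"
  shows "minimal_presentation K A (restrict_scalars \<theta> P1) f (restrict_scalars \<theta> P0) g (restrict_scalars \<theta> M)"
proof -
  have "a_kernel (restrict_scalars \<theta> P0) (restrict_scalars \<theta> M) g = a_kernel P0 M g"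
    by (simp add: a_kernel_def')
  then show ?thesis
    using assms projective_cover_restrict[of P0 g M]
      projective_cover_restrict[of P1 f "P0\<lparr>carrier := a_kernel P0 M g\<rparr>"]
    by (simp add: minimal_presentation_def restrict_carrier_update)
qed

text \<open>Rigidity over \<open>A\<close> becomes factorization along the restricted presentation,
  and this is literally factorization over \<open>B\<close> since the sets of homomorphisms
  coincide.\<close>

lemma tau_rigid_restrict_iff:
  assumes M: "fd_rmodule K B M" and pres: "minimal_presentation K B P1 f P0 g M"
  shows "tau_rigid K A (restrict_scalars \<theta> M) \<longleftrightarrow> factors_through B P1 f P0 M"
  unfolding tau_rigid_iff_factors_through[OF fd_rmodule_restrict[OF M] minimal_presentation_restrict[OF pres]]
  by (simp add: factors_through_def rmod_hom_restrict)

end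

section \<open>The path algebra of the separated quiver\<close>

text \<open>The quiver provides only the number of arrows between two vertices. The basis is
  therefore indexed by a given set of the right size, and coordinates are extensional functions on
  it so that they are unique.\<close>

lemma indexed_basis:
  assumes V: "vectorspace K V" and fd: "vectorspace.fin_dim K V"
    and I: "finite I" "card I = vectorspace.dim K V"
  shows "\<exists>b. (\<forall>i\<in>I. b i \<in> carrier V) \<and>
    (\<forall>x\<in>carrier V. \<exists>!c. c \<in> I \<rightarrow>\<^sub>E carrier K \<and> finsum V (\<lambda>i. c i \<odot>\<^bsub>V\<^esub> b i) I = x)"
proof -
  interpret V: vectorspace K V by (rule V)
  obtain B where B: "finite B" "V.basis B" using V.finite_basis_exists[OF fd] by blast
  have BC: "B \<subseteq> carrier V" using B(2) by (simp add: V.basis_def)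
  obtain b where b: "bij_betw b I B"
    using finite_same_card_bij[OF I(1) B(1)] I(2) V.dim_basis[OF B] by auto
  then have inj: "inj_on b I" and im: "b ` I = B" by (auto simp: bij_betw_def)
  have bc: "b i \<in> carrier V" if "i \<in> I" for i using that im BC by blast
  have reindex: "V.lincomb a B = finsum V (\<lambda>i. a (b i) \<odot>\<^bsub>V\<^esub> b i) I" if "a \<in> B \<rightarrow> carrier K" for a
    unfolding V.lincomb_def im[symmetric]
    by (rule V.M.finsum_reindex[OF _ inj]) (use that im bc in auto)
  have "\<exists>!c. c \<in> I \<rightarrow>\<^sub>E carrier K \<and> finsum V (\<lambda>i. c i \<odot>\<^bsub>V\<^esub> b i) I = x" if x: "x \<in> carrier V" for x
  proof -
    obtain a where a: "a \<in> B \<rightarrow>\<^sub>E carrier K" "V.lincomb a B = x"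
      and uniq: "\<And>a'. \<lbrakk>a' \<in> B \<rightarrow>\<^sub>E carrier K; V.lincomb a' B = x\<rbrakk> \<Longrightarrow> a' = a"
      using V.basis_criterion[OF B(1) BC] B(2) x by metis
    show ?thesis
    proof (rule ex1I[of _ "\<lambda>i\<in>I. a (b i)"], intro conjI)
      show "(\<lambda>i\<in>I. a (b i)) \<in> I \<rightarrow>\<^sub>E carrier K" using a(1) im by auto
      have "finsum V (\<lambda>i. (\<lambda>i\<in>I. a (b i)) i \<odot>\<^bsub>V\<^esub> b i) I = finsum V (\<lambda>i. a (b i) \<odot>\<^bsub>V\<^esub> b i) I"
        using a(1) im bc by (intro V.M.finsum_cong') auto
      also have "\<dots> = V.lincomb a B" using a(1) by (intro reindex[symmetric]) auto
      also have "\<dots> = x" by (rule a(2))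
      finally show "finsum V (\<lambda>i. (\<lambda>i\<in>I. a (b i)) i \<odot>\<^bsub>V\<^esub> b i) I = x" .
    next
      fix c assume c: "c \<in> I \<rightarrow>\<^sub>E carrier K \<and> finsum V (\<lambda>i. c i \<odot>\<^bsub>V\<^esub> b i) I = x"
      define a' where "a' = (\<lambda>v\<in>B. c (inv_into I b v))"
      have a'b: "a' (b i) = c i" if "i \<in> I" for i
        using that im inj by (auto simp: a'_def inv_into_f_f)
      have a': "a' \<in> B \<rightarrow>\<^sub>E carrier K"
        using c im by (auto simp: a'_def PiE_iff inv_into_into)
      then have "V.lincomb a' B = finsum V (\<lambda>i. a' (b i) \<odot>\<^bsub>V\<^esub> b i) I" by (intro reindex) auto
      also have "\<dots> = finsum V (\<lambda>i. c i \<odot>\<^bsub>V\<^esub> b i) I"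
        using a'b c bc by (intro V.M.finsum_cong') auto
      finally have "a' = a" using uniq[OF a'] c by simp
      then show "c = (\<lambda>i\<in>I. a (b i))" using c a'b by (auto simp: PiE_iff extensional_def fun_eq_iff)
    qed
  qed
  then show ?thesis using bc by blast
qed

section \<open>Peirce decomposition and coordinates modulo the radical\<close>

context split_algebra
begin

text \<open>These elements form a product of copies of the field inside the algebra, which maps
  isomorphically onto A/J.\<close>

definition diagonal :: "('v \<Rightarrow> 'k) \<Rightarrow> 'a" where
  "diagonal c = finsum A (\<lambda>v. c v \<odot>\<^bsub>A\<^esub> e v) V"

lemma diagonal_closed: "c \<in> V \<rightarrow> carrier K \<Longrightarrow> diagonal c \<in> carrier A"
  unfolding diagonal_def by (rule M.finsum_closed) (auto intro: e_closed)

lemma e_mult_e: "\<lbrakk>v \<in> V; w \<in> V\<rbrakk> \<Longrightarrow> e v \<otimes>\<^bsub>A\<^esub> e w = (if v = w then e v else \<zero>\<^bsub>A\<^esub>)"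
  by (simp add: e_idem e_orth)

lemma e_mult_diagonal:
  assumes c: "c \<in> V \<rightarrow> carrier K" and v: "v \<in> V"
  shows "e v \<otimes>\<^bsub>A\<^esub> diagonal c = c v \<odot>\<^bsub>A\<^esub> e v" "diagonal c \<otimes>\<^bsub>A\<^esub> e v = c v \<odot>\<^bsub>A\<^esub> e v"
proof -
  have cl: "(\<lambda>w. c w \<odot>\<^bsub>A\<^esub> e w) \<in> V \<rightarrow> carrier A" using c e_closed by auto
  have c': "c w \<in> carrier K" if "w \<in> V" for w using c that by auto
  have single: "finsum A (\<lambda>w. if v = w then c w \<odot>\<^bsub>A\<^esub> e w else \<zero>\<^bsub>A\<^esub>) V = c v \<odot>\<^bsub>A\<^esub> e v"
    using M.finsum_singleton[of v V "\<lambda>w. c w \<odot>\<^bsub>A\<^esub> e w"] v fin_V cl by simp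
  have t: "e v \<otimes>\<^bsub>A\<^esub> (c w \<odot>\<^bsub>A\<^esub> e w) = (if v = w then c w \<odot>\<^bsub>A\<^esub> e w else \<zero>\<^bsub>A\<^esub>)"
    "(c w \<odot>\<^bsub>A\<^esub> e w) \<otimes>\<^bsub>A\<^esub> e v = (if v = w then c w \<odot>\<^bsub>A\<^esub> e w else \<zero>\<^bsub>A\<^esub>)" if "w \<in> V" for w
    using that v c'[OF that] e_closed by (auto simp: smult_mult_left smult_mult_right e_mult_e smult_r_null)
  have "e v \<otimes>\<^bsub>A\<^esub> diagonal c = finsum A (\<lambda>w. e v \<otimes>\<^bsub>A\<^esub> (c w \<odot>\<^bsub>A\<^esub> e w)) V"
    using fin_V e_closed[OF v] cl by (simp add: diagonal_def finsum_mult_right)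
  also have "\<dots> = finsum A (\<lambda>w. if v = w then c w \<odot>\<^bsub>A\<^esub> e w else \<zero>\<^bsub>A\<^esub>) V"
    using t cl by (intro M.finsum_cong') auto
  finally show "e v \<otimes>\<^bsub>A\<^esub> diagonal c = c v \<odot>\<^bsub>A\<^esub> e v" by (simp only: single)
  have "diagonal c \<otimes>\<^bsub>A\<^esub> e v = finsum A (\<lambda>w. (c w \<odot>\<^bsub>A\<^esub> e w) \<otimes>\<^bsub>A\<^esub> e v) V"
    using fin_V e_closed[OF v] cl by (simp add: diagonal_def finsum_mult_right)
  also have "\<dots> = finsum A (\<lambda>w. if v = w then c w \<odot>\<^bsub>A\<^esub> e w else \<zero>\<^bsub>A\<^esub>) V"
    using t cl by (intro M.finsum_cong') auto
  finally show "diagonal c \<otimes>\<^bsub>A\<^esub> e v = c v \<odot>\<^bsub>A\<^esub> e v" by (simp only: single)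
qed

lemma peirce_sums:
  assumes a: "a \<in> carrier A"
  shows "a = finsum A (\<lambda>v. e v \<otimes>\<^bsub>A\<^esub> a) V"
    and "w \<in> V \<Longrightarrow> e w \<otimes>\<^bsub>A\<^esub> a = finsum A (\<lambda>v. e w \<otimes>\<^bsub>A\<^esub> a \<otimes>\<^bsub>A\<^esub> e v) V"
proof -
  have "\<one>\<^bsub>A\<^esub> \<otimes>\<^bsub>A\<^esub> a = finsum A (\<lambda>v. e v \<otimes>\<^bsub>A\<^esub> a) V"
    unfolding e_sum[symmetric] using a e_closed by (intro finsum_mult_right(2) fin_V) auto
  then show "a = finsum A (\<lambda>v. e v \<otimes>\<^bsub>A\<^esub> a) V" using a by simp
  assume w: "w \<in> V"
  have "(e w \<otimes>\<^bsub>A\<^esub> a) \<otimes>\<^bsub>A\<^esub> \<one>\<^bsub>A\<^esub> = finsum A (\<lambda>v. e w \<otimes>\<^bsub>A\<^esub> a \<otimes>\<^bsub>A\<^esub> e v) V"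
    unfolding e_sum[symmetric] using a w e_closed by (intro finsum_mult_right(1) fin_V) auto
  then show "e w \<otimes>\<^bsub>A\<^esub> a = finsum A (\<lambda>v. e w \<otimes>\<^bsub>A\<^esub> a \<otimes>\<^bsub>A\<^esub> e v) V" using a e_closed[OF w] by simp
qed

text \<open>The unit is the sum of the e_v, so an element is the sum of its Peirce
  components.\<close>

lemma peirce_eqI:
  assumes a: "a \<in> carrier A" and b: "b \<in> carrier A"
    and eq: "\<And>v w. \<lbrakk>v \<in> V; w \<in> V\<rbrakk> \<Longrightarrow> e v \<otimes>\<^bsub>A\<^esub> a \<otimes>\<^bsub>A\<^esub> e w = e v \<otimes>\<^bsub>A\<^esub> b \<otimes>\<^bsub>A\<^esub> e w"
  shows "a = b"
proof -
  have *: "finsum A (\<lambda>w. e v \<otimes>\<^bsub>A\<^esub> a \<otimes>\<^bsub>A\<^esub> e w) V = finsum A (\<lambda>w. e v \<otimes>\<^bsub>A\<^esub> b \<otimes>\<^bsub>A\<^esub> e w) V" if v: "v \<in> V" for v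
    using v b e_closed by (intro M.finsum_cong') (auto simp: eq)
  have "e v \<otimes>\<^bsub>A\<^esub> a = e v \<otimes>\<^bsub>A\<^esub> b" if v: "v \<in> V" for v
    by (rule trans[OF peirce_sums(2)[OF a v] trans[OF *[OF v] peirce_sums(2)[OF b v, symmetric]]])
  then have "finsum A (\<lambda>v. e v \<otimes>\<^bsub>A\<^esub> a) V = finsum A (\<lambda>v. e v \<otimes>\<^bsub>A\<^esub> b) V"
    using b e_closed by (intro M.finsum_cong') auto
  then show ?thesis using peirce_sums(1)[OF a, symmetric] peirce_sums(1)[OF b, symmetric] by simp
qed

lemma peirce_JI:
  assumes a: "a \<in> carrier A"
    and eq: "\<And>v w. \<lbrakk>v \<in> V; w \<in> V\<rbrakk> \<Longrightarrow> e v \<otimes>\<^bsub>A\<^esub> a \<otimes>\<^bsub>A\<^esub> e w \<in> J"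
  shows "a \<in> J"
proof -
  have *: "finsum A (\<lambda>w. e v \<otimes>\<^bsub>A\<^esub> a \<otimes>\<^bsub>A\<^esub> e w) V \<in> J" if v: "v \<in> V" for v
    by (rule J_finsum[OF fin_V]) (use v eq in auto)
  have "e v \<otimes>\<^bsub>A\<^esub> a \<in> J" if v: "v \<in> V" for v
    by (subst peirce_sums(2)[OF a v]) (rule *[OF v])
  then have "finsum A (\<lambda>v. e v \<otimes>\<^bsub>A\<^esub> a) V \<in> J" by (intro J_finsum[OF fin_V]) auto
  then show ?thesis using peirce_sums(1)[OF a, symmetric] by simp
qed

lemma diagonal_add:
  assumes "c \<in> V \<rightarrow> carrier K" "d \<in> V \<rightarrow> carrier K"
  shows "diagonal (\<lambda>v. c v \<oplus>\<^bsub>K\<^esub> d v) = diagonal c \<oplus>\<^bsub>A\<^esub> diagonal d"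
proof -
  have "diagonal (\<lambda>v. c v \<oplus>\<^bsub>K\<^esub> d v) = finsum A (\<lambda>v. c v \<odot>\<^bsub>A\<^esub> e v \<oplus>\<^bsub>A\<^esub> d v \<odot>\<^bsub>A\<^esub> e v) V"
    unfolding diagonal_def using assms e_closed
    by (intro M.finsum_cong') (auto simp: smult_l_distr Pi_iff)
  also have "\<dots> = diagonal c \<oplus>\<^bsub>A\<^esub> diagonal d"
    unfolding diagonal_def using assms e_closed by (intro M.finsum_addf) (auto simp: Pi_iff)
  finally show ?thesis .
qed

lemma diagonal_smult:
  assumes "c \<in> V \<rightarrow> carrier K" "k \<in> carrier K"
  shows "diagonal (\<lambda>v. k \<otimes>\<^bsub>K\<^esub> c v) = k \<odot>\<^bsub>A\<^esub> diagonal c"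
proof -
  have "diagonal (\<lambda>v. k \<otimes>\<^bsub>K\<^esub> c v) = finsum A (\<lambda>v. k \<odot>\<^bsub>A\<^esub> (c v \<odot>\<^bsub>A\<^esub> e v)) V"
    unfolding diagonal_def using assms e_closed
    by (intro M.finsum_cong') (auto simp: smult_assoc1 Pi_iff)
  also have "\<dots> = k \<odot>\<^bsub>A\<^esub> diagonal c"
    unfolding diagonal_def using assms e_closed by (intro finsum_smult[symmetric] fin_V) (auto simp: Pi_iff)
  finally show ?thesis .
qed

lemma diagonal_mult:
  assumes c: "c \<in> V \<rightarrow> carrier K" and d: "d \<in> V \<rightarrow> carrier K"
  shows "diagonal (\<lambda>v. c v \<otimes>\<^bsub>K\<^esub> d v) = diagonal c \<otimes>\<^bsub>A\<^esub> diagonal d"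
proof -
  have "diagonal c \<otimes>\<^bsub>A\<^esub> diagonal d = finsum A (\<lambda>v. diagonal c \<otimes>\<^bsub>A\<^esub> (d v \<odot>\<^bsub>A\<^esub> e v)) V"
    unfolding diagonal_def[of d]
    by (rule finsum_mult_right(1)[OF fin_V _ diagonal_closed[OF c]]) (use d e_closed in auto)
  also have "\<dots> = diagonal (\<lambda>v. c v \<otimes>\<^bsub>K\<^esub> d v)"
    unfolding diagonal_def[of "\<lambda>v. c v \<otimes>\<^bsub>K\<^esub> d v"] using c d e_closed diagonal_closed[OF c]
    by (intro M.finsum_cong')
      (auto simp: Pi_iff smult_mult_right e_mult_diagonal(2)[OF c] smult_assoc1[symmetric] R.m_comm)
  finally show ?thesis by simp
qed

lemma diagonal_one: "diagonal (\<lambda>v. \<one>\<^bsub>K\<^esub>) = \<one>\<^bsub>A\<^esub>"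
  unfolding diagonal_def e_sum[symmetric] using e_closed by (intro M.finsum_cong') auto

lemma e_not_in_J: "v \<in> V \<Longrightarrow> e v \<notin> J"
  using J_square e_idem e_nonzero by metis

text \<open>Multiplying the difference by e_v shows that (c v - d v) e_v lies in \<open>J\<close>.
  If the scalar were nonzero, the idempotent e_v itself would lie in \<open>J\<close>.\<close>

lemma qc_diagonal_inj:
  assumes c: "c \<in> V \<rightarrow> carrier K" and d: "d \<in> V \<rightarrow> carrier K" and v: "v \<in> V"
    and eq: "qc (diagonal c) = qc (diagonal d)"
  shows "c v = d v"
proof (rule ccontr)
  assume ne: "c v \<noteq> d v"
  have cd: "c v \<in> carrier K" "d v \<in> carrier K" using c d v by auto
  define k where "k = c v \<ominus>\<^bsub>K\<^esub> d v"
  have k: "k \<in> carrier K" "k \<noteq> \<zero>\<^bsub>K\<^esub>" using ne cd by (auto simp: k_def)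
  have "diagonal c \<ominus>\<^bsub>A\<^esub> diagonal d \<in> J"
    using eq qc_eq_iff[OF diagonal_closed[OF c] diagonal_closed[OF d]] by simp
  then have "e v \<otimes>\<^bsub>A\<^esub> (diagonal c \<ominus>\<^bsub>A\<^esub> diagonal d) \<in> J" by (rule J_mult_left[OF e_closed[OF v]])
  also have "e v \<otimes>\<^bsub>A\<^esub> (diagonal c \<ominus>\<^bsub>A\<^esub> diagonal d) = c v \<odot>\<^bsub>A\<^esub> e v \<ominus>\<^bsub>A\<^esub> d v \<odot>\<^bsub>A\<^esub> e v"
    using e_closed[OF v] diagonal_closed[OF c] diagonal_closed[OF d] v c d
    by (simp add: M.minus_eq A.r_distr A.r_minus e_mult_diagonal(1))
  also have "\<dots> = k \<odot>\<^bsub>A\<^esub> e v"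
    using cd e_closed[OF v] by (simp add: k_def M.minus_eq R.minus_eq smult_l_distr smult_l_minus)
  finally have kJ: "k \<odot>\<^bsub>A\<^esub> e v \<in> J" .
  have "inv\<^bsub>K\<^esub> k \<odot>\<^bsub>A\<^esub> (k \<odot>\<^bsub>A\<^esub> e v) \<in> J"
    using k by (intro J_smult[OF _ kJ]) (simp add: field_Units)
  also have "inv\<^bsub>K\<^esub> k \<odot>\<^bsub>A\<^esub> (k \<odot>\<^bsub>A\<^esub> e v) = e v"
    using k e_closed[OF v] by (simp add: smult_assoc1[symmetric] field_Units)
  finally show False using e_not_in_J[OF v] by simp
qed

text \<open>For \<open>c v\<close> one takes the scalar of the corner component at v modulo
  \<open>J\<close>. Then all Peirce components of the difference between a and
  \<open>diagonal c\<close> lie in \<open>J\<close>.\<close>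

lemma qc_diagonal_surj:
  assumes a: "a \<in> carrier A"
  shows "\<exists>c \<in> V \<rightarrow> carrier K. qc a = qc (diagonal c)"
proof -
  obtain c where c: "\<And>v. v \<in> V \<Longrightarrow> c v \<in> carrier K \<and> e v \<otimes>\<^bsub>A\<^esub> a \<otimes>\<^bsub>A\<^esub> e v \<ominus>\<^bsub>A\<^esub> c v \<odot>\<^bsub>A\<^esub> e v \<in> J"
    using diag[OF _ a] by metis
  then have cV: "c \<in> V \<rightarrow> carrier K" by blast
  note D = diagonal_closed[OF cV]
  have "a \<ominus>\<^bsub>A\<^esub> diagonal c \<in> J"
  proof (rule peirce_JI)
    show "a \<ominus>\<^bsub>A\<^esub> diagonal c \<in> carrier A" using a D by simp
    fix v w assume v: "v \<in> V" and w: "w \<in> V"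
    have cv: "c v \<in> carrier K" using c[OF v] by blast
    have "e v \<otimes>\<^bsub>A\<^esub> (a \<ominus>\<^bsub>A\<^esub> diagonal c) \<otimes>\<^bsub>A\<^esub> e w =
        e v \<otimes>\<^bsub>A\<^esub> a \<otimes>\<^bsub>A\<^esub> e w \<ominus>\<^bsub>A\<^esub> c v \<odot>\<^bsub>A\<^esub> (if v = w then e v else \<zero>\<^bsub>A\<^esub>)"
      using a D e_closed[OF v] e_closed[OF w] cv e_mult_e[OF v w]
      by (simp add: M.minus_eq A.r_distr A.l_distr A.r_minus A.l_minus e_mult_diagonal(1)[OF cV v] smult_mult_left)
    also have "\<dots> \<in> J"
      using c[OF v] off_diag[OF v w _ a] a e_closed[OF v] e_closed[OF w] cv
      by (auto simp: smult_r_null M.minus_eq)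
    finally show "e v \<otimes>\<^bsub>A\<^esub> (a \<ominus>\<^bsub>A\<^esub> diagonal c) \<otimes>\<^bsub>A\<^esub> e w \<in> J" .
  qed
  then show ?thesis using qc_eq_iff[OF a D] cV by blast
qed

end

context split_algebra
begin

text \<open>The dimension is that of e_i J e_j in the quotient by J^2, which here is the quotient by
  zero and has singletons as elements. A basis of this space is read back as elements of
  \<open>J\<close> that e_i fixes from the left and e_j from the right.\<close>

lemma peirce_basis:
  assumes i: "i \<in> V" and j: "j \<in> V" and I: "finite I"
    and card: "card I = vectorspace.dim K ((quot_algebra A {\<zero>\<^bsub>A\<^esub>})
      \<lparr>carrier := (\<lambda>x. {\<zero>\<^bsub>A\<^esub>} +>\<^bsub>A\<^esub> (e i \<otimes>\<^bsub>A\<^esub> x \<otimes>\<^bsub>A\<^esub> e j)) ` J\<rparr>)"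
  shows "\<exists>b. (\<forall>\<alpha>\<in>I. b \<alpha> \<in> J \<and> e i \<otimes>\<^bsub>A\<^esub> b \<alpha> = b \<alpha> \<and> b \<alpha> \<otimes>\<^bsub>A\<^esub> e j = b \<alpha>) \<and>
    (\<forall>x\<in>J. \<exists>!c. c \<in> I \<rightarrow>\<^sub>E carrier K \<and> finsum A (\<lambda>\<alpha>. c \<alpha> \<odot>\<^bsub>A\<^esub> b \<alpha>) I = e i \<otimes>\<^bsub>A\<^esub> x \<otimes>\<^bsub>A\<^esub> e j)"
proof -
  note ij = e_closed[OF i] e_closed[OF j]
  define p where "p x = e i \<otimes>\<^bsub>A\<^esub> x \<otimes>\<^bsub>A\<^esub> e j" for x
  have sing: "{\<zero>\<^bsub>A\<^esub>} +>\<^bsub>A\<^esub> a = {a}" if "a \<in> carrier A" for a using that by (auto simp: a_r_coset_def')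
  have pc: "p x \<in> carrier A" if "x \<in> carrier A" for x using that ij by (simp add: p_def)
  have pJ: "p x \<in> J" if "x \<in> J" for x
    unfolding p_def using that ij J_mult_left rsubmoduleD(4)[OF J_rsubmodule] by simp
  define W where "W = (quot_algebra A {\<zero>\<^bsub>A\<^esub>})\<lparr>carrier := (\<lambda>x. {p x}) ` J\<rparr>"
  have "(\<lambda>x. {\<zero>\<^bsub>A\<^esub>} +>\<^bsub>A\<^esub> (e i \<otimes>\<^bsub>A\<^esub> x \<otimes>\<^bsub>A\<^esub> e j)) ` J = (\<lambda>x. {p x}) ` J"
    using sing pc J_closed by (simp add: p_def image_def)
  then have cardW: "card I = vectorspace.dim K W" using card by (simp add: W_def)
  have Wc: "carrier W = (\<lambda>x. {p x}) ` J" by (simp add: W_def)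
  have Wadd: "{a} \<oplus>\<^bsub>W\<^esub> {b} = {a \<oplus>\<^bsub>A\<^esub> b}" for a b
    by (simp add: W_def quot_algebra_def FactRing_def set_add_def')
  have Wsmult: "c \<odot>\<^bsub>W\<^esub> {a} = {c \<odot>\<^bsub>A\<^esub> a}" if "c \<in> carrier K" "a \<in> carrier A" for c a
    using that by (simp add: W_def quot_algebra_def sing)
  have Wzero: "\<zero>\<^bsub>W\<^esub> = {\<zero>\<^bsub>A\<^esub>}" by (simp add: W_def quot_algebra_def FactRing_def)
  have Jsub: "subspace K J A" using fd_rmodule.rsubmodule_subspace[OF regular_fd J_rsubmodule]
    by (auto simp: subspace_def submodule_def vectorspace_axioms module_axioms)
  have JV: "vectorspace K (A\<lparr>carrier := J\<rparr>)" by (rule subspace_is_vs[OF Jsub])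
  have Jfd: "vectorspace.fin_dim K (A\<lparr>carrier := J\<rparr>)" by (rule subspace_fin_dim[OF Jsub fin_dim])
  have padd: "p (x \<oplus>\<^bsub>A\<^esub> y) = p x \<oplus>\<^bsub>A\<^esub> p y" if "x \<in> carrier A" "y \<in> carrier A" for x y
    using that ij by (simp add: p_def A.r_distr A.l_distr)
  have psmult: "p (c \<odot>\<^bsub>A\<^esub> x) = c \<odot>\<^bsub>A\<^esub> p x" if "c \<in> carrier K" "x \<in> carrier A" for c x
    using that ij by (simp add: p_def smult_mult_left smult_mult_right)
  have pzero: "p \<zero>\<^bsub>A\<^esub> = \<zero>\<^bsub>A\<^esub>" using ij by (simp add: p_def)
  note im = vectorspace_surj_image[where \<pi> = "\<lambda>x. {p x}" and W = W, OF JV]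
  have W: "vectorspace K W"
    by (rule im(1)) (use J_closed pc in \<open>simp_all add: Wc Wadd Wsmult Wzero padd psmult pzero\<close>)
  have Wfd: "vectorspace.fin_dim K W"
    by (rule im(2)) (use J_closed pc Jfd in \<open>simp_all add: Wc Wadd Wsmult Wzero padd psmult pzero\<close>)
  interpret W: vectorspace K W by (rule W)
  from indexed_basis[OF W Wfd I cardW] obtain b' where b': "\<forall>\<alpha>\<in>I. b' \<alpha> \<in> carrier W"
    and uniq: "\<forall>x\<in>carrier W. \<exists>!c. c \<in> I \<rightarrow>\<^sub>E carrier K \<and> finsum W (\<lambda>\<alpha>. c \<alpha> \<odot>\<^bsub>W\<^esub> b' \<alpha>) I = x"
    by (elim exE conjE)
  have "\<forall>\<alpha>\<in>I. \<exists>x. x \<in> J \<and> b' \<alpha> = {p x}" using b' by (auto simp: Wc)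
  then obtain b0 where b0: "\<And>\<alpha>. \<alpha> \<in> I \<Longrightarrow> b0 \<alpha> \<in> J \<and> b' \<alpha> = {p (b0 \<alpha>)}"
    by metis
  define b where "b \<alpha> = p (b0 \<alpha>)" for \<alpha>
  have bJ: "b \<alpha> \<in> J" if "\<alpha> \<in> I" for \<alpha> using b0[OF that] pJ by (simp add: b_def)
  have pid: "e i \<otimes>\<^bsub>A\<^esub> p x = p x" "p x \<otimes>\<^bsub>A\<^esub> e j = p x" "p (p x) = p x" if "x \<in> carrier A" for x
  proof -
    show 1: "e i \<otimes>\<^bsub>A\<^esub> p x = p x" using that ij e_idem[OF i] by (simp add: p_def A.m_assoc[symmetric])
    show 2: "p x \<otimes>\<^bsub>A\<^esub> e j = p x" using that ij e_idem[OF j] by (simp add: p_def A.m_assoc)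
    show "p (p x) = p x" using 1 2 by (simp add: p_def)
  qed
  have bW: "{b \<alpha>} \<in> carrier W" if "\<alpha> \<in> I" for \<alpha> using b0[OF that] by (auto simp: b_def Wc)
  \<comment> \<open>A linear combination of singletons in the quotient is the singleton of the
    linear combination in \<open>A\<close>.\<close>
  have sum: "finsum W (\<lambda>\<alpha>. c \<alpha> \<odot>\<^bsub>W\<^esub> b' \<alpha>) I = {finsum A (\<lambda>\<alpha>. c \<alpha> \<odot>\<^bsub>A\<^esub> b \<alpha>) I}" if c: "c \<in> I \<rightarrow> carrier K" for c
  proof -
    have "finsum W (\<lambda>\<alpha>. c \<alpha> \<odot>\<^bsub>W\<^esub> b' \<alpha>) I' = {finsum A (\<lambda>\<alpha>. c \<alpha> \<odot>\<^bsub>A\<^esub> b \<alpha>) I'}" if "finite I'" "I' \<subseteq> I" for I'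
      using that
    proof (induct I' rule: finite_induct)
      case empty
      show ?case by (simp add: Wzero)
    next
      case (insert \<alpha> I')
      have cb: "c \<beta> \<in> carrier K" "b \<beta> \<in> carrier A" "b' \<beta> = {b \<beta>}" "b' \<beta> \<in> carrier W" if "\<beta> \<in> insert \<alpha> I'" for \<beta>
        using that insert.prems c b' b0 bJ[THEN J_closed] by (auto simp: b_def)
      have Wc: "c \<beta> \<odot>\<^bsub>W\<^esub> b' \<beta> \<in> carrier W" if "\<beta> \<in> insert \<alpha> I'" for \<beta>
        using cb[OF that] by (intro W.smult_closed)
      have "finsum W (\<lambda>\<alpha>. c \<alpha> \<odot>\<^bsub>W\<^esub> b' \<alpha>) (insert \<alpha> I') = c \<alpha> \<odot>\<^bsub>W\<^esub> b' \<alpha> \<oplus>\<^bsub>W\<^esub> {finsum A (\<lambda>\<alpha>. c \<alpha> \<odot>\<^bsub>A\<^esub> b \<alpha>) I'}"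
        using insert Wc by (subst W.M.finsum_insert) auto
      also have "\<dots> = {c \<alpha> \<odot>\<^bsub>A\<^esub> b \<alpha> \<oplus>\<^bsub>A\<^esub> finsum A (\<lambda>\<alpha>. c \<alpha> \<odot>\<^bsub>A\<^esub> b \<alpha>) I'}"
        using Wsmult[of "c \<alpha>" "b \<alpha>"] cb[of \<alpha>] by (simp only: Wadd insertI1)
      also have "c \<alpha> \<odot>\<^bsub>A\<^esub> b \<alpha> \<oplus>\<^bsub>A\<^esub> finsum A (\<lambda>\<alpha>. c \<alpha> \<odot>\<^bsub>A\<^esub> b \<alpha>) I' = finsum A (\<lambda>\<alpha>. c \<alpha> \<odot>\<^bsub>A\<^esub> b \<alpha>) (insert \<alpha> I')"
        using insert.hyps cb by (subst M.finsum_insert) auto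
      finally show ?case .
    qed
    then show ?thesis using I by blast
  qed
  have "\<exists>!c. c \<in> I \<rightarrow>\<^sub>E carrier K \<and> finsum A (\<lambda>\<alpha>. c \<alpha> \<odot>\<^bsub>A\<^esub> b \<alpha>) I = p x" if x: "x \<in> J" for x
  proof -
    have eq: "c \<in> I \<rightarrow>\<^sub>E carrier K \<and> finsum W (\<lambda>\<alpha>. c \<alpha> \<odot>\<^bsub>W\<^esub> b' \<alpha>) I = {p x} \<longleftrightarrow>
        c \<in> I \<rightarrow>\<^sub>E carrier K \<and> finsum A (\<lambda>\<alpha>. c \<alpha> \<odot>\<^bsub>A\<^esub> b \<alpha>) I = p x" for c
      using sum[of c] by (auto simp: PiE_iff)
    have "{p x} \<in> carrier W" using x by (simp add: Wc)
    from bspec[OF uniq this] show ?thesis unfolding eq .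
  qed
  moreover have "b \<alpha> \<in> J \<and> e i \<otimes>\<^bsub>A\<^esub> b \<alpha> = b \<alpha> \<and> b \<alpha> \<otimes>\<^bsub>A\<^esub> e j = b \<alpha>" if "\<alpha> \<in> I" for \<alpha>
    using bJ[OF that] b0[OF that] pid[OF J_closed] by (simp add: b_def)
  ultimately show ?thesis by (intro exI[of _ b] conjI ballI) (simp_all add: p_def)
qed

end

text \<open>\<open>A\<close> is only a record closed under its operations; its axioms are pulled
  back from \<open>B\<close>. The equation 0 + 0 = 0 forces the image of zero to be zero, which
  \<open>algebra_iso\<close> does not state.\<close>

lemma fd_algebra_iso:
  assumes B: "fd_algebra K B" and iso: "\<theta> \<in> algebra_iso K A B"
    and add: "\<And>x y. \<lbrakk>x \<in> carrier A; y \<in> carrier A\<rbrakk> \<Longrightarrow> x \<oplus>\<^bsub>A\<^esub> y \<in> carrier A"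
    and mult: "\<And>x y. \<lbrakk>x \<in> carrier A; y \<in> carrier A\<rbrakk> \<Longrightarrow> x \<otimes>\<^bsub>A\<^esub> y \<in> carrier A"
    and smult: "\<And>c x. \<lbrakk>c \<in> carrier K; x \<in> carrier A\<rbrakk> \<Longrightarrow> c \<odot>\<^bsub>A\<^esub> x \<in> carrier A"
    and one: "\<one>\<^bsub>A\<^esub> \<in> carrier A" and zero: "\<zero>\<^bsub>A\<^esub> \<in> carrier A" "\<zero>\<^bsub>A\<^esub> \<oplus>\<^bsub>A\<^esub> \<zero>\<^bsub>A\<^esub> = \<zero>\<^bsub>A\<^esub>"
  shows "fd_algebra K A"
proof -
  interpret B: fd_algebra K B by (rule B)
  let ?i = "inv_into (carrier A) \<theta>"
  have im: "\<theta> ` carrier A = carrier B" and inj: "inj_on \<theta> (carrier A)"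
    using iso by (auto simp: algebra_iso_def ring_iso_def bij_betw_def)
  have ops: "\<lbrakk>a \<in> carrier A; b \<in> carrier A\<rbrakk> \<Longrightarrow> \<theta> (a \<oplus>\<^bsub>A\<^esub> b) = \<theta> a \<oplus>\<^bsub>B\<^esub> \<theta> b"
    "\<lbrakk>a \<in> carrier A; b \<in> carrier A\<rbrakk> \<Longrightarrow> \<theta> (a \<otimes>\<^bsub>A\<^esub> b) = \<theta> a \<otimes>\<^bsub>B\<^esub> \<theta> b"
    "\<theta> \<one>\<^bsub>A\<^esub> = \<one>\<^bsub>B\<^esub>" "\<lbrakk>c \<in> carrier K; a \<in> carrier A\<rbrakk> \<Longrightarrow> \<theta> (c \<odot>\<^bsub>A\<^esub> a) = c \<odot>\<^bsub>B\<^esub> \<theta> a" for a b c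
    using iso by (auto simp: algebra_iso_def ring_iso_def ring_hom_def)
  have t0: "\<theta> \<zero>\<^bsub>A\<^esub> \<in> carrier B" using zero(1) im by blast
  have "\<theta> \<zero>\<^bsub>A\<^esub> = \<theta> \<zero>\<^bsub>A\<^esub> \<oplus>\<^bsub>B\<^esub> \<theta> \<zero>\<^bsub>A\<^esub>" using ops(1)[OF zero(1) zero(1)] zero(2) by simp
  then have z: "\<theta> \<zero>\<^bsub>A\<^esub> = \<zero>\<^bsub>B\<^esub>" using t0 B.M.add.r_cancel_one' by simp
  have i: "?i x \<in> carrier A" "\<theta> (?i x) = x" if "x \<in> carrier B" for x
    using that im by (auto intro: inv_into_into f_inv_into_f)
  have eq: "?i x = a" if "a \<in> carrier A" "\<theta> a = x" for a x
    using that inv_into_f_f[OF inj] by blast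
  have img: "?i ` carrier B = carrier A"
    using i(1) eq im by (metis inj inv_into_image_cancel subset_refl)
  show ?thesis
    by (rule fd_algebra_surj_image[OF B, of ?i])
      (auto simp: img i ops z add mult smult one zero intro!: eq)
qed

lemma separated_quiver_simps [simp]:
  "verts (separated_quiver Q) = verts Q <+> verts Q" "arcs (separated_quiver Q) = arcs Q"
  "tail (separated_quiver Q) \<alpha> = Inl (tail Q \<alpha>)" "head (separated_quiver Q) \<alpha> = Inr (head Q \<alpha>)"
  by (simp_all add: separated_quiver_def)

text \<open>Every arrow starts at a vertex of the form \<open>Inl\<close> and ends at one of the
  form \<open>Inr\<close>, so no two arrows can be composed.\<close>

lemma quiver_paths_separated:
  assumes Q: "wf_digraph Q"
  shows "quiver_paths (separated_quiver Q) =
    (\<lambda>v. (Inl v, [])) ` verts Q \<union> (\<lambda>v. (Inr v, [])) ` verts Q \<union>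
    (\<lambda>\<alpha>. (Inl (tail Q \<alpha>), [\<alpha>])) ` arcs Q"
proof -
  interpret Q: wf_digraph Q by (rule Q)
  interpret S: wf_digraph "separated_quiver Q"
    by unfold_locales auto
  have "(u, p) \<in> quiver_paths (separated_quiver Q) \<longleftrightarrow> (u, p) \<in> (\<lambda>v. (Inl v, [])) ` verts Q \<union>
      (\<lambda>v. (Inr v, [])) ` verts Q \<union> (\<lambda>\<alpha>. (Inl (tail Q \<alpha>), [\<alpha>])) ` arcs Q" for u p
  proof (cases p)
    case Nil
    then show ?thesis
      by (cases u) (auto simp: quiver_paths_def S.awalk_Nil_iff)
  next
    case (Cons \<alpha> p')
    then show ?thesis
      using S.arc_implies_awalk[of \<alpha>]
      by (cases p') (auto simp: quiver_paths_def S.awalk_simps split: if_splits)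
  qed
  then show ?thesis by (auto simp del: split_paired_Ex)
qed

lemma path_algebra_simps:
  "one (path_algebra K Q) = (\<lambda>(u, p). if u \<in> verts Q \<and> p = [] then \<one>\<^bsub>K\<^esub> else \<zero>\<^bsub>K\<^esub>)"
  "zero (path_algebra K Q) = (\<lambda>w. \<zero>\<^bsub>K\<^esub>)" "(x \<oplus>\<^bsub>path_algebra K Q\<^esub> y) = (\<lambda>w. x w \<oplus>\<^bsub>K\<^esub> y w)"
  "c \<odot>\<^bsub>path_algebra K Q\<^esub> x = (\<lambda>w. c \<otimes>\<^bsub>K\<^esub> x w)"
  "(x \<otimes>\<^bsub>path_algebra K Q\<^esub> y) (u, p) =
    finsum K (\<lambda>i. x (u, take i p) \<otimes>\<^bsub>K\<^esub> y (pre_digraph.awlast Q u (take i p), drop i p)) {..length p}"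
  by (simp_all add: path_algebra_def)

lemma path_algebra_memI:
  assumes "finite (quiver_paths Q)" "\<And>w. x w \<in> carrier K" "\<And>w. w \<notin> quiver_paths Q \<Longrightarrow> x w = \<zero>\<^bsub>K\<^esub>"
  shows "x \<in> carrier (path_algebra K Q)"
proof -
  have "{w. x w \<noteq> \<zero>\<^bsub>K\<^esub>} \<subseteq> quiver_paths Q" using assms(3) by blast
  then have "finite {w. x w \<noteq> \<zero>\<^bsub>K\<^esub>}" using assms(1) by (rule finite_subset)
  then show ?thesis using assms by (simp add: path_algebra_def del: split_paired_All)
qed

lemma path_algebra_memD:
  assumes "x \<in> carrier (path_algebra K Q)"
  shows "x w \<in> carrier K" "w \<notin> quiver_paths Q \<Longrightarrow> x w = \<zero>\<^bsub>K\<^esub>"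
  using assms by (auto simp: path_algebra_def simp del: split_paired_All)

text \<open>A nonzero summand at some splitting means that both pieces are paths and that the second
  starts where the first ends, so their concatenation is a path. Coefficients off the paths
  therefore vanish.\<close>

lemma path_algebra_mult_closed:
  fixes Q :: "('u, 'f) pre_digraph"
  assumes K: "field K" and Q: "wf_digraph Q" and fin: "finite (quiver_paths Q)"
    and x: "x \<in> carrier (path_algebra K Q)" and y: "y \<in> carrier (path_algebra K Q)"
  shows "x \<otimes>\<^bsub>path_algebra K Q\<^esub> y \<in> carrier (path_algebra K Q)"
proof -
  interpret K: field K by (rule K)
  interpret Q: wf_digraph Q by (rule Q)
  note xK = path_algebra_memD(1)[OF x] and yK = path_algebra_memD(1)[OF y]
  show ?thesis
  proof (rule path_algebra_memI[OF fin])
    fix w :: "'u \<times> 'f list"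
    obtain u p where w: "w = (u, p)" by (cases w)
    show "(x \<otimes>\<^bsub>path_algebra K Q\<^esub> y) w \<in> carrier K"
      unfolding w path_algebra_simps using xK yK by (intro K.finsum_closed) auto
    assume "w \<notin> quiver_paths Q"
    then have nw: "\<not> Q.awalk u p v" for v by (auto simp: w quiver_paths_def)
    have "x (u, take i p) \<otimes>\<^bsub>K\<^esub> y (Q.awlast u (take i p), drop i p) = \<zero>\<^bsub>K\<^esub>" for i
    proof (rule ccontr)
      assume ne: "\<not> ?thesis"
      then have "x (u, take i p) \<noteq> \<zero>\<^bsub>K\<^esub>" "y (Q.awlast u (take i p), drop i p) \<noteq> \<zero>\<^bsub>K\<^esub>" using xK yK by auto
      then have "(u, take i p) \<in> quiver_paths Q" "(Q.awlast u (take i p), drop i p) \<in> quiver_paths Q"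
        using path_algebra_memD(2)[OF x] path_algebra_memD(2)[OF y] by blast+
      then obtain v v' where v: "Q.awalk u (take i p) v" and v': "Q.awalk (Q.awlast u (take i p)) (drop i p) v'"
        by (auto simp: quiver_paths_def)
      have "Q.awlast u (take i p) = v" using v by (rule Q.awalkE)
      then have "Q.awalk u (take i p @ drop i p) v'" using v v' by (simp only: Q.awalk_append_iff)
      then show False using nw by simp
    qed
    then show "(x \<otimes>\<^bsub>path_algebra K Q\<^esub> y) w = \<zero>\<^bsub>K\<^esub>" unfolding w path_algebra_simps by simp
  qed
qed

section \<open>The path algebra of the separated quiver as a matrix algebra\<close>

context split_algebra
begin

context
  fixes Q :: "('v, 'e) pre_digraph" and b :: "'e \<Rightarrow> 'a"
  assumes Q: "fin_digraph Q" and VQ: "verts Q = V"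
    and b: "\<And>\<alpha>. \<alpha> \<in> arcs Q \<Longrightarrow> b \<alpha> \<in> J" "\<And>\<alpha>. \<alpha> \<in> arcs Q \<Longrightarrow> e (tail Q \<alpha>) \<otimes>\<^bsub>A\<^esub> b \<alpha> = b \<alpha>"
      "\<And>\<alpha>. \<alpha> \<in> arcs Q \<Longrightarrow> b \<alpha> \<otimes>\<^bsub>A\<^esub> e (head Q \<alpha>) = b \<alpha>"
    and basis: "\<And>i j x. \<lbrakk>i \<in> V; j \<in> V; x \<in> J\<rbrakk> \<Longrightarrow>
      \<exists>!c. c \<in> {\<alpha> \<in> arcs Q. tail Q \<alpha> = i \<and> head Q \<alpha> = j} \<rightarrow>\<^sub>E carrier K \<and>
        finsum A (\<lambda>\<alpha>. c \<alpha> \<odot>\<^bsub>A\<^esub> b \<alpha>) {\<alpha> \<in> arcs Q. tail Q \<alpha> = i \<and> head Q \<alpha> = j} = e i \<otimes>\<^bsub>A\<^esub> x \<otimes>\<^bsub>A\<^esub> e j"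
begin

abbreviation "arcs_between i j \<equiv> {\<alpha> \<in> arcs Q. tail Q \<alpha> = i \<and> head Q \<alpha> = j}"
abbreviation "arrow_sum c \<equiv> finsum A (\<lambda>\<alpha>. c \<alpha> \<odot>\<^bsub>A\<^esub> b \<alpha>) (arcs Q)"
abbreviation "\<Pi>s \<equiv> path_algebra K (separated_quiver Q)"

lemma fin_arcs: "finite (arcs Q)"
  using fin_digraph.finite_arcs[OF Q] .

lemma tail_V: "\<alpha> \<in> arcs Q \<Longrightarrow> tail Q \<alpha> \<in> V" and head_V: "\<alpha> \<in> arcs Q \<Longrightarrow> head Q \<alpha> \<in> V"
  using wf_digraph.tail_in_verts wf_digraph.head_in_verts fin_digraph.axioms(1)[OF Q] VQ by metis+

lemma b_closed: "\<alpha> \<in> arcs Q \<Longrightarrow> b \<alpha> \<in> carrier A"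
  using b(1) J_closed by blast

lemma arrow_sum_J: "c \<in> arcs Q \<rightarrow> carrier K \<Longrightarrow> arrow_sum c \<in> J"
  using b(1) by (intro J_finsum fin_arcs) (auto intro: J_smult)

lemma arrow_sum_closed: "c \<in> arcs Q \<rightarrow> carrier K \<Longrightarrow> arrow_sum c \<in> carrier A"
  using arrow_sum_J J_closed by blast

lemma e_mult_b: "\<lbrakk>i \<in> V; \<alpha> \<in> arcs Q\<rbrakk> \<Longrightarrow> e i \<otimes>\<^bsub>A\<^esub> b \<alpha> = (if tail Q \<alpha> = i then b \<alpha> else \<zero>\<^bsub>A\<^esub>)"
  using b(2)[of \<alpha>] A.m_assoc[of "e i" "e (tail Q \<alpha>)" "b \<alpha>"] b_closed e_closed tail_V
  by (auto simp: e_orth)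

lemma b_mult_e: "\<lbrakk>j \<in> V; \<alpha> \<in> arcs Q\<rbrakk> \<Longrightarrow> b \<alpha> \<otimes>\<^bsub>A\<^esub> e j = (if head Q \<alpha> = j then b \<alpha> else \<zero>\<^bsub>A\<^esub>)"
  using b(3)[of \<alpha>] A.m_assoc[of "b \<alpha>" "e (head Q \<alpha>)" "e j"] b_closed e_closed head_V
  by (auto simp: e_orth)

text \<open>The element of an arrow from v to w survives multiplication by e_i and e_j only if v = i
  and w = j.\<close>

lemma arrow_sum_component:
  assumes c: "c \<in> arcs Q \<rightarrow> carrier K" and ij: "i \<in> V" "j \<in> V"
  shows "e i \<otimes>\<^bsub>A\<^esub> arrow_sum c \<otimes>\<^bsub>A\<^esub> e j = finsum A (\<lambda>\<alpha>. c \<alpha> \<odot>\<^bsub>A\<^esub> b \<alpha>) (arcs_between i j)"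
proof -
  note eij = e_closed[OF ij(1)] e_closed[OF ij(2)]
  have ck: "c \<alpha> \<in> carrier K" if "\<alpha> \<in> arcs Q" for \<alpha> using c that by auto
  have "e i \<otimes>\<^bsub>A\<^esub> arrow_sum c \<otimes>\<^bsub>A\<^esub> e j = finsum A (\<lambda>\<alpha>. e i \<otimes>\<^bsub>A\<^esub> (c \<alpha> \<odot>\<^bsub>A\<^esub> b \<alpha>) \<otimes>\<^bsub>A\<^esub> e j) (arcs Q)"
    using eij ck b_closed fin_arcs by (simp add: finsum_mult_right Pi_iff)
  also have "\<dots> = finsum A (\<lambda>\<alpha>. c \<alpha> \<odot>\<^bsub>A\<^esub> b \<alpha>) (arcs_between i j)"
  proof (rule M.add.finprod_mono_neutral_cong_right[OF fin_arcs])
    have t: "e i \<otimes>\<^bsub>A\<^esub> (c \<alpha> \<odot>\<^bsub>A\<^esub> b \<alpha>) \<otimes>\<^bsub>A\<^esub> e j =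
        (if \<alpha> \<in> arcs_between i j then c \<alpha> \<odot>\<^bsub>A\<^esub> b \<alpha> else \<zero>\<^bsub>A\<^esub>)" if "\<alpha> \<in> arcs Q" for \<alpha>
      using that eij ck[OF that] b_closed[OF that] e_mult_b[OF ij(1) that] b_mult_e[OF ij(2) that]
      by (simp add: smult_mult_right smult_mult_left smult_r_null)
    then show "\<alpha> \<in> arcs Q - arcs_between i j \<Longrightarrow> e i \<otimes>\<^bsub>A\<^esub> (c \<alpha> \<odot>\<^bsub>A\<^esub> b \<alpha>) \<otimes>\<^bsub>A\<^esub> e j = \<zero>\<^bsub>A\<^esub>"
      "\<alpha> \<in> arcs_between i j \<Longrightarrow> e i \<otimes>\<^bsub>A\<^esub> (c \<alpha> \<odot>\<^bsub>A\<^esub> b \<alpha>) \<otimes>\<^bsub>A\<^esub> e j = c \<alpha> \<odot>\<^bsub>A\<^esub> b \<alpha>" for \<alpha>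
      by auto
  qed (use eij ck b_closed in auto)
  finally show ?thesis .
qed

text \<open>Restricted to the arrows parallel to \<open>\<alpha>\<close>, both families are
  coordinates of the same Peirce component, and these are unique.\<close>

lemma arrow_sum_inj:
  assumes c: "c \<in> arcs Q \<rightarrow> carrier K" and d: "d \<in> arcs Q \<rightarrow> carrier K" and eq: "arrow_sum c = arrow_sum d"
    and \<alpha>: "\<alpha> \<in> arcs Q"
  shows "c \<alpha> = d \<alpha>"
proof -
  let ?I = "arcs_between (tail Q \<alpha>) (head Q \<alpha>)"
  note t = tail_V[OF \<alpha>] head_V[OF \<alpha>]
  have restr: "restrict c' ?I \<in> ?I \<rightarrow>\<^sub>E carrier K \<and>
      finsum A (\<lambda>\<beta>. restrict c' ?I \<beta> \<odot>\<^bsub>A\<^esub> b \<beta>) ?I = e (tail Q \<alpha>) \<otimes>\<^bsub>A\<^esub> arrow_sum d \<otimes>\<^bsub>A\<^esub> e (head Q \<alpha>)"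
    if c': "c' \<in> arcs Q \<rightarrow> carrier K" "arrow_sum c' = arrow_sum d" for c'
  proof
    show "restrict c' ?I \<in> ?I \<rightarrow>\<^sub>E carrier K" using c'(1) by auto
    have "finsum A (\<lambda>\<beta>. restrict c' ?I \<beta> \<odot>\<^bsub>A\<^esub> b \<beta>) ?I = finsum A (\<lambda>\<beta>. c' \<beta> \<odot>\<^bsub>A\<^esub> b \<beta>) ?I"
      using c'(1) b_closed by (intro M.finsum_cong') auto
    also have "\<dots> = e (tail Q \<alpha>) \<otimes>\<^bsub>A\<^esub> arrow_sum d \<otimes>\<^bsub>A\<^esub> e (head Q \<alpha>)"
      using arrow_sum_component[OF c'(1) t] c'(2) by simp
    finally show "finsum A (\<lambda>\<beta>. restrict c' ?I \<beta> \<odot>\<^bsub>A\<^esub> b \<beta>) ?I = e (tail Q \<alpha>) \<otimes>\<^bsub>A\<^esub> arrow_sum d \<otimes>\<^bsub>A\<^esub> e (head Q \<alpha>)" .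
  qed
  from basis[OF t arrow_sum_J[OF d]] obtain c0 where
    uniq: "\<forall>c'. c' \<in> ?I \<rightarrow>\<^sub>E carrier K \<and>
      finsum A (\<lambda>\<beta>. c' \<beta> \<odot>\<^bsub>A\<^esub> b \<beta>) ?I = e (tail Q \<alpha>) \<otimes>\<^bsub>A\<^esub> arrow_sum d \<otimes>\<^bsub>A\<^esub> e (head Q \<alpha>) \<longrightarrow> c' = c0"
    by (rule ex1E) (rule that)
  have "restrict c ?I = c0" by (rule uniq[rule_format, OF restr[OF c eq]])
  moreover have "restrict d ?I = c0" by (rule uniq[rule_format, OF restr[OF d refl]])
  ultimately have "restrict c ?I = restrict d ?I" by simp
  then have "restrict c ?I \<alpha> = restrict d ?I \<alpha>" by (rule fun_cong)
  then show ?thesis using \<alpha> by simp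
qed

lemma arrow_sum_surj:
  assumes x: "x \<in> J"
  shows "\<exists>c \<in> arcs Q \<rightarrow> carrier K. x = arrow_sum c"
proof -
  define C where "C i j = (THE c. c \<in> arcs_between i j \<rightarrow>\<^sub>E carrier K \<and>
      finsum A (\<lambda>\<alpha>. c \<alpha> \<odot>\<^bsub>A\<^esub> b \<alpha>) (arcs_between i j) = e i \<otimes>\<^bsub>A\<^esub> x \<otimes>\<^bsub>A\<^esub> e j)" for i j
  have C': "C i j \<in> arcs_between i j \<rightarrow>\<^sub>E carrier K \<and>
    finsum A (\<lambda>\<alpha>. C i j \<alpha> \<odot>\<^bsub>A\<^esub> b \<alpha>) (arcs_between i j) = e i \<otimes>\<^bsub>A\<^esub> x \<otimes>\<^bsub>A\<^esub> e j" if "i \<in> V" "j \<in> V" for i j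
    unfolding C_def by (rule theI'[OF basis[OF that x]])
  note C = conjunct1[OF C'] conjunct2[OF C']
  \<comment> \<open>The coordinates of the Peirce components are glued along the partition of the
    arrows by their end points.\<close>
  define c where "c \<alpha> = C (tail Q \<alpha>) (head Q \<alpha>) \<alpha>" for \<alpha>
  have c: "c \<in> arcs Q \<rightarrow> carrier K"
  proof
    fix \<alpha> assume \<alpha>: "\<alpha> \<in> arcs Q"
    have "C (tail Q \<alpha>) (head Q \<alpha>) \<alpha> \<in> carrier K"
      by (rule PiE_mem[OF C(1)[OF tail_V[OF \<alpha>] head_V[OF \<alpha>]]]) (simp add: \<alpha>)
    then show "c \<alpha> \<in> carrier K" by (simp add: c_def)
  qed
  have "x = arrow_sum c"
  proof (rule peirce_eqI[OF J_closed[OF x] arrow_sum_closed[OF c]])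
    fix i j assume ij: "i \<in> V" "j \<in> V"
    have "finsum A (\<lambda>\<alpha>. c \<alpha> \<odot>\<^bsub>A\<^esub> b \<alpha>) (arcs_between i j) = finsum A (\<lambda>\<alpha>. C i j \<alpha> \<odot>\<^bsub>A\<^esub> b \<alpha>) (arcs_between i j)"
      using C(1)[OF ij] b_closed by (intro M.finsum_cong') (auto simp: c_def PiE_iff)
    then show "e i \<otimes>\<^bsub>A\<^esub> x \<otimes>\<^bsub>A\<^esub> e j = e i \<otimes>\<^bsub>A\<^esub> arrow_sum c \<otimes>\<^bsub>A\<^esub> e j"
      using arrow_sum_component[OF c ij] C(2)[OF ij] by simp
  qed
  then show ?thesis using c by blast
qed

lemma arrow_sum_add:
  assumes "c \<in> arcs Q \<rightarrow> carrier K" "d \<in> arcs Q \<rightarrow> carrier K"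
  shows "arrow_sum (\<lambda>\<alpha>. c \<alpha> \<oplus>\<^bsub>K\<^esub> d \<alpha>) = arrow_sum c \<oplus>\<^bsub>A\<^esub> arrow_sum d"
proof -
  have "arrow_sum (\<lambda>\<alpha>. c \<alpha> \<oplus>\<^bsub>K\<^esub> d \<alpha>) = finsum A (\<lambda>\<alpha>. c \<alpha> \<odot>\<^bsub>A\<^esub> b \<alpha> \<oplus>\<^bsub>A\<^esub> d \<alpha> \<odot>\<^bsub>A\<^esub> b \<alpha>) (arcs Q)"
    using assms b_closed by (intro M.finsum_cong') (auto simp: smult_l_distr Pi_iff)
  also have "\<dots> = arrow_sum c \<oplus>\<^bsub>A\<^esub> arrow_sum d"
    using assms b_closed by (intro M.finsum_addf) (auto simp: Pi_iff)
  finally show ?thesis .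
qed

lemma arrow_sum_smult:
  assumes "c \<in> arcs Q \<rightarrow> carrier K" "k \<in> carrier K"
  shows "arrow_sum (\<lambda>\<alpha>. k \<otimes>\<^bsub>K\<^esub> c \<alpha>) = k \<odot>\<^bsub>A\<^esub> arrow_sum c"
proof -
  have "arrow_sum (\<lambda>\<alpha>. k \<otimes>\<^bsub>K\<^esub> c \<alpha>) = finsum A (\<lambda>\<alpha>. k \<odot>\<^bsub>A\<^esub> (c \<alpha> \<odot>\<^bsub>A\<^esub> b \<alpha>)) (arcs Q)"
    using assms b_closed by (intro M.finsum_cong') (auto simp: smult_assoc1 Pi_iff)
  also have "\<dots> = k \<odot>\<^bsub>A\<^esub> arrow_sum c"
    using assms b_closed by (intro finsum_smult[symmetric] fin_arcs) (auto simp: Pi_iff)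
  finally show ?thesis .
qed

text \<open>These are the products of trivial paths with arrows: from the left only the idempotent
  of the tail acts, from the right only that of the head.\<close>

lemma diagonal_mult_arrow_sum:
  assumes l: "l \<in> V \<rightarrow> carrier K" and c: "c \<in> arcs Q \<rightarrow> carrier K"
  shows "diagonal l \<otimes>\<^bsub>A\<^esub> arrow_sum c = arrow_sum (\<lambda>\<alpha>. l (tail Q \<alpha>) \<otimes>\<^bsub>K\<^esub> c \<alpha>)" (is ?left)
    and "arrow_sum c \<otimes>\<^bsub>A\<^esub> diagonal l = arrow_sum (\<lambda>\<alpha>. c \<alpha> \<otimes>\<^bsub>K\<^esub> l (head Q \<alpha>))" (is ?right)
proof -
  have k: "c \<alpha> \<in> carrier K" "l (tail Q \<alpha>) \<in> carrier K" "l (head Q \<alpha>) \<in> carrier K" if "\<alpha> \<in> arcs Q" for \<alpha>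
    using that l c tail_V head_V by auto
  note D = diagonal_closed[OF l]
  have left: "diagonal l \<otimes>\<^bsub>A\<^esub> b \<alpha> = l (tail Q \<alpha>) \<odot>\<^bsub>A\<^esub> b \<alpha>" if \<alpha>: "\<alpha> \<in> arcs Q" for \<alpha>
    using A.m_assoc[OF D e_closed[OF tail_V[OF \<alpha>]] b_closed[OF \<alpha>]] k[OF \<alpha>] e_closed[OF tail_V[OF \<alpha>]] b_closed[OF \<alpha>]
    by (simp add: b(2)[OF \<alpha>] e_mult_diagonal(2)[OF l tail_V[OF \<alpha>]] smult_mult_left)
  have right: "b \<alpha> \<otimes>\<^bsub>A\<^esub> diagonal l = l (head Q \<alpha>) \<odot>\<^bsub>A\<^esub> b \<alpha>" if \<alpha>: "\<alpha> \<in> arcs Q" for \<alpha>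
    using A.m_assoc[OF b_closed[OF \<alpha>] e_closed[OF head_V[OF \<alpha>]] D] k[OF \<alpha>] e_closed[OF head_V[OF \<alpha>]] b_closed[OF \<alpha>]
    by (simp add: b(3)[OF \<alpha>] e_mult_diagonal(1)[OF l head_V[OF \<alpha>]] smult_mult_right)
  have "diagonal l \<otimes>\<^bsub>A\<^esub> arrow_sum c = finsum A (\<lambda>\<alpha>. diagonal l \<otimes>\<^bsub>A\<^esub> (c \<alpha> \<odot>\<^bsub>A\<^esub> b \<alpha>)) (arcs Q)"
    using D k b_closed fin_arcs by (intro finsum_mult_right) auto
  also have "\<dots> = arrow_sum (\<lambda>\<alpha>. l (tail Q \<alpha>) \<otimes>\<^bsub>K\<^esub> c \<alpha>)"
    using D k b_closed by (intro M.finsum_cong') (auto simp: smult_mult_right left smult_assoc1[symmetric] R.m_comm)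
  finally show ?left .
  have "arrow_sum c \<otimes>\<^bsub>A\<^esub> diagonal l = finsum A (\<lambda>\<alpha>. (c \<alpha> \<odot>\<^bsub>A\<^esub> b \<alpha>) \<otimes>\<^bsub>A\<^esub> diagonal l) (arcs Q)"
    using D k b_closed fin_arcs by (intro finsum_mult_right) auto
  also have "\<dots> = arrow_sum (\<lambda>\<alpha>. c \<alpha> \<otimes>\<^bsub>K\<^esub> l (head Q \<alpha>))"
    using D k b_closed by (intro M.finsum_cong') (auto simp: smult_mult_left right smult_assoc1[symmetric])
  finally show ?right .
qed

abbreviation "SQ \<equiv> separated_quiver Q"

lemma wf_Q: "wf_digraph Q"
  by (rule fin_digraph.axioms(1)[OF Q])

lemma wf_SQ: "wf_digraph SQ"
  by unfold_locales (auto simp: tail_V head_V VQ)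

lemmas paths_SQ = quiver_paths_separated[OF wf_Q]

lemma finite_paths_SQ: "finite (quiver_paths SQ)"
  using fin_V fin_arcs by (simp add: paths_SQ VQ)

text \<open>An arrow decomposes only as a trivial path times the arrow or as the arrow times a
  trivial path. The latter sits at the minus copy of the head, whence the
  \<open>Inr\<close>.\<close>

lemma path_mult:
  assumes x: "x \<in> carrier \<Pi>s" and y: "y \<in> carrier \<Pi>s"
  shows "(x \<otimes>\<^bsub>\<Pi>s\<^esub> y) (u, []) = x (u, []) \<otimes>\<^bsub>K\<^esub> y (u, [])"
    and "(x \<otimes>\<^bsub>\<Pi>s\<^esub> y) (u, [\<alpha>]) = x (u, []) \<otimes>\<^bsub>K\<^esub> y (u, [\<alpha>]) \<oplus>\<^bsub>K\<^esub> x (u, [\<alpha>]) \<otimes>\<^bsub>K\<^esub> y (Inr (head Q \<alpha>), [])"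
proof -
  note k = path_algebra_memD(1)[OF x] path_algebra_memD(1)[OF y]
  have s0: "{..length ([] :: 'e list)} = {0}" and s1: "{..length [\<alpha>]} = {1, 0}" by auto
  show "(x \<otimes>\<^bsub>\<Pi>s\<^esub> y) (u, []) = x (u, []) \<otimes>\<^bsub>K\<^esub> y (u, [])"
    unfolding path_algebra_simps s0 using k by (simp add: pre_digraph.awalk_verts.simps)
  show "(x \<otimes>\<^bsub>\<Pi>s\<^esub> y) (u, [\<alpha>]) = x (u, []) \<otimes>\<^bsub>K\<^esub> y (u, [\<alpha>]) \<oplus>\<^bsub>K\<^esub> x (u, [\<alpha>]) \<otimes>\<^bsub>K\<^esub> y (Inr (head Q \<alpha>), [])"
    unfolding path_algebra_simps s1 using k by (simp add: pre_digraph.awalk_verts.simps R.a_comm)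
qed

abbreviation "upper x \<equiv> (\<lambda>v. x (Inl v, []))"
abbreviation "lower x \<equiv> (\<lambda>v. x (Inr v, []))"
abbreviation "middle x \<equiv> (\<lambda>\<alpha>. x (Inl (tail Q \<alpha>), [\<alpha>]))"
text \<open>Trivial paths at plus vertices go to the upper left entry, arrows to \<open>J\<close>,
  and trivial paths at minus vertices to the lower right entry. So an arrow meets the upper left
  entry on its left and the lower right entry on its right, as in the matrix product.\<close>

abbreviation "path_map x \<equiv> (qc (diagonal (upper x)), arrow_sum (middle x), qc (diagonal (lower x)))"

lemma path_coefficients:
  assumes "x \<in> carrier \<Pi>s"
  shows "upper x \<in> V \<rightarrow> carrier K" "lower x \<in> V \<rightarrow> carrier K" "middle x \<in> arcs Q \<rightarrow> carrier K"
  using path_algebra_memD(1)[OF assms] by auto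

text \<open>Multiplicativity is the comparison of \<open>path_mult\<close> with
  \<open>triangular_mult\<close>. Bijectivity expresses that the e_v are a basis modulo
  \<open>J\<close> and that the elements of the arrows are a basis of \<open>J\<close>.\<close>

lemma path_map_iso: "path_map \<in> algebra_iso K \<Pi>s \<Delta>"
proof -
  note c = path_coefficients
  have closed: "path_map x \<in> carrier \<Delta>" if "x \<in> carrier \<Pi>s" for x
    using c[OF that] by (simp add: diagonal_closed arrow_sum_J)
  have "path_map \<in> ring_hom \<Pi>s \<Delta>"
  proof (rule ring_hom_memI)
    show "path_map \<one>\<^bsub>\<Pi>s\<^esub> = \<one>\<^bsub>\<Delta>\<^esub>"
    proof -
      have "diagonal (upper \<one>\<^bsub>\<Pi>s\<^esub>) = diagonal (\<lambda>v. \<one>\<^bsub>K\<^esub>)" "diagonal (lower \<one>\<^bsub>\<Pi>s\<^esub>) = diagonal (\<lambda>v. \<one>\<^bsub>K\<^esub>)"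
        unfolding diagonal_def using e_closed by (auto intro!: M.finsum_cong' simp: path_algebra_simps(1) VQ)
      moreover have "arrow_sum (middle \<one>\<^bsub>\<Pi>s\<^esub>) = finsum A (\<lambda>\<alpha>. \<zero>\<^bsub>A\<^esub>) (arcs Q)"
        using b_closed by (intro M.finsum_cong') (auto simp: path_algebra_simps(1))
      ultimately show ?thesis by (simp add: triangular_simps(2) diagonal_one)
    qed
  next
    fix x assume x: "x \<in> carrier \<Pi>s"
    show "path_map x \<in> carrier \<Delta>" by (rule closed[OF x])
    fix y assume y: "y \<in> carrier \<Pi>s"
    show "path_map (x \<otimes>\<^bsub>\<Pi>s\<^esub> y) = path_map x \<otimes>\<^bsub>\<Delta>\<^esub> path_map y"
    proof -
      have m: "(\<lambda>\<alpha>. upper x (tail Q \<alpha>) \<otimes>\<^bsub>K\<^esub> middle y \<alpha>) \<in> arcs Q \<rightarrow> carrier K"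
        "(\<lambda>\<alpha>. middle x \<alpha> \<otimes>\<^bsub>K\<^esub> lower y (head Q \<alpha>)) \<in> arcs Q \<rightarrow> carrier K"
        using path_algebra_memD(1)[OF x] path_algebra_memD(1)[OF y] by auto
      show ?thesis
        using c[OF x] c[OF y]
        by (simp add: triangular_mult diagonal_closed arrow_sum_J path_mult[OF x y] diagonal_mult
            arrow_sum_add[OF m] diagonal_mult_arrow_sum)
    qed
    show "path_map (x \<oplus>\<^bsub>\<Pi>s\<^esub> y) = path_map x \<oplus>\<^bsub>\<Delta>\<^esub> path_map y"
      using c[OF x] c[OF y]
      by (simp add: path_algebra_simps(3) triangular_simps(4) qc_ops diagonal_closed diagonal_add arrow_sum_add)
  qed
  moreover have "inj_on path_map (carrier \<Pi>s)"
  proof (rule inj_onI)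
    fix x y assume x: "x \<in> carrier \<Pi>s" and y: "y \<in> carrier \<Pi>s" and eq: "path_map x = path_map y"
    show "x = y"
    proof
      fix w
      show "x w = y w"
      proof (cases "w \<in> quiver_paths SQ")
        case True
        then consider v where "v \<in> V" "w = (Inl v, [])" | v where "v \<in> V" "w = (Inr v, [])"
          | \<alpha> where "\<alpha> \<in> arcs Q" "w = (Inl (tail Q \<alpha>), [\<alpha>])"
          by (auto simp: paths_SQ VQ)
        then show ?thesis
        proof cases
          case 1
          then show ?thesis using qc_diagonal_inj[OF c(1)[OF x] c(1)[OF y] 1(1)] eq by simp
        next
          case 2
          then show ?thesis using qc_diagonal_inj[OF c(2)[OF x] c(2)[OF y] 2(1)] eq by simp
        next
          case 3
          then show ?thesis using arrow_sum_inj[OF c(3)[OF x] c(3)[OF y] _ 3(1)] eq by simp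
        qed
      qed (simp add: path_algebra_memD(2)[OF x] path_algebra_memD(2)[OF y])
    qed
  qed
  moreover have "\<exists>x\<in>carrier \<Pi>s. d = path_map x" if "d \<in> carrier \<Delta>" for d
  proof -
    obtain a j a' where d: "a \<in> carrier A" "j \<in> J" "a' \<in> carrier A" "d = (qc a, j, qc a')"
      using triangular_rep[OF \<open>d \<in> carrier \<Delta>\<close>] by blast
    obtain l m r where l: "l \<in> V \<rightarrow> carrier K" "qc a = qc (diagonal l)" and m: "m \<in> arcs Q \<rightarrow> carrier K" "j = arrow_sum m"
      and r: "r \<in> V \<rightarrow> carrier K" "qc a' = qc (diagonal r)"
      using qc_diagonal_surj[OF d(1)] qc_diagonal_surj[OF d(3)] arrow_sum_surj[OF d(2)] by blast
    \<comment> \<open>Coefficients off the paths must be zero, and a path of length one is given by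
      its arrow \<open>hd p\<close>.\<close>
    define x where "x = (\<lambda>(u, p). if (u, p) \<notin> quiver_paths SQ then \<zero>\<^bsub>K\<^esub> else
      if p = [] then (case u of Inl v \<Rightarrow> l v | Inr v \<Rightarrow> r v) else m (hd p))"
    have x1: "upper x v = l v" "lower x v = r v" if "v \<in> V" for v
      using that by (auto simp: x_def paths_SQ VQ)
    have x2: "middle x \<alpha> = m \<alpha>" if "\<alpha> \<in> arcs Q" for \<alpha>
      using that by (auto simp: x_def paths_SQ)
    have x: "x \<in> carrier \<Pi>s"
    proof (rule path_algebra_memI[OF finite_paths_SQ])
      show "x w \<in> carrier K" for w using l(1) m(1) r(1) by (cases w) (auto simp: x_def paths_SQ VQ)
      show "x w = \<zero>\<^bsub>K\<^esub>" if "w \<notin> quiver_paths SQ" for w using that by (cases w) (simp add: x_def)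
    qed
    have "diagonal (upper x) = diagonal l" "diagonal (lower x) = diagonal r"
      unfolding diagonal_def using x1 l(1) r(1) e_closed by (auto intro!: M.finsum_cong')
    moreover have "arrow_sum (middle x) = arrow_sum m"
      using x2 m(1) b_closed by (auto intro!: M.finsum_cong')
    ultimately show ?thesis using d l m r x by (intro bexI[OF _ x]) simp
  qed
  note surj = this
  have "path_map ` carrier \<Pi>s = carrier \<Delta>"
  proof (intro equalityI subsetI)
    fix d assume "d \<in> path_map ` carrier \<Pi>s"
    then show "d \<in> carrier \<Delta>" by (rule imageE) (simp only: closed)
  next
    fix d assume "d \<in> carrier \<Delta>"
    from surj[OF this] obtain x where x: "x \<in> carrier \<Pi>s" "d = path_map x" by (rule bexE)
    show "d \<in> path_map ` carrier \<Pi>s" by (rule image_eqI[of d path_map x, OF x(2,1)])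
  qed
  moreover have "path_map (k \<odot>\<^bsub>\<Pi>s\<^esub> x) = k \<odot>\<^bsub>\<Delta>\<^esub> path_map x" if "k \<in> carrier K" "x \<in> carrier \<Pi>s" for k x
    using that c[OF that(2)]
    by (simp add: path_algebra_simps(4) triangular_simps(5) qc_ops diagonal_closed diagonal_smult arrow_sum_smult)
  ultimately show ?thesis by (simp add: algebra_iso_def ring_iso_def bij_betw_def)
qed

lemma fd_algebra_path: "fd_algebra K \<Pi>s"
proof (rule fd_algebra_iso[OF fd_algebra_triangular path_map_iso])
  fix x y assume x: "x \<in> carrier \<Pi>s" and y: "y \<in> carrier \<Pi>s"
  note k = path_algebra_memD[OF x] path_algebra_memD[OF y]
  show "x \<oplus>\<^bsub>\<Pi>s\<^esub> y \<in> carrier \<Pi>s"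
    by (rule path_algebra_memI[OF finite_paths_SQ]) (simp_all add: path_algebra_simps(3) k)
  show "x \<otimes>\<^bsub>\<Pi>s\<^esub> y \<in> carrier \<Pi>s"
    by (rule path_algebra_mult_closed[OF field_axioms wf_SQ finite_paths_SQ x y])
next
  fix c x assume c: "c \<in> carrier K" and x: "x \<in> carrier \<Pi>s"
  show "c \<odot>\<^bsub>\<Pi>s\<^esub> x \<in> carrier \<Pi>s"
    using c path_algebra_memD[OF x]
    by (intro path_algebra_memI[OF finite_paths_SQ]) (simp_all add: path_algebra_simps(4))
next
  show "\<one>\<^bsub>\<Pi>s\<^esub> \<in> carrier \<Pi>s"
    by (rule path_algebra_memI[OF finite_paths_SQ]) (auto simp: path_algebra_simps(1) paths_SQ)
  show "\<zero>\<^bsub>\<Pi>s\<^esub> \<in> carrier \<Pi>s"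
    by (rule path_algebra_memI[OF finite_paths_SQ]) (simp_all add: path_algebra_simps(2))
  show "\<zero>\<^bsub>\<Pi>s\<^esub> \<oplus>\<^bsub>\<Pi>s\<^esub> \<zero>\<^bsub>\<Pi>s\<^esub> = \<zero>\<^bsub>\<Pi>s\<^esub>" by (simp add: path_algebra_simps)
qed

end

text \<open>The Peirce bases are chosen for all pairs of vertices at once and glued to a single
  family indexed by the arrows.\<close>

theorem path_algebra_separated_iso:
  fixes Q :: "('v, 'e) pre_digraph"
  assumes Q: "fin_digraph Q" and VQ: "verts Q = V"
    and dims: "\<And>i j. \<lbrakk>i \<in> V; j \<in> V\<rbrakk> \<Longrightarrow> card {\<alpha> \<in> arcs Q. tail Q \<alpha> = i \<and> head Q \<alpha> = j} =
      vectorspace.dim K ((quot_algebra A {\<zero>\<^bsub>A\<^esub>})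
        \<lparr>carrier := (\<lambda>x. {\<zero>\<^bsub>A\<^esub>} +>\<^bsub>A\<^esub> (e i \<otimes>\<^bsub>A\<^esub> x \<otimes>\<^bsub>A\<^esub> e j)) ` J\<rparr>)"
  shows "fd_algebra K (path_algebra K (separated_quiver Q))"
    and "\<exists>\<theta>. \<theta> \<in> algebra_iso K (path_algebra K (separated_quiver Q)) \<Delta>"
proof -
  let ?I = "\<lambda>i j. {\<alpha> \<in> arcs Q. tail Q \<alpha> = i \<and> head Q \<alpha> = j}"
  define P where "P i j b \<longleftrightarrow> (\<forall>\<alpha>\<in>?I i j. b \<alpha> \<in> J \<and> e i \<otimes>\<^bsub>A\<^esub> b \<alpha> = b \<alpha> \<and> b \<alpha> \<otimes>\<^bsub>A\<^esub> e j = b \<alpha>) \<and>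
    (\<forall>x\<in>J. \<exists>!c. c \<in> ?I i j \<rightarrow>\<^sub>E carrier K \<and> finsum A (\<lambda>\<alpha>. c \<alpha> \<odot>\<^bsub>A\<^esub> b \<alpha>) (?I i j) = e i \<otimes>\<^bsub>A\<^esub> x \<otimes>\<^bsub>A\<^esub> e j)"
    for i j b
  define C where "C i j = (SOME b. P i j b)" for i j
  have fin: "finite (?I i j)" for i j using fin_digraph.finite_arcs[OF Q] by simp
  have C: "P i j (C i j)" if "i \<in> V" "j \<in> V" for i j
    unfolding C_def P_def by (rule someI_ex[OF peirce_basis[OF that fin dims[OF that]]])
  note C1 = C[unfolded P_def, THEN conjunct1, rule_format] and C2 = C[unfolded P_def, THEN conjunct2, rule_format]
  define b where "b \<alpha> = C (tail Q \<alpha>) (head Q \<alpha>) \<alpha>" for \<alpha>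
  have V: "tail Q \<alpha> \<in> V" "head Q \<alpha> \<in> V" if "\<alpha> \<in> arcs Q" for \<alpha>
    using that wf_digraph.tail_in_verts wf_digraph.head_in_verts fin_digraph.axioms(1)[OF Q] VQ by auto
  have b: "b \<alpha> \<in> J \<and> e (tail Q \<alpha>) \<otimes>\<^bsub>A\<^esub> b \<alpha> = b \<alpha> \<and> b \<alpha> \<otimes>\<^bsub>A\<^esub> e (head Q \<alpha>) = b \<alpha>" if "\<alpha> \<in> arcs Q" for \<alpha>
    unfolding b_def by (rule C1[OF V[OF that]]) (simp add: that)
  have basis: "\<exists>!c. c \<in> ?I i j \<rightarrow>\<^sub>E carrier K \<and> finsum A (\<lambda>\<alpha>. c \<alpha> \<odot>\<^bsub>A\<^esub> b \<alpha>) (?I i j) = e i \<otimes>\<^bsub>A\<^esub> x \<otimes>\<^bsub>A\<^esub> e j"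
    if "i \<in> V" "j \<in> V" "x \<in> J" for i j x
  proof -
    have "finsum A (\<lambda>\<alpha>. c \<alpha> \<odot>\<^bsub>A\<^esub> b \<alpha>) (?I i j) = finsum A (\<lambda>\<alpha>. c \<alpha> \<odot>\<^bsub>A\<^esub> C i j \<alpha>) (?I i j)"
      if "c \<in> ?I i j \<rightarrow>\<^sub>E carrier K" for c
      using that C1[OF \<open>i \<in> V\<close> \<open>j \<in> V\<close>] J_closed by (intro M.finsum_cong') (auto simp: b_def PiE_iff)
    then have "c \<in> ?I i j \<rightarrow>\<^sub>E carrier K \<and> finsum A (\<lambda>\<alpha>. c \<alpha> \<odot>\<^bsub>A\<^esub> b \<alpha>) (?I i j) = y \<longleftrightarrow>
        c \<in> ?I i j \<rightarrow>\<^sub>E carrier K \<and> finsum A (\<lambda>\<alpha>. c \<alpha> \<odot>\<^bsub>A\<^esub> C i j \<alpha>) (?I i j) = y" for c y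
      by (intro conj_cong) simp_all
    then show ?thesis using C2[OF that] by simp
  qed
  note hyps = Q VQ b[THEN conjunct1] b[THEN conjunct2, THEN conjunct1] b[THEN conjunct2, THEN conjunct2] basis
  show "fd_algebra K (path_algebra K (separated_quiver Q))" by (rule fd_algebra_path[OF hyps])
  show "\<exists>\<theta>. \<theta> \<in> algebra_iso K (path_algebra K (separated_quiver Q)) \<Delta>" by (rule exI, rule path_map_iso[OF hyps])
qed

end

text \<open>The existence claim keeps the quantifier over isomorphisms from being vacuous. The
  equivalence holds for each of them, because restriction along any isomorphism leads to the same
  factorization property of F M over the triangular algebra.\<close>

theorem theorem3:
  fixes K :: "'k ring"
    and \<Lambda> :: "('k, 'a) module"
    and Q :: "('v, 'e) pre_digraph"
    and M :: "('k, 'a, 'x) rmodule"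
    and P0 :: "('k, 'a, 'p) rmodule"
    and P1 :: "('k, 'a, 'q) rmodule"
    and f :: "'q \<Rightarrow> 'p"
    and g :: "'p \<Rightarrow> 'x"
  assumes "algebraically_closed K"
    and "fd_algebra K \<Lambda>"
    and "basic_algebra \<Lambda>"
    and "radical_square_zero \<Lambda>"
    and "is_quiver_of K \<Lambda> Q"
    and "fd_rmodule K \<Lambda> M"
    and "minimal_presentation K \<Lambda> P1 f P0 g M"
  shows
    "(\<exists>\<theta>. \<theta> \<in> algebra_iso K (path_algebra K (separated_quiver Q)) (triangular_algebra \<Lambda>)) \<and>
     (\<forall>\<theta> \<in> algebra_iso K (path_algebra K (separated_quiver Q)) (triangular_algebra \<Lambda>).
        tau_rigid K \<Lambda> M \<longleftrightarrow>
        tau_rigid K (path_algebra K (separated_quiver Q)) (restrict_scalars \<theta> (functor_F \<Lambda> M)) \<and>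
        add_inter_trivial K \<Lambda> P0 P1)"
proof -
  \<comment> \<open>J^2 = 0 turns the quotient by J^2 in the definition of the quiver into the
    quotient by zero.\<close>
  obtain \<epsilon> where Q: "fin_digraph Q" and inj: "inj_on \<epsilon> (verts Q)"
    and E: "complete_primitive_idempotents \<Lambda> (\<epsilon> ` verts Q)"
    and dims: "\<And>i j. \<lbrakk>i \<in> verts Q; j \<in> verts Q\<rbrakk> \<Longrightarrow> card {\<alpha> \<in> arcs Q. tail Q \<alpha> = i \<and> head Q \<alpha> = j} =
      vectorspace.dim K ((quot_algebra \<Lambda> {\<zero>\<^bsub>\<Lambda>\<^esub>})
        \<lparr>carrier := (\<lambda>x. {\<zero>\<^bsub>\<Lambda>\<^esub>} +>\<^bsub>\<Lambda>\<^esub> (\<epsilon> i \<otimes>\<^bsub>\<Lambda>\<^esub> x \<otimes>\<^bsub>\<Lambda>\<^esub> \<epsilon> j)) ` jacobson_radical \<Lambda>\<rparr>)"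
    using assms(5) unfolding is_quiver_of_def Let_def assms(4)[unfolded radical_square_zero_def] by blast
  interpret split_algebra K \<Lambda> \<epsilon> "verts Q"
    by (rule basic_split_algebra[OF assms(1-4) inj E])
  note M = assms(6) and pres = assms(7)
  have path: "fd_algebra K (path_algebra K (separated_quiver Q))"
    and iso: "\<exists>\<theta>. \<theta> \<in> algebra_iso K (path_algebra K (separated_quiver Q)) (triangular_algebra \<Lambda>)"
    using path_algebra_separated_iso[OF Q refl dims] by blast+
  \<comment> \<open>Over \<open>\<Lambda>\<close>, factorization splits into the extension condition
    on the kernel and the condition on add; the extension condition is factorization for F
    M.\<close>
  have "tau_rigid K \<Lambda> M \<longleftrightarrow>
      tau_rigid K (path_algebra K (separated_quiver Q)) (restrict_scalars \<theta> (functor_F \<Lambda> M)) \<and>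
      add_inter_trivial K \<Lambda> P0 P1"
    if "\<theta> \<in> algebra_iso K (path_algebra K (separated_quiver Q)) (triangular_algebra \<Lambda>)" for \<theta>
    using tau_rigid_restrict_iff[OF path that fd_rmodule_FF[OF M] minimal_presentation_FF[OF M pres]]
    by (simp add: tau_rigid_iff_factors_through[OF M pres] factors_through_iff[OF M pres] factors_through_FF_iff[OF M pres])
  then show ?thesis using iso by blast
qed

end
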